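(* Let $\alpha\ge0$, $1\le p<\infty$ and $\beta,\mu\in\mathbb{R}$ with $\mu>\beta-\frac1p>0$, and consider the generalized Stieltjes operator on $\mathcal{T}_p^{(\alpha)}(|t|^\alpha)$ $$\mathcal{S}_{\beta,\mu}f(t)=\int_0^\infty\frac{u^{\beta-1}}{(1+u)^\mu}f(tu)\,du,\qquad t\in\mathbb{R}.$$ Then: (i) $\mathcal{S}_{\beta,\mu}$ is bounded on $\mathcal{T}_p^{(\alpha)}(|t|^\alpha)$ and $\|\mathcal{S}_{\beta,\mu}\|=B\!\left(\mu-\beta+\frac1p,\beta-\frac1p\right)$. (ii) If $f\in\mathcal{T}_p^{(\alpha)}(|t|^\alpha)$, then $$\mathcal{S}_{\beta,\mu}f(t)=\int_{-\infty}^\infty\phi_{\mu-\beta+1/p,\,\mu}(r)\,T_{r,p}f(t)\,dr,\qquad \text{(almost every) } t\in\mathbb{R},$$ where $\phi_{a,\mu}(r)=\frac{e^{ar}}{(1+e^r)^\mu}$ and $T_{r,p}f(s)=e^{-r/p}f(e^{-r}s)$. (iii) $\sigma(\mathcal{S}_{\beta,\mu})=\left\{B\!\left(\beta-\frac1p+i\xi,\mu-\beta+\frac1p-i\xi\right):\xi\in\mathbb{R}\right\}\cup\{0\}$. (iv) For $p>1$ and $\frac1p+\frac1{p'}=1$, the adjoint of $\mathcal{S}_{\beta,\mu}$ on $\mathcal{T}_p^{(\alpha)}(|t|^\alpha)$ is $\mathcal{S}_{\mu-\beta+1,\mu}$ on $\mathcal{T}_{p'}^{(\alpha)}(|t|^\alpha)$.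 In particular $\mathcal{S}_{\beta,2\beta-1}$ is self-adjoint on $\mathcal{T}_2^{(\alpha)}(|t|^\alpha)$ for $\beta>\frac12$.
   Context: $B(z,w)=\Gamma(z)\Gamma(w)/\Gamma(z+w)$ is the Beta function; functions are complex-valued. For $f$ in the Schwartz class on $\mathbb{R}$, $\alpha>0$ and an integer $n>\alpha$ put $W_+^\alpha f(x)=\frac{(-1)^n}{\Gamma(n-\alpha)}\frac{d^n}{dx^n}\int_x^\infty(t-x)^{n-\alpha-1}f(t)\,dt$ and $W_-^\alpha f(x)=\frac1{\Gamma(n-\alpha)}\frac{d^n}{dx^n}\int_{-\infty}^x(x-t)^{n-\alpha-1}f(t)\,dt$; $W_\pm^0f=f$. Let $W_0^\alpha f(t)=W_-^\alpha f(t)$ for $t<0$ and $W_0^\alpha f(t)=W_+^\alpha f(t)$ for $t>0$. For $1\le p<\infty$, $\mathcal{T}_p^{(\alpha)}(|t|^\alpha)$ is the completion of the Schwartz class on $\mathbb{R}$ in the norm $|||f|||_{\alpha,p}=\frac1{\Gamma(\alpha+1)}\left(\int_{-\infty}^\infty(|W_0^\alpha f(t)|\,|t|^\alpha)^pdt\right)^{1/p}$; $\mathcal{T}_p^{(0)}(|t|^0)=L^p(\mathbb{R})$. It embeds continuously in $L^p(\mathbb{R})$ and is regarded as a subspace of it. The map $D_0^\alpha f(t)=\frac1{\Gamma(\alpha+1)}|t|^\alpha W_0^\alpha f(t)$ extends to an isometric isomorphism $\mathcal{T}_p^{(\alpha)}(|t|^\alpha)\to L^p(\mathbb{R})$. Concretely,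 $\mathcal{T}_p^{(\alpha)}(|t|^\alpha)$ is the direct sum of two copies, supported on $(0,\infty)$ and $(-\infty,0)$, of the half-line space $\mathcal{T}_p^{(\alpha)}(t^\alpha)=\{\,t\mapsto\alpha\int_t^\infty(s-t)^{\alpha-1}h(s)s^{-\alpha}ds:\ h\in L^p(\mathbb{R}^+)\}$ (for $\alpha>0$), where $h=D_0^\alpha f$ on $(0,\infty)$ (and symmetrically on $(-\infty,0)$). For $1<p<\infty$ the dual of $\mathcal{T}_p^{(\alpha)}(|t|^\alpha)$ is $\mathcal{T}_{p'}^{(\alpha)}(|t|^\alpha)$ via the bilinear pairing $\langle f,g\rangle_\alpha=\int_{-\infty}^\infty D_0^\alpha f(t)D_0^\alpha g(t)\,dt$; adjoints are taken with respect to it. $\mathcal{T}_2^{(\alpha)}(|t|^\alpha)$ is a Hilbert space with inner product $\int D_0^\alpha f\,\overline{D_0^\alpha g}$. *)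

theory Defs
  imports "HOL-Analysis.Analysis"
begin

text \<open>Elements of function spaces are represented by Borel functions on the line; two functions
  represent the same element iff they agree almost everywhere.\<close>

definition Lp :: "real \<Rightarrow> (real \<Rightarrow> complex) set" where
  "Lp p = {f \<in> borel_measurable lborel. integrable lborel (\<lambda>t. cmod (f t) powr p)}"

definition Lp_norm :: "real \<Rightarrow> (real \<Rightarrow> complex) \<Rightarrow> real" where
  "Lp_norm p f = (LINT t|lborel. cmod (f t) powr p) powr (1 / p)"

definition nth_deriv :: "nat \<Rightarrow> (real \<Rightarrow> complex) \<Rightarrow> real \<Rightarrow> complex" where
  "nth_deriv n f = ((\<lambda>g x. vector_derivative g (at x)) ^^ n) f"

definition schwartz :: "(real \<Rightarrow> complex) set" where
  "schwartz = {f. (\<forall>n x. nth_deriv n f differentiable (at x)) \<and>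
                  (\<forall>k n. \<exists>C. \<forall>x. \<bar>x\<bar> ^ k * cmod (nth_deriv n f x) \<le> C)}"

text \<open>For a Schwartz function every integer \<open>n > \<alpha>\<close> gives the same Weyl derivative of order
  \<open>\<alpha>\<close>; the least such \<open>n\<close> is used below.\<close>

definition weyl_ord :: "real \<Rightarrow> nat" where
  "weyl_ord \<alpha> = Suc (nat \<lfloor>\<alpha>\<rfloor>)"

definition weyl_plus :: "real \<Rightarrow> (real \<Rightarrow> complex) \<Rightarrow> real \<Rightarrow> complex" where
  "weyl_plus \<alpha> f = (if \<alpha> = 0 then f else
     (let n = weyl_ord \<alpha> in
       (\<lambda>x. ((-1) ^ n / Gamma (real n - \<alpha>)) *\<^sub>R
          nth_deriv n (\<lambda>y. LINT t:{y<..}|lborel. ((t - y) powr (real n - \<alpha> - 1)) *\<^sub>R f t) x)))"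

definition weyl_minus :: "real \<Rightarrow> (real \<Rightarrow> complex) \<Rightarrow> real \<Rightarrow> complex" where
  "weyl_minus \<alpha> f = (if \<alpha> = 0 then f else
     (let n = weyl_ord \<alpha> in
       (\<lambda>x. (1 / Gamma (real n - \<alpha>)) *\<^sub>R
          nth_deriv n (\<lambda>y. LINT t:{..<y}|lborel. ((y - t) powr (real n - \<alpha> - 1)) *\<^sub>R f t) x)))"

text \<open>The value at the single point \<open>t = 0\<close> is immaterial.\<close>

definition weyl_zero :: "real \<Rightarrow> (real \<Rightarrow> complex) \<Rightarrow> real \<Rightarrow> complex" where
  "weyl_zero \<alpha> f t = (if t < 0 then weyl_minus \<alpha> f t else weyl_plus \<alpha> f t)"

definition D0_schwartz :: "real \<Rightarrow> (real \<Rightarrow> complex) \<Rightarrow> real \<Rightarrow> complex" where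
  "D0_schwartz \<alpha> f t = (\<bar>t\<bar> powr \<alpha> / Gamma (\<alpha> + 1)) *\<^sub>R weyl_zero \<alpha> f t"

text \<open>On Schwartz functions the norm \<open>|||f|||\<close> is \<open>Lp_norm p (D0_schwartz \<alpha> f)\<close>.  The completion
  of the Schwartz class in this norm, regarded as a subspace of \<open>L\<^sup>p\<close>, consists of the
  \<open>L\<^sup>p\<close>-limits \<open>f\<close> of those sequences \<open>F\<close> of Schwartz functions for which \<open>D0_schwartz \<alpha> (F n)\<close>
  converges in \<open>L\<^sup>p\<close> (equivalently, by completeness of \<open>L\<^sup>p\<close>, for which \<open>F\<close> is Cauchy in
  \<open>|||.|||\<close>); the limit \<open>h\<close> is the value at \<open>f\<close> of the continuous extension of \<open>D0_schwartz\<close>.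
  As the completion embeds in \<open>L\<^sup>p\<close>, \<open>h\<close> is unique up to a null set.
  For \<open>\<alpha> = 0\<close> the space is all of \<open>L\<^sup>p\<close>, because the Schwartz class is dense there.\<close>

definition D0_graph :: "real \<Rightarrow> real \<Rightarrow> (real \<Rightarrow> complex) \<Rightarrow> (real \<Rightarrow> complex) \<Rightarrow> bool" where
  "D0_graph \<alpha> p f h \<longleftrightarrow> f \<in> Lp p \<and> h \<in> Lp p \<and>
     (\<exists>F. (\<forall>n::nat. F n \<in> schwartz) \<and>
          (\<lambda>n. Lp_norm p (\<lambda>t. F n t - f t)) \<longlonglongrightarrow> 0 \<and>
          (\<lambda>n. Lp_norm p (\<lambda>t. D0_schwartz \<alpha> (F n) t - h t)) \<longlonglongrightarrow> 0)"

definition T_space :: "real \<Rightarrow> real \<Rightarrow> (real \<Rightarrow> complex) set" where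
  "T_space \<alpha> p = {f. \<exists>h. D0_graph \<alpha> p f h}"

definition D0 :: "real \<Rightarrow> real \<Rightarrow> (real \<Rightarrow> complex) \<Rightarrow> real \<Rightarrow> complex" where
  "D0 \<alpha> p f = (SOME h. D0_graph \<alpha> p f h)"

definition T_norm :: "real \<Rightarrow> real \<Rightarrow> (real \<Rightarrow> complex) \<Rightarrow> real" where
  "T_norm \<alpha> p f = Lp_norm p (D0 \<alpha> p f)"

text \<open>Bounded operators on a space \<open>V\<close> of functions modulo null sets, normed by \<open>N\<close>.
  Linearity and the inverse in the definition of the spectrum are therefore understood almost
  everywhere.\<close>

definition bounded_op_on ::
  "(real \<Rightarrow> complex) set \<Rightarrow> ((real \<Rightarrow> complex) \<Rightarrow> real) \<Rightarrow>
   ((real \<Rightarrow> complex) \<Rightarrow> (real \<Rightarrow> complex)) \<Rightarrow> bool" where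
  "bounded_op_on V N A \<longleftrightarrow>
     (\<forall>f\<in>V. A f \<in> V) \<and>
     (\<forall>f\<in>V. \<forall>g\<in>V. \<forall>a b. AE t in lborel.
        A (\<lambda>s. a * f s + b * g s) t = a * A f t + b * A g t) \<and>
     (\<exists>C. \<forall>f\<in>V. N (A f) \<le> C * N f)"

definition op_norm_on ::
  "(real \<Rightarrow> complex) set \<Rightarrow> ((real \<Rightarrow> complex) \<Rightarrow> real) \<Rightarrow>
   ((real \<Rightarrow> complex) \<Rightarrow> (real \<Rightarrow> complex)) \<Rightarrow> real" where
  "op_norm_on V N A = (SUP f\<in>{f\<in>V. N f \<le> 1}. N (A f))"

definition spectrum_on ::
  "(real \<Rightarrow> complex) set \<Rightarrow> ((real \<Rightarrow> complex) \<Rightarrow> real) \<Rightarrow>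
   ((real \<Rightarrow> complex) \<Rightarrow> (real \<Rightarrow> complex)) \<Rightarrow> complex set" where
  "spectrum_on V N A = {l. \<not> (\<exists>R. bounded_op_on V N R \<and>
     (\<forall>f\<in>V. AE t in lborel. R (\<lambda>s. l * f s - A f s) t = f t) \<and>
     (\<forall>f\<in>V. AE t in lborel. l * R f t - A (R f) t = f t))}"

definition T_pairing ::
  "real \<Rightarrow> real \<Rightarrow> real \<Rightarrow> (real \<Rightarrow> complex) \<Rightarrow> (real \<Rightarrow> complex) \<Rightarrow> complex" where
  "T_pairing \<alpha> p q f g = (LINT t|lborel. D0 \<alpha> p f t * D0 \<alpha> q g t)"

text \<open>For conjugate exponents \<open>p\<close> and \<open>q\<close> the dual of \<open>T_space \<alpha> p\<close> is \<open>T_space \<alpha> q\<close> via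
  \<open>T_pairing\<close>, so at most one \<open>B\<close> (up to null sets) is the adjoint of \<open>A\<close>.\<close>

definition is_T_adjoint ::
  "real \<Rightarrow> real \<Rightarrow> real \<Rightarrow> ((real \<Rightarrow> complex) \<Rightarrow> (real \<Rightarrow> complex)) \<Rightarrow>
   ((real \<Rightarrow> complex) \<Rightarrow> (real \<Rightarrow> complex)) \<Rightarrow> bool" where
  "is_T_adjoint \<alpha> p q A B \<longleftrightarrow>
     bounded_op_on (T_space \<alpha> p) (T_norm \<alpha> p) A \<and>
     bounded_op_on (T_space \<alpha> q) (T_norm \<alpha> q) B \<and>
     (\<forall>f\<in>T_space \<alpha> p. \<forall>g\<in>T_space \<alpha> q. T_pairing \<alpha> p q (A f) g = T_pairing \<alpha> p q f (B g))"

definition T_inner :: "real \<Rightarrow> (real \<Rightarrow> complex) \<Rightarrow> (real \<Rightarrow> complex) \<Rightarrow> complex" where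
  "T_inner \<alpha> f g = (LINT t|lborel. D0 \<alpha> 2 f t * cnj (D0 \<alpha> 2 g t))"

definition T_self_adjoint ::
  "real \<Rightarrow> ((real \<Rightarrow> complex) \<Rightarrow> (real \<Rightarrow> complex)) \<Rightarrow> bool" where
  "T_self_adjoint \<alpha> A \<longleftrightarrow>
     bounded_op_on (T_space \<alpha> 2) (T_norm \<alpha> 2) A \<and>
     (\<forall>f\<in>T_space \<alpha> 2. \<forall>g\<in>T_space \<alpha> 2. T_inner \<alpha> (A f) g = T_inner \<alpha> f (A g))"

definition stieltjes :: "real \<Rightarrow> real \<Rightarrow> (real \<Rightarrow> complex) \<Rightarrow> real \<Rightarrow> complex" where
  "stieltjes \<beta> \<mu> f t =
     (LINT u:{0<..}|lborel. (u powr (\<beta> - 1) / (1 + u) powr \<mu>) *\<^sub>R f (t * u))"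

definition phi_kernel :: "real \<Rightarrow> real \<Rightarrow> real \<Rightarrow> real" where
  "phi_kernel a \<mu> r = exp (a * r) / (1 + exp r) powr \<mu>"

definition dilation :: "real \<Rightarrow> real \<Rightarrow> (real \<Rightarrow> complex) \<Rightarrow> real \<Rightarrow> complex" where
  "dilation r p f s = exp (- r / p) *\<^sub>R f (exp (- r) * s)"

end

theory Submission
  imports Defs "HOL-Probability.Probability" "HOL-Real_Asymp.Real_Asymp"
begin

text \<open>
  After \<open>u = exp (- r)\<close> the Stieltjes operator becomes a dilation convolution
  \<open>f \<mapsto> (t \<mapsto> \<integral> k r * f (exp (- r) * t) dr)\<close>.  All such operators commute, they compose by convolution of
  their kernels, and by Minkowski's inequality they are bounded on \<open>L\<^sup>p\<close> by
  \<open>\<integral> exp (r / p) * |k r| dr\<close>.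

  For a Schwartz function \<open>F\<close> and an integer \<open>n > \<alpha>\<close>, \<open>D\<^sub>0 F\<close> is an Erdelyi-Kober integral of
  \<open>(- s) ^ n * F\<^sup>(\<^sup>n\<^sup>) s\<close>, again a dilation convolution; the composition law of these
  integrals and Taylor's formula give \<open>F = J (D\<^sub>0 F)\<close>, where \<open>J\<close> is the Erdelyi-Kober integral of order
  \<open>\<alpha>\<close>.  Since \<open>J\<close> is bounded and injective on \<open>L\<^sup>p\<close> and the functions \<open>D\<^sub>0 F\<close> are dense there, the space
  is \<open>J L\<^sup>p\<close> with the norm transported from \<open>L\<^sup>p\<close>.  Dilation convolutions commute with \<open>J\<close>, so
  everything reduces to \<open>\<alpha> = 0\<close>.

  On \<open>L\<^sup>p\<close> put \<open>\<psi> r = exp (r / p) * k r\<close>.  Truncations of \<open>t powr (- 1 / p + \<i> * \<xi>)\<close> are approximate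
  eigenvectors for the value at \<open>\<xi>\<close> of the Fourier transform of \<open>\<psi>\<close>; this gives the lower bound for
  the norm and one half of the spectrum.  Conversely, if \<open>l \<noteq> 0\<close> is not such a value, then
  \<open>ft \<psi> / (l - ft \<psi>)\<close> is the Fourier transform of an integrable function, because \<open>\<psi>\<close> is smooth and
  exponentially decaying; this function is the kernel of the resolvent.  For the Stieltjes kernel the
  Fourier transform is the Beta function.
\<close>

section \<open>Jensen's inequality and the spaces \<open>L\<^sup>p\<close>\<close>

text \<open>The weight |t|^\<alpha> in \<open>D0_schwartz\<close> is what makes the reduction to
  \<alpha> = 0 possible: Weyl differentiation of order \<alpha> lowers the degree of homogeneity by
  \<alpha>, the weight raises it again, so D0 and J commute with all dilations, and norm and
  spectrum do not depend on \<alpha>. The obstacle in the density argument is that D0 treats the two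
  half-lines separately while a Schwartz function cannot jump at 0. A smooth cutoff at scale 1/m has
  an n-th derivative of size m^n near 0, but the weight turns it into (m |t|)^n exp (- m |t|), which
  is bounded in m and tends to 0 for t \<noteq> 0; so the smoothing leaves no trace in the limit.
  Exponentials are the natural test functions because fractional integrals over (t, \<infinity>)
  only multiply them by constants. The point 0 of the spectrum requires no eigenvectors of its own:
  approximate eigenvalues may be limits of values of the Fourier transform, and 0 is their limit at
  infinity.\<close>

lemma powr_tangent:
  fixes p s x :: real
  assumes "1 \<le> p" "0 < s" "0 \<le> x"
  shows "p * x * s powr (p - 1) \<le> x powr p + (p - 1) * s powr p"
proof (cases "x = 0")
  case False
  \<comment> \<open>Weighted AM-GM for x^p and s^p with weights 1/p and 1 - 1/p. The result says
    that x^p lies above its tangent at s.\<close>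
  have "(x powr p) powr (1 / p) * (s powr p) powr (1 - 1 / p)
      \<le> 1 / p * x powr p + (1 - 1 / p) * s powr p"
    by (rule Youngs_inequality_0) (use assms False in auto)
  moreover have "(s powr p) powr (1 - 1 / p) = s powr (p - 1)"
  proof -
    have "p * (1 - 1 / p) = p - 1" using assms by (simp add: right_diff_distrib)
    then show ?thesis by (simp add: powr_powr)
  qed
  ultimately have "p * (x * s powr (p - 1)) \<le> p * (1 / p * x powr p + (1 - 1 / p) * s powr p)"
    using assms False by (intro mult_left_mono) (auto simp: powr_powr)
  also have "\<dots> = x powr p + (p - 1) * s powr p"
    using assms by (simp add: field_simps)
  finally show ?thesis by (simp add: mult.assoc)
qed (use assms in auto)

text \<open>Two tangent inequalities at the common point u = l x + (1 - l) y are averaged with the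
  weights l and 1 - l; the left sides then add up to p u^p.\<close>

lemma powr_convex_comb:
  fixes p x y l :: real
  assumes "1 \<le> p" "0 \<le> x" "0 \<le> y" "0 \<le> l" "l \<le> 1"
  shows "(l * x + (1 - l) * y) powr p \<le> l * x powr p + (1 - l) * y powr p"
proof (cases "l * x + (1 - l) * y = 0")
  case False
  define u where "u = l * x + (1 - l) * y"
  have u: "0 < u" using assms False unfolding u_def by (smt (verit) mult_nonneg_nonneg)
  have a: "l * (p * x * u powr (p - 1)) \<le> l * (x powr p + (p - 1) * u powr p)"
    using powr_tangent[OF assms(1) u assms(2)] assms by (intro mult_left_mono) auto
  have b: "(1 - l) * (p * y * u powr (p - 1)) \<le> (1 - l) * (y powr p + (p - 1) * u powr p)"
    using powr_tangent[OF assms(1) u assms(3)] assms by (intro mult_left_mono) auto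
  have "p * u * u powr (p - 1) = p * u powr p"
    using u by (simp add: powr_diff)
  moreover have "p * u * u powr (p - 1) = l * (p * x * u powr (p - 1)) + (1 - l) *
      (p * y * u powr (p - 1))"
    unfolding u_def by (simp add: algebra_simps)
  moreover have "l * (x powr p + (p - 1) * u powr p) + (1 - l) * (y powr p + (p - 1) * u powr p)
     = l * x powr p + (1 - l) * y powr p + (p - 1) * u powr p"
    by (simp add: algebra_simps)
  ultimately have "p * u powr p \<le> l * x powr p + (1 - l) * y powr p + (p - 1) * u powr p"
    using a b by linarith
  then show ?thesis by (simp add: u_def algebra_simps)
qed (use assms in auto)

lemma powr_sum_le:
  fixes p x y :: real
  assumes "1 \<le> p" "0 \<le> x" "0 \<le> y"
  shows "(x + y) powr p \<le> 2 powr p * (x powr p + y powr p)"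
proof -
  have "(x + y) powr p = (2 * (1/2 * x + (1 - 1/2) * y)) powr p" by (simp add: distrib_left)
  also have "\<dots> = 2 powr p * (1/2 * x + (1 - 1/2) * y) powr p"
    using assms by (subst powr_mult) auto
  also have "\<dots> \<le> 2 powr p * (1/2 * x powr p + (1 - 1/2) * y powr p)"
    using assms by (intro mult_left_mono powr_convex_comb) auto
  also have "\<dots> \<le> 2 powr p * (x powr p + y powr p)"
    by (intro mult_left_mono) (auto simp: field_simps)
  finally show ?thesis .
qed

text \<open>Jensen's inequality for the measure with density k, which is not normalised; hence the
  factor with exponent p - 1. Integrating the tangent inequality at a constant s gives one bound for
  each s, and the best s is chosen.\<close>

lemma jensen_powr:
  fixes k x :: "'a \<Rightarrow> real"
  assumes p: "1 \<le> p" and k: "integrable M k" and x[measurable]: "x \<in> borel_measurable M"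
    and kp: "integrable M (\<lambda>r. k r * x r powr p)"
    and k0: "\<And>r. 0 \<le> k r" and x0: "\<And>r. 0 \<le> x r"
  shows "integrable M (\<lambda>r. k r * x r)"
    and "(LINT r|M. k r * x r) powr p \<le> (LINT r|M. k r) powr (p - 1) * (LINT r|M. k r * x r powr p)"
proof -
  have [measurable]: "k \<in> borel_measurable M" using k by auto
  have le: "k r * x r \<le> k r + k r * x r powr p" for r
  proof -
    have "x r \<le> 1 + x r powr p"
    proof (cases "x r \<le> 1")
      case True then show ?thesis by (smt (verit) powr_ge_zero)
    next
      case False
      then have "x r powr 1 \<le> x r powr p" using p by (intro powr_mono) auto
      then show ?thesis using False by simp
    qed
    then have "k r * x r \<le> k r * (1 + x r powr p)" using k0 by (intro mult_left_mono)
    then show ?thesis by (simp add: algebra_simps)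
  qed
  show kx: "integrable M (\<lambda>r. k r * x r)"
    by (rule Bochner_Integration.integrable_bound[OF Bochner_Integration.integrable_add[OF k kp]])
       (use le k0 x0 in \<open>auto simp: abs_mult\<close>)
  define K where "K = (LINT r|M. k r)"
  define X where "X = (LINT r|M. k r * x r powr p)"
  define Y where "Y = (LINT r|M. k r * x r)"
  have K0: "K \<ge> 0" unfolding K_def using k0 by (intro integral_nonneg_AE) auto
  have X0: "X \<ge> 0" unfolding X_def using k0 by (intro integral_nonneg_AE) auto
  have Y0: "Y \<ge> 0" unfolding Y_def using k0 x0 by (intro integral_nonneg_AE) auto
  show "(LINT r|M. k r * x r) powr p \<le> (LINT r|M. k r) powr (p - 1) * (LINT r|M. k r * x r powr p)"
  proof (cases "K = 0 \<or> X = 0")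
    case True
    have "AE r in M. k r * x r = 0"
    proof (cases "K = 0")
      case True
      then have "AE r in M. k r = 0"
        unfolding K_def using k k0 by (subst (asm) integral_nonneg_eq_0_iff_AE) auto
      then show ?thesis by auto
    next
      case False
      with \<open>K = 0 \<or> X = 0\<close> have "X = 0" by simp
      then have "AE r in M. k r * x r powr p = 0"
        unfolding X_def using kp k0 by (subst (asm) integral_nonneg_eq_0_iff_AE) auto
      then show ?thesis by auto
    qed
    then have "Y = 0" unfolding Y_def by (rule integral_eq_zero_AE)
    then show ?thesis using X0 K0 p unfolding K_def[symmetric] X_def[symmetric] Y_def[symmetric] by auto
  next
    case False
    then have KX: "K > 0" "X > 0" using K0 X0 by auto
    \<comment> \<open>The tangent point is the p-th mean of x, so that s^p K = X and the right side
      of the integrated inequality collapses to p X.\<close>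
    define s where "s = (X / K) powr (1 / p)"
    have s: "s > 0" "s powr p = X / K" using KX p by (auto simp: s_def powr_powr)
    have "(LINT r|M. (p * s powr (p - 1)) * (k r * x r))
        \<le> (LINT r|M. k r * x r powr p + ((p - 1) * s powr p) * k r)"
    proof (intro integral_mono)
      fix r
      have "k r * (p * x r * s powr (p - 1)) \<le> k r * (x r powr p + (p - 1) * s powr p)"
        using k0 x0 s p by (intro mult_left_mono powr_tangent) auto
      then show "(p * s powr (p - 1)) * (k r * x r) \<le> k r * x r powr p + ((p - 1) * s powr p) * k r"
        by (simp add: algebra_simps)
    qed (use kx kp k in auto)
    then have "p * s powr (p - 1) * Y \<le> X + (p - 1) * s powr p * K"
      using kx kp k by (simp add: K_def X_def Y_def)
    also have "\<dots> = p * X" using s KX by (simp add: field_simps)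
    finally have "s powr (p - 1) * Y \<le> X" using p by simp
    then have "(s powr (p - 1) * Y) powr p \<le> X powr p" using Y0 p by (intro powr_mono2) auto
    then have "s powr ((p - 1) * p) * Y powr p \<le> X powr p" using Y0 s by (simp add: powr_mult powr_powr)
    moreover have "s powr ((p - 1) * p) = (X / K) powr (p - 1)"
      using s by (metis mult.commute powr_powr)
    ultimately have "(X / K) powr (p - 1) * Y powr p \<le> X powr p" by simp
    then have "X powr (p - 1) * Y powr p \<le> X powr p * K powr (p - 1)"
      using KX by (simp add: powr_divide field_simps)
    also have "\<dots> = X powr (p - 1) * (X * K powr (p - 1))" using KX by (simp add: powr_diff)
    finally have "Y powr p \<le> X * K powr (p - 1)" using KX by simp
    then show ?thesis by (simp add: K_def X_def Y_def mult.commute)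
  qed
qed

section \<open>The spaces L^p: norm, triangle inequality, convergence\<close>

lemma LpD: "f \<in> Lp p \<Longrightarrow> f \<in> borel_measurable borel" "f \<in> Lp p \<Longrightarrow> integrable lborel (\<lambda>t. cmod (f t) powr p)"
  by (auto simp: Lp_def)

lemma LpI: "f \<in> borel_measurable borel \<Longrightarrow> integrable lborel (\<lambda>t. cmod (f t) powr p) \<Longrightarrow> f \<in> Lp p"
  by (auto simp: Lp_def)

lemma Lp_norm_nonneg: "0 \<le> Lp_norm p f"
  by (simp add: Lp_norm_def)

lemma Lp_norm_powr: "1 \<le> p \<Longrightarrow> Lp_norm p f powr p = (LINT t|lborel. cmod (f t) powr p)"
  by (simp add: Lp_norm_def powr_powr)

lemma Lp_norm_le_iff:
  assumes "1 \<le> p" "0 \<le> C"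
  shows "Lp_norm p f \<le> C \<longleftrightarrow> (LINT t|lborel. cmod (f t) powr p) \<le> C powr p"
proof -
  have "Lp_norm p f \<le> C \<longleftrightarrow> Lp_norm p f powr p \<le> C powr p"
    using assms Lp_norm_nonneg[of p f] by (smt (verit) powr_less_mono2 powr_mono2)
  then show ?thesis using Lp_norm_powr[OF assms(1)] by simp
qed

lemma Lp_bound:
  assumes g: "integrable lborel (\<lambda>t. g t powr p)" and f[measurable]: "f \<in> borel_measurable borel"
    and le: "AE t in lborel. cmod (f t) \<le> g t" and p: "0 \<le> p"
  shows "f \<in> Lp p"
proof (rule LpI)
  have "AE t in lborel. norm (cmod (f t) powr p) \<le> norm (g t powr p)"
    using le by eventually_elim (auto intro!: powr_mono2 p)
  then show "integrable lborel (\<lambda>t. cmod (f t) powr p)"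
    by (intro Bochner_Integration.integrable_bound[OF g]) auto
qed fact

lemma Lp_bound_Lp:
  assumes "g \<in> Lp p" "f \<in> borel_measurable borel" "AE t in lborel. cmod (f t) \<le> cmod (g t)" "0 \<le> p"
  shows "f \<in> Lp p"
  using Lp_bound[of "\<lambda>t. cmod (g t)" p f] assms LpD by auto

lemma Lp_add:
  assumes p: "1 \<le> p" and f: "f \<in> Lp p" and g: "g \<in> Lp p"
  shows "(\<lambda>t. f t + g t) \<in> Lp p"
proof (rule LpI)
  note [measurable] = LpD(1)[OF f] LpD(1)[OF g]
  show "(\<lambda>t. f t + g t) \<in> borel_measurable borel" by measurable
  have "integrable lborel (\<lambda>t. 2 powr p * (cmod (f t) powr p + cmod (g t) powr p))"
    using LpD(2)[OF f] LpD(2)[OF g] by auto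
  then show "integrable lborel (\<lambda>t. cmod (f t + g t) powr p)"
  proof (rule Bochner_Integration.integrable_bound)
    have "cmod (f t + g t) powr p \<le> 2 powr p * (cmod (f t) powr p + cmod (g t) powr p)" for t
      using powr_sum_le[OF p, of "cmod (f t)" "cmod (g t)"] norm_triangle_ineq[of "f t" "g t"] p
      by (smt (verit) norm_ge_zero powr_mono2)
    then show "AE t in lborel. norm (cmod (f t + g t) powr p)
        \<le> norm (2 powr p * (cmod (f t) powr p + cmod (g t) powr p))"
      by auto
  qed simp
qed

lemma Lp_cmult: "f \<in> Lp p \<Longrightarrow> (\<lambda>t. c * f t) \<in> Lp p"
  by (auto simp: Lp_def norm_mult powr_mult)

lemma Lp_diff: "1 \<le> p \<Longrightarrow> f \<in> Lp p \<Longrightarrow> g \<in> Lp p \<Longrightarrow> (\<lambda>t. f t - g t) \<in> Lp p"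
  using Lp_add[of p f "\<lambda>t. (-1) * g t"] Lp_cmult[of g p "-1"] by simp

lemma Lp_zero: "(\<lambda>t. 0) \<in> Lp p"
  by (auto simp: Lp_def)

lemma Lp_lincomb: "1 \<le> p \<Longrightarrow> f \<in> Lp p \<Longrightarrow> g \<in> Lp p \<Longrightarrow> (\<lambda>t. a * f t + b * g t) \<in> Lp p"
  by (intro Lp_add Lp_cmult)

lemma Lp_norm_cmult:
  assumes p: "1 \<le> p" shows "Lp_norm p (\<lambda>t. c * f t) = cmod c * Lp_norm p f"
proof -
  have "(LINT t|lborel. cmod (c * f t) powr p) = cmod c powr p * (LINT t|lborel. cmod (f t) powr p)"
    by (simp add: norm_mult powr_mult)
  then show ?thesis using p unfolding Lp_norm_def
    by (simp add: powr_mult integral_nonneg_AE powr_powr)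
qed

lemma Lp_norm_cong_AE:
  assumes "f \<in> borel_measurable borel" "g \<in> borel_measurable borel" "AE t in lborel. f t = g t"
  shows "Lp_norm p f = Lp_norm p g"
proof -
  note [measurable] = assms(1,2)
  have "(LINT t|lborel. cmod (f t) powr p) = (LINT t|lborel. cmod (g t) powr p)"
    by (rule integral_cong_AE) (use assms(3) in auto)
  then show ?thesis by (simp add: Lp_norm_def)
qed

lemma Lp_norm_eq_0:
  assumes p: "1 \<le> p" and f: "f \<in> Lp p" and 0: "Lp_norm p f = 0"
  shows "AE t in lborel. f t = 0"
proof -
  have "(LINT t|lborel. cmod (f t) powr p) = 0"
    using Lp_norm_powr[OF p, of f] 0 p by simp
  then have "AE t in lborel. cmod (f t) powr p = 0"
    using LpD(2)[OF f] by (subst (asm) integral_nonneg_eq_0_iff_AE) auto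
  then show ?thesis by auto
qed

text \<open>Convexity is applied to the normalised functions |f|/A and |g|/B with weights A/(A + B)
  and B/(A + B), where A and B are the norms; a vanishing norm has to be split off first.\<close>

lemma Lp_norm_triangle:
  assumes p: "1 \<le> p" and f: "f \<in> Lp p" and g: "g \<in> Lp p"
  shows "Lp_norm p (\<lambda>t. f t + g t) \<le> Lp_norm p f + Lp_norm p g"
proof -
  note [measurable] = LpD(1)[OF f] LpD(1)[OF g]
  define A where "A = Lp_norm p f"
  define B where "B = Lp_norm p g"
  have AB: "A \<ge> 0" "B \<ge> 0" by (auto simp: A_def B_def Lp_norm_nonneg)
  consider "A = 0" | "B = 0" | "A > 0" "B > 0" using AB by linarith
  then show ?thesis
  proof cases
    case 1
    then have "AE t in lborel. f t = 0" using Lp_norm_eq_0[OF p f] by (simp add: A_def)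
    then have "Lp_norm p (\<lambda>t. f t + g t) = Lp_norm p g" by (intro Lp_norm_cong_AE) auto
    then show ?thesis using Lp_norm_nonneg[of p f] by simp
  next
    case 2
    then have "AE t in lborel. g t = 0" using Lp_norm_eq_0[OF p g] by (simp add: B_def)
    then have "Lp_norm p (\<lambda>t. f t + g t) = Lp_norm p f" by (intro Lp_norm_cong_AE) auto
    then show ?thesis using Lp_norm_nonneg[of p g] by simp
  next
    case 3
    define l where "l = A / (A + B)"
    have l: "0 \<le> l" "l \<le> 1" "(A + B) * l = A" "(A + B) * (1 - l) = B" using 3
        by (auto simp: l_def field_simps)
    define H where "H t = (A + B) powr p * (l / A powr p * cmod (f t) powr p + (1 - l) / B powr p * cmod
        (g t) powr p)" for t
    have Hi: "integrable lborel H" unfolding H_def using LpD(2)[OF f] LpD(2)[OF g] by auto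
    have "cmod (f t + g t) powr p \<le> H t" for t
    proof -
      have "cmod (f t + g t) \<le> A * (cmod (f t) / A) + B * (cmod (g t) / B)"
        using 3 norm_triangle_ineq[of "f t" "g t"] by simp
      also have "\<dots> = ((A + B) * l) * (cmod (f t) / A) + ((A + B) * (1 - l)) * (cmod (g t) / B)"
        unfolding l ..
      also have "\<dots> = (A + B) * (l * (cmod (f t) / A) + (1 - l) * (cmod (g t) / B))"
        by (simp only: distrib_left mult.assoc)
      finally have "cmod (f t + g t) powr p \<le> ((A + B) *
          (l * (cmod (f t) / A) + (1 - l) * (cmod (g t) / B))) powr p"
        using p by (intro powr_mono2) auto
      also have "\<dots> = (A + B) powr p * (l * (cmod (f t) / A) + (1 - l) * (cmod (g t) / B)) powr p"
        using 3 l by (subst powr_mult) auto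
      also have "\<dots> \<le> (A + B) powr p * (l * (cmod (f t) / A) powr p + (1 - l) * (cmod (g t) / B) powr p)"
        using 3 l p by (intro mult_left_mono powr_convex_comb) auto
      also have "\<dots> = H t" using 3 by (simp add: H_def powr_divide)
      finally show ?thesis .
    qed
    then have "(LINT t|lborel. cmod (f t + g t) powr p) \<le> integral\<^sup>L lborel H"
      using Hi LpD(2)[OF Lp_add[OF p f g]] by (intro integral_mono) auto
    also have "\<dots> = (A + B) powr p * (l / A powr p * (A powr p) + (1 - l) / B powr p * (B powr p))"
      unfolding H_def A_def B_def Lp_norm_powr[OF p] using LpD(2)[OF f] LpD(2)[OF g] by simp
    also have "\<dots> = (A + B) powr p" using 3 by simp
    finally show ?thesis using Lp_norm_le_iff[OF p, of "A + B" "\<lambda>t. f t + g t"] AB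
      by (simp add: A_def B_def)
  qed
qed

lemma Lp_norm_minus: "Lp_norm p (\<lambda>t. f t - g t) = Lp_norm p (\<lambda>t. g t - f t)"
  by (simp add: Lp_norm_def norm_minus_commute)

lemma Lp_norm_triangle_diff:
  assumes p: "1 \<le> p" and "f \<in> Lp p" "g \<in> Lp p" "h \<in> Lp p"
  shows "Lp_norm p (\<lambda>t. f t - h t) \<le> Lp_norm p (\<lambda>t. f t - g t) + Lp_norm p (\<lambda>t. g t - h t)"
  using Lp_norm_triangle[OF p, of "\<lambda>t. f t - g t" "\<lambda>t. g t - h t"] Lp_diff[OF p] assms by simp

lemma Lp_limit_unique_AE:
  assumes p: "1 \<le> p" and F: "\<And>n. F n \<in> Lp p" and f: "f \<in> Lp p" and g: "g \<in> Lp p"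
    and "(\<lambda>n. Lp_norm p (\<lambda>t. F n t - f t)) \<longlonglongrightarrow> 0"
    and "(\<lambda>n. Lp_norm p (\<lambda>t. F n t - g t)) \<longlonglongrightarrow> 0"
  shows "AE t in lborel. f t = g t"
proof -
  have "(\<lambda>n. Lp_norm p (\<lambda>t. F n t - f t) + Lp_norm p (\<lambda>t. F n t - g t)) \<longlonglongrightarrow> 0 + 0"
    by (intro tendsto_add assms)
  moreover have "Lp_norm p (\<lambda>t. f t - g t) \<le> Lp_norm p (\<lambda>t. F n t - f t) + Lp_norm p (\<lambda>t. F n t - g t)"
      for n
    using Lp_norm_triangle_diff[OF p f F g, of n] Lp_norm_minus[of p f "F n"] by simp
  ultimately have "Lp_norm p (\<lambda>t. f t - g t) \<le> 0 + 0"
    by (intro LIMSEQ_le_const) auto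
  then have "Lp_norm p (\<lambda>t. f t - g t) = 0" using Lp_norm_nonneg[of p] by (simp add: antisym)
  then have "AE t in lborel. f t - g t = 0"
    by (intro Lp_norm_eq_0[OF p Lp_diff[OF p f g]])
  then show ?thesis by auto
qed

lemma Lp_dominated_convergence:
  assumes p: "1 \<le> p" and F[measurable]: "\<And>n. F n \<in> borel_measurable borel"
    and f[measurable]: "f \<in> borel_measurable borel"
    and w: "integrable lborel (\<lambda>t. w t powr p)"
    and lim: "AE t in lborel. (\<lambda>n. F n t) \<longlonglongrightarrow> f t"
    and bd: "\<And>n. AE t in lborel. cmod (F n t) \<le> w t"
  shows "\<And>n. F n \<in> Lp p" "f \<in> Lp p" "(\<lambda>n. Lp_norm p (\<lambda>t. F n t - f t)) \<longlonglongrightarrow> 0"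
proof -
  have bd': "AE t in lborel. \<forall>n. cmod (F n t) \<le> w t" using bd by (simp add: AE_all_countable)
  have fw: "AE t in lborel. cmod (f t) \<le> w t"
    using lim bd'
  proof eventually_elim
    case (elim t)
    have "(\<lambda>n. cmod (F n t)) \<longlonglongrightarrow> cmod (f t)" using elim(1) by (rule tendsto_norm)
    then show ?case using elim(2) by (intro LIMSEQ_le_const2) auto
  qed
  show 1: "F n \<in> Lp p" for n using Lp_bound[OF w F bd] p by simp
  show 2: "f \<in> Lp p" using Lp_bound[OF w f fw] p by simp
  have "(\<lambda>n. LINT t|lborel. cmod (F n t - f t) powr p) \<longlonglongrightarrow> (LINT t::real|lborel. (0::real))"
  proof (rule integral_dominated_convergence[where w = "\<lambda>t. 2 powr p * (w t powr p)"])
    show "integrable lborel (\<lambda>t. 2 powr p * w t powr p)" using w by simp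
    show "AE t in lborel. (\<lambda>n. cmod (F n t - f t) powr p) \<longlonglongrightarrow> 0"
      using lim
    proof eventually_elim
      case (elim t)
      have "(\<lambda>n. cmod (F n t - f t) powr p) \<longlonglongrightarrow> 0 powr p"
        by (intro tendsto_powr' tendsto_norm_zero) (use elim p in \<open>auto simp: LIM_zero\<close>)
      then show ?case using p by simp
    qed
    show "AE t in lborel. norm (cmod (F n t - f t) powr p) \<le> 2 powr p * w t powr p" for n
      using bd' fw
    proof eventually_elim
      case (elim t)
      have "cmod (F n t - f t) \<le> 2 * w t" using elim norm_triangle_ineq4[of "F n t" "f t"]
          by (smt (verit))
      moreover have "0 \<le> w t" using elim(2) norm_ge_zero order_trans by blast
      ultimately have "cmod (F n t - f t) powr p \<le> (2 * w t) powr p" using p by (intro powr_mono2) auto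
      then show ?case using \<open>0 \<le> w t\<close> by (simp add: powr_mult)
    qed
  qed auto
  then have "(\<lambda>n. (LINT t|lborel. cmod (F n t - f t) powr p) powr (1 / p)) \<longlonglongrightarrow> 0 powr (1 / p)"
    using p by (intro tendsto_powr') (auto intro!: always_eventually)
  then show "(\<lambda>n. Lp_norm p (\<lambda>t. F n t - f t)) \<longlonglongrightarrow> 0"
    using p by (simp add: Lp_norm_def)
qed

section \<open>Dilation convolutions\<close>

text \<open>Jensen in r for fixed t, then Fubini. The bound agrees with Minkowski's when the norms
  of the functions \<open>G r\<close> do not depend on r, and the normalised dilations are of this
  kind.\<close>

lemma minkowski_integral:
  fixes k :: "real \<Rightarrow> real" and G :: "real \<Rightarrow> real \<Rightarrow> real"
  assumes p: "1 \<le> p" and k: "integrable lborel k" and k0: "\<And>r. 0 \<le> k r" and G0: "\<And>r t. 0 \<le> G r t"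
    and G[measurable]: "(\<lambda>(r, t). G r t) \<in> borel_measurable (borel \<Otimes>\<^sub>M borel)"
    and int: "integrable (lborel \<Otimes>\<^sub>M lborel) (\<lambda>(r, t). k r * G r t powr p)"
  shows "AE t in lborel. integrable lborel (\<lambda>r. k r * G r t)"
    and "integrable lborel (\<lambda>t. (LINT r|lborel. k r * G r t) powr p)"
    and "(LINT t|lborel. (LINT r|lborel. k r * G r t) powr p) \<le>
      (LINT r|lborel. k r) powr (p - 1) * (LINT r|lborel. k r * (LINT t|lborel. G r t powr p))"
proof -
  have [measurable]: "k \<in> borel_measurable borel" using k by auto
  have Gt[measurable]: "(\<lambda>r. G r t) \<in> borel_measurable borel" for t by measurable
  have 1: "AE t in lborel. integrable lborel (\<lambda>r. k r * G r t powr p)"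
    using lborel_pair.AE_integrable_snd[OF int] .
  have i: "integrable lborel (\<lambda>t. LINT r|lborel. k r * G r t powr p)"
    using lborel_pair.integrable_snd[OF int] .
  show 2: "AE t in lborel. integrable lborel (\<lambda>r. k r * G r t)"
    using 1
  proof eventually_elim
    case (elim t) show ?case
      by (rule jensen_powr(1)[OF p k _ elim]) (use k0 G0 Gt in auto)
  qed
  have 3: "AE t in lborel. (LINT r|lborel. k r * G r t) powr p \<le>
      (LINT r|lborel. k r) powr (p - 1) * (LINT r|lborel. k r * G r t powr p)"
    using 1
  proof eventually_elim
    case (elim t) show ?case
      by (rule jensen_powr(2)[OF p k _ elim]) (use k0 G0 Gt in auto)
  qed
  let ?B = "\<lambda>t. (LINT r|lborel. k r) powr (p - 1) * (LINT r|lborel. k r * G r t powr p)"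
  have iB: "integrable lborel ?B" using i by auto
  show 4: "integrable lborel (\<lambda>t. (LINT r|lborel. k r * G r t) powr p)"
  proof (rule Bochner_Integration.integrable_bound[OF iB])
    show "AE t in lborel. norm ((LINT r|lborel. k r * G r t) powr p) \<le> norm (?B t)"
      using 3 by eventually_elim auto
  qed measurable
  have "(LINT t|lborel. (LINT r|lborel. k r * G r t) powr p) \<le> (LINT t|lborel. ?B t)"
    by (rule integral_mono_AE[OF 4 iB 3])
  also have "\<dots> = (LINT r|lborel. k r) powr (p - 1) * (LINT r|lborel. k r *
      (LINT t|lborel. G r t powr p))"
    using lborel_pair.Fubini_integral[OF int] by simp
  finally show "(LINT t|lborel. (LINT r|lborel. k r * G r t) powr p) \<le>
      (LINT r|lborel. k r) powr (p - 1) * (LINT r|lborel. k r * (LINT t|lborel. G r t powr p))" .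
qed

section \<open>Affine changes of variable\<close>

lemma lborel_integral_scale:
  fixes f :: "real \<Rightarrow> 'a :: {banach, second_countable_topology}"
  shows "0 < c \<Longrightarrow> (LINT t|lborel. f (c * t)) = (1 / c) *\<^sub>R (LINT t|lborel. f t)"
  using lborel_integral_real_affine[of c f 0] by simp

lemma lborel_integrable_scale:
  fixes f :: "real \<Rightarrow> 'a :: {banach, second_countable_topology}"
  shows "c \<noteq> 0 \<Longrightarrow> integrable lborel f \<Longrightarrow> integrable lborel (\<lambda>t. f (c * t))"
  using lborel_integrable_real_affine[of f c 0] by simp

lemma lborel_integral_shift:
  fixes f :: "real \<Rightarrow> 'a :: {banach, second_countable_topology}"
  shows "(LINT t|lborel. f (t + c)) = (LINT t|lborel. f t)"
  using lborel_integral_real_affine[of 1 f c] by (simp add: add.commute)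

lemma lborel_integrable_shift:
  fixes f :: "real \<Rightarrow> 'a :: {banach, second_countable_topology}"
  shows "integrable lborel f \<Longrightarrow> integrable lborel (\<lambda>t. f (t + c))"
  using lborel_integrable_real_affine[of f 1 c] by (simp add: add.commute)

lemma lborel_integral_reflect:
  fixes f :: "real \<Rightarrow> 'a :: {banach, second_countable_topology}"
  shows "(LINT t|lborel. f (c - t)) = (LINT t|lborel. f t)"
  using lborel_integral_real_affine[of "-1" f c] by simp

lemma lborel_integrable_reflect:
  fixes f :: "real \<Rightarrow> 'a :: {banach, second_countable_topology}"
  shows "integrable lborel f \<Longrightarrow> integrable lborel (\<lambda>t. f (c - t))"
  using lborel_integrable_real_affine[of f "-1" c] by simp

text \<open>The weight exp (r / p) is the norm on L^p of the operator that takes f to the function f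
  (exp (- r) * t) of t.\<close>

definition kernel :: "real \<Rightarrow> (real \<Rightarrow> complex) \<Rightarrow> bool" where
  "kernel p k \<longleftrightarrow> k \<in> borel_measurable borel \<and> integrable lborel (\<lambda>r. exp (r / p) * cmod (k r))"

definition dil_op :: "(real \<Rightarrow> complex) \<Rightarrow> (real \<Rightarrow> complex) \<Rightarrow> real \<Rightarrow> complex" where
  "dil_op k f t = (LINT r|lborel. k r * f (exp (- r) * t))"

text \<open>\<open>mass p k\<close> bounds the operator norm of \<open>dil_op k\<close> on \<open>L\<^sup>p\<close>, and \<open>kernel p k\<close> says that it is finite.\<close>

definition mass :: "real \<Rightarrow> (real \<Rightarrow> complex) \<Rightarrow> real" where
  "mass p k = (LINT r|lborel. exp (r / p) * cmod (k r))"

lemma kernelD: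
  "kernel p k \<Longrightarrow> k \<in> borel_measurable borel" "kernel p k
      \<Longrightarrow> integrable lborel (\<lambda>r. exp (r / p) * cmod (k r))"
  by (auto simp: kernel_def)

lemma mass_nonneg: "0 \<le> mass p k"
  by (simp add: mass_def)

lemma dil_op_measurable[measurable]:
  assumes [measurable]: "k \<in> borel_measurable borel" "f \<in> borel_measurable borel"
  shows "dil_op k f \<in> borel_measurable borel"
  unfolding dil_op_def by measurable

lemma Lp_dilate:
  assumes p: "1 \<le> p" and f: "f \<in> Lp p"
  shows "integrable lborel (\<lambda>t. (exp (- r / p) * cmod (f (exp (- r) * t))) powr p)"
    and "(LINT t|lborel. (exp (- r / p) * cmod (f (exp (- r) * t))) powr p) = Lp_norm p f powr p"
proof -
  have eq: "(exp (- r / p) * cmod (f (exp (- r) * t))) powr p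
      = exp (- r) * cmod (f (exp (- r) * t)) powr p" for t
    using p by (simp add: powr_mult exp_powr_real)
  show "integrable lborel (\<lambda>t. (exp (- r / p) * cmod (f (exp (- r) * t))) powr p)"
    unfolding eq using lborel_integrable_scale[OF _ LpD(2)[OF f], of "exp (- r)"] by simp
  show "(LINT t|lborel. (exp (- r / p) * cmod (f (exp (- r) * t))) powr p) = Lp_norm p f powr p"
    unfolding eq Lp_norm_powr[OF p]
    using lborel_integral_scale[of "exp (- r)" "\<lambda>t. cmod (f t) powr p"] by simp
qed

lemma dil_op_bound:
  assumes p: "1 \<le> p" and k: "kernel p k" and f: "f \<in> Lp p"
  shows "AE t in lborel. integrable lborel (\<lambda>r. k r * f (exp (- r) * t))"
    and "dil_op k f \<in> Lp p"
    and "Lp_norm p (dil_op k f) \<le> mass p k * Lp_norm p f"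
proof -
  note [measurable] = kernelD(1)[OF k] LpD(1)[OF f]
  \<comment> \<open>The factor exp (r / p) is moved into K, so that every \<open>G r\<close> has the
    norm of f.\<close>
  define K where "K r = exp (r / p) * cmod (k r)" for r
  define G where "G r t = exp (- r / p) * cmod (f (exp (- r) * t))" for r t
  have K: "integrable lborel K" unfolding K_def using kernelD(2)[OF k] .
  have [measurable]: "K \<in> borel_measurable borel" "(\<lambda>(r, t). G r t) \<in> borel_measurable (borel \<Otimes>\<^sub>M borel)"
    unfolding K_def G_def by measurable
  have K0: "0 \<le> K r" and G0: "0 \<le> G r t" for r t by (auto simp: K_def G_def)
  have Gp: "integrable lborel (\<lambda>t. G r t powr p)" "(LINT t|lborel. G r t powr p)
      = Lp_norm p f powr p" for r
    unfolding G_def using Lp_dilate[OF p f] by auto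
  have int: "integrable (lborel \<Otimes>\<^sub>M lborel) (\<lambda>(r, t). K r * G r t powr p)"
  proof (rule lborel_pair.Fubini_integrable)
    show "integrable lborel (\<lambda>r. LINT t|lborel. norm (case (r, t) of (r, t) \<Rightarrow> K r * G r t powr p))"
      using K K0 by (simp add: abs_mult Gp)
    show "AE r in lborel. integrable lborel (\<lambda>t. case (r, t) of (r, t) \<Rightarrow> K r * G r t powr p)"
      using Gp by simp
  qed measurable
  have eq: "K r * G r t = cmod (k r * f (exp (- r) * t))" for r t
    by (simp add: K_def G_def norm_mult exp_minus field_simps)
  note M = minkowski_integral[OF p K K0 G0 _ int]
  show 1: "AE t in lborel. integrable lborel (\<lambda>r. k r * f (exp (- r) * t))"
  proof -
    have "AE t in lborel. integrable lborel (\<lambda>r. K r * G r t)" by (rule M(1)) measurable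
    then show ?thesis
    proof eventually_elim
      case (elim t) then show ?case unfolding eq by (subst (asm) integrable_norm_iff) auto
    qed
  qed
  have m: "integrable lborel (\<lambda>t. (LINT r|lborel. K r * G r t) powr p)" by (rule M(2)) measurable
  have le: "AE t in lborel. cmod (dil_op k f t) \<le> (LINT r|lborel. K r * G r t)"
    by (rule AE_I2) (simp add: dil_op_def eq)
  show 2: "dil_op k f \<in> Lp p"
    by (rule Lp_bound[OF m _ le]) (use p in auto)
  have "(LINT t|lborel. cmod (dil_op k f t) powr p) \<le> (LINT t|lborel. (LINT r|lborel. K r * G r t) powr
      p)"
    by (rule integral_mono_AE[OF LpD(2)[OF 2] m]) (use le p
        in \<open>auto elim!: eventually_mono intro!: powr_mono2\<close>)
  also have "\<dots> \<le> (LINT r|lborel. K r) powr (p - 1) * (LINT r|lborel. K r *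
      (LINT t|lborel. G r t powr p))"
    by (rule M(3)) measurable
  also have "\<dots> = mass p k powr (p - 1) * (mass p k * Lp_norm p f powr p)"
    unfolding Gp mass_def K_def by simp
  also have "\<dots> = (mass p k * Lp_norm p f) powr p"
    using mass_nonneg[of p k] Lp_norm_nonneg[of p f] p by (cases "mass p k = 0")
        (auto simp: powr_mult powr_diff)
  finally show "Lp_norm p (dil_op k f) \<le> mass p k * Lp_norm p f"
    using p mass_nonneg[of p k] Lp_norm_nonneg[of p f] by (subst Lp_norm_le_iff) auto
qed

lemma dil_op_lincomb:
  assumes p: "1 \<le> p" and k: "kernel p k" and f: "f \<in> Lp p" and g: "g \<in> Lp p"
  shows "AE t in lborel. dil_op k (\<lambda>s. a * f s + b * g s) t = a * dil_op k f t + b * dil_op k g t"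
  using dil_op_bound(1)[OF p k f] dil_op_bound(1)[OF p k g]
proof eventually_elim
  case (elim t)
  have "dil_op k (\<lambda>s. a * f s + b * g s) t
     = (LINT r|lborel. a * (k r * f (exp (- r) * t)) + b * (k r * g (exp (- r) * t)))"
    unfolding dil_op_def by (simp add: algebra_simps)
  also have "\<dots> = a * dil_op k f t + b * dil_op k g t"
    unfolding dil_op_def using elim by simp
  finally show ?case .
qed

lemma dil_op_diff:
  assumes p: "1 \<le> p" and k: "kernel p k" and f: "f \<in> Lp p" and g: "g \<in> Lp p"
  shows "AE t in lborel. dil_op k (\<lambda>s. f s - g s) t = dil_op k f t - dil_op k g t"
  using dil_op_lincomb[OF p k f g, of 1 "-1"] by simp

text \<open>A bounded operator sends f - g, which has norm 0, to a function of norm 0.\<close>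

lemma dil_op_cong_AE:
  assumes p: "1 \<le> p" and k: "kernel p k" and f: "f \<in> Lp p" and g: "g \<in> Lp p"
    and eq: "AE t in lborel. f t = g t"
  shows "AE t in lborel. dil_op k f t = dil_op k g t"
proof -
  note [measurable] = LpD(1)[OF f] LpD(1)[OF g]
  have d: "(\<lambda>t. f t - g t) \<in> Lp p" using Lp_diff[OF p f g] .
  have "Lp_norm p (\<lambda>t. f t - g t) = Lp_norm p (\<lambda>t. 0)"
    by (rule Lp_norm_cong_AE) (use eq in auto)
  then have "Lp_norm p (dil_op k (\<lambda>t. f t - g t)) = 0"
    using dil_op_bound(3)[OF p k d] Lp_norm_nonneg[of p "dil_op k (\<lambda>t. f t - g t)"] p
    by (simp add: Lp_norm_def)
  then have "AE t in lborel. dil_op k (\<lambda>t. f t - g t) t = 0"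
    using Lp_norm_eq_0[OF p dil_op_bound(2)[OF p k d]] by simp
  then show ?thesis using dil_op_diff[OF p k f g] by eventually_elim simp
qed

lemma dil_op_tendsto:
  assumes p: "1 \<le> p" and k: "kernel p k" and F: "\<And>n. F n \<in> Lp p" and f: "f \<in> Lp p"
    and lim: "(\<lambda>n. Lp_norm p (\<lambda>t. F n t - f t)) \<longlonglongrightarrow> 0"
  shows "(\<lambda>n. Lp_norm p (\<lambda>t. dil_op k (F n) t - dil_op k f t)) \<longlonglongrightarrow> 0"
proof (rule Lim_null_comparison)
  show "(\<lambda>n. mass p k * Lp_norm p (\<lambda>t. F n t - f t)) \<longlonglongrightarrow> 0"
    using tendsto_mult_right_zero[OF lim] by simp
  have "Lp_norm p (\<lambda>t. dil_op k (F n) t - dil_op k f t) \<le> mass p k * Lp_norm p (\<lambda>t. F n t - f t)" for n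
  proof -
    note [measurable] = LpD(1)[OF f] LpD(1)[OF F] kernelD(1)[OF k]
    have "Lp_norm p (\<lambda>t. dil_op k (F n) t - dil_op k f t) = Lp_norm p (dil_op k (\<lambda>t. F n t - f t))"
      by (rule Lp_norm_cong_AE) (use dil_op_diff[OF p k F f, of n] in \<open>auto elim!: eventually_mono\<close>)
    then show ?thesis using dil_op_bound(3)[OF p k Lp_diff[OF p F f]] by simp
  qed
  then show "\<forall>\<^sub>F n in sequentially. norm (Lp_norm p (\<lambda>t. dil_op k (F n) t - dil_op k f t))
      \<le> mass p k * Lp_norm p (\<lambda>t. F n t - f t)"
    by (auto simp: Lp_norm_nonneg)
qed

lemma dil_op_kernel_lincomb:
  assumes p: "1 \<le> p" and k: "kernel p k" and l: "kernel p l" and f: "f \<in> Lp p"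
  shows "AE t in lborel. dil_op (\<lambda>r. a * k r + b * l r) f t = a * dil_op k f t + b * dil_op l f t"
  using dil_op_bound(1)[OF p k f] dil_op_bound(1)[OF p l f]
proof eventually_elim
  case (elim t)
  have "dil_op (\<lambda>r. a * k r + b * l r) f t
     = (LINT r|lborel. a * (k r * f (exp (- r) * t)) + b * (l r * f (exp (- r) * t)))"
    unfolding dil_op_def by (simp add: algebra_simps)
  also have "\<dots> = a * dil_op k f t + b * dil_op l f t"
    unfolding dil_op_def using elim by simp
  finally show ?case .
qed

section \<open>Composition of dilation convolutions\<close>

definition conv :: "(real \<Rightarrow> complex) \<Rightarrow> (real \<Rightarrow> complex) \<Rightarrow> real \<Rightarrow> complex" where
  "conv k l s = (LINT r|lborel. k r * l (s - r))"

lemma conv_commute: "conv k l = conv l k"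
proof
  fix s
  have "conv k l s = (LINT r|lborel. k (s - r) * l (s - (s - r)))"
    unfolding conv_def by (subst lborel_integral_reflect[of _ s, symmetric]) simp
  then show "conv k l s = conv l k s" by (simp add: conv_def mult.commute)
qed

lemma conv_measurable[measurable]:
  assumes [measurable]: "k \<in> borel_measurable borel" "l \<in> borel_measurable borel"
  shows "conv k l \<in> borel_measurable borel"
  unfolding conv_def by measurable

text \<open>The weight is multiplicative, exp (s / p) = exp (r / p) * exp ((s - r) / p), so by
  Fubini the weighted L^1 space is closed under convolution.\<close>

lemma kernel_conv:
  assumes k: "kernel p k" and l: "kernel p l"
  shows "kernel p (conv k l)" "AE s in lborel. integrable lborel (\<lambda>r. k r * l (s - r))"
proof -
  note [measurable] = kernelD(1)[OF k] kernelD(1)[OF l]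
  have sh: "integrable lborel (\<lambda>s. exp (s / p) * cmod (l (s - r)))"
    "(LINT s|lborel. exp (s / p) * cmod (l (s - r))) = exp (r / p) * mass p l" for r
  proof -
    have eq: "exp (s / p) * cmod (l (s - r)) = exp (r / p) * (exp ((s + - r) / p) * cmod (l (s + - r)))"
        for s
      by (simp add: exp_add diff_divide_distrib exp_diff)
    show "integrable lborel (\<lambda>s. exp (s / p) * cmod (l (s - r)))"
      unfolding eq using lborel_integrable_shift[OF kernelD(2)[OF l], of "- r"] by simp
    show "(LINT s|lborel. exp (s / p) * cmod (l (s - r))) = exp (r / p) * mass p l"
      unfolding eq using lborel_integral_shift[of "\<lambda>s. exp (s / p) * cmod (l s)" "- r"]
          by (simp add: mass_def)
  qed
  have int: "integrable (lborel \<Otimes>\<^sub>M lborel) (\<lambda>(r, s). complex_of_real (exp (s / p)) * (k r * l (s - r)))"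
  proof (rule lborel_pair.Fubini_integrable)
    have n: "(LINT s|lborel. norm (case (r, s) of (r, s) \<Rightarrow> complex_of_real (exp (s / p)) *
        (k r * l (s - r)))) = exp (r / p) * cmod (k r) * mass p l" for r
    proof -
      have "(LINT s|lborel. norm (case (r, s) of (r, s) \<Rightarrow> complex_of_real (exp (s / p)) *
          (k r * l (s - r)))) = (LINT s|lborel. cmod (k r) * (exp (s / p) * cmod (l (s - r))))"
        by (simp add: norm_mult algebra_simps)
      then show ?thesis using sh by simp
    qed
    show "integrable lborel (\<lambda>r. LINT s|lborel. norm (case (r, s) of (r, s) \<Rightarrow> complex_of_real
        (exp (s / p)) * (k r * l (s - r))))"
      unfolding n using kernelD(2)[OF k] by simp
    have "integrable lborel (\<lambda>s. complex_of_real (exp (s / p)) * (k r * l (s - r)))" for r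
    proof -
      have "integrable lborel (\<lambda>s. cmod (k r) * (exp (s / p) * cmod (l (s - r))))" using sh by simp
      then show ?thesis by (rule Bochner_Integration.integrable_bound) (auto simp: norm_mult)
    qed
    then show "AE r in lborel. integrable lborel (\<lambda>s. case (r, s) of (r, s) \<Rightarrow> complex_of_real
        (exp (s / p)) * (k r * l (s - r)))"
      by simp
  qed measurable
  show "AE s in lborel. integrable lborel (\<lambda>r. k r * l (s - r))"
    using lborel_pair.AE_integrable_snd[OF int]
  proof eventually_elim
    case (elim s)
    then have "integrable lborel (\<lambda>r. complex_of_real (exp (- s / p)) *
        (complex_of_real (exp (s / p)) * (k r * l (s - r))))"
      by simp
    moreover have "complex_of_real (exp (- s / p)) * (complex_of_real (exp (s / p)) * z) = z" for z
      by (simp flip: mult.assoc of_real_mult exp_add)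
    ultimately show ?case by (simp only:)
  qed
  have "integrable lborel (\<lambda>s. LINT r|lborel. complex_of_real (exp (s / p)) * (k r * l (s - r)))"
    using lborel_pair.integrable_snd[OF int] .
  then have "integrable lborel (\<lambda>s. complex_of_real (exp (s / p)) * conv k l s)"
    by (simp add: conv_def)
  then have "integrable lborel (\<lambda>s. norm (complex_of_real (exp (s / p)) * conv k l s))"
    by (rule integrable_norm)
  then show "kernel p (conv k l)" unfolding kernel_def by (simp add: norm_mult)
qed

text \<open>For almost every fixed t the inner integral is shifted by r and the order of integration
  is exchanged.\<close>

lemma dil_op_comp:
  assumes p: "1 \<le> p" and k: "kernel p k" and l: "kernel p l" and f: "f \<in> Lp p"
  shows "AE t in lborel. dil_op k (dil_op l f) t = dil_op (conv k l) f t"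
proof -
  note [measurable] = kernelD(1)[OF k] kernelD(1)[OF l] LpD(1)[OF f]
  \<comment> \<open>The moduli supply absolute integrability of the double integral:
    \<open>conv ka la\<close> against \<open>fa\<close> is again covered by
    \<open>dil_op_bound\<close>.\<close>
  define ka where "ka r = complex_of_real (cmod (k r))" for r
  define la where "la r = complex_of_real (cmod (l r))" for r
  define fa where "fa t = complex_of_real (cmod (f t))" for t
  have [measurable]: "ka \<in> borel_measurable borel" "la \<in> borel_measurable borel"
      "fa \<in> borel_measurable borel"
    unfolding ka_def la_def fa_def by measurable
  have ka: "kernel p ka" and la: "kernel p la" using k l unfolding kernel_def ka_def la_def by auto
  have fa: "fa \<in> Lp p" using f unfolding Lp_def fa_def by auto
  have cv: "conv ka la s = complex_of_real (LINT r|lborel. cmod (k r * l (s - r)))" for s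
    unfolding conv_def ka_def la_def by (simp add: norm_mult flip: of_real_mult)
  show ?thesis
    using dil_op_bound(1)[OF p kernel_conv(1)[OF ka la] fa]
  proof eventually_elim
    case (elim t)
    have int: "integrable (lborel \<Otimes>\<^sub>M lborel) (\<lambda>(s, r). k r * l (s - r) * f (exp (- s) * t))"
    proof (rule lborel_pair.Fubini_integrable)
      have eq: "complex_of_real (LINT r|lborel. cmod (k r * l (s - r) * f (exp (- s) * t)))
          = conv ka la s * fa (exp (- s) * t)" for s
        unfolding cv fa_def by (simp add: norm_mult)
      have "integrable lborel (\<lambda>s. complex_of_real (LINT r|lborel. cmod
          (k r * l (s - r) * f (exp (- s) * t))))"
        unfolding eq using elim .
      then show "integrable lborel (\<lambda>s. LINT r|lborel. cmod
          (case (s, r) of (s, r) \<Rightarrow> k r * l (s - r) * f (exp (- s) * t)))"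
        by (simp add: complex_of_real_integrable_eq)
      show "AE s in lborel. integrable lborel (\<lambda>r. case (s, r) of (s, r) \<Rightarrow> k r * l (s - r) * f
          (exp (- s) * t))"
        using kernel_conv(2)[OF k l] by eventually_elim simp
    qed measurable
    have "dil_op (conv k l) f t = (LINT s|lborel. LINT r|lborel. k r * l (s - r) * f (exp (- s) * t))"
      unfolding dil_op_def conv_def by simp
    also have "\<dots> = (LINT r|lborel. LINT s|lborel. k r * l (s - r) * f (exp (- s) * t))"
      using lborel_pair.Fubini_integral[OF int] by simp
    also have "\<dots> = (LINT r|lborel. k r * (LINT s|lborel. l (s - r) * f (exp (- s) * t)))"
      by (simp add: mult.assoc)
    also have "\<dots> = (LINT r|lborel. k r * dil_op l f (exp (- r) * t))"
    proof (intro Bochner_Integration.integral_cong refl arg_cong2[where f = "(*)"])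
      fix r
      show "(LINT s|lborel. l (s - r) * f (exp (- s) * t)) = dil_op l f (exp (- r) * t)"
        unfolding dil_op_def
        by (subst lborel_integral_shift[of _ r, symmetric])
            (simp add: exp_add exp_diff exp_minus field_simps)
    qed
    finally show ?case by (simp add: dil_op_def)
  qed
qed

lemma dil_op_commute:
  assumes p: "1 \<le> p" and k: "kernel p k" and l: "kernel p l" and f: "f \<in> Lp p"
  shows "AE t in lborel. dil_op k (dil_op l f) t = dil_op l (dil_op k f) t"
  using dil_op_comp[OF p k l f] dil_op_comp[OF p l k f] by eventually_elim (simp add: conv_commute)

lemma dil_op_cmult: "dil_op k (\<lambda>s. c * f s) t = c * dil_op k f t"
  unfolding dil_op_def by (simp add: mult.left_commute)

text \<open>Substituting exp r * t for t in the pairing moves the dilation from f to g, with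
  Jacobian exp r; reflecting r then gives this kernel.\<close>

definition transpose_kernel :: "(real \<Rightarrow> complex) \<Rightarrow> real \<Rightarrow> complex" where
  "transpose_kernel k r = complex_of_real (exp (- r)) * k (- r)"

lemma kernel_transpose:
  assumes "1 / p + 1 / q = 1" "kernel p k"
  shows "kernel q (transpose_kernel k)"
proof -
  note [measurable] = kernelD(1)[OF assms(2)]
  have "exp (r / q) * cmod (transpose_kernel k r) = exp ((0 - r) / p) * cmod (k (0 - r))" for r
  proof -
    have "1 / q = 1 - 1 / p" using assms(1) by simp
    then have "r / q = r * (1 - 1 / p)" by (metis mult.right_neutral times_divide_eq_right)
    then have "exp (r / q) = exp r * exp (- r / p)" by (simp add: right_diff_distrib flip: exp_add)
    then show ?thesis by (simp add: transpose_kernel_def norm_mult norm_inverse exp_minus)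
  qed
  then show ?thesis
    using lborel_integrable_reflect[OF kernelD(2)[OF assms(2)], of 0]
    unfolding kernel_def by (simp add: transpose_kernel_def[abs_def])
qed

text \<open>Young's inequality for the normalised dilate of f and for g takes the place of Hoelder's
  inequality; the integral of its right side over t is a constant times exp (r / p) * |k r|.\<close>

lemma pairing_integrable:
  assumes p: "1 < p" and q: "1 < q" and pq: "1 / p + 1 / q = 1" and k: "kernel p k" and f: "f \<in> Lp p"
      and g: "g \<in> Lp q"
  shows "integrable (lborel \<Otimes>\<^sub>M lborel) (\<lambda>(r, t). k r * f (exp (- r) * t) * g t)"
proof (rule lborel_pair.Fubini_integrable)
  note [measurable] = kernelD(1)[OF k] LpD(1)[OF f] LpD(1)[OF g]
  show "(\<lambda>(r, t). k r * f (exp (- r) * t) * g t) \<in> borel_measurable (lborel \<Otimes>\<^sub>M lborel)"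
    by measurable
  define G where "G r t = exp (- r / p) * cmod (f (exp (- r) * t))" for r t
  define B where "B r t = exp (r / p) * cmod (k r) * (G r t powr p / p + cmod (g t) powr q / q)" for r t
  have p1: "1 \<le> p" using p by simp
  have Bi: "integrable lborel (B r)" for r
    unfolding B_def[abs_def] G_def using Lp_dilate(1)[OF p1 f] LpD(2)[OF g] by auto
  have BI: "(LINT t|lborel. B r t) = exp (r / p) * cmod (k r) *
      (Lp_norm p f powr p / p + (LINT t|lborel. cmod (g t) powr q) / q)" for r
    unfolding B_def[abs_def] G_def using Lp_dilate[OF p1 f] LpD(2)[OF g] by simp
  have le: "cmod (k r * f (exp (- r) * t) * g t) \<le> B r t" for r t
  proof -
    have "G r t * cmod (g t) \<le> G r t powr p / p + cmod (g t) powr q / q"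
      by (rule Youngs_inequality[OF p q pq]) (auto simp: G_def)
    then have "exp (r / p) * cmod (k r) * (G r t * cmod (g t)) \<le> B r t"
      unfolding B_def by (intro mult_left_mono) auto
    then show ?thesis by (simp add: G_def norm_mult exp_minus field_simps)
  qed
  have i: "integrable lborel (\<lambda>t. k r * f (exp (- r) * t) * g t)" for r
    by (rule Bochner_Integration.integrable_bound[OF Bi[of r]])
        (use le in \<open>auto intro!: AE_I2 order_trans[OF le]\<close>)
  then show "AE r in lborel. integrable lborel (\<lambda>t. case (r, t) of (r, t) \<Rightarrow> k r * f (exp (- r) * t) * g
      t)"
    by simp
  have BBi: "integrable lborel (\<lambda>r. LINT t|lborel. B r t)"
    unfolding BI using kernelD(2)[OF k] by simp
  show "integrable lborel (\<lambda>r. LINT t|lborel. cmod (case (r, t) of (r, t) \<Rightarrow> k r * f (exp (- r) * t) * g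
      t))"
  proof (rule Bochner_Integration.integrable_bound[OF BBi])
    have "(LINT t|lborel. cmod (k r * f (exp (- r) * t) * g t)) \<le> (LINT t|lborel. B r t)" for r
      using i Bi le by (intro integral_mono) auto
    then show "AE r in lborel. norm (LINT t|lborel. cmod
        (case (r, t) of (r, t) \<Rightarrow> k r * f (exp (- r) * t) * g t)) \<le> norm (LINT t|lborel. B r t)"
      by (intro AE_I2) (auto intro: order_trans[OF _ abs_ge_self])
  qed measurable
qed

lemma dil_op_transpose:
  assumes p: "1 < p" and q: "1 < q" and pq: "1 / p + 1 / q = 1" and k: "kernel p k" and f: "f \<in> Lp p"
      and g: "g \<in> Lp q"
  shows "(LINT t|lborel. dil_op k f t * g t) = (LINT t|lborel. f t * dil_op (transpose_kernel k) g t)"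
proof -
  have k': "kernel q (transpose_kernel k)" using kernel_transpose[OF pq k] .
  have qp: "1 / q + 1 / p = 1" using pq by simp
  have "(LINT t|lborel. dil_op k f t * g t) = (LINT t|lborel. LINT r|lborel. k r * f (exp (- r) * t) * g
      t)"
    unfolding dil_op_def by simp
  also have "\<dots> = (LINT r|lborel. LINT t|lborel. k r * f (exp (- r) * t) * g t)"
    using lborel_pair.Fubini_integral[OF pairing_integrable[OF p q pq k f g]] .
  also have "\<dots> = (LINT r|lborel. LINT t|lborel. k (- r) * f (exp r * t) * g t)"
    by (subst lborel_integral_reflect[of _ 0, symmetric]) simp
  also have "\<dots> = (LINT r|lborel. LINT t|lborel. transpose_kernel k r * g (exp (- r) * t) * f t)"
  proof (rule Bochner_Integration.integral_cong[OF refl])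
    fix r
    have "(LINT t|lborel. transpose_kernel k r * g (exp (- r) * t) * f t)
        = (LINT t|lborel. (\<lambda>t. transpose_kernel k r * g t * f (exp r * t)) (exp (- r) * t))"
    proof -
      have "exp r * (exp (- r) * t) = t" for t :: real by (simp add: exp_minus)
      then show ?thesis by (simp only:)
    qed
    also have "\<dots> = (1 / exp (- r)) *\<^sub>R (LINT t|lborel. transpose_kernel k r * g t * f (exp r * t))"
      by (rule lborel_integral_scale) simp
    also have "\<dots> = (LINT t|lborel. (1 / exp (- r)) *\<^sub>R (transpose_kernel k r * g t * f (exp r * t)))"
      by simp
    also have "\<dots> = (LINT t|lborel. k (- r) * f (exp r * t) * g t)"
      by (simp add: transpose_kernel_def scaleR_conv_of_real exp_minus field_simps)
    finally show "(LINT t|lborel. k (- r) * f (exp r * t) * g t)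
        = (LINT t|lborel. transpose_kernel k r * g (exp (- r) * t) * f t)" ..
  qed
  also have "\<dots> = (LINT t|lborel. LINT r|lborel. transpose_kernel k r * g (exp (- r) * t) * f t)"
    using lborel_pair.Fubini_integral[OF pairing_integrable[OF q p qp k' g f]] by simp
  also have "\<dots> = (LINT t|lborel. f t * dil_op (transpose_kernel k) g t)"
    unfolding dil_op_def by (simp add: mult.commute)
  finally show ?thesis .
qed

section \<open>Exponential substitution and Beta integrals\<close>

lemma has_vector_derivative_iff_quotient:
  fixes f :: "real \<Rightarrow> 'a::real_normed_vector"
  shows "(f has_vector_derivative D) (at x) \<longleftrightarrow> ((\<lambda>y. (f y - f x) /\<^sub>R (y - x)) \<longlongrightarrow> D) (at x)"
proof -
  have "(f has_vector_derivative D) (at x) \<longleftrightarrow> ((\<lambda>y. norm (f y - f x - (y - x) *\<^sub>R D) / norm (y - x)) \<longlongrightarrow> 0)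
      (at x)"
    unfolding has_vector_derivative_def has_derivative_iff_norm
    by (simp add: bounded_linear_scaleR_left)
  also have "\<dots> \<longleftrightarrow> ((\<lambda>y. norm ((f y - f x) /\<^sub>R (y - x) - D)) \<longlongrightarrow> 0) (at x)"
  proof (rule filterlim_cong[OF refl refl])
    show "\<forall>\<^sub>F y in at x. norm (f y - f x - (y - x) *\<^sub>R D) / norm (y - x)
        = norm ((f y - f x) /\<^sub>R (y - x) - D)"
    proof (rule eventually_mono[OF eventually_neq_at_within[of x]])
      fix y :: real assume "y \<noteq> x"
      then have "(f y - f x) /\<^sub>R (y - x) - D = (f y - f x - (y - x) *\<^sub>R D) /\<^sub>R (y - x)"
        by (simp add: scaleR_diff_right)
      then show "norm (f y - f x - (y - x) *\<^sub>R D) / norm (y - x) = norm ((f y - f x) /\<^sub>R (y - x) - D)"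
        by (simp add: divide_inverse mult.commute)
    qed
  qed
  also have "\<dots> \<longleftrightarrow> ((\<lambda>y. (f y - f x) /\<^sub>R (y - x)) \<longlongrightarrow> D) (at x)"
    by (simp add: tendsto_norm_zero_iff LIM_zero_iff)
  finally show ?thesis .
qed

text \<open>The mean value inequality turns the bound on f' into a bound on the difference
  quotients; dominated convergence then applies along every sequence tending to x.\<close>

lemma has_vector_derivative_integral:
  fixes f :: "real \<Rightarrow> 'b \<Rightarrow> 'a::{banach, second_countable_topology}"
  assumes e: "0 < e"
    and der: "\<And>y t. dist x y < e \<Longrightarrow> ((\<lambda>y. f y t) has_vector_derivative f' y t) (at y)"
    and int: "\<And>y. dist x y < e \<Longrightarrow> integrable M (f y)"
    and meas: "f' x \<in> borel_measurable M"
    and w: "integrable M w"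
    and bd: "\<And>y t. dist x y < e \<Longrightarrow> t \<in> space M \<Longrightarrow> norm (f' y t) \<le> w t"
  shows "((\<lambda>y. integral\<^sup>L M (f y)) has_vector_derivative integral\<^sup>L M (f' x)) (at x)"
  unfolding has_vector_derivative_iff_quotient tendsto_at_iff_sequentially comp_def
proof (intro allI impI)
  fix X assume X: "\<forall>i. X i \<in> UNIV - {x}" "X \<longlonglongrightarrow> x"
  have ev: "\<forall>\<^sub>F i in sequentially. dist x (X i) < e"
    using X(2) e by (simp add: tendsto_iff dist_commute)
  then obtain N where N: "\<And>i. i \<ge> N \<Longrightarrow> dist x (X i) < e" by (auto simp: eventually_sequentially)
  \<comment> \<open>Dropping the first N terms keeps the whole sequence in the ball where the
    hypotheses hold.\<close>
  define Y where "Y i = X (i + N)" for i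
  have Y: "dist x (Y i) < e" "Y i \<noteq> x" for i using N X by (auto simp: Y_def)
  have Yl: "Y \<longlonglongrightarrow> x" unfolding Y_def using X(2) by (rule LIMSEQ_ignore_initial_segment)
  have x: "dist x x < e" using e by simp
  have "(\<lambda>i. LINT t|M. (f (Y i) t - f x t) /\<^sub>R (Y i - x)) \<longlonglongrightarrow> integral\<^sup>L M (f' x)"
  proof (rule integral_dominated_convergence[where w = w])
    show "AE t in M. (\<lambda>i. (f (Y i) t - f x t) /\<^sub>R (Y i - x)) \<longlonglongrightarrow> f' x t"
    proof (rule AE_I2)
      fix t
      show "(\<lambda>i. (f (Y i) t - f x t) /\<^sub>R (Y i - x)) \<longlonglongrightarrow> f' x t"
      proof (rule filterlim_compose[where g = "\<lambda>y. (f y t - f x t) /\<^sub>R (y - x)" and f = Y])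
        show "((\<lambda>y. (f y t - f x t) /\<^sub>R (y - x)) \<longlongrightarrow> f' x t) (at x)"
          using der[OF x, of t] unfolding has_vector_derivative_iff_quotient .
        show "filterlim Y (at x) sequentially"
          using Yl Y(2) by (intro filterlim_atI) auto
      qed
    qed
    show "AE t in M. norm ((f (Y i) t - f x t) /\<^sub>R (Y i - x)) \<le> w t" for i
    proof (rule AE_I2)
      fix t assume t: "t \<in> space M"
      have "norm (f (Y i) t - f x t) \<le> w t * norm (Y i - x)"
      proof (rule differentiable_bound[where S = "ball x e" and f' = "\<lambda>z h. h *\<^sub>R f' z t"])
        show "((\<lambda>y. f y t) has_derivative (\<lambda>h. h *\<^sub>R f' z t)) (at z within ball x e)"
            if "z \<in> ball x e" for z
          using der[of z t] that unfolding has_vector_derivative_def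
          by (auto dest!: has_derivative_at_withinI[where s = "ball x e"])
        show "onorm (\<lambda>h. h *\<^sub>R f' z t) \<le> w t" if "z \<in> ball x e" for z
          using bd[of z t] that t by (intro onorm_le) (auto simp: mult.commute intro!: mult_left_mono)
      qed (use Y e in auto)
      then show "norm ((f (Y i) t - f x t) /\<^sub>R (Y i - x)) \<le> w t"
        using Y(2)[of i] by (simp only: norm_scaleR) (simp add: abs_inverse divide_simps mult.commute)
    qed
    show "(\<lambda>t. (f (Y i) t - f x t) /\<^sub>R (Y i - x)) \<in> borel_measurable M" for i
      using int[OF Y(1)] int[OF x] by (intro borel_measurable_scaleR borel_measurable_diff) auto
  qed (use meas w in auto)
  moreover have "(LINT t|M. (f (Y i) t - f x t) /\<^sub>R (Y i - x))
      = (integral\<^sup>L M (f (Y i)) - integral\<^sup>L M (f x)) /\<^sub>R (Y i - x)" for i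
    using int[OF Y(1)[of i]] int[OF x] by simp
  ultimately have "(\<lambda>i. (integral\<^sup>L M (f (Y i)) - integral\<^sup>L M (f x)) /\<^sub>R (Y i - x)) \<longlonglongrightarrow> integral\<^sup>L M
      (f' x)"
    by (simp only:)
  then show "(\<lambda>i. (integral\<^sup>L M (f (X i)) - integral\<^sup>L M (f x)) /\<^sub>R (X i - x)) \<longlonglongrightarrow> integral\<^sup>L M (f' x)"
    unfolding Y_def by (rule LIMSEQ_offset)
qed

lemma integral_derivative_eq_0:
  fixes G :: "real \<Rightarrow> complex"
  assumes G: "\<And>x. (G has_vector_derivative G' x) (at x)" and c: "\<And>x. isCont G' x"
    and i: "integrable lborel G'" and "(G \<longlongrightarrow> 0) at_top" "(G \<longlongrightarrow> 0) at_bot"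
  shows "(LINT x|lborel. G' x) = 0"
proof -
  have "(LBINT x=-\<infinity>..\<infinity>. G' x) = 0 - 0"
  proof (rule interval_integral_FTC_integrable[where F = G])
    show "((G \<circ> real_of_ereal) \<longlongrightarrow> 0) (at_right (- \<infinity>))"
      using assms(5) unfolding ereal_tendsto_simps .
    show "((G \<circ> real_of_ereal) \<longlongrightarrow> 0) (at_left \<infinity>)"
      using assms(4) unfolding ereal_tendsto_simps .
    show "set_integrable lborel (einterval (- \<infinity>) \<infinity>) G'"
      using i by (simp add: set_integrable_def)
  qed (use G c in auto)
  then show ?thesis by (simp add: interval_lebesgue_integral_def set_lebesgue_integral_def)
qed

text \<open>Both measures are compared on the image of [- n, n] under exp, where the substitution
  rule for bounded intervals applies, and continuity from below gives the half-line.\<close>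

lemma distr_exp_lborel:
  "density lborel (\<lambda>u::real. ennreal (indicator {0<..} u))
      = distr (density lborel (\<lambda>r. ennreal (exp r))) borel exp"
proof (rule measure_eqI)
  fix A :: "real set" assume "A \<in> sets (density lborel (\<lambda>u::real. ennreal (indicator {0<..} u)))"
  then have A[measurable]: "A \<in> sets borel" by simp
  define E where "E n = {exp (- real n)..exp (real n)}" for n
  define R where "R n = {- real n..real n}" for n
  have [measurable]: "E n \<in> sets borel" "R n \<in> sets borel" for n by (auto simp: E_def R_def)
  have ind: "indicator {0<..} u * indicator A u = (indicator (A \<inter> {0<..}) u :: ennreal)" for u :: real
    by (auto split: split_indicator)
  have "emeasure (density lborel (\<lambda>u::real. ennreal (indicator {0<..} u))) A
      = emeasure lborel (A \<inter> {0<..})"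
    by (subst emeasure_density) (auto simp: ennreal_indicator ind)
  also have "A \<inter> {0<..} = (\<Union>n. A \<inter> E n)"
  proof safe
    fix x :: real assume "x \<in> A" "x > 0"
    obtain n where "\<bar>ln x\<bar> \<le> real n" using real_arch_simple by blast
    then have "exp (- real n) \<le> exp (ln x)" "exp (ln x) \<le> exp (real n)" by (auto simp del: exp_ln)
    then show "x \<in> (\<Union>n. A \<inter> E n)" using \<open>x > 0\<close> \<open>x \<in> A\<close> by (auto simp: E_def)
  next
    fix x n assume "x \<in> E n" 
    then have "exp (- real n) \<le> x" by (simp add: E_def)
    then show "0 < x" using exp_gt_zero[of "- real n"] by linarith
  qed
  finally have 1: "emeasure (density lborel (\<lambda>u::real. ennreal (indicator {0<..} u))) A
      = emeasure lborel (\<Union>n. A \<inter> E n)" .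
  have l1: "(\<lambda>n. emeasure lborel (A \<inter> E n)) \<longlonglongrightarrow> emeasure lborel (\<Union>n. A \<inter> E n)"
  proof (rule Lim_emeasure_incseq)
    have "E m \<subseteq> E n" if "m \<le> n" for m n using that unfolding E_def
        by (intro ivl_subset[THEN iffD2] atLeastatMost_subset_iff[THEN iffD2]) auto
    then show "incseq (\<lambda>n. A \<inter> E n)" by (auto simp: incseq_def)
  qed auto
  let ?M = "density lborel (\<lambda>r. ennreal (exp (r::real)))"
  have "emeasure (distr ?M borel exp) A = emeasure ?M (exp -` A)"
    by (subst emeasure_distr) auto
  also have "exp -` A = (\<Union>n. exp -` A \<inter> R n)"
  proof safe
    fix x :: real assume "exp x \<in> A"
    obtain n where "\<bar>x\<bar> \<le> real n" using real_arch_simple by blast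
    then show "x \<in> (\<Union>n. exp -` A \<inter> R n)" using \<open>exp x \<in> A\<close>
        by (auto simp: R_def abs_le_iff intro!: exI[of _ n])
  qed
  finally have 2: "emeasure (distr ?M borel exp) A = emeasure ?M (\<Union>n. exp -` A \<inter> R n)" .
  have [measurable]: "(exp :: real \<Rightarrow> real) -` A \<in> sets borel"
    using measurable_sets[OF borel_measurable_exp A] by simp
  have l2: "(\<lambda>n. emeasure ?M (exp -` A \<inter> R n)) \<longlonglongrightarrow> emeasure ?M (\<Union>n. exp -` A \<inter> R n)"
    by (rule Lim_emeasure_incseq) (auto simp: incseq_def R_def)
  have eq: "emeasure lborel (A \<inter> E n) = emeasure ?M (exp -` A \<inter> R n)" for n
  proof -
    have "(\<integral>\<^sup>+x. indicator A x * indicator {exp (- real n)..exp (real n)} x \<partial>lborel) =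
       (\<integral>\<^sup>+x. ennreal (indicator A (exp x) * exp x * indicator {- real n..real n} x) \<partial>lborel)"
      using nn_integral_substitution[of exp "- real n" "real n" "indicator A" exp]
      using continuous_on_exp[OF continuous_on_id, of "{- real n..real n}"]
      by (auto intro!: derivative_eq_intros simp: set_borel_measurable_def ennreal_indicator
          ennreal_mult'')
    moreover have "(\<integral>\<^sup>+x. indicator A x * indicator {exp (- real n)..exp (real n)} x \<partial>lborel)
        = emeasure lborel (A \<inter> E n)"
    proof -
      have "(\<integral>\<^sup>+x. indicator A x * indicator {exp (- real n)..exp (real n)} x \<partial>lborel)
          = (\<integral>\<^sup>+x. indicator (A \<inter> E n) x \<partial>lborel)"
        by (intro nn_integral_cong) (auto simp: E_def split: split_indicator)
      also have "\<dots> = emeasure lborel (A \<inter> E n)" by (rule nn_integral_indicator) auto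
      finally show ?thesis .
    qed
    moreover have "emeasure ?M (exp -` A \<inter> R n) = (\<integral>\<^sup>+x. ennreal
        (indicator A (exp x) * exp x * indicator {- real n..real n} x) \<partial>lborel)"
      by (subst emeasure_density) (auto intro!: nn_integral_cong simp: R_def split: split_indicator)
    ultimately show ?thesis by simp
  qed
  show "emeasure (density lborel (\<lambda>u::real. ennreal (indicator {0<..} u))) A
      = emeasure (distr ?M borel exp) A"
    unfolding 1 2 using LIMSEQ_unique[OF l1 l2[folded eq]] .
qed simp

lemma exp_substitution:
  fixes g :: "real \<Rightarrow> 'a::{banach, second_countable_topology}"
  assumes [measurable]: "g \<in> borel_measurable borel"
  shows "integrable lborel (\<lambda>u. indicator {0<..} u *\<^sub>R g u)
      \<longleftrightarrow> integrable lborel (\<lambda>r. exp r *\<^sub>R g (exp r))"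
    and "(LINT u|lborel. indicator {0<..} u *\<^sub>R g u) = (LINT r|lborel. exp r *\<^sub>R g (exp r))"
proof -
  let ?D = "density lborel (\<lambda>u::real. ennreal (indicator {0<..} u))"
  have "integrable lborel (\<lambda>u. indicator {0<..} u *\<^sub>R g u) \<longleftrightarrow> integrable ?D g"
    by (subst integrable_density) auto
  also have "\<dots> \<longleftrightarrow> integrable lborel (\<lambda>r. exp r *\<^sub>R g (exp r))"
    unfolding distr_exp_lborel by (subst integrable_distr_eq) (auto simp: integrable_density)
  finally show "integrable lborel (\<lambda>u. indicator {0<..} u *\<^sub>R g u)
      \<longleftrightarrow> integrable lborel (\<lambda>r. exp r *\<^sub>R g (exp r))" .
  have "(LINT u|lborel. indicator {0<..} u *\<^sub>R g u) = (LINT u|?D. g u)"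
    by (subst integral_density) auto
  also have "\<dots> = (LINT r|lborel. exp r *\<^sub>R g (exp r))"
    unfolding distr_exp_lborel by (subst integral_distr) (auto simp: integral_density)
  finally show "(LINT u|lborel. indicator {0<..} u *\<^sub>R g u) = (LINT r|lborel. exp r *\<^sub>R g (exp r))" .
qed

lemma exp_substitution_neg:
  fixes g :: "real \<Rightarrow> 'a::{banach, second_countable_topology}"
  assumes [measurable]: "g \<in> borel_measurable borel"
  shows "integrable lborel (\<lambda>u. indicator {0<..} u *\<^sub>R g u)
      \<longleftrightarrow> integrable lborel (\<lambda>r. exp (- r) *\<^sub>R g (exp (- r)))"
    and "(LINT u|lborel. indicator {0<..} u *\<^sub>R g u) = (LINT r|lborel. exp (- r) *\<^sub>R g (exp (- r)))"
proof -
  show "integrable lborel (\<lambda>u. indicator {0<..} u *\<^sub>R g u)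
      \<longleftrightarrow> integrable lborel (\<lambda>r. exp (- r) *\<^sub>R g (exp (- r)))"
    unfolding exp_substitution(1)[OF assms]
    using lborel_integrable_real_affine_iff[of "-1" "\<lambda>r. exp r *\<^sub>R g (exp r)" 0] by simp
  show "(LINT u|lborel. indicator {0<..} u *\<^sub>R g u) = (LINT r|lborel. exp (- r) *\<^sub>R g (exp (- r)))"
    unfolding exp_substitution(2)[OF assms]
    using lborel_integral_reflect[of "\<lambda>r. exp r *\<^sub>R g (exp r)" 0] by simp
qed

section \<open>Gamma and Beta integrals in the logarithmic variable\<close>

lemma Gamma_integral_log:
  assumes z: "Re z > 0"
  shows "integrable lborel (\<lambda>r. exp (z * complex_of_real r - complex_of_real (exp r)))"
    and "(LINT r|lborel. exp (z * complex_of_real r - complex_of_real (exp r))) = Gamma z"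
proof -
  define g where "g t = (complex_of_real t powr (z - 1) / complex_of_real (exp t))" for t
  \<comment> \<open>A Borel version of \<open>g\<close>, which permits the passage from Lebesgue to
    Borel integrability; only the values on the positive half-line count.\<close>
  define g0 where "g0 t = (if t > 0 then exp ((z - 1) * complex_of_real (ln t)) / complex_of_real
      (exp t) else 0)" for t
  have [measurable]: "g0 \<in> borel_measurable borel" unfolding g0_def by measurable
  have eq: "g t = g0 t" if "t \<in> {0<..}" for t
    using that by (simp add: g_def g0_def powr_def Ln_of_real)
  have "g absolutely_integrable_on {0<..}"
    unfolding g_def using absolutely_integrable_Gamma_integral'[OF z] .
  then have a: "integrable lebesgue (\<lambda>t. indicator {0<..} t *\<^sub>R g0 t)"
  proof -
    have "(\<lambda>t. indicator {0<..} t *\<^sub>R g t) = (\<lambda>t. indicator {0<..} t *\<^sub>R g0 t)"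
      using eq by (auto simp: fun_eq_iff split: split_indicator)
    then show ?thesis using \<open>g absolutely_integrable_on {0<..}\<close> by (simp add: set_integrable_def)
  qed
  then have i: "integrable lborel (\<lambda>t. indicator {0<..} t *\<^sub>R g0 t)"
    by (subst (asm) integrable_completion) auto
  have "(g has_integral Gamma z) {0<..}" unfolding g_def by (rule Gamma_integral_complex'[OF z])
  then have h: "(g0 has_integral Gamma z) {0<..}"
    by (rule has_integral_eq[rotated]) (simp add: eq)
  have "set_integrable lborel {0<..} g0" using i by (simp add: set_integrable_def)
  then have "(LINT t:{0<..}|lborel. g0 t) = integral {0<..} g0" by (rule set_borel_integral_eq_integral)
  then have v: "(LINT t|lborel. indicator {0<..} t *\<^sub>R g0 t) = Gamma z"
    using integral_unique[OF h] by (simp add: set_lebesgue_integral_def)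
  have e: "exp r *\<^sub>R g0 (exp r) = exp (z * complex_of_real r - complex_of_real (exp r))" for r
    unfolding g0_def by (simp add: scaleR_conv_of_real exp_diff left_diff_distrib exp_of_real)
  show "integrable lborel (\<lambda>r. exp (z * complex_of_real r - complex_of_real (exp r)))"
    using i exp_substitution(1)[of g0] unfolding e by simp
  show "(LINT r|lborel. exp (z * complex_of_real r - complex_of_real (exp r))) = Gamma z"
    using v exp_substitution(2)[of g0] unfolding e by simp
qed

text \<open>Euler's argument: the double integral of \<open>F\<close> is computed in both orders.
  Shifting r by s splits off Gamma z and Gamma w; shifting s by ln (1 + exp r) splits off Gamma
  \<mu> and leaves the Beta integrand.\<close>

lemma Beta_integral_log:
  fixes z w :: complex and \<mu> :: real
  assumes z: "Re z > 0" and w: "Re w > 0" and zw: "z + w = complex_of_real \<mu>"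
  shows "has_bochner_integral lborel (\<lambda>r. exp (z * complex_of_real r) * complex_of_real
      ((1 + exp r) powr - \<mu>)) (Beta z w)"
proof -
  have mu: "\<mu> > 0" using arg_cong[OF zw, of Re] z w by simp
  define F where "F s r = exp (z * complex_of_real r + complex_of_real (\<mu> * s) - complex_of_real
      (exp s * (1 + exp r)))" for s r
  have [measurable]: "(\<lambda>(s, r). F s r) \<in> borel_measurable (borel \<Otimes>\<^sub>M borel)"
    unfolding F_def by measurable
  define A where "A r = exp (z * complex_of_real r - complex_of_real (exp r))" for r
  define B where "B s = exp (w * complex_of_real s - complex_of_real (exp s))" for s
  have A: "integrable lborel A" "integral\<^sup>L lborel A = Gamma z"
    unfolding A_def using Gamma_integral_log[OF z] by auto
  have B: "integrable lborel B" "integral\<^sup>L lborel B = Gamma w"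
    unfolding B_def using Gamma_integral_log[OF w] by auto
  have F1: "F s r = A (r + s) * B s" for s r
  proof -
    have "complex_of_real (\<mu> * s) = (z + w) * complex_of_real s" by (simp add: zw)
    then show ?thesis unfolding F_def A_def B_def exp_add[symmetric]
      by (simp add: algebra_simps exp_add)
  qed
  have F2: "F s r = exp (z * complex_of_real r) * complex_of_real ((1 + exp r) powr - \<mu>) *
      exp (complex_of_real \<mu> * complex_of_real (s + ln (1 + exp r)) - complex_of_real
          (exp (s + ln (1 + exp r))))" for s r
  proof -
    have "1 + exp r > 0" by (simp add: add_pos_pos)
    then have "exp (s + ln (1 + exp r)) = exp s * (1 + exp r)" "(1 + exp r) powr - \<mu>
        = exp (- \<mu> * ln (1 + exp r))"
      by (auto simp: exp_add powr_def)
    then show ?thesis unfolding F_def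
      by (simp add: exp_of_real[symmetric] exp_add[symmetric] exp_diff[symmetric] algebra_simps
          del: exp_of_real flip: exp_of_real)
  qed
  have int: "integrable (lborel \<Otimes>\<^sub>M lborel) (\<lambda>(s, r). F s r)"
  proof (rule lborel_pair.Fubini_integrable)
    have "(LINT r|lborel. cmod (F s r)) = (LINT r|lborel. cmod (A r)) * cmod (B s)" for s
      unfolding F1 norm_mult using lborel_integral_shift[of "\<lambda>r. cmod (A r)" s] by simp
    then show "integrable lborel (\<lambda>s. LINT r|lborel. cmod (case (s, r) of (s, r) \<Rightarrow> F s r))"
      using B by simp
    show "AE s in lborel. integrable lborel (\<lambda>r. case (s, r) of (s, r) \<Rightarrow> F s r)"
      unfolding F1 using lborel_integrable_shift[OF A(1)] by simp
  qed measurable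
  have Gm: "integrable lborel (\<lambda>s. exp (complex_of_real \<mu> * complex_of_real s - complex_of_real
      (exp s)))"
     "(LINT s|lborel. exp (complex_of_real \<mu> * complex_of_real s - complex_of_real (exp s)))
         = Gamma (complex_of_real \<mu>)"
    using Gamma_integral_log[of "complex_of_real \<mu>"] mu by auto
  have L: "(LINT s|lborel. F s r) = exp (z * complex_of_real r) * complex_of_real ((1 + exp r) powr - \<mu>)
      * Gamma (complex_of_real \<mu>)" for r
    unfolding F2 using lborel_integral_shift[of "\<lambda>s. exp
        (complex_of_real \<mu> * complex_of_real s - complex_of_real (exp s))" "ln (1 + exp r)"] Gm(2)
    by simp
  have G0: "Gamma (complex_of_real \<mu>) \<noteq> 0" using Gamma_real_pos[OF mu]
      by (simp add: Gamma_complex_of_real)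
  have 1: "integrable lborel (\<lambda>r. exp (z * complex_of_real r) * complex_of_real ((1 + exp r) powr - \<mu>))"
  proof -
    have "integrable lborel (\<lambda>r. 1 / Gamma (complex_of_real \<mu>) * (LINT s|lborel. F s r))"
      using lborel_pair.integrable_snd[OF int] by (intro integrable_mult_right) simp
    then show ?thesis unfolding L using G0 by simp
  qed
  have "Gamma z * Gamma w = (LINT s|lborel. LINT r|lborel. F s r)"
    unfolding F1 using lborel_integral_shift[of A] A B by simp
  also have "\<dots> = (LINT r|lborel. LINT s|lborel. F s r)"
    using lborel_pair.Fubini_integral[OF int] by simp
  also have "\<dots> = (LINT r|lborel. exp (z * complex_of_real r) * complex_of_real ((1 + exp r) powr - \<mu>)) *
      Gamma (complex_of_real \<mu>)"
    unfolding L by simp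
  finally show ?thesis using 1 G0 by (simp add: has_bochner_integral_iff Beta_def zw)
qed

section \<open>Fourier inversion and resolvent kernels\<close>

lemma integrable_inverse_square: "integrable lborel (\<lambda>x::real. 1 / (1 + x\<^sup>2))"
  using integrable_inverse_1_plus_square by (simp add: set_integrable_def inverse_eq_divide)

lemma cis_measurable[measurable]: "cis \<in> borel_measurable borel"
  unfolding cis_conv_exp[abs_def] by measurable

lemma cis_has_vector_derivative:
  "((\<lambda>r. cis (c * r)) has_vector_derivative \<i> * complex_of_real c * cis (c * r)) (at r)"
proof -
  have "((\<lambda>z. exp (\<i> * complex_of_real c * z)) has_field_derivative \<i> * complex_of_real c * exp
      (\<i> * complex_of_real c * complex_of_real r)) (at (complex_of_real r))"
    by (auto intro!: derivative_eq_intros)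
  from has_vector_derivative_real_field[OF this] show ?thesis
    by (simp add: cis_conv_exp mult.assoc)
qed

lemma isCont_cis: "isCont (\<lambda>r. cis (c * r)) x"
  using cis_has_vector_derivative by (rule has_vector_derivative_continuous)

definition ft :: "(real \<Rightarrow> complex) \<Rightarrow> real \<Rightarrow> complex" where
  "ft k \<xi> = (LINT r|lborel. k r * cis (- \<xi> * r))"

lemma integrable_mult_cis:
  assumes "integrable lborel k"
  shows "integrable lborel (\<lambda>r. k r * cis (c * r))"
proof -
  have [measurable]: "k \<in> borel_measurable borel" using assms by auto
  show ?thesis by (rule Bochner_Integration.integrable_bound[OF assms]) (auto simp: norm_mult)
qed

lemma ft_bound: "integrable lborel k \<Longrightarrow> cmod (ft k \<xi>) \<le> (LINT r|lborel. cmod (k r))"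
  unfolding ft_def
  by (rule order_trans[OF integral_norm_bound]) (simp add: norm_mult)

text \<open>The rate is integrable, and it is the one that two integrations by parts give for a
  Fourier transform.\<close>

definition decays :: "(real \<Rightarrow> complex) \<Rightarrow> bool" where
  "decays h \<longleftrightarrow> (\<exists>C. \<forall>x. cmod (h x) \<le> C / (1 + x\<^sup>2))"

lemma decays_integrable:
  assumes "decays h" and [measurable]: "h \<in> borel_measurable borel"
  shows "integrable lborel h"
proof -
  obtain C where C: "\<And>x. cmod (h x) \<le> C / (1 + x\<^sup>2)" using assms(1) by (auto simp: decays_def)
  have "integrable lborel (\<lambda>x::real. C * (1 / (1 + x\<^sup>2)))" using integrable_inverse_square
      by (rule integrable_mult_right)
  then show ?thesis
    by (rule Bochner_Integration.integrable_bound) (auto intro!: AE_I2 order_trans[OF C]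
        divide_right_mono add_nonneg_nonneg)
qed

lemma decays_tendsto:
  assumes "decays h" shows "(h \<longlongrightarrow> 0) at_top" "(h \<longlongrightarrow> 0) at_bot"
proof -
  obtain C where C: "\<And>x. cmod (h x) \<le> C / (1 + x\<^sup>2)" using assms(1) by (auto simp: decays_def)
  have t: "((\<lambda>x::real. C / (1 + x\<^sup>2)) \<longlongrightarrow> 0) at_top" "((\<lambda>x::real. C / (1 + x\<^sup>2)) \<longlongrightarrow> 0) at_bot"
    by real_asymp+
  show "(h \<longlongrightarrow> 0) at_top" by (rule Lim_null_comparison[OF _ t(1)]) (use C in auto)
  show "(h \<longlongrightarrow> 0) at_bot" by (rule Lim_null_comparison[OF _ t(2)]) (use C in auto)
qed

lemma decays_bounded_mult:
  assumes "decays h" and "\<And>x. cmod (g x) \<le> B * cmod (h x)"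
  shows "decays g"
proof -
  obtain C where C: "\<And>x. cmod (h x) \<le> C / (1 + x\<^sup>2)" using assms(1) by (auto simp: decays_def)
  have "cmod (g x) \<le> (\<bar>B\<bar> * C) / (1 + x\<^sup>2)" for x
  proof -
    have "cmod (g x) \<le> \<bar>B\<bar> * cmod (h x)"
      using assms(2)[of x] by (smt (verit) mult_right_mono norm_ge_zero)
    also have "\<dots> \<le> \<bar>B\<bar> * (C / (1 + x\<^sup>2))" using C by (intro mult_left_mono) auto
    finally show ?thesis by simp
  qed
  then show ?thesis by (auto simp: decays_def)
qed

lemma decays_add:
  assumes "decays h" "decays g" shows "decays (\<lambda>x. h x + g x)"
proof -
  obtain C where C: "\<And>x. cmod (h x) \<le> C / (1 + x\<^sup>2)" using assms(1) by (auto simp: decays_def)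
  obtain D where D: "\<And>x. cmod (g x) \<le> D / (1 + x\<^sup>2)" using assms(2) by (auto simp: decays_def)
  have "cmod (h x + g x) \<le> (C + D) / (1 + x\<^sup>2)" for x
    using norm_triangle_ineq[of "h x" "g x"] C[of x] D[of x] by (simp add: add_divide_distrib)
  then show ?thesis by (auto simp: decays_def)
qed

lemma isCont_measurable: "(\<And>x. isCont (f :: real \<Rightarrow> complex) x) \<Longrightarrow> f \<in> borel_measurable borel"
  by (intro borel_measurable_continuous_onI continuous_at_imp_continuous_on) auto

text \<open>Integration by parts, in the form that the derivative of
  \<open>h x * cis (- \<xi> * x)\<close> integrates to 0.\<close>

lemma ft_derivative:
  assumes h: "\<And>x. (h has_vector_derivative h1 x) (at x)" and c: "\<And>x. isCont h1 x"
    and d: "decays h" "decays h1"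
  shows "ft h1 \<xi> = \<i> * complex_of_real \<xi> * ft h \<xi>"
proof -
  have ch: "isCont h x" for x using h by (rule has_vector_derivative_continuous)
  have [measurable]: "h \<in> borel_measurable borel" "h1 \<in> borel_measurable borel"
    using ch c by (auto intro!: isCont_measurable)
  let ?e = "\<lambda>x. cis (- \<xi> * x)"
  have i: "integrable lborel (\<lambda>x. h x * ?e x)" "integrable lborel (\<lambda>x. h1 x * ?e x)"
    by (rule integrable_mult_cis[OF decays_integrable[OF d(1)]], measurable)
      (rule integrable_mult_cis[OF decays_integrable[OF d(2)]], measurable)
  have "(LINT x|lborel. h x * (\<i> * complex_of_real (- \<xi>) * ?e x) + h1 x * ?e x) = 0"
  proof (rule integral_derivative_eq_0[where G = "\<lambda>x. h x * ?e x"])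
    show "((\<lambda>x. h x * ?e x) has_vector_derivative h x * (\<i> * complex_of_real (- \<xi>) * ?e x) + h1 x * ?e
        x) (at x)" for x
      by (rule has_vector_derivative_mult[OF h cis_has_vector_derivative])
    show "isCont (\<lambda>x. h x * (\<i> * complex_of_real (- \<xi>) * ?e x) + h1 x * ?e x) x" for x
      by (intro continuous_intros ch c isCont_cis)
    have "integrable lborel (\<lambda>x. (\<i> * complex_of_real (- \<xi>)) * (h x * ?e x) + h1 x * ?e x)"
      using i by (intro Bochner_Integration.integrable_add integrable_mult_right)
    then show "integrable lborel (\<lambda>x. h x * (\<i> * complex_of_real (- \<xi>) * ?e x) + h1 x * ?e x)"
      by (simp add: mult.left_commute)
    have "decays (\<lambda>x. h x * ?e x)" using d(1) by (rule decays_bounded_mult[where B = 1])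
        (simp add: norm_mult)
    then show "((\<lambda>x. h x * ?e x) \<longlongrightarrow> 0) at_top" "((\<lambda>x. h x * ?e x) \<longlongrightarrow> 0) at_bot"
      by (auto intro: decays_tendsto)
  qed
  also have "(\<lambda>x. h x * (\<i> * complex_of_real (- \<xi>) * ?e x) + h1 x * ?e x)
      = (\<lambda>x. (\<i> * complex_of_real (- \<xi>)) * (h x * ?e x) + h1 x * ?e x)"
    by (simp add: fun_eq_iff mult.left_commute)
  finally show ?thesis using i unfolding ft_def by (simp add: algebra_simps)
qed

text \<open>(1 + \<xi>^2) * ft h is the transform of h - h2 and therefore bounded.\<close>

lemma ft_decays:
  assumes h: "\<And>x. (h has_vector_derivative h1 x) (at x)" "\<And>x. (h1 has_vector_derivative h2 x) (at x)"
    and c: "\<And>x. isCont h2 x" and d: "decays h" "decays h1" "decays h2"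
  shows "decays (ft h)"
proof -
  have ch: "isCont h x" "isCont h1 x" for x using h by (auto intro: has_vector_derivative_continuous)
  have i: "integrable lborel h" "integrable lborel h2"
    using ch c d by (auto intro!: decays_integrable isCont_measurable)
  have "ft h2 \<xi> = - (complex_of_real (\<xi>\<^sup>2) * ft h \<xi>)" for \<xi>
    unfolding ft_derivative[OF h(2) c d(2,3)] ft_derivative[OF h(1) ch(2) d(1,2)]
    by (simp add: power2_eq_square algebra_simps)
  then have eq: "complex_of_real (1 + \<xi>\<^sup>2) * ft h \<xi> = ft h \<xi> - ft h2 \<xi>" for \<xi>
    by (simp add: algebra_simps)
  have "(1 + \<xi>\<^sup>2) * cmod (ft h \<xi>) \<le> (LINT r|lborel. cmod (h r)) + (LINT r|lborel. cmod (h2 r))" for \<xi>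
  proof -
    have "(1 + \<xi>\<^sup>2) * cmod (ft h \<xi>) = cmod (complex_of_real (1 + \<xi>\<^sup>2) * ft h \<xi>)"
      unfolding norm_mult norm_of_real by simp
    also have "\<dots> \<le> cmod (ft h \<xi>) + cmod (ft h2 \<xi>)" unfolding eq by (rule norm_triangle_ineq4)
    finally show ?thesis using ft_bound[OF i(1), of \<xi>] ft_bound[OF i(2), of \<xi>] by simp
  qed
  then show ?thesis unfolding decays_def
    by (intro exI[of _ "(LINT r|lborel. cmod (h r)) + (LINT r|lborel. cmod (h2 r))"])
        (simp add: field_simps add_pos_nonneg)
qed

lemma ft_has_vector_derivative:
  assumes k: "integrable lborel k" and rk: "integrable lborel (\<lambda>r. complex_of_real r * k r)"
  shows "(ft k has_vector_derivative ft (\<lambda>r. - \<i> * (complex_of_real r * k r)) \<xi>) (at \<xi>)"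
proof -
  have [measurable]: "k \<in> borel_measurable borel" using k by auto
  have "((\<lambda>\<xi>. LINT r|lborel. k r * cis (- \<xi> * r)) has_vector_derivative
     (LINT r|lborel. - \<i> * (complex_of_real r * k r) * cis (- \<xi> * r))) (at \<xi>)"
  proof (rule has_vector_derivative_integral[where e = 1 and w = "\<lambda>r. cmod (complex_of_real r * k r)"])
    fix y r :: real
    have "((\<lambda>y. cis (- r * y)) has_vector_derivative \<i> * complex_of_real (- r) * cis (- r * y)) (at y)"
      by (rule cis_has_vector_derivative)
    from has_vector_derivative_mult_right[OF this, of "k r"]
    show "((\<lambda>y. k r * cis (- y * r)) has_vector_derivative - \<i> * (complex_of_real r * k r) * cis
        (- y * r)) (at y)"
      by (simp add: mult_ac)
  next
    show "integrable lborel (\<lambda>r. k r * cis (- y * r))" for y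
      by (rule integrable_mult_cis[OF k])
    show "integrable lborel (\<lambda>r. cmod (complex_of_real r * k r))"
      using rk by (rule integrable_norm)
  qed (auto simp: norm_mult)
  then show ?thesis by (simp add: ft_def[abs_def])
qed

lemma std_normal_ft: "(LINT x|lborel. std_normal_density x *\<^sub>R cis (t * x))
    = complex_of_real (exp (- (t\<^sup>2) / 2))"
proof -
  have "char std_normal_distribution t = (LINT x|lborel. std_normal_density x *\<^sub>R iexp (t * x))"
    unfolding char_def by (subst integral_density) (auto simp: normal_density_nonneg)
  then show ?thesis unfolding char_std_normal_distribution by (simp add: cis_conv_exp)
qed

text \<open>Regularisation by Gaussians, whose Fourier transform is the characteristic function of the
  standard normal distribution.\<close>

lemma fourier_inversion:
  assumes k: "integrable lborel k" and c: "\<And>x. isCont k x" and b: "\<And>x. cmod (k x) \<le> B"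
    and f: "integrable lborel (ft k)"
  shows "(LINT \<xi>|lborel. ft k \<xi> * cis (\<xi> * r)) = complex_of_real (2 * pi) * k r"
proof -
  have [measurable]: "k \<in> borel_measurable borel" "ft k \<in> borel_measurable borel" using k f by auto
  let ?D = std_normal_density
  have D[simp]: "0 \<le> ?D x" "integrable lborel ?D" for x
    by (auto intro: normal_density_nonneg integrable_normal_density)
  have D0: "?D 0 = 1 / sqrt (2 * pi)" by (simp add: normal_density_def)
  have DC: "isCont ?D x" for x unfolding normal_density_def by (intro continuous_intros) auto
  have DB: "?D x \<le> ?D 0" for x unfolding normal_density_def by (simp add: divide_right_mono)
  have ft_D: "(LINT \<xi>|lborel. complex_of_real (?D (\<xi> / n)) * cis (\<xi> * y))
      = complex_of_real (n * sqrt (2 * pi) * ?D (n * y))" if n: "n > 0" for n y :: real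
  proof -
    have "(LINT \<xi>|lborel. complex_of_real (?D (\<xi> / n)) * cis (\<xi> * y))
        = (LINT \<xi>|lborel. (\<lambda>x. ?D x *\<^sub>R cis ((n * y) * x)) (1 / n * \<xi>))"
      using n by (intro Bochner_Integration.integral_cong) (auto simp: scaleR_conv_of_real mult.commute)
    also have "\<dots> = n *\<^sub>R complex_of_real (exp (- ((n * y)\<^sup>2) / 2))"
      using n by (subst lborel_integral_scale) (auto simp: std_normal_ft)
    finally show ?thesis by (simp add: scaleR_conv_of_real normal_density_def)
  qed
  \<comment> \<open>Fubini moves the transform from k to the Gaussian. A Gaussian of width n on the
    frequency side averages k at scale 1/n, so that k r is recovered on the right as n
    grows.\<close>
  have A: "(LINT \<xi>|lborel. ft k \<xi> * cis (\<xi> * r) * complex_of_real (?D (\<xi> / n)))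
      = complex_of_real (sqrt (2 * pi)) * (LINT x|lborel. k (r - x / n) * complex_of_real (?D x))"
          if n: "n > 0" for n :: real
  proof -
    have iD: "integrable lborel (\<lambda>\<xi>. complex_of_real (?D (\<xi> / n)))"
      using lborel_integrable_scale[of "1 / n" ?D] n by simp
    have int: "integrable (lborel \<Otimes>\<^sub>M lborel) (\<lambda>(\<xi>, s). k s * cis (- \<xi> * s) * cis (\<xi> * r) *
        complex_of_real (?D (\<xi> / n)))"
    proof (rule lborel_pair.Fubini_integrable)
      show "integrable lborel (\<lambda>\<xi>. LINT s|lborel. cmod (case (\<xi>, s) of (\<xi>, s) \<Rightarrow> k s * cis (- \<xi> * s) *
          cis (\<xi> * r) * complex_of_real (?D (\<xi> / n))))"
        using integrable_norm[OF iD] by (simp add: norm_mult)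
      show "AE \<xi> in lborel. integrable lborel (\<lambda>s. case (\<xi>, s) of (\<xi>, s) \<Rightarrow> k s * cis (- \<xi> * s) * cis
          (\<xi> * r) * complex_of_real (?D (\<xi> / n)))"
      proof (rule AE_I2)
        fix \<xi> :: real
        have "integrable lborel (\<lambda>s. (k s * cis (- \<xi> * s)) *
            (cis (\<xi> * r) * complex_of_real (?D (\<xi> / n))))"
          by (intro integrable_mult_left integrable_mult_cis k)
        then show "integrable lborel (\<lambda>s. case (\<xi>, s) of (\<xi>, s) \<Rightarrow> k s * cis (- \<xi> * s) * cis (\<xi> * r) *
            complex_of_real (?D (\<xi> / n)))"
          by (simp add: mult.assoc)
      qed
    qed measurable
    have "(LINT \<xi>|lborel. ft k \<xi> * cis (\<xi> * r) * complex_of_real (?D (\<xi> / n))) =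
       (LINT \<xi>|lborel. LINT s|lborel. k s * cis (- \<xi> * s) * cis (\<xi> * r) * complex_of_real (?D (\<xi> / n)))"
      unfolding ft_def by simp
    also have "\<dots> = (LINT s|lborel. LINT \<xi>|lborel. k s * cis (- \<xi> * s) * cis (\<xi> * r) * complex_of_real
        (?D (\<xi> / n)))"
      using lborel_pair.Fubini_integral[OF int] by simp
    also have "\<dots> = (LINT s|lborel. k s * (LINT \<xi>|lborel. complex_of_real (?D (\<xi> / n)) * cis
        (\<xi> * (r - s))))"
    proof (rule Bochner_Integration.integral_cong[OF refl])
      fix s
      have "k s * cis (- \<xi> * s) * cis (\<xi> * r) * complex_of_real (?D (\<xi> / n))
          = k s * (complex_of_real (?D (\<xi> / n)) * cis (\<xi> * (r - s)))" for \<xi>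
      proof -
        have "cis (\<xi> * (r - s)) = cis (- \<xi> * s) * cis (\<xi> * r)" by (simp add: cis_mult algebra_simps)
        then show ?thesis by (simp add: mult_ac)
      qed
      then show "(LINT \<xi>|lborel. k s * cis (- \<xi> * s) * cis (\<xi> * r) * complex_of_real (?D (\<xi> / n)))
          = k s * (LINT \<xi>|lborel. complex_of_real (?D (\<xi> / n)) * cis (\<xi> * (r - s)))"
        by (simp only: integral_mult_right_zero)
    qed
    also have "\<dots> = (LINT s|lborel. (\<lambda>y. k (r - y) * complex_of_real (n * sqrt (2 * pi) * ?D (n * y)))
        (r - s))"
      unfolding ft_D[OF n] by simp
    also have "\<dots> = (LINT y|lborel. k (r - y) * complex_of_real (n * sqrt (2 * pi) * ?D (n * y)))"
      by (rule lborel_integral_reflect)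
    also have "\<dots> = (LINT y|lborel. (\<lambda>x. k (r - x / n) * complex_of_real (n * sqrt (2 * pi) * ?D x))
        (n * y))"
      using n by simp
    also have "\<dots> = (1 / n) *\<^sub>R (LINT x|lborel. k (r - x / n) * complex_of_real
        (n * sqrt (2 * pi) * ?D x))"
      by (rule lborel_integral_scale[OF n])
    also have "\<dots> = (LINT x|lborel. complex_of_real (sqrt (2 * pi)) *
        (k (r - x / n) * complex_of_real (?D x)))"
      unfolding integral_scaleR_right[symmetric] using n
          by (intro Bochner_Integration.integral_cong refl) (simp add: scaleR_conv_of_real)
    finally show ?thesis by simp
  qed
  have "(\<lambda>n. LINT \<xi>|lborel. ft k \<xi> * cis (\<xi> * r) * complex_of_real (?D (\<xi> / real (Suc n)))) \<longlonglongrightarrow>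
      (LINT \<xi>|lborel. ft k \<xi> * cis (\<xi> * r) * complex_of_real (?D 0))"
  proof (rule integral_dominated_convergence[where w = "\<lambda>\<xi>. cmod (ft k \<xi>) * ?D 0"])
    show "AE \<xi> in lborel. (\<lambda>n. ft k \<xi> * cis (\<xi> * r) * complex_of_real (?D (\<xi> / real (Suc n)))) \<longlonglongrightarrow> ft k \<xi>
        * cis (\<xi> * r) * complex_of_real (?D 0)"
    proof (intro AE_I2 tendsto_intros)
      fix \<xi> :: real
      have "(\<lambda>n. \<xi> / real (Suc n)) \<longlonglongrightarrow> 0" by real_asymp
      then show "(\<lambda>n. ?D (\<xi> / real (Suc n))) \<longlonglongrightarrow> ?D 0" by (rule isCont_tendsto_compose[OF DC])
    qed
    show "AE \<xi> in lborel. norm (ft k \<xi> * cis (\<xi> * r) * complex_of_real (?D (\<xi> / real (Suc n))))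
        \<le> cmod (ft k \<xi>) * ?D 0" for n
      using DB by (auto simp: norm_mult intro!: AE_I2 mult_left_mono)
  qed (use f in auto)
  moreover have "(\<lambda>n. LINT x|lborel. k (r - x / real (Suc n)) * complex_of_real (?D x)) \<longlonglongrightarrow>
      (LINT x|lborel. k r * complex_of_real (?D x))"
  proof (rule integral_dominated_convergence[where w = "\<lambda>x. B * ?D x"])
    show "AE x in lborel. (\<lambda>n. k (r - x / real (Suc n)) * complex_of_real (?D x)) \<longlonglongrightarrow> k r *
        complex_of_real (?D x)"
    proof (intro AE_I2 tendsto_intros)
      fix x :: real
      have "(\<lambda>n. r - x / real (Suc n)) \<longlonglongrightarrow> r" by real_asymp
      then show "(\<lambda>n. k (r - x / real (Suc n))) \<longlonglongrightarrow> k r" by (rule isCont_tendsto_compose[OF c])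
    qed
    show "AE x in lborel. norm (k (r - x / real (Suc n)) * complex_of_real (?D x)) \<le> B * ?D x" for n
      using b by (auto simp: norm_mult intro!: AE_I2 mult_right_mono)
  qed auto
  moreover have "(LINT x|lborel. k r * complex_of_real (?D x)) = k r"
    using integral_normal_density[of 1 0] by simp
  ultimately have "(LINT \<xi>|lborel. ft k \<xi> * cis (\<xi> * r) * complex_of_real (?D 0))
      = complex_of_real (sqrt (2 * pi)) * k r"
    using A[of "real (Suc _)"] by (intro LIMSEQ_unique) (auto intro!: tendsto_intros)
  then have "(LINT \<xi>|lborel. ft k \<xi> * cis (\<xi> * r)) * complex_of_real (1 / sqrt (2 * pi))
      = complex_of_real (sqrt (2 * pi)) * k r"
    unfolding D0 by simp
  then have "(LINT \<xi>|lborel. ft k \<xi> * cis (\<xi> * r)) = complex_of_real (sqrt (2 * pi)) *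
      (complex_of_real (sqrt (2 * pi)) * k r)"
    by (simp add: field_simps)
  also have "\<dots> = complex_of_real (sqrt (2 * pi) * sqrt (2 * pi)) * k r"
    by (simp only: of_real_mult mult.assoc)
  finally show ?thesis by simp
qed

lemma conv_inverse_ft:
  assumes k: "integrable lborel k" and f: "integrable lborel \<psi>"
  shows "conv k (\<lambda>r. LINT \<xi>|lborel. \<psi> \<xi> * cis (\<xi> * r)) r = (LINT \<xi>|lborel. ft k \<xi> * \<psi> \<xi> * cis (\<xi> * r))"
proof -
  have [measurable]: "k \<in> borel_measurable borel" "\<psi> \<in> borel_measurable borel" using k f by auto
  have int: "integrable (lborel \<Otimes>\<^sub>M lborel) (\<lambda>(s, \<xi>). k s * (\<psi> \<xi> * cis (\<xi> * (r - s))))"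
  proof (rule lborel_pair.Fubini_integrable)
    show "integrable lborel (\<lambda>s. LINT \<xi>|lborel. cmod (case (s, \<xi>) of (s, \<xi>) \<Rightarrow> k s *
        (\<psi> \<xi> * cis (\<xi> * (r - s)))))"
      using k by (simp add: norm_mult)
    have "integrable lborel (\<lambda>\<xi>. \<psi> \<xi> * cis (\<xi> * c))" for c
      using integrable_mult_cis[OF f, of c] by (simp add: mult.commute)
    then show "AE s in lborel. integrable lborel (\<lambda>\<xi>. case (s, \<xi>) of (s, \<xi>) \<Rightarrow> k s *
        (\<psi> \<xi> * cis (\<xi> * (r - s))))"
      by simp
  qed measurable
  have "conv k (\<lambda>r. LINT \<xi>|lborel. \<psi> \<xi> * cis (\<xi> * r)) r
      = (LINT s|lborel. LINT \<xi>|lborel. k s * (\<psi> \<xi> * cis (\<xi> * (r - s))))"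
    unfolding conv_def by simp
  also have "\<dots> = (LINT \<xi>|lborel. LINT s|lborel. k s * (\<psi> \<xi> * cis (\<xi> * (r - s))))"
    using lborel_pair.Fubini_integral[OF int] by simp
  also have "\<dots> = (LINT \<xi>|lborel. ft k \<xi> * \<psi> \<xi> * cis (\<xi> * r))"
  proof (rule Bochner_Integration.integral_cong[OF refl])
    fix \<xi>
    have "k s * (\<psi> \<xi> * cis (\<xi> * (r - s))) = (k s * cis (- \<xi> * s)) * (\<psi> \<xi> * cis (\<xi> * r))" for s
    proof -
      have "cis (\<xi> * (r - s)) = cis (- \<xi> * s) * cis (\<xi> * r)" by (simp add: cis_mult algebra_simps)
      then show ?thesis by (simp only: mult_ac)
    qed
    then have "(LINT s|lborel. k s * (\<psi> \<xi> * cis (\<xi> * (r - s))))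
        = (LINT s|lborel. (k s * cis (- \<xi> * s)) * (\<psi> \<xi> * cis (\<xi> * r)))"
      by (simp only:)
    then show "(LINT s|lborel. k s * (\<psi> \<xi> * cis (\<xi> * (r - s)))) = ft k \<xi> * \<psi> \<xi> * cis (\<xi> * r)"
      unfolding ft_def integral_mult_left_zero by (simp only: mult.assoc)
  qed
  finally show ?thesis .
qed

text \<open>Unlike \<open>decays\<close>, this is stable under multiplication by the variable, which
  differentiates the Fourier transform.\<close>

definition exp_decays :: "(real \<Rightarrow> complex) \<Rightarrow> bool" where
  "exp_decays h \<longleftrightarrow> (\<exists>C \<delta>. 0 < \<delta> \<and> (\<forall>r. cmod (h r) \<le> C * exp (- (\<delta> * \<bar>r\<bar>))))"

lemma exp_decaysE:
  assumes "exp_decays h"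
  obtains C \<delta> where "0 < \<delta>" "0 \<le> C" "\<And>r. cmod (h r) \<le> C * exp (- (\<delta> * \<bar>r\<bar>))"
proof -
  obtain C \<delta> where C: "0 < \<delta>" "\<And>r. cmod (h r) \<le> C * exp (- (\<delta> * \<bar>r\<bar>))"
    using assms by (auto simp: exp_decays_def)
  have "0 \<le> C" using order_trans[OF norm_ge_zero C(2)[of 0]] by simp
  then show ?thesis using that C by blast
qed

lemma exp_decays_decays:
  assumes "exp_decays h" shows "decays h"
proof -
  obtain C \<delta> where C: "0 < \<delta>" "0 \<le> C" "\<And>r. cmod (h r) \<le> C * exp (- (\<delta> * \<bar>r\<bar>))"
    using exp_decaysE[OF assms] by blast
  have "exp (- (\<delta> * \<bar>x\<bar>)) \<le> (1 + 2 / \<delta>\<^sup>2) / (1 + x\<^sup>2)" for x :: real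
  proof -
    have "1 + \<delta> * \<bar>x\<bar> + (\<delta> * \<bar>x\<bar>)\<^sup>2 / 2 \<le> exp (\<delta> * \<bar>x\<bar>)"
      using C(1) by (intro exp_lower_Taylor_quadratic) auto
    then have "1 + \<delta>\<^sup>2 * x\<^sup>2 / 2 \<le> exp (\<delta> * \<bar>x\<bar>)" using C(1)
        by (simp add: power_mult_distrib) (smt (verit) mult_nonneg_nonneg abs_ge_zero)
    moreover have "1 + x\<^sup>2 \<le> (1 + 2 / \<delta>\<^sup>2) * (1 + \<delta>\<^sup>2 * x\<^sup>2 / 2)"
      using C(1) by (simp add: field_simps)
    moreover have "(1 + 2 / \<delta>\<^sup>2) * (1 + \<delta>\<^sup>2 * x\<^sup>2 / 2) \<le> (1 + 2 / \<delta>\<^sup>2) * exp (\<delta> * \<bar>x\<bar>)"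
      using calculation(1) by (intro mult_left_mono) auto
    ultimately have "1 + x\<^sup>2 \<le> (1 + 2 / \<delta>\<^sup>2) * exp (\<delta> * \<bar>x\<bar>)" by linarith
    moreover have "0 < 1 + x\<^sup>2" by (simp add: add_pos_nonneg)
    ultimately show ?thesis by (simp add: exp_minus field_simps)
  qed
  then have "C * exp (- (\<delta> * \<bar>x\<bar>)) \<le> C * ((1 + 2 / \<delta>\<^sup>2) / (1 + x\<^sup>2))" for x :: real
    using C(2) by (intro mult_left_mono)
  then have "cmod (h x) \<le> (C * (1 + 2 / \<delta>\<^sup>2)) / (1 + x\<^sup>2)" for x
    using C(3)[of x] order_trans by fastforce
  then show ?thesis unfolding decays_def by blast
qed

lemma exp_decays_mult_bounded:
  assumes "exp_decays h" and "\<And>x. cmod (g x) \<le> B * cmod (h x)"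
  shows "exp_decays g"
proof -
  obtain C \<delta> where C: "0 < \<delta>" "0 \<le> C" "\<And>r. cmod (h r) \<le> C * exp (- (\<delta> * \<bar>r\<bar>))"
    using exp_decaysE[OF assms(1)] by blast
  have "cmod (g x) \<le> (\<bar>B\<bar> * C) * exp (- (\<delta> * \<bar>x\<bar>))" for x
  proof -
    have "cmod (g x) \<le> \<bar>B\<bar> * cmod (h x)"
      using assms(2)[of x] by (smt (verit) mult_right_mono norm_ge_zero)
    also have "\<dots> \<le> \<bar>B\<bar> * (C * exp (- (\<delta> * \<bar>x\<bar>)))" using C by (intro mult_left_mono) auto
    finally show ?thesis by simp
  qed
  then show ?thesis using C(1) by (auto simp: exp_decays_def)
qed

lemma exp_decays_add:
  assumes "exp_decays h" "exp_decays g" shows "exp_decays (\<lambda>x. h x + g x)"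
proof -
  obtain C \<delta> where C: "0 < \<delta>" "0 \<le> C" "\<And>r. cmod (h r) \<le> C * exp (- (\<delta> * \<bar>r\<bar>))"
    using exp_decaysE[OF assms(1)] by blast
  obtain D \<epsilon> where D: "0 < \<epsilon>" "0 \<le> D" "\<And>r. cmod (g r) \<le> D * exp (- (\<epsilon> * \<bar>r\<bar>))"
    using exp_decaysE[OF assms(2)] by blast
  have "cmod (h x + g x) \<le> (C + D) * exp (- (min \<delta> \<epsilon> * \<bar>x\<bar>))" for x
  proof -
    have "C * exp (- (\<delta> * \<bar>x\<bar>)) \<le> C * exp (- (min \<delta> \<epsilon> * \<bar>x\<bar>))"
      "D * exp (- (\<epsilon> * \<bar>x\<bar>)) \<le> D * exp (- (min \<delta> \<epsilon> * \<bar>x\<bar>))"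
      using C D by (auto intro!: mult_left_mono mult_right_mono)
    then show ?thesis using norm_triangle_ineq[of "h x" "g x"] C(3)[of x] D(3)[of x]
        by (simp add: algebra_simps)
  qed
  then show ?thesis using C(1) D(1) unfolding exp_decays_def
      by (intro exI[of _ "C + D"] exI[of _ "min \<delta> \<epsilon>"]) auto
qed

text \<open>Half of the exponential rate absorbs the factor |x|.\<close>

lemma exp_decays_mult_id:
  assumes "exp_decays h" shows "exp_decays (\<lambda>x. complex_of_real x * h x)"
proof -
  obtain C \<delta> where C: "0 < \<delta>" "0 \<le> C" "\<And>r. cmod (h r) \<le> C * exp (- (\<delta> * \<bar>r\<bar>))"
    using exp_decaysE[OF assms(1)] by blast
  have "cmod (complex_of_real x * h x) \<le> (2 * C / \<delta>) * exp (- (\<delta> / 2 * \<bar>x\<bar>))" for x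
  proof -
    have "\<delta> / 2 * \<bar>x\<bar> \<le> exp (\<delta> / 2 * \<bar>x\<bar>)" by (metis exp_ge_add_one_self add_increasing zero_le_one
        order_trans less_add_one less_imp_le add.commute)
    then have a: "\<bar>x\<bar> \<le> 2 / \<delta> * exp (\<delta> / 2 * \<bar>x\<bar>)" using C(1) by (simp add: field_simps)
    have "cmod (complex_of_real x * h x) \<le> \<bar>x\<bar> * (C * exp (- (\<delta> * \<bar>x\<bar>)))"
      using C(3) by (simp add: norm_mult mult_left_mono)
    also have "\<dots> \<le> (2 / \<delta> * exp (\<delta> / 2 * \<bar>x\<bar>)) * (C * exp (- (\<delta> * \<bar>x\<bar>)))"
      using a C(2) by (intro mult_right_mono) auto
    also have "\<dots> = (2 * C / \<delta>) * (exp (\<delta> / 2 * \<bar>x\<bar>) * exp (- (\<delta> * \<bar>x\<bar>)))" by simp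
    also have "exp (\<delta> / 2 * \<bar>x\<bar>) * exp (- (\<delta> * \<bar>x\<bar>)) = exp (- (\<delta> / 2 * \<bar>x\<bar>))" by (simp flip: exp_add)
    finally show ?thesis .
  qed
  then show ?thesis using C(1) unfolding exp_decays_def
      by (intro exI[of _ "2 * C / \<delta>"] exI[of _ "\<delta> / 2"]) auto
qed

definition smooth_exp_decays :: "(real \<Rightarrow> complex) \<Rightarrow> (real \<Rightarrow> complex) \<Rightarrow> (real \<Rightarrow> complex) \<Rightarrow> bool" where
  "smooth_exp_decays h h1 h2 \<longleftrightarrow> (\<forall>x. (h has_vector_derivative h1 x) (at x))
      \<and> (\<forall>x. (h1 has_vector_derivative h2 x) (at x)) \<and>
     (\<forall>x. isCont h2 x) \<and> exp_decays h \<and> exp_decays h1 \<and> exp_decays h2"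

text \<open>Iterating this lemma makes the Fourier transform as often differentiable as desired,
  with quadratic decay of every derivative.\<close>

lemma smooth_exp_decays_mult_id:
  assumes "smooth_exp_decays h h1 h2"
  shows "smooth_exp_decays (\<lambda>r. - \<i> * (complex_of_real r * h r))
      (\<lambda>r. - \<i> * (h r + complex_of_real r * h1 r))
     (\<lambda>r. - \<i> * (2 * h1 r + complex_of_real r * h2 r))"
proof -
  have h: "\<And>x. (h has_vector_derivative h1 x) (at x)" "\<And>x. (h1 has_vector_derivative h2 x) (at x)"
      "\<And>x. isCont h2 x"
    "exp_decays h" "exp_decays h1" "exp_decays h2"
    using assms by (auto simp: smooth_exp_decays_def)
  have r: "(complex_of_real has_vector_derivative 1) (at x)" for x :: real
    by (rule has_vector_derivative_eq_rhs[OF has_vector_derivative_of_real[OF DERIV_ident]]) simp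
  have i: "exp_decays (\<lambda>r. - \<i> * g r)" if "exp_decays g" for g
    using that by (rule exp_decays_mult_bounded[where B = 1]) (simp add: norm_mult)
  have t: "exp_decays (\<lambda>r. 2 * g r)" if "exp_decays g" for g :: "real \<Rightarrow> complex"
    using that by (rule exp_decays_mult_bounded[where B = 2]) (simp add: norm_mult)
  have c1: "isCont h1 x" for x using h(2) by (rule has_vector_derivative_continuous)
  show ?thesis unfolding smooth_exp_decays_def
  proof (intro conjI allI)
    show "((\<lambda>r. - \<i> * (complex_of_real r * h r)) has_vector_derivative - \<i> *
        (h x + complex_of_real x * h1 x)) (at x)" for x
      using has_vector_derivative_mult_right[OF has_vector_derivative_mult[OF r h(1)], of "- \<i>" x]
          by (simp add: algebra_simps)
    show "((\<lambda>r. - \<i> * (h r + complex_of_real r * h1 r)) has_vector_derivative - \<i> *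
        (2 * h1 x + complex_of_real x * h2 x)) (at x)" for x
      using has_vector_derivative_mult_right[OF has_vector_derivative_add[OF h(1)
          has_vector_derivative_mult[OF r h(2)]], of "- \<i>" x]
      by (simp add: algebra_simps)
    show "isCont (\<lambda>r. - \<i> * (2 * h1 r + complex_of_real r * h2 r)) x" for x
      by (intro continuous_intros h(3) c1)
  qed (intro i t exp_decays_add exp_decays_mult_id h)+
qed

lemma smooth_exp_decaysD:
  assumes "smooth_exp_decays h h1 h2"
  shows "integrable lborel h" "decays (ft h)" "\<And>x. isCont h x"
proof -
  have h: "\<And>x. (h has_vector_derivative h1 x) (at x)" "\<And>x. (h1 has_vector_derivative h2 x) (at x)"
      "\<And>x. isCont h2 x"
    "exp_decays h" "exp_decays h1" "exp_decays h2"
    using assms by (auto simp: smooth_exp_decays_def)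
  show c: "isCont h x" for x using h(1) by (rule has_vector_derivative_continuous)
  show "integrable lborel h" using c h exp_decays_decays
      by (intro decays_integrable isCont_measurable) auto
  show "decays (ft h)" using h exp_decays_decays by (intro ft_decays[where h = h and ?h1.0 = h1
      and ?h2.0 = h2]) auto
qed

text \<open>\<open>m\<close> is the inverse Fourier transform of \<open>ft k / (l - ft k)\<close>; two derivatives of this quotient decay
  quadratically, which makes \<open>m\<close> integrable.\<close>

lemma resolvent_kernel:
  assumes k: "smooth_exp_decays k k1 k2" and l0: "l \<noteq> 0" and l: "\<And>\<xi>. ft k \<xi> \<noteq> l"
  shows "\<exists>m. integrable lborel m \<and> (\<forall>r. l * m r - conv k m r = k r)"
proof -
  \<comment> \<open>\<open>ft ka\<close>, \<open>ft kb\<close> and \<open>ft kc\<close> are the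
    first three derivatives of \<open>ft k\<close>. The third serves for the continuity of the
    second.\<close>
  define ka where "ka r = - \<i> * (complex_of_real r * k r)" for r
  define kb where "kb r = - \<i> * (complex_of_real r * ka r)" for r
  define kc where "kc r = - \<i> * (complex_of_real r * kb r)" for r
  obtain a1 a2 where A: "smooth_exp_decays ka a1 a2" unfolding ka_def
      using smooth_exp_decays_mult_id[OF k] by blast
  obtain b1 b2 where B: "smooth_exp_decays kb b1 b2" unfolding kb_def
      using smooth_exp_decays_mult_id[OF A] by blast
  obtain c1 c2 where Cc: "smooth_exp_decays kc c1 c2" unfolding kc_def
      using smooth_exp_decays_mult_id[OF B] by blast
  note K = smooth_exp_decaysD[OF k] note A = smooth_exp_decaysD[OF A] note B
      = smooth_exp_decaysD[OF B] note Cc = smooth_exp_decaysD[OF Cc]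
  have mi: "integrable lborel (\<lambda>r. complex_of_real r * g r)"
      if "integrable lborel (\<lambda>r. - \<i> * (complex_of_real r * g r))" for g
    using integrable_mult_right[of \<i>, OF that] by simp
  have d0: "(ft k has_vector_derivative ft ka \<xi>) (at \<xi>)" for \<xi>
    using ft_has_vector_derivative[OF K(1) mi[OF A(1)[unfolded ka_def]]] by (simp add: ka_def[abs_def])
  have d1: "(ft ka has_vector_derivative ft kb \<xi>) (at \<xi>)" for \<xi>
    using ft_has_vector_derivative[OF A(1) mi[OF B(1)[unfolded kb_def]]] by (simp add: kb_def[abs_def])
  have d2: "(ft kb has_vector_derivative ft kc \<xi>) (at \<xi>)" for \<xi>
    using ft_has_vector_derivative[OF B(1) mi[OF Cc(1)[unfolded kc_def]]] by (simp add: kc_def[abs_def])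
  have cont: "isCont (ft k) \<xi>" "isCont (ft ka) \<xi>" "isCont (ft kb) \<xi>" for \<xi>
    using d0 d1 d2 by (auto intro: has_vector_derivative_continuous)
  \<comment> \<open>\<open>l\<close> stays at a positive distance from the values of
    \<open>ft k\<close>: outside a compact interval these have modulus below |l|/2, and on the
    interval the distance attains its minimum. Nothing orders \<open>R1\<close> and
    \<open>R2\<close>, hence the min and max.\<close>
  obtain d where d: "0 < d" "\<And>\<xi>. d \<le> cmod (l - ft k \<xi>)"
  proof -
    have "\<forall>\<^sub>F \<xi> in at_top. cmod (ft k \<xi>) < cmod l / 2" "\<forall>\<^sub>F \<xi> in at_bot. cmod (ft k \<xi>) < cmod l / 2"
      using order_tendstoD(2)[OF tendsto_norm_zero[OF decays_tendsto(1)[OF K(2)]], of "cmod l / 2"]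
        order_tendstoD(2)[OF tendsto_norm_zero[OF decays_tendsto(2)[OF K(2)]], of "cmod l / 2"] l0
            by simp_all
    then obtain R1 R2 where R: "\<And>\<xi>. \<xi> \<ge> R1 \<Longrightarrow> cmod (ft k \<xi>) < cmod l / 2" "\<And>\<xi>. \<xi> \<le> R2 \<Longrightarrow> cmod (ft k \<xi>)
        < cmod l / 2"
      unfolding eventually_at_top_linorder eventually_at_bot_linorder by blast
    have "\<exists>x\<in>{min R1 R2..max R1 R2}. \<forall>y\<in>{min R1 R2..max R1 R2}. cmod (l - ft k x) \<le> cmod (l - ft k y)"
      by (rule continuous_attains_inf) (auto intro!: continuous_intros continuous_at_imp_continuous_on
          cont)
    then obtain x where x: "\<And>y. min R1 R2 \<le> y \<Longrightarrow> y \<le> max R1 R2 \<Longrightarrow> cmod (l - ft k x) \<le> cmod (l - ft k y)"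
      by (auto simp: Ball_def)
    show ?thesis
    proof (rule that[of "min (cmod l / 2) (cmod (l - ft k x))"])
      show "0 < min (cmod l / 2) (cmod (l - ft k x))" using l0 l[of x] by auto
      fix \<xi>
      show "min (cmod l / 2) (cmod (l - ft k x)) \<le> cmod (l - ft k \<xi>)"
      proof (cases "min R1 R2 \<le> \<xi> \<and> \<xi> \<le> max R1 R2")
        case True then show ?thesis using x by (simp add: min.coboundedI2)
      next
        case False
        then have "cmod (ft k \<xi>) < cmod l / 2" using R by (cases "\<xi> \<ge> R1") auto
        then show ?thesis using norm_triangle_ineq2[of l "ft k \<xi>"] by linarith
      qed
    qed
  qed
  have ln: "l - ft k \<xi> \<noteq> 0" for \<xi> using l[of \<xi>] by auto
  \<comment> \<open>\<open>p0\<close> is z / (l - z) at z = ft k, and \<open>p1\<close>,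
    \<open>p2\<close> are its derivatives by the chain rule. Every term keeps a decaying factor
    \<open>ft k\<close>, \<open>ft ka\<close> or \<open>ft kb\<close>, while the denominators are
    bounded below by powers of d.\<close>
  define p0 where "p0 \<xi> = ft k \<xi> / (l - ft k \<xi>)" for \<xi>
  define p1 where "p1 \<xi> = ft ka \<xi> * (l / (l - ft k \<xi>)\<^sup>2)" for \<xi>
  define p2 where "p2 \<xi> = ft ka \<xi> * (ft ka \<xi> * (2 * l / (l - ft k \<xi>) ^ 3)) + ft kb \<xi> *
      (l / (l - ft k \<xi>)\<^sup>2)" for \<xi>
  have D0: "(p0 has_vector_derivative p1 \<xi>) (at \<xi>)" for \<xi>
  proof -
    have "((\<lambda>z. z / (l - z)) has_field_derivative l / (l - ft k \<xi>)\<^sup>2) (at (ft k \<xi>))"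
      using ln[of \<xi>] by (auto intro!: derivative_eq_intros simp: power2_eq_square field_simps)
    from field_vector_diff_chain_at[OF d0 this] show ?thesis by (simp add: p0_def[abs_def] p1_def o_def)
  qed
  have D1: "(p1 has_vector_derivative p2 \<xi>) (at \<xi>)" for \<xi>
  proof -
    have "((\<lambda>z. l / (l - z)\<^sup>2) has_field_derivative 2 * l / (l - ft k \<xi>) ^ 3) (at (ft k \<xi>))"
      using ln[of \<xi>] by (auto intro!: derivative_eq_intros simp: power2_eq_square power3_eq_cube
          divide_simps) (simp add: algebra_simps)
    from has_vector_derivative_mult[OF d1 field_vector_diff_chain_at[OF d0 this]] show ?thesis
      by (simp add: p1_def[abs_def] p2_def o_def)
  qed
  have C2: "isCont p2 \<xi>" for \<xi>
    unfolding p2_def using ln by (intro continuous_intros cont) auto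
  have q: "cmod (c / (l - ft k \<xi>) ^ n) \<le> cmod c / d ^ n" for c \<xi> n
  proof -
    have "0 < cmod (l - ft k \<xi>)" using d(1) d(2)[of \<xi>] by linarith
    then show ?thesis unfolding norm_divide norm_power
      using d(1) d(2)[of \<xi>] by (intro divide_left_mono power_mono mult_pos_pos zero_less_power) auto
  qed
  have P0: "decays p0" using K(2)
  proof (rule decays_bounded_mult)
    show "cmod (p0 \<xi>) \<le> (cmod 1 / d ^ 1) * cmod (ft k \<xi>)" for \<xi>
      using mult_left_mono[OF q[of 1 \<xi> 1], of "cmod (ft k \<xi>)"]
          by (simp add: p0_def norm_divide mult.commute)
  qed
  have P1: "decays p1" using A(2)
  proof (rule decays_bounded_mult)
    show "cmod (p1 \<xi>) \<le> (cmod l / d ^ 2) * cmod (ft ka \<xi>)" for \<xi>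
      using mult_left_mono[OF q[of l \<xi> 2], of "cmod (ft ka \<xi>)"]
          by (simp only: p1_def norm_mult mult.commute[of "cmod l / d ^ 2"]) simp
  qed
  have P2: "decays p2" unfolding p2_def
  proof (rule decays_add)
    show "decays (\<lambda>\<xi>. ft kb \<xi> * (l / (l - ft k \<xi>)\<^sup>2))" using B(2)
    proof (rule decays_bounded_mult)
      show "cmod (ft kb \<xi> * (l / (l - ft k \<xi>)\<^sup>2)) \<le> (cmod l / d ^ 2) * cmod (ft kb \<xi>)" for \<xi>
        using mult_left_mono[OF q[of l \<xi> 2], of "cmod (ft kb \<xi>)"]
            by (simp only: norm_mult mult.commute[of "cmod l / d ^ 2"]) simp
    qed
    show "decays (\<lambda>\<xi>. ft ka \<xi> * (ft ka \<xi> * (2 * l / (l - ft k \<xi>) ^ 3)))" using A(2)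
    proof (rule decays_bounded_mult)
      fix \<xi>
      have "cmod (ft ka \<xi> * (2 * l / (l - ft k \<xi>) ^ 3))
          \<le> (LINT r|lborel. cmod (ka r)) * (cmod (2 * l) / d ^ 3)"
        unfolding norm_mult[of "ft ka \<xi>"] by (intro mult_mono ft_bound A q) auto
      from mult_left_mono[OF this, of "cmod (ft ka \<xi>)"]
      show "cmod (ft ka \<xi> * (ft ka \<xi> * (2 * l / (l - ft k \<xi>) ^ 3)))
          \<le> ((LINT r|lborel. cmod (ka r)) * (cmod (2 * l) / d ^ 3)) * cmod (ft ka \<xi>)"
        unfolding norm_mult[of "ft ka \<xi>"] by (simp only: mult_ac norm_ge_zero True_implies_equals)
    qed
  qed
  have c0: "isCont p0 \<xi>" for \<xi> using D0 by (rule has_vector_derivative_continuous)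
  have [measurable]: "p0 \<in> borel_measurable borel" using c0 by (rule isCont_measurable)
  have i0: "integrable lborel p0" using P0 by (rule decays_integrable) measurable
  \<comment> \<open>Up to the factor 2 pi this is the wanted m. Being the reflected Fourier
    transform of \<open>p0\<close>, it decays quadratically.\<close>
  define u where "u r = (LINT \<xi>|lborel. p0 \<xi> * cis (\<xi> * r))" for r
  have u: "u r = ft p0 (- r)" for r by (simp add: u_def ft_def mult.commute)
  have "decays (ft p0)" by (rule ft_decays[OF D0 D1 C2 P0 P1 P2])
  then have "decays u" unfolding decays_def u by (metis power2_minus)
  moreover have [measurable]: "u \<in> borel_measurable borel" unfolding u_def by measurable
  ultimately have iu: "integrable lborel u" by (rule decays_integrable)
  obtain Bd where Bd: "\<And>x. cmod (k x) \<le> Bd"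
  proof -
    have "exp_decays k" using k by (simp add: smooth_exp_decays_def)
    then obtain C \<delta> where C: "0 < \<delta>" "0 \<le> C" "\<And>r. cmod (k r) \<le> C * exp (- (\<delta> * \<bar>r\<bar>))"
      using exp_decaysE by blast
    have "C * exp (- (\<delta> * \<bar>r\<bar>)) \<le> C * 1" for r using C(1,2) by (intro mult_left_mono) auto
    then show ?thesis using that[of C] C(3) order_trans by fastforce
  qed
  have ik: "integrable lborel (ft k)" using K(2) cont(1) by (intro decays_integrable isCont_measurable)
  \<comment> \<open>The identity ft k * p0 = l * p0 - ft k, transformed back; the factor 2 pi is
    that of Fourier inversion.\<close>
  have main: "l * u r - conv k u r = complex_of_real (2 * pi) * k r" for r
  proof -
    have ip: "integrable lborel (\<lambda>\<xi>. p0 \<xi> * cis (\<xi> * r))" using integrable_mult_cis[OF i0, of r]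
        by (simp add: mult.commute)
    have ikc: "integrable lborel (\<lambda>\<xi>. ft k \<xi> * cis (\<xi> * r))" using integrable_mult_cis[OF ik, of r]
        by (simp add: mult.commute)
    have eq: "ft k \<xi> * p0 \<xi> * cis (\<xi> * r) = l * (p0 \<xi> * cis (\<xi> * r)) - ft k \<xi> * cis (\<xi> * r)" for \<xi>
    proof -
      have "ft k \<xi> * p0 \<xi> = l * p0 \<xi> - ft k \<xi>" using ln[of \<xi>] unfolding p0_def by (simp add: field_simps)
      then show ?thesis by (simp only: left_diff_distrib mult.assoc)
    qed
    have "conv k u r = (LINT \<xi>|lborel. ft k \<xi> * p0 \<xi> * cis (\<xi> * r))"
      unfolding u_def[abs_def] by (rule conv_inverse_ft[OF K(1) i0])
    also have "\<dots> = l * u r - (LINT \<xi>|lborel. ft k \<xi> * cis (\<xi> * r))"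
      unfolding eq u_def using ip ikc by simp
    finally show ?thesis using fourier_inversion[OF K(1) K(3) Bd ik, of r] by simp
  qed
  define m where "m r = u r / complex_of_real (2 * pi)" for r
  have "conv k m r = conv k u r / complex_of_real (2 * pi)" for r
    unfolding conv_def m_def by simp
  then have "l * m r - conv k m r = k r" for r
    using main[of r] by (simp add: m_def field_simps)
  moreover have "integrable lborel m" unfolding m_def using iu by simp
  ultimately show ?thesis by blast
qed

section \<open>Smoothness, decay and Fourier transform of \<open>phi_kernel\<close>\<close>

lemma phi_kernel_smooth_exp_decays:
  assumes a: "0 < a" "a < \<mu>"
  shows "\<exists>k1 k2. smooth_exp_decays (\<lambda>r. complex_of_real (phi_kernel a \<mu> r)) k1 k2"
proof -
  \<comment> \<open>The logistic function, with s' = s (1 - s). The logarithmic derivative of f is a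
    - \<mu> s, so f1 and f2 are f times polynomials in s, which are bounded because s lies between 0
    and 1.\<close>
  define s where "s r = exp r / (1 + exp r)" for r :: real
  have e: "0 < 1 + exp r" for r :: real by (simp add: add_pos_pos)
  have s: "0 \<le> s r" "s r \<le> 1" for r using e[of r] by (auto simp: s_def field_simps)
  have ds: "(s has_real_derivative s r * (1 - s r)) (at r)" for r
    unfolding s_def using e[of r]
    by (auto intro!: derivative_eq_intros simp: field_simps power2_eq_square)
  define f where "f r = phi_kernel a \<mu> r" for r
  define f1 where "f1 r = f r * (a - \<mu> * s r)" for r
  define f2 where "f2 r = f r * ((a - \<mu> * s r)\<^sup>2 - \<mu> * (s r * (1 - s r)))" for r
  have df: "(f has_real_derivative f1 r) (at r)" for r
  proof -
    have eq: "f = (\<lambda>r. exp (a * r - \<mu> * ln (1 + exp r)))"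
      unfolding f_def phi_kernel_def using e by (simp add: fun_eq_iff powr_def exp_diff
          less_imp_neq[symmetric])
    show ?thesis unfolding f1_def s_def unfolding eq using e[of r]
      by (auto intro!: derivative_eq_intros)
  qed
  have df1: "(f1 has_real_derivative f2 r) (at r)" for r
    unfolding f1_def f2_def
    by (rule derivative_eq_intros df ds refl)+ (simp add: f1_def algebra_simps power2_eq_square)
  have cs: "isCont s r" for r using ds by (rule DERIV_isCont)
  have cf: "isCont f r" for r using df by (rule DERIV_isCont)
  have cf2: "isCont f2 r" for r unfolding f2_def by (intro continuous_intros cs cf)
  have E: "exp_decays (\<lambda>r. complex_of_real (f r))"
  proof -
    \<comment> \<open>The rate is a at minus infinity, where the denominator is at least 1, and
      \<mu> - a at plus infinity, where the denominator is at least exp (\<mu> r).\<close>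
    have "f r \<le> exp (- (min a (\<mu> - a) * \<bar>r\<bar>))" for r
    proof (cases "r \<ge> 0")
      case True
      have "exp r powr \<mu> \<le> (1 + exp r) powr \<mu>" using a by (intro powr_mono2) auto
      then have "f r \<le> exp (a * r) / exp (\<mu> * r)" using e[of r]
        unfolding f_def phi_kernel_def by (intro divide_left_mono)
            (auto simp: exp_powr_real mult.commute)
      also have "\<dots> = exp (- ((\<mu> - a) * r))" by (simp add: algebra_simps flip: exp_diff)
      also have "\<dots> \<le> exp (- (min a (\<mu> - a) * \<bar>r\<bar>))" using True by (auto intro!: mult_right_mono)
      finally show ?thesis .
    next
      case False
      have "1 powr \<mu> \<le> (1 + exp r) powr \<mu>" using a by (intro powr_mono2) auto
      then have "f r \<le> exp (a * r)" unfolding f_def phi_kernel_def using e[of r]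
          by (simp add: divide_le_eq)
      also have "\<dots> \<le> exp (- (min a (\<mu> - a) * \<bar>r\<bar>))" using False by (auto intro!: mult_right_mono)
      finally show ?thesis .
    qed
    moreover have "0 \<le> f r" for r by (simp add: f_def phi_kernel_def)
    ultimately show ?thesis unfolding exp_decays_def using a
      by (intro exI[of _ 1] exI[of _ "min a (\<mu> - a)"]) auto
  qed
  have b: "\<bar>a - \<mu> * s r\<bar> \<le> \<bar>a\<bar> + \<bar>\<mu>\<bar>" for r
  proof -
    have "\<bar>\<mu> * s r\<bar> \<le> \<bar>\<mu>\<bar> * 1" unfolding abs_mult using s[of r] by (intro mult_left_mono) auto
    then show ?thesis by linarith
  qed
  have E1: "exp_decays (\<lambda>r. complex_of_real (f1 r))" using E
  proof (rule exp_decays_mult_bounded)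
    fix r
    have "\<bar>f1 r\<bar> \<le> (\<bar>a\<bar> + \<bar>\<mu>\<bar>) * \<bar>f r\<bar>"
      using mult_left_mono[OF b[of r], of "\<bar>f r\<bar>"] unfolding f1_def abs_mult by (simp add: mult.commute)
    then show "cmod (complex_of_real (f1 r)) \<le> (\<bar>a\<bar> + \<bar>\<mu>\<bar>) * cmod (complex_of_real (f r))"
      by (simp only: norm_of_real)
  qed
  have E2: "exp_decays (\<lambda>r. complex_of_real (f2 r))" using E
  proof (rule exp_decays_mult_bounded)
    fix r
    have "\<bar>(a - \<mu> * s r)\<^sup>2\<bar> \<le> (\<bar>a\<bar> + \<bar>\<mu>\<bar>)\<^sup>2" using b[of r] by (simp add: abs_le_square_iff[symmetric])
    moreover have "\<bar>\<mu> * (s r * (1 - s r))\<bar> \<le> \<bar>\<mu>\<bar> * 1" unfolding abs_mult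
      using s[of r] by (intro mult_left_mono) (auto intro!: mult_le_one)
    ultimately have "\<bar>(a - \<mu> * s r)\<^sup>2 - \<mu> * (s r * (1 - s r))\<bar> \<le> (\<bar>a\<bar> + \<bar>\<mu>\<bar>)\<^sup>2 + \<bar>\<mu>\<bar>" by linarith
    from mult_left_mono[OF this, of "\<bar>f r\<bar>"]
    have "\<bar>f2 r\<bar> \<le> ((\<bar>a\<bar> + \<bar>\<mu>\<bar>)\<^sup>2 + \<bar>\<mu>\<bar>) * \<bar>f r\<bar>"
      unfolding f2_def abs_mult by (simp add: mult.commute)
    then show "cmod (complex_of_real (f2 r)) \<le> ((\<bar>a\<bar> + \<bar>\<mu>\<bar>)\<^sup>2 + \<bar>\<mu>\<bar>) * cmod (complex_of_real (f r))"
      by (simp only: norm_of_real)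
  qed
  have "smooth_exp_decays (\<lambda>r. complex_of_real (f r)) (\<lambda>r. complex_of_real (f1 r))
      (\<lambda>r. complex_of_real (f2 r))"
    unfolding smooth_exp_decays_def using E E1 E2 df df1 cf2
    by (auto intro!: has_vector_derivative_of_real continuous_intros
        simp: has_real_derivative_iff_has_vector_derivative)
  then show ?thesis unfolding f_def by blast
qed

lemma ft_phi_kernel:
  assumes a: "0 < a" "a < \<mu>"
  shows "ft (\<lambda>r. complex_of_real (phi_kernel a \<mu> r)) \<xi> = Beta
      (complex_of_real a - \<i> * complex_of_real \<xi>) (complex_of_real (\<mu> - a) + \<i> * complex_of_real \<xi>)"
proof -
  have "has_bochner_integral lborel (\<lambda>r. exp ((complex_of_real a - \<i> * complex_of_real \<xi>) *
      complex_of_real r) * complex_of_real ((1 + exp r) powr - \<mu>))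
    (Beta (complex_of_real a - \<i> * complex_of_real \<xi>) (complex_of_real (\<mu> - a) + \<i> * complex_of_real \<xi>))"
    by (rule Beta_integral_log) (use a in auto)
  moreover have "exp ((complex_of_real a - \<i> * complex_of_real \<xi>) * complex_of_real r) * complex_of_real
      ((1 + exp r) powr - \<mu>)
    = complex_of_real (phi_kernel a \<mu> r) * cis (- \<xi> * r)" for r
  proof -
    have "exp ((complex_of_real a - \<i> * complex_of_real \<xi>) * complex_of_real r)
        = complex_of_real (exp (a * r)) * cis (- \<xi> * r)"
      by (simp add: cis_conv_exp algebra_simps flip: exp_of_real exp_add)
    then show ?thesis by (simp add: phi_kernel_def powr_minus_divide)
  qed
  ultimately show ?thesis by (simp add: ft_def has_bochner_integral_iff)
qed

section \<open>Erdelyi-Kober kernels\<close>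

text \<open>A functional monotone class theorem. The rays form an intersection-stable generator of
  the Borel sets; Dynkin's argument gives all indicators, increasing limits give the bounded
  nonnegative functions, and positive and negative parts give the rest.\<close>

lemma bounded_borel_induct:
  fixes P :: "(real \<Rightarrow> real) \<Rightarrow> bool"
  assumes u[measurable]: "u \<in> borel_measurable borel" and bd: "\<And>x. \<bar>u x\<bar> \<le> C"
    and one: "P (\<lambda>_. 1)" and ind: "\<And>a. P (indicator {a<..})"
    and lin: "\<And>u v c d. P u \<Longrightarrow> P v \<Longrightarrow> P (\<lambda>x. c * u x + d * v x)"
    and lim: "\<And>U u C. (\<And>i. U i \<in> borel_measurable borel) \<Longrightarrow> (\<And>i. P (U i)) \<Longrightarrow> (\<And>i x. \<bar>U i x\<bar> \<le> C) \<Longrightarrow>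
       (\<And>x. (\<lambda>i. U i x) \<longlonglongrightarrow> u x) \<Longrightarrow> P u"
  shows "P u"
proof -
  have zero: "P (\<lambda>_. 0)" using lin[OF one one, of 0 0] by simp
  have sets: "P (indicator A)" if "A \<in> sets borel" for A
  proof -
    have A: "A \<in> sigma_sets UNIV (range (\<lambda>a. {a::real<..}))"
      using that unfolding borel_Ioi by (simp add: sets_measure_of)
    have stable: "Int_stable (range (\<lambda>a. {a::real<..}))"
    proof -
      have "{a<..} \<inter> {b<..} = {max a b<..}" for a b :: real by auto
      then show ?thesis by (auto simp: Int_stable_def)
    qed
    have closed: "range (\<lambda>a. {a::real<..}) \<subseteq> Pow UNIV" by simp
    show ?thesis
      using stable closed A
    proof (induction rule: sigma_sets_induct_disjoint)
      case (union A)
      have m: "A i \<in> sets borel" for i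
        using union(2) unfolding borel_Ioi by (auto simp: sets_measure_of)
      show ?case
      proof (rule lim[where C = 1])
        show "(\<lambda>x. \<Sum>i<n. indicator (A i) x :: real) \<in> borel_measurable borel" for n
          by (intro borel_measurable_sum borel_measurable_indicator m)
        show "P (\<lambda>x. \<Sum>i<n. indicator (A i) x :: real)" for n
        proof (induction n)
          case (Suc n) then show ?case using lin[OF Suc union(3)[of n], of 1 1] by simp
        qed (use zero in simp)
        have s: "(\<Sum>i<n. indicator (A i) x) = (indicator (\<Union>i<n. A i) x :: real)" for n x
          using union(1) by (intro indicator_UN_disjoint[symmetric]) (auto simp: disjoint_family_on_def)
        show "\<bar>\<Sum>i<n. indicator (A i) x :: real\<bar> \<le> 1" for n x unfolding s by (simp add: indicator_def)
        show "(\<lambda>n. \<Sum>i<n. indicator (A i) x :: real) \<longlonglongrightarrow> indicator (\<Union>i. A i) x" for x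
          unfolding s by (rule LIMSEQ_indicator_UN)
      qed
    next
      case (compl A)
      have "(indicator (UNIV - A) :: real \<Rightarrow> real) = (\<lambda>x. 1 * 1 + (- 1) * indicator A x)"
        by (auto simp: fun_eq_iff indicator_def)
      then show ?case using lin[OF one compl(2), of 1 "-1"] by simp
    next
      case empty then show ?case using zero by (simp add: indicator_def[abs_def])
    next
      case (basic A) then show ?case using ind by auto
    qed
  qed
  have pos: "P v" if v: "v \<in> borel_measurable borel" "\<And>x. 0 \<le> v x" "\<And>x. v x \<le> C" for v :: "real \<Rightarrow> real"
      and C
  proof -
    \<comment> \<open>Boundedness is carried as a premise because the induction builds arbitrary
      nonnegative functions; it passes down to summands and to the members of an increasing
      sequence.\<close>
    have "(\<exists>C. \<forall>x. v x \<le> C) \<longrightarrow> P v"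
      using v(1,2)
    proof (induction rule: borel_measurable_induct_real)
      case (set A) then show ?case using sets by simp
    next
      case (mult u c)
      show ?case
      proof (cases "c = 0")
        case False
        show ?thesis
        proof
          assume "\<exists>C. \<forall>x. c * u x \<le> C"
          then obtain C where "\<And>x. c * u x \<le> C" by blast
          then have "\<forall>x. u x \<le> C / c" using False mult by (simp add: field_simps)
          then have "P u" using mult by blast
          then show "P (\<lambda>x. c * u x)" using lin[OF _ zero, of u c 0] by simp
        qed
      qed (use zero in simp)
    next
      case (add u v)
      show ?case
      proof
        assume "\<exists>C. \<forall>x. v x + u x \<le> C"
        then obtain C where C: "\<And>x. v x + u x \<le> C" by blast
        have "u x \<le> C" "v x \<le> C" for x
          using C[of x] add.hyps(2)[of x] add.hyps(4)[of x] by auto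
        then have "P u" "P v" using add by blast+
        then show "P (\<lambda>x. v x + u x)" using lin[of v u 1 1] by simp
      qed
    next
      case (seq U)
      show ?case
      proof
        assume "\<exists>C. \<forall>x. v x \<le> C"
        then obtain C where C: "\<And>x. v x \<le> C" by blast
        have le: "U i x \<le> v x" for i x
          using seq.hyps(3) by (intro incseq_le[of "\<lambda>i. U i x"] seq.hyps(4))
              (auto simp: incseq_def le_fun_def)
        have bd: "U i x \<le> C" for i x using le C order_trans by blast
        show "P v"
        proof (rule lim[of U C])
          show "P (U i)" for i using bd seq.IH by blast
          show "\<bar>U i x\<bar> \<le> C" for i x using bd seq.hyps(2)[of i x] by simp
        qed (use seq.hyps in auto)
      qed
    qed
    then show ?thesis using v(3) by blast
  qed
  have 1: "P (\<lambda>x. max 0 (u x))" by (rule pos[where C = C])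
      (use bd order_trans[OF abs_ge_zero bd] in \<open>auto simp: max_def abs_le_iff\<close>)
  have 2: "P (\<lambda>x. max 0 (- u x))" by (rule pos[where C = C])
      (use bd order_trans[OF abs_ge_zero bd] in \<open>auto simp: max_def abs_le_iff\<close>)
  have "u = (\<lambda>x. 1 * max 0 (u x) + (- 1) * max 0 (- u x))" by (auto simp: fun_eq_iff max_def)
  then show ?thesis using lin[OF 1 2, of 1 "- 1"] by simp
qed

section \<open>Beta integrals and the composition law\<close>

lemma has_bochner_integral_Beta:
  fixes a b :: real
  assumes a: "0 < a" and b: "0 < b"
  shows "has_bochner_integral lborel (\<lambda>x. if 0 < x \<and> x < 1 then x powr (a - 1) * (1 - x) powr (b - 1)
      else 0) (Beta a b)"
proof -
  let ?f = "\<lambda>x::real. x powr (a - 1) * (1 - x) powr (b - 1)"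
  have h: "(?f has_integral Beta a b) {0..1}" by (rule has_integral_Beta_real[OF a b])
  have "?f absolutely_integrable_on {0..1}"
    by (rule nonnegative_absolutely_integrable_1) (use h in \<open>auto simp: has_integral_integrable\<close>)
  then have "integrable lebesgue (\<lambda>x. indicator {0..1} x *\<^sub>R ?f x)" by (simp add: set_integrable_def)
  then have i: "integrable lborel (\<lambda>x. indicator {0..1} x *\<^sub>R ?f x)"
    by (subst (asm) integrable_completion) auto
  then have "(LINT x:{0..1}|lborel. ?f x) = integral {0..1} ?f"
    by (intro set_borel_integral_eq_integral) (simp add: set_integrable_def)
  then have v: "(LINT x|lborel. indicator {0..1} x *\<^sub>R ?f x) = Beta a b"
    using integral_unique[OF h] by (simp add: set_lebesgue_integral_def)
  have eq: "indicator {0..1} x *\<^sub>R ?f x = (if 0 < x \<and> x < 1 then ?f x else 0)" for x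
    by (auto simp: indicator_def)
  show ?thesis using i v unfolding eq by (simp add: has_bochner_integral_iff)
qed

lemma has_bochner_integral_Beta_log:
  fixes a b :: real
  assumes a: "0 < a" and b: "0 < b"
  shows "has_bochner_integral lborel (\<lambda>r. if r < 0 then exp (a * r) * (1 - exp r) powr (b - 1) else 0)
      (Beta a b)"
proof -
  define g where "g x = (if 0 < x \<and> x < 1 then x powr (a - 1) * (1 - x) powr (b - 1) else 0)" for x
      :: real
  have [measurable]: "g \<in> borel_measurable borel" unfolding g_def by measurable
  have e1: "indicator {0<..} x *\<^sub>R g x = g x" for x by (auto simp: g_def indicator_def)
  have e2: "exp r *\<^sub>R g (exp r) = (if r < 0 then exp (a * r) * (1 - exp r) powr (b - 1) else 0)" for r
  proof -
    have "exp r * exp r powr (a - 1) = exp (a * r)" by (simp add: exp_powr_real algebra_simps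
        flip: exp_add)
    then show ?thesis by (simp add: g_def flip: mult.assoc)
  qed
  have "has_bochner_integral lborel g (Beta a b)"
    unfolding g_def[abs_def] by (rule has_bochner_integral_Beta[OF a b])
  then show ?thesis using exp_substitution[of g]
    unfolding e1 e2 by (simp add: has_bochner_integral_iff)
qed

text \<open>With \<open>x = exp (- r)\<close>, \<open>dil_op (ek a b) f t\<close> is the Erdelyi-Kober integral
  \<open>1 / Gamma b * \<integral> (x - 1) powr (b - 1) * x powr (- a - b) * f (x * t) dx\<close> over \<open>x > 1\<close>.\<close>

definition ek :: "real \<Rightarrow> real \<Rightarrow> real \<Rightarrow> complex" where
  "ek a b r = complex_of_real (if r < 0 then exp (a * r) * (1 - exp r) powr (b - 1) / Gamma b else 0)"

lemma ek_measurable[measurable]: "ek a b \<in> borel_measurable borel"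
  unfolding ek_def by measurable

text \<open>The weighted kernel is an Euler integrand with exponents a + 1/p and b; the summand 1/p
  makes a = 0 admissible.\<close>

lemma kernel_ek:
  assumes "1 \<le> p" "0 \<le> a" "0 < b"
  shows "kernel p (ek a b)"
proof -
  have "0 < a + 1 / p" using assms by (simp add: add_nonneg_pos)
  from has_bochner_integral_Beta_log[OF this assms(3)]
  have "integrable lborel (\<lambda>r. (1 / Gamma b) * (if r < 0 then exp ((a + 1 / p) * r) * (1 - exp r) powr
      (b - 1) else 0))"
    by (intro integrable_mult_right) (auto simp: has_bochner_integral_iff)
  moreover have "(1 / Gamma b) * (if r < 0 then exp ((a + 1 / p) * r) * (1 - exp r) powr (b - 1) else 0)
      = exp (r / p) * cmod (ek a b r)" for r
    using Gamma_real_pos[OF assms(3)] by (simp add: ek_def norm_mult norm_divide exp_add algebra_simps)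
  ultimately show ?thesis unfolding kernel_def by (simp add: ek_measurable)
qed

text \<open>The semigroup law of fractional integration. With y = exp (- r) and S = exp s the
  convolution is an Euler integral over 1 < y < 1/S; the parameter c + a of the second factor is the
  one for which no power of y is left besides the Jacobian.\<close>

lemma conv_ek:
  assumes a: "0 < a" and b: "0 < b"
  shows "conv (ek c a) (ek (c + a) b) = ek c (a + b)"
proof
  fix s
  show "conv (ek c a) (ek (c + a) b) s = ek c (a + b) s"
  proof (cases "s < 0")
    case False
    then have eq: "ek c a r * ek (c + a) b (s - r) = 0" for r by (simp add: ek_def)
    show ?thesis using False unfolding conv_def eq by (simp add: ek_def)
  next
    case True
    define S where "S = exp s"
    have S: "0 < S" "S < 1" using True by (auto simp: S_def)
    define g where "g y = (if 1 < y \<and> S * y < 1 then (y - 1) powr (a - 1) * (1 - S * y) powr (b - 1)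
        else 0)" for y
    have [measurable]: "g \<in> borel_measurable borel" unfolding g_def by measurable
    define K where "K = exp ((c + a) * s) / (Gamma a * Gamma b)"
    have F: "ek c a r * ek (c + a) b (s - r) = complex_of_real (K * (exp (- r) *\<^sub>R g (exp (- r))))" for r
    proof (cases "s < r \<and> r < 0")
      case True
      have 1: "(1 - exp r) powr (a - 1) = exp ((a - 1) * r) * (exp (- r) - 1) powr (a - 1)"
      proof -
        have "1 - exp r = exp r * (exp (- r) - 1)" by (simp add: right_diff_distrib flip: exp_add)
        then show ?thesis using True by (simp add: powr_mult exp_powr_real mult.commute)
      qed
      have "S * exp (- r) < 1" "1 < exp (- r)" using True by (auto simp: S_def simp flip: exp_add)
      moreover have 2: "exp (s - r) = S * exp (- r)" by (simp add: S_def flip: exp_add)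
      moreover have 3: "exp (c * r) * exp ((a - 1) * r) * exp ((c + a) * (s - r))
          = exp ((c + a) * s) * exp (- r)"
        by (simp add: algebra_simps flip: exp_add)
      ultimately show ?thesis using True by (simp add: ek_def g_def K_def 1 flip: of_real_mult
          of_real_divide 3)
    next
      case False
      have "\<not> (1 < exp (- r) \<and> S * exp (- r) < 1)" using False by (auto simp: S_def simp flip: exp_add)
      then have "g (exp (- r)) = 0" by (auto simp: g_def)
      moreover have "ek c a r * ek (c + a) b (s - r) = 0" using False by (auto simp: ek_def)
      ultimately show ?thesis by simp
    qed
    \<comment> \<open>The length of the interval 1 < y < 1/S; the map y = 1 + d * v carries 0 < v <
      1 onto it.\<close>
    define d where "d = 1 / S - 1"
    have d: "d > 0" using S by (simp add: d_def field_simps)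
    have g1: "g (1 + d * v) = d powr (a - 1) * (1 - S) powr (b - 1) * (if 0 < v \<and> v
        < 1 then v powr (a - 1) * (1 - v) powr (b - 1) else 0)" for v
    proof -
      have e: "1 - S * (1 + d * v) = (1 - S) * (1 - v)" using S by (simp add: d_def field_simps)
      have "S * (1 + d * v) < 1 \<longleftrightarrow> 0 < (1 - S) * (1 - v)" using e by linarith
      also have "\<dots> \<longleftrightarrow> v < 1" using S by (simp add: zero_less_mult_iff)
      finally have v1: "S * (1 + d * v) < 1 \<longleftrightarrow> v < 1" .
      have v0: "1 < 1 + d * v \<longleftrightarrow> 0 < v" using d by (simp add: zero_less_mult_iff)
      show ?thesis using d S unfolding g_def v0 v1 e by (simp add: powr_mult)
    qed
    have "conv (ek c a) (ek (c + a) b) s = complex_of_real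
        (K * (LINT r|lborel. exp (- r) *\<^sub>R g (exp (- r))))"
      unfolding conv_def F by (simp only: integral_complex_of_real integral_mult_right_zero)
    also have "(LINT r|lborel. exp (- r) *\<^sub>R g (exp (- r)))
        = (LINT y|lborel. indicator {0<..} y *\<^sub>R g y)"
      by (rule exp_substitution_neg(2)[symmetric]) measurable
    also have "\<dots> = (LINT y|lborel. g y)"
      by (intro Bochner_Integration.integral_cong) (auto simp: g_def indicator_def)
    also have "\<dots> = d * (LINT v|lborel. g (1 + d * v))"
      using d by (subst lborel_integral_real_affine[of d g 1]) auto
    also have "\<dots> = d * (d powr (a - 1) * (1 - S) powr (b - 1) * Beta a b)"
      unfolding g1 using has_bochner_integral_Beta[OF a b] by (simp add: has_bochner_integral_iff)
    also have "K * \<dots> = exp (c * s) * (1 - exp s) powr (a + b - 1) / Gamma (a + b)"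
    proof -
      have "d = (1 - S) / S" using S by (simp add: d_def field_simps)
      then have "d powr a = (1 - S) powr a / exp (a * s)" using S
          by (simp add: powr_divide S_def exp_powr_real mult.commute)
      moreover have "d * d powr (a - 1) = d powr a" using d by (simp add: powr_diff)
      ultimately have "d * d powr (a - 1) = (1 - S) powr a / exp (a * s)" by simp
      moreover have "(1 - S) powr a * (1 - S) powr (b - 1) = (1 - S) powr (a + b - 1)" using S
          by (simp add: add_diff_eq flip: powr_add)
      moreover have "exp ((c + a) * s) = exp (c * s) * exp (a * s)"
          by (simp add: algebra_simps flip: exp_add)
      ultimately show ?thesis using Gamma_real_pos[OF a] Gamma_real_pos[OF b]
        by (simp add: K_def Beta_def S_def flip: mult.assoc)
    qed
    finally show ?thesis using True by (simp add: ek_def[of c "a + b" s])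
  qed
qed

section \<open>Injectivity of the Erdelyi-Kober integrals\<close>

lemma AE_lborel_ex_between:
  fixes a b :: real
  assumes "AE t in lborel. P t" "a < b"
  shows "\<exists>t. a < t \<and> t < b \<and> P t"
proof (rule ccontr)
  assume "\<not> ?thesis"
  then have "AE t in lborel. t \<notin> {a<..<b}" using assms(1) by (auto elim!: eventually_mono)
  then have "emeasure lborel {a<..<b} = 0"
    by (subst (asm) AE_iff_measurable[where N = "{a<..<b}"]) auto
  then show False using assms(2) by simp
qed

lemma AE_lborel_reflect:
  fixes P :: "real \<Rightarrow> bool"
  assumes "AE t in lborel. P t"
  shows "AE t in lborel. P (- t)"
proof -
  obtain N where N: "{t \<in> space lborel. \<not> P t} \<subseteq> N" "emeasure lborel N = 0" "N \<in> sets lborel"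
    using assms by (rule AE_E)
  have "AE t in lborel. t \<notin> N" using N by (intro AE_not_in) auto
  moreover have "Measurable.pred borel (\<lambda>t. t \<notin> N)" using N(3) by simp
  ultimately have "AE t in lborel. 0 + -1 * t \<notin> N" by (intro AE_borel_affine) auto
  then show ?thesis by eventually_elim (use N(1) in auto)
qed

text \<open>The tails determine the integral of f against every bounded Borel weight, by
  \<open>bounded_borel_induct\<close>; the weight cnj f / |f| then yields the integral of
  |f|.\<close>

lemma integrable_eq_0_if_tails:
  fixes f :: "real \<Rightarrow> complex"
  assumes f: "integrable lborel f" and tail: "\<And>a. (LINT s|lborel. indicator {a<..} s *\<^sub>R f s) = 0"
  shows "AE s in lborel. f s = 0"
proof -
  have [measurable]: "f \<in> borel_measurable borel" using f by auto
  have all: "(LINT s|lborel. f s) = 0"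
  proof (rule LIMSEQ_unique)
    show "(\<lambda>n. LINT s|lborel. indicator {- real n<..} s *\<^sub>R f s) \<longlonglongrightarrow> (LINT s|lborel. f s)"
    proof (rule integral_dominated_convergence[where w = "\<lambda>s. cmod (f s)"])
      show "AE s in lborel. (\<lambda>n. indicator {- real n<..} s *\<^sub>R f s) \<longlonglongrightarrow> f s"
      proof (rule AE_I2)
        fix s :: real
        obtain N where "\<bar>s\<bar> < real N" using reals_Archimedean2 by blast
        then have "\<forall>\<^sub>F n in sequentially. indicator {- real n<..} s *\<^sub>R f s = f s"
          by (intro eventually_sequentiallyI[of N]) (auto simp: indicator_def)
        then show "(\<lambda>n. indicator {- real n<..} s *\<^sub>R f s) \<longlonglongrightarrow> f s" by (rule tendsto_eventually)
      qed
    qed (use f in \<open>auto simp: indicator_def\<close>)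
    show "(\<lambda>n. LINT s|lborel. indicator {- real n<..} s *\<^sub>R f s) \<longlonglongrightarrow> 0" unfolding tail by simp
  qed
  have P: "integrable lborel (\<lambda>s. w s *\<^sub>R f s) \<and> (LINT s|lborel. w s *\<^sub>R f s) = 0"
    if w: "w \<in> borel_measurable borel" "\<And>x. \<bar>w x\<bar> \<le> 1" for w :: "real \<Rightarrow> real"
    using w
  proof (rule bounded_borel_induct)
    show "integrable lborel (\<lambda>s. 1 *\<^sub>R f s) \<and> (LINT s|lborel. 1 *\<^sub>R f s) = 0" using f all by simp
    show "integrable lborel (\<lambda>s. indicator {a<..} s *\<^sub>R f s)
        \<and> (LINT s|lborel. indicator {a<..} s *\<^sub>R f s) = 0" for a
      using f tail by (auto intro!: integrable_mult_indicator)
  next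
    fix u v :: "real \<Rightarrow> real" and c d
    assume "integrable lborel (\<lambda>s. u s *\<^sub>R f s) \<and> (LINT s|lborel. u s *\<^sub>R f s) = 0"
      "integrable lborel (\<lambda>s. v s *\<^sub>R f s) \<and> (LINT s|lborel. v s *\<^sub>R f s) = 0"
    then have "has_bochner_integral lborel (\<lambda>s. c *\<^sub>R (u s *\<^sub>R f s) + d *\<^sub>R (v s *\<^sub>R f s))
        (c *\<^sub>R 0 + d *\<^sub>R 0)"
      by (intro has_bochner_integral_add has_bochner_integral_scaleR_right)
          (auto simp: has_bochner_integral_iff)
    then show "integrable lborel (\<lambda>s. (c * u s + d * v s) *\<^sub>R f s)
        \<and> (LINT s|lborel. (c * u s + d * v s) *\<^sub>R f s) = 0"
      by (simp add: has_bochner_integral_iff scaleR_add_left)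
  next
    fix U :: "nat \<Rightarrow> real \<Rightarrow> real" and u :: "real \<Rightarrow> real" and C
    assume [measurable]: "\<And>i. U i \<in> borel_measurable borel"
      and U: "\<And>i. integrable lborel (\<lambda>s. U i s *\<^sub>R f s) \<and> (LINT s|lborel. U i s *\<^sub>R f s) = 0"
      and bd: "\<And>i x. \<bar>U i x\<bar> \<le> C" and l: "\<And>x. (\<lambda>i. U i x) \<longlonglongrightarrow> u x"
    have [measurable]: "u \<in> borel_measurable borel" using l
        by (intro borel_measurable_LIMSEQ_real[of borel U u]) auto
    have w: "integrable lborel (\<lambda>s. C * cmod (f s))" using f by simp
    have ae: "AE s in lborel. (\<lambda>i. U i s *\<^sub>R f s) \<longlonglongrightarrow> u s *\<^sub>R f s"
      using l by (auto intro!: tendsto_intros)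
    have b: "AE s in lborel. norm (U i s *\<^sub>R f s) \<le> C * cmod (f s)" for i
      using bd by (auto intro!: mult_right_mono)
    have "integrable lborel (\<lambda>s. u s *\<^sub>R f s)"
      by (rule integrable_dominated_convergence[OF _ _ w ae b]) measurable
    moreover have "(\<lambda>i. LINT s|lborel. U i s *\<^sub>R f s) \<longlonglongrightarrow> (LINT s|lborel. u s *\<^sub>R f s)"
      by (rule integral_dominated_convergence[OF _ _ w ae b]) measurable
    then have "(LINT s|lborel. u s *\<^sub>R f s) = 0" using U by (simp add: LIMSEQ_const_iff)
    ultimately show "integrable lborel (\<lambda>s. u s *\<^sub>R f s) \<and> (LINT s|lborel. u s *\<^sub>R f s) = 0" by simp
  qed
  \<comment> \<open>\<open>w1\<close> and \<open>w2\<close> are the real and imaginary part of cnj f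
    / |f|, with value 0 where f vanishes.\<close>
  define w1 where "w1 s = Re (f s) / cmod (f s)" for s
  define w2 where "w2 s = - Im (f s) / cmod (f s)" for s
  have [measurable]: "w1 \<in> borel_measurable borel" "w2 \<in> borel_measurable borel" unfolding w1_def w2_def
      by measurable
  have b: "\<bar>w1 s\<bar> \<le> 1" "\<bar>w2 s\<bar> \<le> 1" for s
    using abs_Re_le_cmod[of "f s"] abs_Im_le_cmod[of "f s"] by (auto simp: w1_def w2_def divide_le_eq_1)
  have "has_bochner_integral lborel (\<lambda>s. w1 s *\<^sub>R f s + \<i> * (w2 s *\<^sub>R f s)) (0 + \<i> * 0)"
    using P[of w1] P[of w2] b
    by (intro has_bochner_integral_add has_bochner_integral_mult_right)
        (auto simp: has_bochner_integral_iff)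
  moreover have "w1 s *\<^sub>R f s + \<i> * (w2 s *\<^sub>R f s) = complex_of_real (cmod (f s))" for s
  proof (cases "f s = 0")
    case False
    have "w1 s *\<^sub>R f s + \<i> * (w2 s *\<^sub>R f s) = cnj (f s) * f s / complex_of_real (cmod (f s))"
      using False by (simp add: w1_def w2_def complex_eq_iff field_simps)
    also have "\<dots> = complex_of_real (cmod (f s))"
      using False by (simp add: complex_norm_square[symmetric] mult.commute power2_eq_square)
    finally show ?thesis .
  qed simp
  ultimately have "(LINT s|lborel. complex_of_real (cmod (f s))) = 0"
      by (simp add: has_bochner_integral_iff)
  then have "(LINT s|lborel. cmod (f s)) = 0" by simp
  then show ?thesis using f by (subst (asm) integral_nonneg_eq_0_iff_AE) auto
qed

text \<open>With s = exp (- r) * t an integral of order one becomes a weighted tail integral, the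
  form to which \<open>integrable_eq_0_if_tails\<close> applies.\<close>

lemma dil_op_ek1:
  fixes j t :: real
  assumes [measurable]: "h \<in> borel_measurable borel" and t: "0 < t"
  shows "integrable lborel (\<lambda>r. ek j 1 r * h (exp (- r) * t))
      \<longleftrightarrow> integrable lborel (\<lambda>s. indicator {t<..} s *\<^sub>R (s powr (- j - 1) *\<^sub>R h s))"
    and "dil_op (ek j 1) h t = t powr j *\<^sub>R (LINT s|lborel. indicator {t<..} s *\<^sub>R
        (s powr (- j - 1) *\<^sub>R h s))"
proof -
  define g where "g u = indicator {1<..} u *\<^sub>R (u powr (- j - 1) *\<^sub>R h (u * t))" for u :: real
  have [measurable]: "g \<in> borel_measurable borel" unfolding g_def by measurable
  have g0: "indicator {0<..} u *\<^sub>R g u = g u" for u by (auto simp: g_def indicator_def)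
  have e: "exp (- r) *\<^sub>R g (exp (- r)) = ek j 1 r * h (exp (- r) * t)" for r
  proof -
    have "exp (- r) * exp (- r) powr (- j - 1) = exp (j * r)"
        by (simp add: exp_powr_real algebra_simps flip: exp_add)
    then show ?thesis by (auto simp: g_def ek_def indicator_def scaleR_conv_of_real simp
        flip: mult.assoc of_real_mult)
  qed
  define G where "G s = indicator {t<..} s *\<^sub>R (s powr (- j - 1) *\<^sub>R h s)" for s
  have gG: "g u = t powr (j + 1) *\<^sub>R G (t * u)" for u
  proof (cases "u > 1")
    case True
    then have "t powr (j + 1) * (t * u) powr (- j - 1) = u powr (- j - 1)"
      using t by (simp add: powr_mult flip: powr_add mult.assoc)
    then show ?thesis using True t by (simp add: g_def G_def mult.commute)
  next
    case False then show ?thesis using t by (simp add: g_def G_def)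
  qed
  have "integrable lborel (\<lambda>r. ek j 1 r * h (exp (- r) * t)) \<longleftrightarrow> integrable lborel g"
    using exp_substitution_neg(1)[of g] unfolding g0 e by simp
  also have "\<dots> \<longleftrightarrow> integrable lborel (\<lambda>u. G (t * u))" 
  proof
    assume "integrable lborel g"
    then have "integrable lborel (\<lambda>u. (1 / t powr (j + 1)) *\<^sub>R g u)" by (intro integrable_scaleR_right)
    then show "integrable lborel (\<lambda>u. G (t * u))" unfolding gG using t by simp
  next
    assume "integrable lborel (\<lambda>u. G (t * u))"
    then have "integrable lborel (\<lambda>u. t powr (j + 1) *\<^sub>R G (t * u))" by (intro integrable_scaleR_right)
    then show "integrable lborel g" by (simp flip: gG)
  qed
  also have "\<dots> \<longleftrightarrow> integrable lborel G"
    using lborel_integrable_real_affine_iff[of t G 0] t by simp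
  finally show "integrable lborel (\<lambda>r. ek j 1 r * h (exp (- r) * t))
      \<longleftrightarrow> integrable lborel (\<lambda>s. indicator {t<..} s *\<^sub>R (s powr (- j - 1) *\<^sub>R h s))"
    unfolding G_def .
  have "dil_op (ek j 1) h t = (LINT u|lborel. g u)"
    using exp_substitution_neg(2)[of g] unfolding g0 e dil_op_def by simp
  also have "\<dots> = t powr (j + 1) *\<^sub>R ((1 / t) *\<^sub>R (LINT s|lborel. G s))"
    unfolding gG by (simp add: lborel_integral_scale[OF t, of G])
  also have "\<dots> = t powr j *\<^sub>R (LINT s|lborel. G s)" using t by (simp add: powr_add)
  finally show "dil_op (ek j 1) h t = t powr j *\<^sub>R (LINT s|lborel. indicator {t<..} s *\<^sub>R
      (s powr (- j - 1) *\<^sub>R h s))"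
    unfolding G_def .
qed

text \<open>The tail integrals of s^(- j - 1) h s vanish for almost every t > 0, hence, by
  continuity in t, for every t > 0.\<close>

lemma ek1_injective_pos:
  assumes p: "1 \<le> p" and j: "0 \<le> j" and h: "h \<in> Lp p" and z: "AE t in lborel. dil_op (ek j 1) h t = 0"
  shows "AE t in lborel. 0 < t \<longrightarrow> h t = 0"
proof -
  note [measurable] = LpD(1)[OF h]
  define f where "f s = s powr (- j - 1) *\<^sub>R h s" for s
  have [measurable]: "f \<in> borel_measurable borel" unfolding f_def by measurable
  define good where "good t \<longleftrightarrow> integrable lborel (\<lambda>s. indicator {t<..} s *\<^sub>R f s)
      \<and> (LINT s|lborel. indicator {t<..} s *\<^sub>R f s) = 0" for t
  have good: "AE t in lborel. 0 < t \<longrightarrow> good t"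
    using z dil_op_bound(1)[OF p kernel_ek[OF p j zero_less_one] h]
  proof eventually_elim
    case (elim t)
    show ?case using elim dil_op_ek1[of h t j] by (auto simp: good_def f_def)
  qed
  have all: "good a" if a: "0 < a" for a
  proof -
    obtain t0 where t0: "a / 2 < t0" "t0 < a" "0 < t0 \<longrightarrow> good t0"
        using AE_lborel_ex_between[OF good, of "a / 2" a] a by auto
    then have i0: "integrable lborel (\<lambda>s. indicator {t0<..} s *\<^sub>R f s)" using a by (simp add: good_def)
    have "\<exists>t. a < t \<and> t < a + 1 / real (Suc n) \<and> (0 < t \<longrightarrow> good t)" for n
      by (rule AE_lborel_ex_between[OF good]) simp
    then obtain X where X: "\<And>n. a < X n" "\<And>n. X n < a + 1 / real (Suc n)" "\<And>n. 0 < X n \<longrightarrow> good (X n)"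
        by metis
    have Xl: "X \<longlonglongrightarrow> a"
    proof (rule tendsto_sandwich[where f = "\<lambda>_. a" and h = "\<lambda>n. a + 1 / real (Suc n)"])
      show "(\<lambda>n. a + 1 / real (Suc n)) \<longlonglongrightarrow> a" by real_asymp
      show "\<forall>\<^sub>F n in sequentially. a \<le> X n" "\<forall>\<^sub>F n in sequentially. X n \<le> a + 1 / real (Suc n)"
        using X(1,2) by (auto intro!: always_eventually less_imp_le simp del: of_nat_Suc)
    qed simp
    have ae: "AE s in lborel. (\<lambda>n. indicator {X n<..} s *\<^sub>R f s) \<longlonglongrightarrow> indicator {a<..} s *\<^sub>R f s"
    proof (rule AE_I2)
      fix s
      show "(\<lambda>n. indicator {X n<..} s *\<^sub>R f s) \<longlonglongrightarrow> indicator {a<..} s *\<^sub>R f s"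
      proof (cases "a < s")
        case True
        have "\<forall>\<^sub>F n in sequentially. indicator {X n<..} s *\<^sub>R f s = indicator {a<..} s *\<^sub>R f s"
          using order_tendstoD(2)[OF Xl True] by eventually_elim (use True in auto)
        then show ?thesis by (rule tendsto_eventually)
      next
        case False
        then have "indicator {X n<..} s *\<^sub>R f s = 0" for n using X(1)[of n] by (simp add: indicator_def)
        then have "(\<lambda>n. indicator {X n<..} s *\<^sub>R f s) = (\<lambda>n. 0)" by (simp only:)
        then show ?thesis using False by simp
      qed
    qed
    have w: "integrable lborel (\<lambda>s. norm (indicator {t0<..} s *\<^sub>R f s))" using i0
        by (rule integrable_norm)
    have b: "AE s in lborel. norm (indicator {X n<..} s *\<^sub>R f s)
        \<le> norm (indicator {t0<..} s *\<^sub>R f s)" for n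
      using t0 X(1)[of n] by (auto simp: indicator_def)
    have "(\<lambda>n. LINT s|lborel. indicator {X n<..} s *\<^sub>R f s) \<longlonglongrightarrow>
        (LINT s|lborel. indicator {a<..} s *\<^sub>R f s)"
      by (rule integral_dominated_convergence[OF _ _ w ae b]) measurable
    moreover have "(LINT s|lborel. indicator {X n<..} s *\<^sub>R f s) = 0" for n
      using X(1,3)[of n] a by (simp add: good_def)
    ultimately have "(LINT s|lborel. indicator {a<..} s *\<^sub>R f s) = 0" by (simp add: LIMSEQ_const_iff)
    moreover have "integrable lborel (\<lambda>s. indicator {a<..} s *\<^sub>R f s)"
      by (rule integrable_dominated_convergence[OF _ _ w ae b]) measurable
    ultimately show ?thesis by (simp add: good_def)
  qed
  \<comment> \<open>Integrability is known only on rays away from 0, so the half-line is exhausted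
    by the rays above 1 / Suc n.\<close>
  have "AE s in lborel. \<forall>n. indicator {1 / real (Suc n)<..} s *\<^sub>R f s = 0"
  proof (subst AE_all_countable, intro allI integrable_eq_0_if_tails)
    fix n
    have d: "0 < 1 / real (Suc n)" by simp
    show "integrable lborel (\<lambda>s. indicator {1 / real (Suc n)<..} s *\<^sub>R f s)" using all[OF d]
        by (simp add: good_def)
    fix a
    have "indicator {a<..} s *\<^sub>R (indicator {1 / real (Suc n)<..} s *\<^sub>R f s)
        = indicator {max a (1 / real (Suc n))<..} s *\<^sub>R f s" for s
      by (auto simp: indicator_def)
    moreover have "good (max a (1 / real (Suc n)))" using d
        by (intro all) (simp only: less_max_iff_disj simp_thms)
    ultimately show "(LINT s|lborel. indicator {a<..} s *\<^sub>R (indicator {1 / real (Suc n)<..} s *\<^sub>R f s))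
        = 0"
      by (simp only: good_def)
  qed
  then show ?thesis
  proof eventually_elim
    case (elim s)
    show ?case
    proof
      assume s: "0 < s"
      then obtain n where "1 / real (Suc n) < s" using reals_Archimedean[of s]
          by (auto simp: inverse_eq_divide)
      then have "f s = 0" using elim[rule_format, of n] by simp
      then show "h s = 0" using s by (simp add: f_def)
    qed
  qed
qed

lemma dil_op_reflect: "dil_op k (\<lambda>s. f (- s)) t = dil_op k f (- t)"
  by (simp add: dil_op_def)

lemma Lp_reflect: "f \<in> Lp p \<Longrightarrow> (\<lambda>s. f (- s)) \<in> Lp p"
  using lborel_integrable_reflect[of "\<lambda>t. cmod (f t) powr p" 0] by (auto simp: Lp_def)

lemma ek1_injective:
  assumes p: "1 \<le> p" and j: "0 \<le> j" and h: "h \<in> Lp p" and z: "AE t in lborel. dil_op (ek j 1) h t = 0"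
  shows "AE t in lborel. h t = 0"
proof -
  have "AE t in lborel. dil_op (ek j 1) (\<lambda>s. h (- s)) t = 0"
    unfolding dil_op_reflect using AE_lborel_reflect[OF z] .
  from AE_lborel_reflect[OF ek1_injective_pos[OF p j Lp_reflect[OF h] this]]
  have "AE t in lborel. 0 < - t \<longrightarrow> h t = 0" by simp
  moreover have "AE t in lborel. (t :: real) \<noteq> 0" by (rule AE_lborel_singleton)
  ultimately show ?thesis using ek1_injective_pos[OF p j h z]
      by eventually_elim (metis linorder_neqE_linordered_idom neg_0_less_iff_less)
qed

text \<open>The composition law peels off one integral of order one at a time.\<close>

lemma ek_nat_injective:
  assumes p: "1 \<le> p" and h: "h \<in> Lp p" and z: "AE t in lborel. dil_op (ek 0 (real (Suc n))) h t = 0"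
  shows "AE t in lborel. h t = 0"
  using h z
proof (induction n arbitrary: h)
  case 0 then show ?case using ek1_injective[OF p, of 0 h] by simp
next
  case (Suc n)
  have k: "kernel p (ek 0 (real (Suc n)))" "kernel p (ek (real (Suc n)) 1)" using p
      by (auto intro!: kernel_ek)
  have c: "conv (ek 0 (real (Suc n))) (ek (real (Suc n)) 1) = ek 0 (real (Suc (Suc n)))"
    using conv_ek[of "real (Suc n)" 1 0] by (simp add: add.commute)
  have "AE t in lborel. dil_op (ek 0 (real (Suc n))) (dil_op (ek (real (Suc n)) 1) h) t = 0"
    using dil_op_comp[OF p k Suc(2)] Suc(3) unfolding c by eventually_elim simp
  from Suc.IH[OF dil_op_bound(2)[OF p k(2) Suc(2)] this]
  show ?case by (intro ek1_injective[OF p _ Suc(2)]) auto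
qed

text \<open>Composing with the integral of the complementary order \<open>Suc n - a\<close> leads to
  an integer order.\<close>

lemma ek_injective:
  assumes p: "1 \<le> p" and a: "0 < a" and h: "h \<in> Lp p" and z: "AE t in lborel. dil_op (ek 0 a) h t = 0"
  shows "AE t in lborel. h t = 0"
proof -
  obtain n where n: "a < real (Suc n)" using reals_Archimedean2[of a] less_trans[of a _ "real (Suc _)"]
      by (metis lessI of_nat_less_iff)
  have k: "kernel p (ek 0 a)" "kernel p (ek a (real (Suc n) - a))" using p a n
      by (auto intro!: kernel_ek)
  have c: "conv (ek 0 a) (ek a (real (Suc n) - a)) = ek 0 (real (Suc n))"
    using conv_ek[of a "real (Suc n) - a" 0] a n by simp
  have "AE t in lborel. dil_op (ek a (real (Suc n) - a)) (dil_op (ek 0 a) h) t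
      = dil_op (ek a (real (Suc n) - a)) (\<lambda>_. 0) t"
    by (rule dil_op_cong_AE[OF p k(2) dil_op_bound(2)[OF p k(1) h] Lp_zero z])
  then have "AE t in lborel. dil_op (ek 0 (real (Suc n))) h t = 0"
    using dil_op_comp[OF p k(2,1) h] unfolding conv_commute[of "ek a _"] c
    by eventually_elim (simp add: dil_op_def)
  then show ?thesis by (rule ek_nat_injective[OF p h])
qed

section \<open>The Weyl derivative of a Schwartz function\<close>

lemma nth_deriv_0[simp]: "nth_deriv 0 f = f"
  by (simp add: nth_deriv_def)

lemma nth_deriv_Suc: "nth_deriv (Suc n) f = (\<lambda>x. vector_derivative (nth_deriv n f) (at x))"
  by (simp add: nth_deriv_def)

lemma nth_deriv_eqI:
  assumes "\<And>n x. (G n has_vector_derivative G (Suc n) x) (at x)"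
  shows "nth_deriv n (G 0) = G n"
proof (induction n)
  case (Suc n)
  show ?case unfolding nth_deriv_Suc Suc using vector_derivative_at[OF assms] by (rule ext)
qed simp

lemma reflect_derivatives:
  fixes G :: "nat \<Rightarrow> real \<Rightarrow> complex"
  assumes G: "\<And>n x. (G n has_vector_derivative G (Suc n) x) (at x)"
  shows "((\<lambda>x. (- 1) ^ n * G n (- x)) has_vector_derivative (- 1) ^ Suc n * G (Suc n) (- x)) (at x)"
proof -
  have "((\<lambda>x. G n (- x)) has_vector_derivative (- 1) *\<^sub>R G (Suc n) (- x)) (at x)"
    using vector_diff_chain_at[of uminus "- 1" x "G n" "G (Suc n) (- x)"] G[of n "- x"]
      has_vector_derivative_minus[OF has_vector_derivative_id, of "at x"]
    by (simp add: o_def)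
  from has_vector_derivative_mult_right[OF this, of "(- 1) ^ n"]
  show ?thesis by simp
qed

lemma schwartzI:
  assumes d: "\<And>n x. (G n has_vector_derivative G (Suc n) x) (at x)"
    and b: "\<And>k n. \<exists>C. \<forall>x. \<bar>x\<bar> ^ k * cmod (G n x) \<le> C"
  shows "G 0 \<in> schwartz"
  unfolding schwartz_def mem_Collect_eq nth_deriv_eqI[of G, OF d]
  using d b by (auto intro: differentiableI_vector)

lemma schwartz_derivative:
  assumes "F \<in> schwartz"
  shows "(nth_deriv n F has_vector_derivative nth_deriv (Suc n) F x) (at x)"
  using assms unfolding nth_deriv_Suc schwartz_def by (auto simp: vector_derivative_works[symmetric])

lemma schwartz_isCont: "F \<in> schwartz \<Longrightarrow> isCont (nth_deriv n F) x"
  using schwartz_derivative by (rule has_vector_derivative_continuous)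

lemma schwartz_measurable: "F \<in> schwartz \<Longrightarrow> nth_deriv n F \<in> borel_measurable borel"
  using schwartz_isCont by (rule isCont_measurable)

lemma schwartz_measurable0: "F \<in> schwartz \<Longrightarrow> F \<in> borel_measurable borel"
  using schwartz_measurable[of F 0] by simp

lemma schwartz_bound:
  assumes "F \<in> schwartz"
  obtains C where "0 \<le> C" "\<And>x. \<bar>x\<bar> ^ k * cmod (nth_deriv n F x) \<le> C / (1 + x\<^sup>2)"
proof -
  obtain C0 C2 where C: "\<And>x. \<bar>x\<bar> ^ k * cmod (nth_deriv n F x)
      \<le> C0" "\<And>x. \<bar>x\<bar> ^ (k + 2) * cmod (nth_deriv n F x) \<le> C2"
    using assms unfolding schwartz_def mem_Collect_eq by metis
  have "\<bar>x\<bar> ^ k * cmod (nth_deriv n F x) \<le> (C0 + C2) / (1 + x\<^sup>2)" for x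
  proof -
    have "(1 + x\<^sup>2) * (\<bar>x\<bar> ^ k * cmod (nth_deriv n F x))
        = \<bar>x\<bar> ^ k * cmod (nth_deriv n F x) + \<bar>x\<bar> ^ (k + 2) * cmod (nth_deriv n F x)"
      by (simp add: algebra_simps power_add power2_eq_square)
    also have "\<dots> \<le> C0 + C2" using C[of x] by simp
    finally show ?thesis by (simp add: field_simps add_pos_nonneg)
  qed
  moreover have "0 \<le> C0" "0 \<le> C2" using order_trans[OF _ C(1)[of 0]] order_trans[OF _ C(2)[of 0]] by auto
  ultimately show ?thesis using that[of "C0 + C2"] by auto
qed

lemma Lp_if_inverse_square_bound:
  assumes p: "1 \<le> p" and [measurable]: "f \<in> borel_measurable borel"
      and C: "0 \<le> C" "\<And>x. cmod (f x) \<le> C / (1 + x\<^sup>2)"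
  shows "f \<in> Lp p"
proof (rule Lp_bound)
  show "integrable lborel (\<lambda>x. (C / (1 + x\<^sup>2)) powr p)"
  proof (rule Bochner_Integration.integrable_bound)
    show "integrable lborel (\<lambda>x::real. C powr p * (1 / (1 + x\<^sup>2)))" using integrable_inverse_square
        by (rule integrable_mult_right)
    have "(1 / (1 + x\<^sup>2)) powr p \<le> (1 / (1 + x\<^sup>2)) powr 1" for x :: real
      using p by (intro powr_mono') (auto simp: add_pos_nonneg)
    then have "(C / (1 + x\<^sup>2)) powr p \<le> C powr p * (1 / (1 + x\<^sup>2))" for x :: real
      using C(1) mult_left_mono[of "(1 / (1 + x\<^sup>2)) powr p" "1 / (1 + x\<^sup>2)" "C powr p"]
      by (simp add: powr_divide add_pos_nonneg)
    then show "AE x in lborel. norm ((C / (1 + x\<^sup>2)) powr p) \<le> norm (C powr p * (1 / (1 + x\<^sup>2)))"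
      using C(1) by (auto intro!: AE_I2 order_trans[OF _ abs_ge_self])
  qed measurable
qed (use p C in auto)

lemma schwartz_Lp:
  assumes p: "1 \<le> p" and F: "F \<in> schwartz"
  shows "(\<lambda>x. complex_of_real ((- x) ^ k) * nth_deriv n F x) \<in> Lp p"
proof -
  note [measurable] = schwartz_measurable[OF F]
  obtain C where C: "0 \<le> C" "\<And>x. \<bar>x\<bar> ^ k * cmod (nth_deriv n F x) \<le> C / (1 + x\<^sup>2)"
      using schwartz_bound[OF F] by blast
  show ?thesis
    by (rule Lp_if_inverse_square_bound[OF p _ C(1)]) (use C
        in \<open>auto simp: norm_mult power_abs norm_power\<close>)
qed

lemma schwartz_Lp0: "1 \<le> p \<Longrightarrow> F \<in> schwartz \<Longrightarrow> F \<in> Lp p"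
  using schwartz_Lp[of p F 0 0] by simp

lemma schwartz_lincomb:
  assumes F: "F \<in> schwartz" and H: "H \<in> schwartz"
  shows "(\<lambda>x. a * F x + b * H x) \<in> schwartz" "nth_deriv n (\<lambda>x. a * F x + b * H x)
      = (\<lambda>x. a * nth_deriv n F x + b * nth_deriv n H x)"
proof -
  define G where "G n x = a * nth_deriv n F x + b * nth_deriv n H x" for n x
  have d: "(G n has_vector_derivative G (Suc n) x) (at x)" for n x
    unfolding G_def by (intro has_vector_derivative_add has_vector_derivative_mult_right
        schwartz_derivative F H)
  have "\<exists>C. \<forall>x. \<bar>x\<bar> ^ k * cmod (G n x) \<le> C" for k n
  proof -
    obtain C1 C2 where C: "\<And>x. \<bar>x\<bar> ^ k * cmod (nth_deriv n F x)
        \<le> C1" "\<And>x. \<bar>x\<bar> ^ k * cmod (nth_deriv n H x) \<le> C2"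
      using F H unfolding schwartz_def by blast
    have "\<bar>x\<bar> ^ k * cmod (G n x) \<le> cmod a * C1 + cmod b * C2" for x
    proof -
      have "\<bar>x\<bar> ^ k * cmod (G n x) \<le> \<bar>x\<bar> ^ k * (cmod a * cmod (nth_deriv n F x) + cmod b * cmod
          (nth_deriv n H x))"
        unfolding G_def using norm_triangle_ineq[of "a * nth_deriv n F x" "b * nth_deriv n H x"]
        by (intro mult_left_mono) (auto simp: norm_mult)
      also have "\<dots> = cmod a * (\<bar>x\<bar> ^ k * cmod (nth_deriv n F x)) + cmod b *
          (\<bar>x\<bar> ^ k * cmod (nth_deriv n H x))"
        by (simp add: algebra_simps)
      also have "\<dots> \<le> cmod a * C1 + cmod b * C2" using C by (intro add_mono mult_left_mono) auto
      finally show ?thesis .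
    qed
    then show ?thesis by blast
  qed
  from schwartzI[of G, OF d this] nth_deriv_eqI[of G, OF d]
  show "(\<lambda>x. a * F x + b * H x) \<in> schwartz" "nth_deriv n (\<lambda>x. a * F x + b * H x)
      = (\<lambda>x. a * nth_deriv n F x + b * nth_deriv n H x)"
    by (simp_all add: G_def[abs_def])
qed

lemma schwartz_reflect:
  assumes F: "F \<in> schwartz"
  shows "(\<lambda>x. F (- x)) \<in> schwartz" "nth_deriv n (\<lambda>x. F (- x)) = (\<lambda>x. (- 1) ^ n * nth_deriv n F (- x))"
proof -
  define G where "G n x = (- 1) ^ n * nth_deriv n F (- x)" for n x
  have d: "(G n has_vector_derivative G (Suc n) x) (at x)" for n x
    unfolding G_def by (rule reflect_derivatives[of "\<lambda>n. nth_deriv n F", OF schwartz_derivative[OF F]])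
  have "\<exists>C. \<forall>x. \<bar>x\<bar> ^ k * cmod (G n x) \<le> C" for k n
  proof -
    obtain C where C: "\<And>x. \<bar>x\<bar> ^ k * cmod (nth_deriv n F x) \<le> C"
      using F unfolding schwartz_def by blast
    have "\<bar>x\<bar> ^ k * cmod (G n x) \<le> C" for x
      using C[of "- x"] by (simp add: G_def norm_mult norm_power)
    then show ?thesis by blast
  qed
  from schwartzI[of G, OF d this] nth_deriv_eqI[of G, OF d]
  show "(\<lambda>x. F (- x)) \<in> schwartz" "nth_deriv n (\<lambda>x. F (- x)) = (\<lambda>x. (- 1) ^ n * nth_deriv n F (- x))"
    by (simp_all add: G_def[abs_def])
qed

text \<open>Up to a factor 2 the integrand is below s^(b - 1) / (1 + s)^2, which in the variable ln
  s is \<open>phi_kernel b 2\<close>.\<close>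

lemma integrable_power_inverse_square:
  assumes b: "0 < b" "b \<le> 1"
  shows "integrable lborel (\<lambda>s::real. indicator {0<..} s *\<^sub>R (s powr (b - 1) * (1 / (1 + s\<^sup>2))))"
proof -
  define g where "g s = s powr (b - 1) / (1 + s) powr 2" for s :: real
  have [measurable]: "g \<in> borel_measurable borel" unfolding g_def by measurable
  have e: "exp r *\<^sub>R g (exp r) = phi_kernel b 2 r" for r
    by (simp add: g_def phi_kernel_def exp_powr_real algebra_simps flip: exp_add)
  obtain k1 k2 where "smooth_exp_decays (\<lambda>r. complex_of_real (phi_kernel b 2 r)) k1 k2"
    using phi_kernel_smooth_exp_decays[of b 2] b by auto
  then have "integrable lborel (\<lambda>r. complex_of_real (phi_kernel b 2 r))" by (rule smooth_exp_decaysD)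
  then have "integrable lborel (phi_kernel b 2)" by (simp add: complex_of_real_integrable_eq)
  then have "integrable lborel (\<lambda>s. indicator {0<..} s *\<^sub>R g s)"
    using exp_substitution(1)[of g] unfolding e by simp
  then have "integrable lborel (\<lambda>s. 2 * (indicator {0<..} s *\<^sub>R g s))" by (rule integrable_mult_right)
  then show ?thesis
  proof (rule Bochner_Integration.integrable_bound)
    have "s powr (b - 1) * (1 / (1 + s\<^sup>2)) \<le> 2 * g s" if s: "0 < s" for s :: real
    proof -
      have "(1 + s)\<^sup>2 \<le> 2 * (1 + s\<^sup>2)" using zero_le_power2[of "1 - s"]
          by (simp add: power2_eq_square algebra_simps)
      then have "1 / (1 + s\<^sup>2) \<le> 2 / (1 + s)\<^sup>2" using s by (simp add: field_simps add_pos_nonneg)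
      from mult_left_mono[OF this, of "s powr (b - 1)"] show ?thesis using s
          by (simp add: g_def mult.commute)
    qed
    then show "AE s in lborel. norm (indicator {0<..} s *\<^sub>R (s powr (b - 1) * (1 / (1 + s\<^sup>2))))
        \<le> norm (2 * (indicator {0<..} s *\<^sub>R g s))"
      by (auto simp: indicator_def g_def)
  qed measurable
qed

text \<open>Peetre's inequality for the exponent 2: all translates with |y| \<le> M share one
  majorant.\<close>

lemma one_plus_square_shift:
  fixes s y M :: real
  assumes "\<bar>y\<bar> \<le> M"
  shows "1 / (1 + (s + y)\<^sup>2) \<le> 2 * (1 + M\<^sup>2) / (1 + s\<^sup>2)"
proof -
  have "s\<^sup>2 \<le> 2 * (s + y)\<^sup>2 + 2 * y\<^sup>2" using zero_le_power2[of "s + 2 * y"]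
      by (simp add: power2_eq_square algebra_simps)
  moreover have "y\<^sup>2 \<le> M\<^sup>2" using assms by (metis abs_ge_zero power2_abs power_mono)
  moreover have "0 \<le> M\<^sup>2 * (s + y)\<^sup>2" by simp
  moreover have "2 * (1 + M\<^sup>2) * (1 + A) = 2 + 2 * A + 2 * M\<^sup>2 + 2 * (M\<^sup>2 * A)" for A :: real
      by (simp add: algebra_simps)
  moreover have "0 \<le> (s + y)\<^sup>2" by simp
  ultimately have "1 + s\<^sup>2 \<le> 2 * (1 + M\<^sup>2) * (1 + (s + y)\<^sup>2)" by (smt (verit))
  then show ?thesis by (simp add: field_simps add_pos_nonneg)
qed

text \<open>The Weyl integral of order b without its Gamma factor, shifted so that y stands in the
  argument of F and derivatives in y fall on F.\<close>

definition frac_int :: "real \<Rightarrow> (real \<Rightarrow> complex) \<Rightarrow> real \<Rightarrow> complex" where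
  "frac_int b F y = (LINT s|lborel. indicator {0<..} s *\<^sub>R (s powr (b - 1) *\<^sub>R F (s + y)))"

lemma frac_int_integrable:
  assumes b: "0 < b" "b \<le> 1" and F: "F \<in> schwartz"
  shows "integrable lborel (\<lambda>s. indicator {0<..} s *\<^sub>R (s powr (b - 1) *\<^sub>R nth_deriv n F (s + y)))"
    and "\<exists>C. \<forall>s y'. \<bar>y'\<bar> \<le> M \<longrightarrow> cmod (indicator {0<..} s *\<^sub>R (s powr (b - 1) *\<^sub>R nth_deriv n F (s + y')))
        \<le> C * (indicator {0<..} s *\<^sub>R (s powr (b - 1) * (1 / (1 + s\<^sup>2))))"
proof -
  note [measurable] = schwartz_measurable[OF F]
  have bd: "\<exists>C. \<forall>s y'. \<bar>y'\<bar> \<le> M \<longrightarrow> cmod (indicator {0<..} s *\<^sub>R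
      (s powr (b - 1) *\<^sub>R nth_deriv n F (s + y'))) \<le> C *
      (indicator {0<..} s *\<^sub>R (s powr (b - 1) * (1 / (1 + s\<^sup>2))))" for M
  proof -
    obtain C where C: "0 \<le> C" "\<And>x. \<bar>x\<bar> ^ 0 * cmod (nth_deriv n F x) \<le> C / (1 + x\<^sup>2)"
        using schwartz_bound[OF F] by blast
    have "cmod (indicator {0<..} s *\<^sub>R (s powr (b - 1) *\<^sub>R nth_deriv n F (s + y')))
        \<le> (C * (2 * (1 + M\<^sup>2))) * (indicator {0<..} s *\<^sub>R (s powr (b - 1) * (1 / (1 + s\<^sup>2))))" if "\<bar>y'\<bar>
        \<le> M" for s y'
    proof -
      have "cmod (nth_deriv n F (s + y')) \<le> C * (1 / (1 + (s + y')\<^sup>2))" using C(2)[of "s + y'"] by simp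
      also have "\<dots> \<le> C * (2 * (1 + M\<^sup>2) / (1 + s\<^sup>2))" using one_plus_square_shift[OF that] C(1)
          by (intro mult_left_mono)
      finally have "s powr (b - 1) * cmod (nth_deriv n F (s + y'))
          \<le> s powr (b - 1) * (C * (2 * (1 + M\<^sup>2) / (1 + s\<^sup>2)))"
        by (intro mult_left_mono) auto
      then show ?thesis by (auto simp: indicator_def mult_ac)
    qed
    then show ?thesis by blast
  qed
  then show "\<exists>C. \<forall>s y'. \<bar>y'\<bar> \<le> M \<longrightarrow> cmod (indicator {0<..} s *\<^sub>R
      (s powr (b - 1) *\<^sub>R nth_deriv n F (s + y'))) \<le> C *
      (indicator {0<..} s *\<^sub>R (s powr (b - 1) * (1 / (1 + s\<^sup>2))))" .
  from bd[of "\<bar>y\<bar>"] obtain C where C0: "\<forall>s y'. \<bar>y'\<bar> \<le> \<bar>y\<bar>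
      \<longrightarrow> cmod (indicator {0<..} s *\<^sub>R (s powr (b - 1) *\<^sub>R nth_deriv n F (s + y')))
      \<le> C * (indicator {0<..} s *\<^sub>R (s powr (b - 1) * (1 / (1 + s\<^sup>2))))"
    by (rule exE)
  note C = C0[rule_format, OF order_refl]
  show "integrable lborel (\<lambda>s. indicator {0<..} s *\<^sub>R (s powr (b - 1) *\<^sub>R nth_deriv n F (s + y)))"
  proof (rule Bochner_Integration.integrable_bound[OF integrable_mult_right[OF
      integrable_power_inverse_square[OF b], of C]])
    show "AE s in lborel. norm (indicator {0<..} s *\<^sub>R (s powr (b - 1) *\<^sub>R nth_deriv n F (s + y)))
        \<le> norm (C * (indicator {0<..} s *\<^sub>R (s powr (b - 1) * (1 / (1 + s\<^sup>2)))))"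
      unfolding real_norm_def by (intro AE_I2 order_trans[OF C abs_ge_self])
  qed measurable
qed

lemma frac_int_derivative:
  assumes b: "0 < b" "b \<le> 1" and F: "F \<in> schwartz"
  shows "(frac_int b (nth_deriv n F) has_vector_derivative frac_int b (nth_deriv (Suc n) F) x) (at x)"
proof -
  note [measurable] = schwartz_measurable[OF F]
  obtain C where C: "\<And>s y'. \<bar>y'\<bar> \<le> \<bar>x\<bar> + 1 \<Longrightarrow> cmod (indicator {0<..} s *\<^sub>R
      (s powr (b - 1) *\<^sub>R nth_deriv (Suc n) F (s + y')))
      \<le> C * (indicator {0<..} s *\<^sub>R (s powr (b - 1) * (1 / (1 + s\<^sup>2))))"
    using frac_int_integrable(2)[OF b F, of "\<bar>x\<bar> + 1"] by blast
  have "((\<lambda>y. LINT s|lborel. indicator {0<..} s *\<^sub>R (s powr (b - 1) *\<^sub>R nth_deriv n F (s + y)))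
      has_vector_derivative
     (LINT s|lborel. indicator {0<..} s *\<^sub>R (s powr (b - 1) *\<^sub>R nth_deriv (Suc n) F (s + x)))) (at x)"
  proof (rule has_vector_derivative_integral[where e = 1 and w
      = "\<lambda>s. C * (indicator {0<..} s *\<^sub>R (s powr (b - 1) * (1 / (1 + s\<^sup>2))))"])
    fix y s
    have "((\<lambda>y. nth_deriv n F (s + y)) has_vector_derivative nth_deriv (Suc n) F (s + y)) (at y)"
    proof -
      have "((\<lambda>y. s + y) has_vector_derivative 1) (at y)" by (auto intro!: derivative_eq_intros)
      from vector_diff_chain_at[OF this schwartz_derivative[OF F, of n "s + y"]] show ?thesis
          by (simp add: o_def)
    qed
    then show "((\<lambda>y. indicator {0<..} s *\<^sub>R (s powr (b - 1) *\<^sub>R nth_deriv n F (s + y)))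
        has_vector_derivative
       indicator {0<..} s *\<^sub>R (s powr (b - 1) *\<^sub>R nth_deriv (Suc n) F (s + y))) (at y)"
      by (auto intro!: derivative_eq_intros)
    assume "dist x y < 1"
    then have "\<bar>y\<bar> \<le> \<bar>x\<bar> + 1" by (simp add: dist_real_def)
    then show "norm (indicator {0<..} s *\<^sub>R (s powr (b - 1) *\<^sub>R nth_deriv (Suc n) F (s + y)))
        \<le> C * (indicator {0<..} s *\<^sub>R (s powr (b - 1) * (1 / (1 + s\<^sup>2))))"
      by (rule C)
  next
    show "integrable lborel (\<lambda>s. C * (indicator {0<..} s *\<^sub>R (s powr (b - 1) * (1 / (1 + s\<^sup>2)))))"
      using integrable_power_inverse_square[OF b] by (rule integrable_mult_right)
    show "integrable lborel (\<lambda>s. indicator {0<..} s *\<^sub>R (s powr (b - 1) *\<^sub>R nth_deriv n F (s + y)))" for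
        y
      by (rule frac_int_integrable(1)[OF b F])
  qed auto
  then show ?thesis by (simp add: frac_int_def[abs_def])
qed

lemma nth_deriv_frac_int:
  assumes "0 < b" "b \<le> 1" "F \<in> schwartz"
  shows "nth_deriv n (frac_int b F) = frac_int b (nth_deriv n F)"
    and "nth_deriv n (\<lambda>y. frac_int b F (- y)) = (\<lambda>y. (- 1) ^ n * frac_int b (nth_deriv n F) (- y))"
  using nth_deriv_eqI[of "\<lambda>n. frac_int b (nth_deriv n F)", OF frac_int_derivative[OF assms]]
    nth_deriv_eqI[of "\<lambda>n y. (- 1) ^ n * frac_int b (nth_deriv n F) (- y)", OF
        reflect_derivatives[of "\<lambda>n. frac_int b (nth_deriv n F)", OF frac_int_derivative[OF assms]]]
  by simp_all

section \<open>Erdelyi-Kober integrals of weighted derivatives, and Taylor's formula\<close>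

lemma of_real_minus_power: "complex_of_real ((- s) ^ n) = (- 1) ^ n * complex_of_real (s ^ n)"
  by (subst power_minus) simp

text \<open>Since n = a + b, the factor s^n cancels the powers that distinguish an Erdelyi-Kober
  kernel from a fractional integral. What remains is the integral of order b of g along the ray from
  t away from the origin.\<close>

lemma dil_op_ek_power:
  assumes g[measurable]: "g \<in> borel_measurable borel" and b: "0 < b" and n: "a + b = real n"
      and t: "t \<noteq> 0"
  shows "dil_op (ek a b) (\<lambda>s. complex_of_real (s ^ n) * g s) t =
     complex_of_real (t ^ n * \<bar>t\<bar> powr - b / Gamma b) *
         (LINT s|lborel. indicator {0<..} s *\<^sub>R (s powr (b - 1) *\<^sub>R g (t + sgn t * s)))"
proof -
  define k where "k u = indicator {1<..} u *\<^sub>R ((u - 1) powr (b - 1) *\<^sub>R g (u * t))" for u :: real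
  have [measurable]: "k \<in> borel_measurable borel" unfolding k_def by measurable
  have k0: "indicator {0<..} u *\<^sub>R k u = k u" for u by (auto simp: k_def indicator_def)
  have e: "ek a b r * (complex_of_real ((exp (- r) * t) ^ n) * g (exp (- r) * t))
      = complex_of_real (t ^ n / Gamma b) * (exp (- r) *\<^sub>R k (exp (- r)))" for r
  proof (cases "r < 0")
    case True
    have 1: "(1 - exp r) powr (b - 1) = exp ((b - 1) * r) * (exp (- r) - 1) powr (b - 1)"
    proof -
      have "1 - exp r = exp r * (exp (- r) - 1)" by (simp add: right_diff_distrib flip: exp_add)
      then show ?thesis using True by (simp add: powr_mult exp_powr_real mult.commute)
    qed
    have "exp (- r) ^ n = exp (- r * (a + b))" unfolding n
        by (simp add: exp_of_nat_mult[symmetric] mult.commute)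
    then have "exp (a * r) * exp ((b - 1) * r) * exp (- r) ^ n = exp (- r)"
        by (simp add: algebra_simps flip: exp_add)
    then have "exp (a * r) * (1 - exp r) powr (b - 1) / Gamma b * (exp (- r) * t) ^ n
        = (t ^ n / Gamma b) * (exp (- r) * (exp (- r) - 1) powr (b - 1))"
      unfolding 1 power_mult_distrib by (simp add: field_simps)
    then have "ek a b r * complex_of_real ((exp (- r) * t) ^ n)
        = complex_of_real ((t ^ n / Gamma b) * (exp (- r) * (exp (- r) - 1) powr (b - 1)))"
      using True by (simp only: ek_def if_True of_real_mult[symmetric])
    then have "ek a b r * (complex_of_real ((exp (- r) * t) ^ n) * g (exp (- r) * t)) =
      complex_of_real ((t ^ n / Gamma b) * (exp (- r) * (exp (- r) - 1) powr (b - 1))) * g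
          (exp (- r) * t)"
      by (simp only: mult.assoc[symmetric])
    then show ?thesis using True by (simp add: k_def scaleR_conv_of_real mult_ac)
  qed (simp add: ek_def k_def)
  have K: "k (1 + (1 / \<bar>t\<bar>) * s) = \<bar>t\<bar> powr (1 - b) *\<^sub>R
      (indicator {0<..} s *\<^sub>R (s powr (b - 1) *\<^sub>R g (t + sgn t * s)))" for s
  proof -
    have "(1 + 1 / \<bar>t\<bar> * s) * t = t + sgn t * s" using t by (auto simp: sgn_if field_simps)
    moreover have "1 < 1 + 1 / \<bar>t\<bar> * s \<longleftrightarrow> 0 < s" using t by (simp add: zero_less_divide_iff)
    moreover have "(s / \<bar>t\<bar>) powr (b - 1) = \<bar>t\<bar> powr (1 - b) * s powr (b - 1)" if "0 < s"
      using that t powr_minus_divide[of "\<bar>t\<bar>" "b - 1"] by (simp add: powr_divide field_simps)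
    ultimately show ?thesis by (auto simp: k_def indicator_def)
  qed
  have "dil_op (ek a b) (\<lambda>s. complex_of_real (s ^ n) * g s) t
      = complex_of_real (t ^ n / Gamma b) * (LINT r|lborel. exp (- r) *\<^sub>R k (exp (- r)))"
    unfolding dil_op_def e by (rule integral_mult_right_zero)
  also have "(LINT r|lborel. exp (- r) *\<^sub>R k (exp (- r))) = (LINT u|lborel. k u)"
    using exp_substitution_neg(2)[of k] unfolding k0 by simp
  also have "\<dots> = (1 / \<bar>t\<bar>) *\<^sub>R (LINT s|lborel. k (1 + (1 / \<bar>t\<bar>) * s))"
    using lborel_integral_real_affine[of "1 / \<bar>t\<bar>" k 1] t by simp
  also have "(LINT s|lborel. k (1 + (1 / \<bar>t\<bar>) * s)) = (LINT s|lborel. \<bar>t\<bar> powr (1 - b) *\<^sub>R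
      (indicator {0<..} s *\<^sub>R (s powr (b - 1) *\<^sub>R g (t + sgn t * s))))"
    unfolding K ..
  also have "complex_of_real (t ^ n / Gamma b) * ((1 / \<bar>t\<bar>) *\<^sub>R
      (LINT s|lborel. \<bar>t\<bar> powr (1 - b) *\<^sub>R (indicator {0<..} s *\<^sub>R
      (s powr (b - 1) *\<^sub>R g (t + sgn t * s)))))
    = complex_of_real (t ^ n / Gamma b * (\<bar>t\<bar> powr (1 - b) / \<bar>t\<bar>)) *
        (LINT s|lborel. indicator {0<..} s *\<^sub>R (s powr (b - 1) *\<^sub>R g (t + sgn t * s)))"
    by (simp only: integral_scaleR_right) (simp add: scaleR_conv_of_real mult_ac)
  also have "\<bar>t\<bar> powr (1 - b) / \<bar>t\<bar> = \<bar>t\<bar> powr - b"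
    using t by (simp add: powr_diff powr_minus field_simps)
  finally show ?thesis by (simp add: mult.commute)
qed

lemma schwartz_half_line_integral:
  assumes F: "F \<in> schwartz" and c: "c = 1 \<or> c = - 1"
  shows "(LINT s|lborel. indicator {0<..} s *\<^sub>R nth_deriv (Suc n) F (t + c * s))
      = - complex_of_real c * nth_deriv n F t"
proof -
  note [measurable] = schwartz_measurable[OF F]
  obtain C where C: "0 \<le> C" "\<And>x. \<bar>x\<bar> ^ 0 * cmod (nth_deriv (Suc n) F x) \<le> C / (1 + x\<^sup>2)"
      using schwartz_bound[OF F] by blast
  have d: "decays (nth_deriv (Suc n) F)" using C unfolding decays_def by auto
  obtain C' where C': "0 \<le> C'" "\<And>x. \<bar>x\<bar> ^ 0 * cmod (nth_deriv n F x) \<le> C' / (1 + x\<^sup>2)"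
      using schwartz_bound[OF F] by blast
  have d': "decays (nth_deriv n F)" using C' unfolding decays_def by auto
  have i: "integrable lborel (\<lambda>s. nth_deriv (Suc n) F (t + c * s))"
    using lborel_integrable_real_affine[OF decays_integrable[OF d], of c t] c by auto
  have cc: "c * c = 1" using c by auto
  have "(LBINT s=ereal 0..\<infinity>. c *\<^sub>R nth_deriv (Suc n) F (t + c * s)) = 0 - nth_deriv n F t"
  proof (rule interval_integral_FTC_integrable[where F = "\<lambda>s. nth_deriv n F (t + c * s)"])
    show "((\<lambda>s. nth_deriv n F (t + c * s)) has_vector_derivative c *\<^sub>R nth_deriv (Suc n) F (t + c * x))
        (at x)" for x
    proof -
      have "((\<lambda>s. t + c * s) has_vector_derivative c) (at x)" by (auto intro!: derivative_eq_intros)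
      from vector_diff_chain_at[OF this schwartz_derivative[OF F, of n "t + c * x"]] show ?thesis
          by (simp add: o_def)
    qed
    show "isCont (\<lambda>s. c *\<^sub>R nth_deriv (Suc n) F (t + c * s)) x" for x
      by (intro continuous_intros isCont_o2[OF _ schwartz_isCont[OF F]])
    have "integrable lborel (\<lambda>s. indicator (einterval (ereal 0) \<infinity>) s *\<^sub>R
        (c *\<^sub>R nth_deriv (Suc n) F (t + c * s)))"
      using i by (intro integrable_mult_indicator integrable_scaleR_right) auto
    then show "set_integrable lborel (einterval (ereal 0) \<infinity>) (\<lambda>s. c *\<^sub>R nth_deriv (Suc n) F (t + c * s))"
      by (simp add: set_integrable_def)
    show "(((\<lambda>s. nth_deriv n F (t + c * s)) \<circ> real_of_ereal) \<longlongrightarrow> nth_deriv n F t) (at_right (ereal 0))"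
      unfolding ereal_tendsto_simps
    proof (rule tendsto_within_subset[where S = UNIV])
      have "isCont (\<lambda>s. nth_deriv n F (t + c * s)) 0" by (intro isCont_o2[OF _ schwartz_isCont[OF F]]
          continuous_intros)
      then show "((\<lambda>s. nth_deriv n F (t + c * s)) \<longlongrightarrow> nth_deriv n F t) (at 0)" by (simp add: isCont_def)
    qed simp
    show "(((\<lambda>s. nth_deriv n F (t + c * s)) \<circ> real_of_ereal) \<longlongrightarrow> 0) (at_left \<infinity>)"
      unfolding ereal_tendsto_simps
    proof (cases "c = 1")
      case True
      have "filterlim (\<lambda>s. t + s) at_top at_top" by (rule filterlim_tendsto_add_at_top[OF tendsto_const
          filterlim_ident])
      from filterlim_compose[OF decays_tendsto(1)[OF d'] this] show
          "((\<lambda>s. nth_deriv n F (t + c * s)) \<longlongrightarrow> 0) at_top" using True by simp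
    next
      case False
      then have c: "c = - 1" using c by simp
      have "filterlim (\<lambda>s. t + - s) at_bot at_top" by real_asymp
      from filterlim_compose[OF decays_tendsto(2)[OF d'] this] show
          "((\<lambda>s. nth_deriv n F (t + c * s)) \<longlongrightarrow> 0) at_top" using c by simp
    qed
  qed simp
  moreover have "einterval (ereal 0) \<infinity> = {0<..}" by (auto simp: einterval_def)
  ultimately have "(LINT s|lborel. indicator {0<..} s *\<^sub>R (c *\<^sub>R nth_deriv (Suc n) F (t + c * s)))
      = - nth_deriv n F t"
    by (simp only: interval_lebesgue_integral_def set_lebesgue_integral_def) simp
  moreover have "c *\<^sub>R (LINT s|lborel. indicator {0<..} s *\<^sub>R nth_deriv (Suc n) F (t + c * s)) =
      (LINT s|lborel. indicator {0<..} s *\<^sub>R (c *\<^sub>R nth_deriv (Suc n) F (t + c * s)))"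
    unfolding integral_scaleR_right[symmetric] by (simp only: scaleR_left_commute)
  ultimately have "c *\<^sub>R (LINT s|lborel. indicator {0<..} s *\<^sub>R nth_deriv (Suc n) F (t + c * s))
      = - nth_deriv n F t"
    by simp
  then have "c *\<^sub>R c *\<^sub>R (LINT s|lborel. indicator {0<..} s *\<^sub>R nth_deriv (Suc n) F (t + c * s))
      = c *\<^sub>R (- nth_deriv n F t)"
    by simp
  then show ?thesis using cc by (simp add: scaleR_conv_of_real flip: mult.assoc of_real_mult)
qed

text \<open>An integral of order one undoes one derivative, by the fundamental theorem of calculus
  along the ray from t away from the origin; the boundary term at infinity vanishes.\<close>

lemma ek1_derivative:
  assumes F: "F \<in> schwartz" and t: "t \<noteq> 0"
  shows "dil_op (ek (real n) 1) (\<lambda>s. complex_of_real ((- s) ^ Suc n) * nth_deriv (Suc n) F s) t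
      = complex_of_real ((- t) ^ n) * nth_deriv n F t"
proof -
  note [measurable] = schwartz_measurable[OF F]
  have c: "sgn t = 1 \<or> sgn t = - 1" using t by (auto simp: sgn_if)
  have "dil_op (ek (real n) 1) (\<lambda>s. complex_of_real ((- s) ^ Suc n) * nth_deriv (Suc n) F s) t
    = dil_op (ek (real n) 1) (\<lambda>s. (- 1) ^ Suc n * (complex_of_real (s ^ Suc n) * nth_deriv (Suc n) F s))
        t"
    by (simp only: of_real_minus_power mult.assoc)
  also have "\<dots> = (- 1) ^ Suc n * dil_op (ek (real n) 1)
      (\<lambda>s. complex_of_real (s ^ Suc n) * nth_deriv (Suc n) F s) t"
    by (rule dil_op_cmult)
  also have "dil_op (ek (real n) 1) (\<lambda>s. complex_of_real (s ^ Suc n) * nth_deriv (Suc n) F s) t =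
     complex_of_real (t ^ Suc n * \<bar>t\<bar> powr - 1 / Gamma 1) *
         (LINT s|lborel. indicator {0<..} s *\<^sub>R (s powr (1 - 1) *\<^sub>R nth_deriv (Suc n) F
         (t + sgn t * s)))"
    using t by (intro dil_op_ek_power) auto
  also have "(LINT s|lborel. indicator {0<..} s *\<^sub>R (s powr (1 - 1) *\<^sub>R nth_deriv (Suc n) F
      (t + sgn t * s)))
    = (LINT s|lborel. indicator {0<..} s *\<^sub>R nth_deriv (Suc n) F (t + sgn t * s))"
    by (intro Bochner_Integration.integral_cong) (auto simp: indicator_def)
  also have "\<dots> = - complex_of_real (sgn t) * nth_deriv n F t"
      by (rule schwartz_half_line_integral[OF F c])
  also have "(- 1) ^ Suc n * (complex_of_real (t ^ Suc n * \<bar>t\<bar> powr - 1 / Gamma 1) *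
      (- complex_of_real (sgn t) * nth_deriv n F t))
    = complex_of_real ((- 1) ^ n * t ^ n * (t * (\<bar>t\<bar> powr - 1 * sgn t))) * nth_deriv n F t"
    by simp
  also have "t * (\<bar>t\<bar> powr - 1 * sgn t) = 1" using t by (auto simp: powr_minus sgn_if)
  finally show ?thesis by (simp add: power_minus[of t])
qed

text \<open>Taylor's formula with integral remainder and expansion point at infinity, where all
  polynomial terms vanish. It comes from \<open>ek1_derivative\<close> by iteration, the composition
  law merging the integrals of order one.\<close>

lemma ek_taylor:
  fixes p :: real
  assumes p: "1 \<le> p" and F: "F \<in> schwartz"
  shows "AE t in lborel. dil_op (ek 0 (real (Suc n))) (\<lambda>s. complex_of_real ((- s) ^ Suc n) * nth_deriv
      (Suc n) F s) t = F t"
proof (induction n)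
  case 0
  have "AE t in lborel. (t :: real) \<noteq> 0" by (rule AE_lborel_singleton)
  then show ?case by eventually_elim (use ek1_derivative[OF F, of _ 0] in simp)
next
  case (Suc n)
  let ?h = "\<lambda>n s. complex_of_real ((- s) ^ n) * nth_deriv n F s"
  note [measurable] = schwartz_measurable[OF F]
  have k: "kernel p (ek 0 (real (Suc n)))" "kernel p (ek (real (Suc n)) 1)" using p
      by (auto intro!: kernel_ek)
  have c: "conv (ek 0 (real (Suc n))) (ek (real (Suc n)) 1) = ek 0 (real (Suc (Suc n)))"
    using conv_ek[of "real (Suc n)" 1 0] by (simp add: add.commute)
  have L: "?h n \<in> Lp p" for n using schwartz_Lp[OF p F] .
  have "AE t in lborel. (t :: real) \<noteq> 0" by (rule AE_lborel_singleton)
  then have "AE t in lborel. dil_op (ek (real (Suc n)) 1) (?h (Suc (Suc n))) t = ?h (Suc n) t"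
    by eventually_elim (rule ek1_derivative[OF F])
  from dil_op_cong_AE[OF p k(1) dil_op_bound(2)[OF p k(2) L] L this]
  have "AE t in lborel. dil_op (ek 0 (real (Suc n))) (dil_op (ek (real (Suc n)) 1) (?h (Suc (Suc n)))) t
      = dil_op (ek 0 (real (Suc n))) (?h (Suc n)) t" .
  then show ?case using Suc dil_op_comp[OF p k L, of "Suc (Suc n)"] unfolding c by eventually_elim simp
qed

section \<open>The Weyl derivative as an Erdelyi-Kober integral\<close>

lemma weyl_ord_bounds:
  assumes "0 \<le> \<alpha>"
  shows "0 < real (weyl_ord \<alpha>) - \<alpha>" "real (weyl_ord \<alpha>) - \<alpha> \<le> 1" "weyl_ord \<alpha> = Suc (nat \<lfloor>\<alpha>\<rfloor>)"
  using assms by (auto simp: weyl_ord_def) linarith+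

text \<open>The power of s makes this differential operator commute with dilations.\<close>

definition euler_deriv :: "real \<Rightarrow> (real \<Rightarrow> complex) \<Rightarrow> real \<Rightarrow> complex" where
  "euler_deriv \<alpha> F s = complex_of_real ((- s) ^ weyl_ord \<alpha>) * nth_deriv (weyl_ord \<alpha>) F s"

text \<open>The n derivatives in the Weyl derivative pass inside the integral of order n - \<alpha>
  and fall on F; \<open>dil_op_ek_power\<close> recognises the result. The left half-line is reduced
  to the right one by reflection.\<close>

lemma D0_schwartz_eq:
  assumes a: "0 < \<alpha>" and F: "F \<in> schwartz" and t: "t \<noteq> 0"
  shows "D0_schwartz \<alpha> F t = complex_of_real (1 / Gamma (\<alpha> + 1)) * dil_op (ek \<alpha> (real (weyl_ord \<alpha>) - \<alpha>))
      (euler_deriv \<alpha> F) t"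
proof -
  note [measurable] = schwartz_measurable[OF F]
  define n where "n = weyl_ord \<alpha>"
  define b where "b = real n - \<alpha>"
  have b: "0 < b" "b \<le> 1" using weyl_ord_bounds[of \<alpha>] a by (auto simp: b_def n_def)
  define I where "I = (LINT s|lborel. indicator {0<..} s *\<^sub>R
      (s powr (b - 1) *\<^sub>R nth_deriv n F (t + sgn t * s)))"
  have "dil_op (ek \<alpha> b) (euler_deriv \<alpha> F) t = dil_op (ek \<alpha> b)
      (\<lambda>s. (- 1) ^ n * (complex_of_real (s ^ n) * nth_deriv n F s)) t"
    by (simp only: euler_deriv_def[abs_def] n_def[symmetric] of_real_minus_power mult.assoc)
  also have "\<dots> = (- 1) ^ n * (complex_of_real (t ^ n * \<bar>t\<bar> powr - b / Gamma b) * I)"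
    unfolding dil_op_cmult I_def by (subst dil_op_ek_power) (use b t in \<open>auto simp: b_def\<close>)
  also have "\<dots> = complex_of_real ((- t) ^ n * \<bar>t\<bar> powr - b / Gamma b) * I"
    by (simp add: power_minus[of t])
  finally have R: "dil_op (ek \<alpha> b) (euler_deriv \<alpha> F) t = complex_of_real
      ((- t) ^ n * \<bar>t\<bar> powr - b / Gamma b) * I" .
  \<comment> \<open>The powers of t from \<open>euler_deriv\<close> and from the substitution
    combine to the weight |t|^\<alpha>.\<close>
  have pw: "\<bar>t\<bar> ^ n * \<bar>t\<bar> powr - b = \<bar>t\<bar> powr \<alpha>"
    using t by (simp add: powr_realpow[symmetric] b_def flip: powr_add)
  show ?thesis
  proof (cases "t > 0")
    case True
    have fi: "(\<lambda>y. LINT t:{y<..}|lborel. ((t - y) powr (b - 1)) *\<^sub>R F t) = frac_int b F"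
    proof
      fix y
      show "(LINT t:{y<..}|lborel. ((t - y) powr (b - 1)) *\<^sub>R F t) = frac_int b F y"
        unfolding frac_int_def set_lebesgue_integral_def
        by (subst lborel_integral_shift[of _ y, symmetric])
            (auto intro!: Bochner_Integration.integral_cong simp: indicator_def)
    qed
    have "weyl_plus \<alpha> F t = ((- 1) ^ n / Gamma b) *\<^sub>R nth_deriv n (frac_int b F) t"
      using a unfolding weyl_plus_def by (simp add: Let_def n_def[symmetric] b_def[symmetric] fi)
    also have "nth_deriv n (frac_int b F) t = I"
      unfolding nth_deriv_frac_int(1)[OF b F] frac_int_def I_def using True by (simp add: add.commute)
    finally have "D0_schwartz \<alpha> F t = complex_of_real (1 / Gamma (\<alpha> + 1)) *
        (complex_of_real (\<bar>t\<bar> powr \<alpha> * ((- 1) ^ n / Gamma b)) * I)"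
      using True by (simp add: D0_schwartz_def weyl_zero_def scaleR_conv_of_real)
    also have "\<bar>t\<bar> powr \<alpha> * ((- 1) ^ n / Gamma b) = (- t) ^ n * \<bar>t\<bar> powr - b / Gamma b"
      using True pw by (simp add: power_minus[of t] field_simps)
    finally show ?thesis using R by (simp add: b_def n_def)
  next
    case False
    then have t: "t < 0" using t by simp
    define H where "H x = F (- x)" for x
    have H: "H \<in> schwartz" "nth_deriv n H = (\<lambda>x. (- 1) ^ n * nth_deriv n F (- x))"
      unfolding H_def[abs_def] using schwartz_reflect[OF F] by auto
    have fi: "(\<lambda>y. LINT t:{..<y}|lborel. ((y - t) powr (b - 1)) *\<^sub>R F t) = (\<lambda>y. frac_int b H (- y))"
    proof
      fix y
      show "(LINT t:{..<y}|lborel. ((y - t) powr (b - 1)) *\<^sub>R F t) = frac_int b H (- y)"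
        unfolding frac_int_def set_lebesgue_integral_def H_def
        by (subst lborel_integral_reflect[of _ y, symmetric])
            (auto intro!: Bochner_Integration.integral_cong simp: indicator_def)
    qed
    have "weyl_minus \<alpha> F t = (1 / Gamma b) *\<^sub>R nth_deriv n (\<lambda>y. frac_int b H (- y)) t"
      using a unfolding weyl_minus_def by (simp add: Let_def n_def[symmetric] b_def[symmetric] fi)
    also have "nth_deriv n (\<lambda>y. frac_int b H (- y)) t = I"
    proof -
      have "frac_int b (nth_deriv n H) (- t) = (- 1) ^ n * I"
        unfolding frac_int_def H(2) I_def integral_mult_right_zero[symmetric] using t
        by (intro Bochner_Integration.integral_cong) (auto simp: scaleR_conv_of_real mult_ac)
      then show ?thesis unfolding nth_deriv_frac_int(2)[OF b H(1)]
        by (simp flip: mult.assoc power_mult_distrib)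
    qed
    finally have "D0_schwartz \<alpha> F t = complex_of_real (1 / Gamma (\<alpha> + 1)) *
        (complex_of_real (\<bar>t\<bar> powr \<alpha> * (1 / Gamma b)) * I)"
      using t by (simp add: D0_schwartz_def weyl_zero_def scaleR_conv_of_real)
    also have "\<bar>t\<bar> powr \<alpha> * (1 / Gamma b) = (- t) ^ n * \<bar>t\<bar> powr - b / Gamma b"
      using t pw by (simp add: field_simps)
    finally show ?thesis using R by (simp add: b_def n_def)
  qed
qed

section \<open>Density\<close>

text \<open>For \<open>j = 0\<close> these are Schwartz functions that converge, as \<open>m \<rightarrow> \<infinity>\<close>, to \<open>exp (- c * t)\<close> for \<open>t > 0\<close> and
  to \<open>0\<close> for \<open>t < 0\<close>; the index \<open>j\<close> makes the family closed under differentiation.\<close>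

definition exp_step :: "real \<Rightarrow> real \<Rightarrow> nat \<Rightarrow> real \<Rightarrow> real" where
  "exp_step c m j t = exp (- (c + real j * m) * t) * exp (- exp (- m * t))"

fun exp_step_deriv :: "real \<Rightarrow> real \<Rightarrow> nat \<Rightarrow> nat \<Rightarrow> real \<Rightarrow> real" where
  "exp_step_deriv c m 0 j t = exp_step c m j t"
| "exp_step_deriv c m (Suc n) j t = - (c + real j * m) * exp_step_deriv c m n j t + m * exp_step_deriv c
    m n (Suc j) t"

lemma exp_step_has_derivative:
  "(exp_step_deriv c m n j has_real_derivative exp_step_deriv c m (Suc n) j t) (at t)"
proof (induction n arbitrary: j t)
  case 0
  have "(exp_step c m j has_real_derivative - (c + real j * m) * exp_step c m j t + m * exp_step c m
      (Suc j) t) (at t)"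
    unfolding exp_step_def
    by (rule derivative_eq_intros refl)+ (simp add: algebra_simps exp_add[symmetric])
  then show ?case by simp
next
  case (Suc n)
  have "((\<lambda>t. - (c + real j * m) * exp_step_deriv c m n j t + m * exp_step_deriv c m n (Suc j) t)
      has_real_derivative
     - (c + real j * m) * exp_step_deriv c m (Suc n) j t + m * exp_step_deriv c m (Suc n) (Suc j) t)
         (at t)"
    by (intro DERIV_add DERIV_cmult Suc.IH)
  then show ?case by simp
qed

lemma exp_step_nonneg: "0 \<le> exp_step c m j t"
  by (simp add: exp_step_def)

text \<open>For t \<le> 0 the double exponential beats every exponential: with x = m |t| and K = c +
  j + 1, one has K x \<le> K^2/2 + x^2/2 and 1 + x + x^2/2 \<le> exp x. From m \<ge> 1 follows c
  \<le> c m, hence a constant independent of m.\<close>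

lemma exp_step_neg_bound:
  assumes c: "0 \<le> c" and m: "1 \<le> m" and t: "t \<le> 0"
  shows "exp_step c m j t \<le> exp ((c + real j + 1)\<^sup>2 / 2) * exp (- m * \<bar>t\<bar>)"
proof -
  define x where "x = m * \<bar>t\<bar>"
  define K where "K = c + real j + 1"
  have x: "0 \<le> x" using m by (simp add: x_def)
  have "(c + real j * m) * \<bar>t\<bar> \<le> (c * m + real j * m) * \<bar>t\<bar>"
    using c m by (intro mult_right_mono add_right_mono) (auto simp: mult_le_cancel_left1)
  also have "\<dots> = (K - 1) * x" by (simp add: x_def K_def algebra_simps)
  finally have 1: "- (c + real j * m) * t \<le> (K - 1) * x" using t by (simp add: algebra_simps)
  have "1 + x + x\<^sup>2 / 2 \<le> exp x" using x by (rule exp_lower_Taylor_quadratic)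
  moreover have "K * x \<le> K\<^sup>2 / 2 + x\<^sup>2 / 2" using zero_le_power2[of "K - x"]
      by (simp add: power2_eq_square algebra_simps)
  ultimately have "(K - 1) * x - exp x \<le> K\<^sup>2 / 2 - x" using x by (simp add: algebra_simps)
  then have "- (c + real j * m) * t - exp x \<le> K\<^sup>2 / 2 - x" using 1 by linarith
  moreover have "- m * t = x" using t by (simp add: x_def)
  ultimately have "exp (- (c + real j * m) * t + - exp (- m * t)) \<le> exp (K\<^sup>2 / 2 + - x)"
    by (simp only: exp_le_cancel_iff)
  then show ?thesis unfolding exp_step_def exp_add K_def x_def by simp
qed

text \<open>For j \<ge> 1 the first factor decays at rate at least m on the right as well, so the
  function is concentrated near 0 at scale 1/m.\<close>

lemma exp_step_bound:
  assumes c: "0 \<le> c" and m: "1 \<le> m" and j: "1 \<le> j"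
  shows "exp_step c m j t \<le> exp ((c + real j + 1)\<^sup>2 / 2) * exp (- m * \<bar>t\<bar>)"
proof (cases "t \<le> 0")
  case True then show ?thesis using exp_step_neg_bound[OF c m True] by simp
next
  case False
  have "1 * m \<le> real j * m" using m j by (intro mult_right_mono) auto
  then have "m \<le> c + real j * m" using c by linarith
  then have "m * t \<le> (c + real j * m) * t" using False by (intro mult_right_mono) auto
  then have "- (c + real j * m) * t \<le> - m * \<bar>t\<bar>" using False by (simp add: algebra_simps)
  then have "exp_step c m j t \<le> exp (- m * \<bar>t\<bar>) * 1"
    unfolding exp_step_def by (intro mult_mono) (auto simp del: mult_minus_left)
  also have "\<dots> \<le> exp ((c + real j + 1)\<^sup>2 / 2) * exp (- m * \<bar>t\<bar>)" by simp
  finally show ?thesis .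
qed

lemma exp_step_deriv_bound:
  assumes c: "0 \<le> c"
  shows "1 \<le> j \<Longrightarrow> \<exists>A\<ge>0. \<forall>m t. 1 \<le> m \<longrightarrow> \<bar>exp_step_deriv c m n j t\<bar> \<le> A * (m ^ n * exp (- m * \<bar>t\<bar>))"
proof (induction n arbitrary: j)
  case 0
  then show ?case using exp_step_bound[OF c _ 0] exp_step_nonneg
    by (intro exI[of _ "exp ((c + real j + 1)\<^sup>2 / 2)"]) auto
next
  case (Suc n)
  obtain A where A: "0 \<le> A" "\<And>m t. 1 \<le> m \<Longrightarrow> \<bar>exp_step_deriv c m n j t\<bar> \<le> A * (m ^ n * exp (- m * \<bar>t\<bar>))"
    using Suc.IH[OF Suc.prems] by blast
  obtain B where B: "0 \<le> B" "\<And>m t. 1 \<le> m \<Longrightarrow> \<bar>exp_step_deriv c m n (Suc j) t\<bar>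
      \<le> B * (m ^ n * exp (- m * \<bar>t\<bar>))"
    using Suc.IH[of "Suc j"] by auto
  have "\<bar>exp_step_deriv c m (Suc n) j t\<bar> \<le> ((c + real j) * A + B) * (m ^ Suc n * exp (- m * \<bar>t\<bar>))"
      if m: "1 \<le> m" for m t
  proof -
    define Z where "Z = m ^ n * exp (- m * \<bar>t\<bar>)"
    have Z: "0 \<le> Z" using m by (simp add: Z_def)
    have cj: "0 \<le> c + real j * m" "c + real j * m \<le> (c + real j) * m"
      using c m by (auto simp: algebra_simps mult_le_cancel_left1)
    have m0: "0 \<le> m" using m by simp
    have "\<bar>exp_step_deriv c m (Suc n) j t\<bar> \<le> \<bar>- (c + real j * m) * exp_step_deriv c m n j t\<bar> + \<bar>m *
        exp_step_deriv c m n (Suc j) t\<bar>"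
      by (simp only: exp_step_deriv.simps abs_triangle_ineq)
    also have "\<dots> = (c + real j * m) * \<bar>exp_step_deriv c m n j t\<bar> + m * \<bar>exp_step_deriv c m n (Suc j) t\<bar>"
      by (simp only: abs_mult abs_minus_cancel abs_of_nonneg[OF cj(1)] abs_of_nonneg[OF m0])
    also have "\<dots> \<le> ((c + real j) * m) * (A * Z) + m * (B * Z)"
      using A(2)[OF m, of t] B(2)[OF m, of t] cj m Z A(1) unfolding Z_def[symmetric]
          by (intro add_mono mult_mono) auto
    also have "\<dots> = ((c + real j) * A + B) * (m ^ Suc n * exp (- m * \<bar>t\<bar>))"
      by (simp add: Z_def algebra_simps)
    finally show ?thesis .
  qed
  then show ?case using A(1) B(1) c by (intro exI[of _ "(c + real j) * A + B"]) auto
qed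

text \<open>In the main term all derivatives fall on exp (- c t). Every other term has an index j
  \<ge> 1, so it is concentrated near 0 at scale 1/m and has size m^n.\<close>

lemma exp_step_deriv_0_bound:
  assumes c: "0 \<le> c"
  shows "\<exists>A\<ge>0. \<forall>m t. 1 \<le> m \<longrightarrow> \<bar>exp_step_deriv c m n 0 t - (- c) ^ n * exp_step c m 0 t\<bar>
      \<le> A * (m ^ n * exp (- m * \<bar>t\<bar>))"
proof (induction n)
  case 0 then show ?case by (intro exI[of _ 0]) auto
next
  case (Suc n)
  obtain A where A: "0 \<le> A" "\<And>m t. 1 \<le> m \<Longrightarrow> \<bar>exp_step_deriv c m n 0 t - (- c) ^ n * exp_step c m 0 t\<bar>
      \<le> A * (m ^ n * exp (- m * \<bar>t\<bar>))"
    using Suc by blast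
  obtain B where B: "0 \<le> B" "\<And>m t. 1 \<le> m \<Longrightarrow> \<bar>exp_step_deriv c m n (Suc 0) t\<bar>
      \<le> B * (m ^ n * exp (- m * \<bar>t\<bar>))"
    using exp_step_deriv_bound[OF c, of "Suc 0" n] by auto
  have "\<bar>exp_step_deriv c m (Suc n) 0 t - (- c) ^ Suc n * exp_step c m 0 t\<bar>
      \<le> (c * A + B) * (m ^ Suc n * exp (- m * \<bar>t\<bar>))" if m: "1 \<le> m" for m t
  proof -
    define Z where "Z = m ^ n * exp (- m * \<bar>t\<bar>)"
    have Z: "0 \<le> Z" using m by (simp add: Z_def)
    have "exp_step_deriv c m (Suc n) 0 t - (- c) ^ Suc n * exp_step c m 0 t
      = - c * (exp_step_deriv c m n 0 t - (- c) ^ n * exp_step c m 0 t) + m * exp_step_deriv c m n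
          (Suc 0) t"
      by (simp add: algebra_simps)
    also have "\<bar>\<dots>\<bar> \<le> c * \<bar>exp_step_deriv c m n 0 t - (- c) ^ n * exp_step c m 0 t\<bar> + m * \<bar>exp_step_deriv
        c m n (Suc 0) t\<bar>"
      using c m by (intro order_trans[OF abs_triangle_ineq]) (auto simp: abs_mult)
    also have "\<dots> \<le> (c * m) * (A * Z) + m * (B * Z)"
      using A(2)[OF m, of t] B(2)[OF m, of t] c m Z A(1) unfolding Z_def[symmetric]
      by (intro add_mono mult_mono) (auto simp: mult_le_cancel_left1)
    also have "\<dots> = (c * A + B) * (m ^ Suc n * exp (- m * \<bar>t\<bar>))"
      by (simp add: Z_def algebra_simps)
    finally show ?thesis .
  qed
  then show ?case using A(1) B(1) c by (intro exI[of _ "c * A + B"]) auto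
qed

lemma exp_step_0_bound:
  assumes c: "1 \<le> c" and m: "1 \<le> m"
  shows "exp_step c m 0 t \<le> exp ((c + 1)\<^sup>2 / 2) * exp (- \<bar>t\<bar>)"
proof (cases "t \<le> 0")
  case True
  have "exp (- m * \<bar>t\<bar>) \<le> exp (- \<bar>t\<bar>)" using m by (auto simp: mult_le_cancel_right1)
  then have b: "exp ((c + 1)\<^sup>2 / 2) * exp (- m * \<bar>t\<bar>) \<le> exp ((c + 1)\<^sup>2 / 2) * exp (- \<bar>t\<bar>)"
      by (intro mult_left_mono) auto
  have "exp_step c m 0 t \<le> exp ((c + 1)\<^sup>2 / 2) * exp (- m * \<bar>t\<bar>)"
    using exp_step_neg_bound[of c m t 0] c m True by simp
  then show ?thesis using b by (rule order_trans)
next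
  case False
  have "1 * t \<le> c * t" using c False by (intro mult_right_mono) auto
  then have "exp_step c m 0 t \<le> exp (- \<bar>t\<bar>) * 1"
    unfolding exp_step_def using False by (intro mult_mono) auto
  also have "\<dots> \<le> exp ((c + 1)\<^sup>2 / 2) * exp (- \<bar>t\<bar>)" by simp
  finally show ?thesis .
qed

text \<open>The inequality y \<le> exp y at y = x / (2 n), raised to the power n, costs half of the
  exponential.\<close>

lemma power_exp_bound:
  fixes x :: real
  assumes "0 \<le> x" shows "x ^ n * exp (- x) \<le> (2 * real n) ^ n * exp (- x / 2)"
proof (cases "n = 0")
  case False
  define y where "y = x / (2 * real n)"
  have "x ^ n = (2 * real n) ^ n * y ^ n" unfolding y_def power_mult_distrib[symmetric] using False
      by simp
  also have "\<dots> \<le> (2 * real n) ^ n * exp y ^ n"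
  proof (intro mult_left_mono power_mono)
    show "y \<le> exp y" using exp_ge_add_one_self[of y] by linarith
  qed (use assms in \<open>auto simp: y_def\<close>)
  also have "exp y ^ n = exp (x / 2)" unfolding exp_of_nat_mult[symmetric] using False
      by (simp add: y_def)
  finally have "x ^ n * exp (- x) \<le> (2 * real n) ^ n * exp (x / 2) * exp (- x)"
      by (intro mult_right_mono) auto
  also have "\<dots> = (2 * real n) ^ n * exp (- x / 2)" by (simp add: mult.assoc flip: exp_add)
  finally show ?thesis .
qed (use assms in auto)

text \<open>The weight |t|^n pays for m^n, as (m |t|)^n exp (- m |t|) is bounded. The first bound is
  a majorant uniform in m; the second makes the error tend to 0 for t \<noteq> 0.\<close>

lemma exp_step_weighted_bound:
  assumes c: "1 \<le> c"
  shows "\<exists>C\<ge>0. \<forall>m t. 1 \<le> m \<longrightarrow> \<bar>t\<bar> ^ n * \<bar>exp_step_deriv c m n 0 t\<bar> \<le> C * exp (- \<bar>t\<bar> / 2)"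
    and "\<exists>C\<ge>0. \<forall>m t. 1 \<le> m \<longrightarrow> \<bar>t\<bar> ^ n * \<bar>exp_step_deriv c m n 0 t - (- c) ^ n * exp_step c m 0 t\<bar>
        \<le> C * exp (- m * \<bar>t\<bar> / 2)"
proof -
  obtain A where A: "0 \<le> A" "\<And>m t. 1 \<le> m \<Longrightarrow> \<bar>exp_step_deriv c m n 0 t - (- c) ^ n * exp_step c m 0 t\<bar>
      \<le> A * (m ^ n * exp (- m * \<bar>t\<bar>))"
    using exp_step_deriv_0_bound[of c n] c by auto
  define P where "P = (2 * real n) ^ n"
  define B where "B = exp ((c + 1)\<^sup>2 / 2)"
  have 2: "\<bar>t\<bar> ^ n * \<bar>exp_step_deriv c m n 0 t - (- c) ^ n * exp_step c m 0 t\<bar>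
      \<le> (A * P) * exp (- m * \<bar>t\<bar> / 2)" if m: "1 \<le> m" for m t
  proof -
    have "\<bar>t\<bar> ^ n * \<bar>exp_step_deriv c m n 0 t - (- c) ^ n * exp_step c m 0 t\<bar>
        \<le> \<bar>t\<bar> ^ n * (A * (m ^ n * exp (- m * \<bar>t\<bar>)))"
      using A(2)[OF m] by (intro mult_left_mono) auto
    also have "\<dots> = A * ((m * \<bar>t\<bar>) ^ n * exp (- (m * \<bar>t\<bar>)))" by (simp add: power_mult_distrib)
    also have "\<dots> \<le> A * (P * exp (- (m * \<bar>t\<bar>) / 2))" unfolding P_def using A(1) m
        by (intro mult_left_mono power_exp_bound) auto
    finally show ?thesis by simp
  qed
  have P: "0 \<le> P" by (simp add: P_def)
  show "\<exists>C\<ge>0. \<forall>m t. 1 \<le> m \<longrightarrow> \<bar>t\<bar> ^ n * \<bar>exp_step_deriv c m n 0 t - (- c) ^ n * exp_step c m 0 t\<bar>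
      \<le> C * exp (- m * \<bar>t\<bar> / 2)"
    using 2 A(1) P by (intro exI[of _ "A * P"]) auto
  have "\<bar>t\<bar> ^ n * \<bar>exp_step_deriv c m n 0 t\<bar> \<le> (c ^ n * B * P + A * P) * exp (- \<bar>t\<bar> / 2)"
      if m: "1 \<le> m" for m t
  proof -
    have e: "exp (- m * \<bar>t\<bar> / 2) \<le> exp (- \<bar>t\<bar> / 2)" using m by (auto simp: mult_le_cancel_right1)
    have "\<bar>exp_step_deriv c m n 0 t\<bar> \<le> c ^ n * exp_step c m 0 t + \<bar>exp_step_deriv c m n 0 t - (- c) ^ n
        * exp_step c m 0 t\<bar>"
    proof -
      have "\<bar>(- c) ^ n * exp_step c m 0 t\<bar> = c ^ n * exp_step c m 0 t"
        using c exp_step_nonneg[of c m 0 t] by (simp add: abs_mult power_abs)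
      then show ?thesis by linarith
    qed
    then have "\<bar>t\<bar> ^ n * \<bar>exp_step_deriv c m n 0 t\<bar> \<le> \<bar>t\<bar> ^ n *
        (c ^ n * exp_step c m 0 t + \<bar>exp_step_deriv c m n 0 t - (- c) ^ n * exp_step c m 0 t\<bar>)"
      by (intro mult_left_mono) auto
    also have "\<dots> = c ^ n * (\<bar>t\<bar> ^ n * exp_step c m 0 t) + \<bar>t\<bar> ^ n * \<bar>exp_step_deriv c m n 0 t - (- c) ^
        n * exp_step c m 0 t\<bar>"
      by (simp add: algebra_simps)
    also have "\<dots> \<le> c ^ n * (B * (P * exp (- \<bar>t\<bar> / 2))) + (A * P) * exp (- \<bar>t\<bar> / 2)"
    proof (intro add_mono mult_left_mono)
      have "\<bar>t\<bar> ^ n * exp_step c m 0 t \<le> \<bar>t\<bar> ^ n * (B * exp (- \<bar>t\<bar>))"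
        unfolding B_def using exp_step_0_bound[OF c m] by (intro mult_left_mono) auto
      also have "\<dots> = B * (\<bar>t\<bar> ^ n * exp (- \<bar>t\<bar>))" by simp
      also have "\<dots> \<le> B * (P * exp (- \<bar>t\<bar> / 2))" unfolding P_def
          by (intro mult_left_mono power_exp_bound) (auto simp: B_def)
      finally show "\<bar>t\<bar> ^ n * exp_step c m 0 t \<le> B * (P * exp (- \<bar>t\<bar> / 2))" .
      have "(A * P) * exp (- m * \<bar>t\<bar> / 2) \<le> (A * P) * exp (- \<bar>t\<bar> / 2)" using e A(1) P
          by (intro mult_left_mono) auto
      then show "\<bar>t\<bar> ^ n * \<bar>exp_step_deriv c m n 0 t - (- c) ^ n * exp_step c m 0 t\<bar>
          \<le> A * P * exp (- \<bar>t\<bar> / 2)"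
        using 2[OF m, of t] by linarith
    qed (use c in auto)
    finally show ?thesis by (simp add: algebra_simps)
  qed
  moreover have "0 \<le> c ^ n * B * P + A * P" using c A(1) P by (simp add: B_def)
  ultimately show "\<exists>C\<ge>0. \<forall>m t. 1 \<le> m \<longrightarrow> \<bar>t\<bar> ^ n * \<bar>exp_step_deriv c m n 0 t\<bar> \<le> C * exp (- \<bar>t\<bar> / 2)"
    by blast
qed

lemma exp_step_schwartz:
  assumes c: "1 \<le> c" and m: "1 \<le> m"
  shows "(\<lambda>t. complex_of_real (exp_step c m 0 t)) \<in> schwartz"
    and "nth_deriv n (\<lambda>t. complex_of_real (exp_step c m 0 t))
        = (\<lambda>t. complex_of_real (exp_step_deriv c m n 0 t))"
proof -
  define G where "G n t = complex_of_real (exp_step_deriv c m n 0 t)" for n t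
  have d: "(G n has_vector_derivative G (Suc n) x) (at x)" for n x
    unfolding G_def by (intro has_vector_derivative_of_real exp_step_has_derivative)
  have b: "\<exists>C. \<forall>x. \<bar>x\<bar> ^ k * cmod (G n x) \<le> C" for k n
  proof -
    obtain A where A: "0 \<le> A" "\<And>m t. 1 \<le> m \<Longrightarrow> \<bar>exp_step_deriv c m n 0 t - (- c) ^ n * exp_step c m 0 t\<bar>
        \<le> A * (m ^ n * exp (- m * \<bar>t\<bar>))"
      using exp_step_deriv_0_bound[of c n] c by auto
    define B where "B = exp ((c + 1)\<^sup>2 / 2)"
    have "\<bar>x\<bar> ^ k * cmod (G n x) \<le> (c ^ n * B + A * m ^ n) * ((2 * real k) ^ k)" for x
    proof -
      have "\<bar>(- c) ^ n * exp_step c m 0 x\<bar> = c ^ n * exp_step c m 0 x"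
        using c exp_step_nonneg[of c m 0 x] by (simp add: abs_mult power_abs)
      also have "\<dots> \<le> c ^ n * (B * exp (- \<bar>x\<bar>))" unfolding B_def using c
          by (intro mult_left_mono exp_step_0_bound m) auto
      finally have 1: "\<bar>(- c) ^ n * exp_step c m 0 x\<bar> \<le> c ^ n * (B * exp (- \<bar>x\<bar>))" .
      have "exp (- m * \<bar>x\<bar>) \<le> exp (- \<bar>x\<bar>)" using m by (auto simp: mult_le_cancel_right1)
      then have "A * (m ^ n * exp (- m * \<bar>x\<bar>)) \<le> A * (m ^ n * exp (- \<bar>x\<bar>))" using A(1) m
          by (intro mult_left_mono) auto
      then have "\<bar>exp_step_deriv c m n 0 x\<bar> \<le> c ^ n * (B * exp (- \<bar>x\<bar>)) + A * (m ^ n * exp (- \<bar>x\<bar>))"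
        using 1 A(2)[OF m, of x] by linarith
      also have "\<dots> = (c ^ n * B + A * m ^ n) * exp (- \<bar>x\<bar>)" by (simp add: algebra_simps)
      finally have "\<bar>x\<bar> ^ k * cmod (G n x) \<le> \<bar>x\<bar> ^ k * ((c ^ n * B + A * m ^ n) * exp (- \<bar>x\<bar>))"
        unfolding G_def norm_of_real by (intro mult_left_mono) auto
      also have "\<dots> = (c ^ n * B + A * m ^ n) * (\<bar>x\<bar> ^ k * exp (- \<bar>x\<bar>))" by simp
      also have "\<dots> \<le> (c ^ n * B + A * m ^ n) * ((2 * real k) ^ k * exp (- \<bar>x\<bar> / 2))"
        using c A(1) m by (intro mult_left_mono power_exp_bound) (auto simp: B_def)
      also have "\<dots> \<le> (c ^ n * B + A * m ^ n) * ((2 * real k) ^ k * 1)"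
        using c A(1) m by (intro mult_left_mono) (auto simp: B_def)
      finally show ?thesis by simp
    qed
    then show ?thesis by blast
  qed
  from schwartzI[of G, OF d b] nth_deriv_eqI[of G, OF d]
  show "(\<lambda>t. complex_of_real (exp_step c m 0 t)) \<in> schwartz"
    "nth_deriv n (\<lambda>t. complex_of_real (exp_step c m 0 t))
        = (\<lambda>t. complex_of_real (exp_step_deriv c m n 0 t))"
    by (simp_all add: G_def[abs_def])
qed

lemma exp_half_powr_integrable:
  fixes p C :: real
  assumes p: "1 \<le> p" and C: "0 \<le> C"
  shows "integrable lborel (\<lambda>t::real. (C * exp (- \<bar>t\<bar> / 2)) powr p)"
proof -
  let ?h = "\<lambda>t::real. complex_of_real (C * exp (- \<bar>t\<bar> / 2))"
  have "exp_decays ?h" unfolding exp_decays_def using C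
      by (intro exI[of _ C] exI[of _ "1 / 2"]) (auto simp: norm_mult)
  then obtain D where D: "\<And>x. cmod (?h x) \<le> D / (1 + x\<^sup>2)" using exp_decays_decays unfolding decays_def
      by blast
  have "0 \<le> D" using order_trans[OF norm_ge_zero D[of 0]] by simp
  then have "?h \<in> Lp p" using D by (intro Lp_if_inverse_square_bound[OF p]) auto
  from LpD(2)[OF this] show ?thesis using C by (simp add: norm_mult)
qed

text \<open>Dominated convergence. The limit is (- t)^n times the n-th derivative of exp (- c t) on
  the right half-line and 0 on the left; the weight removes what derivatives of the jump would
  contribute.\<close>

lemma exp_step_tendsto:
  assumes p: "1 \<le> p" and c: "1 \<le> c"
  shows "(\<lambda>t. complex_of_real (if 0 < t then (c * t) ^ n * exp (- c * t) else 0)) \<in> Lp p"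
    and "(\<lambda>i. Lp_norm p (\<lambda>t. complex_of_real ((- t) ^ n) * nth_deriv n
        (\<lambda>t. complex_of_real (exp_step c (real (Suc i)) 0 t)) t
      - complex_of_real (if 0 < t then (c * t) ^ n * exp (- c * t) else 0))) \<longlonglongrightarrow> 0"
proof -
  let ?F = "\<lambda>i t. complex_of_real ((- t) ^ n) * nth_deriv n
      (\<lambda>t. complex_of_real (exp_step c (real (Suc i)) 0 t)) t"
  let ?f = "\<lambda>t. complex_of_real (if 0 < t then (c * t) ^ n * exp (- c * t) else 0)"
  note S = exp_step_schwartz[OF c, of "real (Suc _)"]
  have m1: "1 \<le> real (Suc i)" for i by simp
  obtain C where C: "0 \<le> C" "\<And>m t. 1 \<le> m \<Longrightarrow> \<bar>t\<bar> ^ n * \<bar>exp_step_deriv c m n 0 t\<bar> \<le> C * exp (- \<bar>t\<bar> / 2)"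
    using exp_step_weighted_bound(1)[OF c, of n] by blast
  obtain A where A: "0 \<le> A" "\<And>m t. 1 \<le> m \<Longrightarrow> \<bar>t\<bar> ^ n * \<bar>exp_step_deriv c m n 0 t - (- c) ^ n * exp_step c
      m 0 t\<bar> \<le> A * exp (- m * \<bar>t\<bar> / 2)"
    using exp_step_weighted_bound(2)[OF c, of n] by blast
  have Fm: "?F i \<in> borel_measurable borel" for i
  proof -
    have [measurable]: "nth_deriv n (\<lambda>t. complex_of_real (exp_step c (real (Suc i)) 0 t)) \<in>
        borel_measurable borel"
      by (rule schwartz_measurable[OF S(1)[OF m1]])
    show ?thesis by measurable
  qed
  have bd: "AE t in lborel. cmod (?F i t) \<le> C * exp (- \<bar>t\<bar> / 2)" for i
    using C(2)[OF m1] unfolding S(2)[OF m1] by (auto simp: norm_mult norm_power)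
  have "AE t in lborel. (t :: real) \<noteq> 0" by (rule AE_lborel_singleton)
  then have lim: "AE t in lborel. (\<lambda>i. ?F i t) \<longlonglongrightarrow> ?f t"
  proof eventually_elim
    case (elim t)
    have z: "(\<lambda>i. exp (- real (Suc i) * \<bar>t\<bar> / 2)) \<longlonglongrightarrow> 0"
    proof -
      have "(\<lambda>i. exp (- (\<bar>t\<bar> / 2)) ^ Suc i) \<longlonglongrightarrow> 0" using elim by (intro LIMSEQ_Suc LIMSEQ_power_zero) auto
      moreover have "exp (- real (Suc i) * \<bar>t\<bar> / 2) = exp (- (\<bar>t\<bar> / 2)) ^ Suc i" for i
        unfolding exp_of_nat_mult[symmetric] by (intro arg_cong[where f = exp]) (simp del: of_nat_Suc)
      ultimately show ?thesis by (simp only:)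
    qed
    have e0: "(\<lambda>i. exp_step c (real (Suc i)) 0 t) \<longlonglongrightarrow> (if 0 < t then exp (- c * t) else 0)"
    proof (cases "0 < t")
      case True
      have "(\<lambda>i. exp (- (\<bar>t\<bar>)) ^ Suc i) \<longlonglongrightarrow> 0" using elim by (intro LIMSEQ_Suc LIMSEQ_power_zero) auto
      then have "(\<lambda>i. exp (- real (Suc i) * t)) \<longlonglongrightarrow> 0" using True
          by (simp only: exp_of_nat_mult[symmetric] mult_minus_right mult_minus_left abs_of_pos)
      then have "(\<lambda>i. exp (- c * t) * exp (- exp (- real (Suc i) * t))) \<longlonglongrightarrow> exp (- c * t) * exp (- 0)"
        by (intro tendsto_intros)
      then show ?thesis using True by (simp add: exp_step_def)
    next
      case False
      have "(\<lambda>i. exp_step c (real (Suc i)) 0 t) \<longlonglongrightarrow> 0"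
      proof (rule Lim_null_comparison)
        have "exp (- real (Suc i) * \<bar>t\<bar>) \<le> exp (- real (Suc i) * \<bar>t\<bar> / 2)" for i by simp
        then have "exp_step c (real (Suc i)) 0 t \<le> exp ((c + 1)\<^sup>2 / 2) * exp (- real (Suc i) * \<bar>t\<bar> / 2)"
            for i
          using exp_step_neg_bound[of c "real (Suc i)" t 0] c False
          by (intro order_trans[OF _ mult_left_mono[of "exp (- real (Suc i) * \<bar>t\<bar>)"
              "exp (- real (Suc i) * \<bar>t\<bar> / 2)" "exp ((c + 1)\<^sup>2 / 2)"]]) auto
        then show "\<forall>\<^sub>F i in sequentially. norm (exp_step c (real (Suc i)) 0 t)
            \<le> exp ((c + 1)\<^sup>2 / 2) * exp (- real (Suc i) * \<bar>t\<bar> / 2)"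
          using exp_step_nonneg by (auto intro!: always_eventually)
        show "(\<lambda>i. exp ((c + 1)\<^sup>2 / 2) * exp (- real (Suc i) * \<bar>t\<bar> / 2)) \<longlonglongrightarrow> 0"
          by (rule tendsto_mult_right_zero[OF z])
      qed
      then show ?thesis using False by simp
    qed
    define R where "R i = (- t) ^ n * (exp_step_deriv c (real (Suc i)) n 0 t - (- c) ^ n * exp_step c
        (real (Suc i)) 0 t)" for i
    have "R \<longlonglongrightarrow> 0"
    proof (rule Lim_null_comparison)
      show "\<forall>\<^sub>F i in sequentially. norm (R i) \<le> A * exp (- real (Suc i) * \<bar>t\<bar> / 2)"
        using A(2)[OF m1, of t] by (intro always_eventually allI)
            (simp only: R_def real_norm_def abs_mult power_abs abs_minus_cancel)
      show "(\<lambda>i. A * exp (- real (Suc i) * \<bar>t\<bar> / 2)) \<longlonglongrightarrow> 0"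
        by (rule tendsto_mult_right_zero[OF z])
    qed
    then have "(\<lambda>i. complex_of_real (R i + (- t) ^ n * ((- c) ^ n * exp_step c (real (Suc i)) 0 t))) \<longlonglongrightarrow>
       complex_of_real (0 + (- t) ^ n * ((- c) ^ n * (if 0 < t then exp (- c * t) else 0)))"
      by (intro tendsto_intros e0)
    moreover have "R i + (- t) ^ n * ((- c) ^ n * exp_step c (real (Suc i)) 0 t)
        = (- t) ^ n * exp_step_deriv c (real (Suc i)) n 0 t" for i
      by (simp add: R_def algebra_simps)
    moreover have "0 + (- t) ^ n * ((- c) ^ n * (if 0 < t then exp (- c * t) else 0))
        = (if 0 < t then (c * t) ^ n * exp (- c * t) else 0)"
    proof -
      have "(- t) ^ n * (- c) ^ n = (c * t) ^ n" unfolding power_mult_distrib[symmetric]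
          by (simp add: mult.commute)
      then show ?thesis by (simp flip: mult.assoc)
    qed
    ultimately show ?case unfolding S(2)[OF m1] of_real_mult[symmetric] by (simp only:)
  qed
  have fm: "?f \<in> borel_measurable borel" by measurable
  show "?f \<in> Lp p" by (rule Lp_dominated_convergence(2)[OF p Fm fm exp_half_powr_integrable[OF p C(1)]
      lim bd])
  show "(\<lambda>i. Lp_norm p (\<lambda>t. ?F i t - ?f t)) \<longlonglongrightarrow> 0"
    by (rule Lp_dominated_convergence(3)[OF p Fm fm exp_half_powr_integrable[OF p C(1)] lim bd])
qed

section \<open>Erdelyi-Kober integrals of exponentials\<close>

lemma Gamma_integral_scaled:
  fixes b c :: real
  assumes b: "0 < b" and c: "0 < c"
  shows "(LINT s|lborel. indicator {0<..} s *\<^sub>R (s powr (b - 1) *\<^sub>R complex_of_real (exp (- c * s))))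
      = complex_of_real (Gamma b * c powr - b)"
proof -
  let ?g = "\<lambda>s. s powr (b - 1) *\<^sub>R complex_of_real (exp (- c * s))"
  let ?e = "\<lambda>r. exp (complex_of_real b * complex_of_real r - complex_of_real (exp r))"
  have e: "exp r *\<^sub>R ?g (exp r) = complex_of_real (c powr - b) * ?e (r + ln c)" for r
  proof -
    have "exp (r + ln c) = c * exp r" using c by (simp add: exp_add)
    moreover have "exp r * exp r powr (b - 1) = c powr - b * exp (b * (r + ln c))"
      using c by (simp add: powr_def algebra_simps flip: exp_add)
    ultimately show ?thesis
      by (simp only: scaleR_scaleR) (simp add: scaleR_conv_of_real exp_diff exp_minus field_simps
          flip: exp_of_real)
  qed
  have "(LINT s|lborel. indicator {0<..} s *\<^sub>R ?g s) = (LINT r|lborel. exp r *\<^sub>R ?g (exp r))"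
    by (rule exp_substitution(2)) measurable
  also have "\<dots> = complex_of_real (c powr - b) * (LINT r|lborel. ?e (r + ln c))"
    unfolding e by (rule integral_mult_right_zero)
  also have "(LINT r|lborel. ?e (r + ln c)) = (LINT r|lborel. ?e r)" by (rule lborel_integral_shift)
  also have "\<dots> = Gamma (complex_of_real b)" by (rule Gamma_integral_log(2)) (use b in simp)
  finally show ?thesis by (simp add: Gamma_complex_of_real mult.commute)
qed

text \<open>exp (- c t) is an eigenfunction of the fractional integral of order b over (t,
  \<infinity>), with eigenvalue c^(- b). For t < 0 the ray from t away from the origin never meets
  the support.\<close>

lemma dil_op_ek_exp:
  assumes b: "0 < b" and n: "a + b = real n" and c: "0 < c" and t: "t \<noteq> 0"
  shows "dil_op (ek a b) (\<lambda>t. complex_of_real (if 0 < t then (c * t) ^ n * exp (- c * t) else 0)) t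
    = complex_of_real (if 0 < t then (c * t) powr a * exp (- c * t) else 0)"
proof -
  define g where "g s = complex_of_real (if 0 < s then c ^ n * exp (- c * s) else 0)" for s
  have [measurable]: "g \<in> borel_measurable borel" unfolding g_def by measurable
  have "(\<lambda>t. complex_of_real (if 0 < t then (c * t) ^ n * exp (- c * t) else 0))
      = (\<lambda>s. complex_of_real (s ^ n) * g s)"
    by (auto simp: g_def fun_eq_iff power_mult_distrib)
  then have "dil_op (ek a b) (\<lambda>t. complex_of_real (if 0 < t then (c * t) ^ n * exp (- c * t) else 0)) t =
     complex_of_real (t ^ n * \<bar>t\<bar> powr - b / Gamma b) *
         (LINT s|lborel. indicator {0<..} s *\<^sub>R (s powr (b - 1) *\<^sub>R g (t + sgn t * s)))"
    using dil_op_ek_power[of g b a n t] b n t by simp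
  also have "\<dots> = complex_of_real (if 0 < t then (c * t) powr a * exp (- c * t) else 0)"
  proof (cases "0 < t")
    case True
    have "(LINT s|lborel. indicator {0<..} s *\<^sub>R (s powr (b - 1) *\<^sub>R g (t + sgn t * s)))
      = (LINT s|lborel. complex_of_real (c ^ n * exp (- c * t)) *
          (indicator {0<..} s *\<^sub>R (s powr (b - 1) *\<^sub>R complex_of_real (exp (- c * s)))))"
      using True by (intro Bochner_Integration.integral_cong)
        (auto simp: g_def indicator_def scaleR_conv_of_real algebra_simps exp_add[symmetric] simp
            flip: of_real_mult)
    also have "\<dots> = complex_of_real (c ^ n * exp (- c * t) * (Gamma b * c powr - b))"
      by (simp only: integral_mult_right_zero Gamma_integral_scaled[OF b c] of_real_mult)
    finally have "complex_of_real (t ^ n * \<bar>t\<bar> powr - b / Gamma b) *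
        (LINT s|lborel. indicator {0<..} s *\<^sub>R (s powr (b - 1) *\<^sub>R g (t + sgn t * s)))
      = complex_of_real (t ^ n * \<bar>t\<bar> powr - b / Gamma b *
          (c ^ n * exp (- c * t) * (Gamma b * c powr - b)))"
      by (simp only: of_real_mult)
    also have "t ^ n * \<bar>t\<bar> powr - b / Gamma b * (c ^ n * exp (- c * t) * (Gamma b * c powr - b))
        = (c * t) powr real n * (c * t) powr - b * exp (- c * t)"
      using Gamma_real_pos[OF b] True c by (simp add: powr_mult powr_realpow power_mult_distrib)
    also have "(c * t) powr real n * (c * t) powr - b = (c * t) powr a"
    proof -
      have "real n + - b = a" using n by simp
      then show ?thesis by (simp only: powr_add[symmetric])
    qed
    finally show ?thesis using True by simp
  next
    case False
    then have "indicator {0<..} s *\<^sub>R (s powr (b - 1) *\<^sub>R g (t + sgn t * s)) = 0" for s using t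
        by (auto simp: g_def indicator_def)
    then have "(LINT s|lborel. indicator {0<..} s *\<^sub>R (s powr (b - 1) *\<^sub>R g (t + sgn t * s)))
        = (LINT s::real|lborel. 0)" by (simp only:)
    then show ?thesis using False by simp
  qed
  finally show ?thesis .
qed

section \<open>\<open>D0_schwartz\<close> as an operator into L^p\<close>

lemma D0_schwartz_0: "t \<noteq> 0 \<Longrightarrow> D0_schwartz 0 F t = F t"
  by (simp add: D0_schwartz_def weyl_zero_def weyl_plus_def weyl_minus_def)

text \<open>True for \<alpha> = 0 as well, because 0 powr 0 = 0; at the origin
  \<open>D0_schwartz 0 F\<close> need not agree with F.\<close>

lemma D0_schwartz_at_0: "D0_schwartz \<alpha> F 0 = 0"
  by (simp add: D0_schwartz_def)

lemma kernel_ek_weyl: "1 \<le> p \<Longrightarrow> 0 < \<alpha> \<Longrightarrow> kernel p (ek \<alpha> (real (weyl_ord \<alpha>) - \<alpha>))"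
  using weyl_ord_bounds[of \<alpha>] by (intro kernel_ek) auto

lemma euler_deriv_Lp: "1 \<le> p \<Longrightarrow> F \<in> schwartz \<Longrightarrow> euler_deriv \<alpha> F \<in> Lp p"
  unfolding euler_deriv_def[abs_def] by (rule schwartz_Lp)

lemma D0_schwartz_AE:
  assumes "0 < \<alpha>" and "F \<in> schwartz"
  shows "AE t in lborel. D0_schwartz \<alpha> F t = complex_of_real (1 / Gamma (\<alpha> + 1)) * dil_op
      (ek \<alpha> (real (weyl_ord \<alpha>) - \<alpha>)) (euler_deriv \<alpha> F) t"
proof -
  have "AE t in lborel. (t :: real) \<noteq> 0" by (rule AE_lborel_singleton)
  then show ?thesis by eventually_elim (rule D0_schwartz_eq[OF assms])
qed

lemma D0_schwartz_Lp:
  assumes p: "1 \<le> p" and a: "0 \<le> \<alpha>" and F: "F \<in> schwartz"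
  shows "D0_schwartz \<alpha> F \<in> Lp p"
proof -
  define E where "E t = (if \<alpha> = 0 then F t else complex_of_real (1 / Gamma (\<alpha> + 1)) * dil_op
      (ek \<alpha> (real (weyl_ord \<alpha>) - \<alpha>)) (euler_deriv \<alpha> F) t)" for t
  have E: "E \<in> Lp p"
  proof (cases "\<alpha> = 0")
    case True then show ?thesis using schwartz_Lp0[OF p F] by (simp add: E_def[abs_def])
  next
    case False
    then show ?thesis using dil_op_bound(2)[OF p kernel_ek_weyl[OF p] euler_deriv_Lp[OF p F]] a
      by (simp only: E_def[abs_def] if_False) (rule Lp_cmult, simp)
  qed
  \<comment> \<open>The formula has to hold at every point, t = 0 included, because Borel
    measurability does not pass to almost everywhere equal functions.\<close>
  have "D0_schwartz \<alpha> F t = (if t = 0 then 0 else E t)" for t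
    using D0_schwartz_eq[OF _ F, of \<alpha> t] a by (auto simp: E_def D0_schwartz_0 D0_schwartz_at_0)
  then have eq: "D0_schwartz \<alpha> F = (\<lambda>t. if t = 0 then 0 else E t)" by (rule ext)
  have [measurable]: "E \<in> borel_measurable borel" using LpD(1)[OF E] .
  have "(\<lambda>t. if t = 0 then 0 else E t) \<in> borel_measurable borel" by measurable
  then show ?thesis unfolding eq using p by (intro Lp_bound_Lp[OF E]) auto
qed

lemma D0_schwartz_lincomb:
  fixes p :: real
  assumes p: "1 \<le> p" and a: "0 \<le> \<alpha>" and F: "F \<in> schwartz" and H: "H \<in> schwartz"
  shows "AE t in lborel. D0_schwartz \<alpha> (\<lambda>x. a * F x + b * H x) t
      = a * D0_schwartz \<alpha> F t + b * D0_schwartz \<alpha> H t"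
proof (cases "\<alpha> = 0")
  case True
  have "AE t in lborel. (t :: real) \<noteq> 0" by (rule AE_lborel_singleton)
  then show ?thesis by eventually_elim (simp add: True D0_schwartz_0)
next
  case False
  then have a: "0 < \<alpha>" using a by simp
  note FH = schwartz_lincomb[OF F H, where a = a and b = b]
  have e: "euler_deriv \<alpha> (\<lambda>x. a * F x + b * H x) = (\<lambda>s. a * euler_deriv \<alpha> F s + b * euler_deriv \<alpha> H s)"
    unfolding euler_deriv_def[abs_def] FH(2) by (simp add: fun_eq_iff algebra_simps)
  show ?thesis
    using D0_schwartz_AE[OF a FH(1)] D0_schwartz_AE[OF a F] D0_schwartz_AE[OF a H]
      dil_op_lincomb[OF p kernel_ek_weyl[OF p a] euler_deriv_Lp[OF p F, where \<alpha>
          = \<alpha>] euler_deriv_Lp[OF p H, where \<alpha> = \<alpha>], where a = a and b = b]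
    unfolding e by eventually_elim (simp add: algebra_simps)
qed

lemma D0_schwartz_reflect:
  assumes a: "0 \<le> \<alpha>" and F: "F \<in> schwartz"
  shows "D0_schwartz \<alpha> (\<lambda>x. F (- x)) t = D0_schwartz \<alpha> F (- t)"
proof -
  note R = schwartz_reflect[OF F]
  consider "t = 0" | "t \<noteq> 0" "\<alpha> = 0" | "t \<noteq> 0" "0 < \<alpha>" using a by linarith
  then show ?thesis
  proof cases
    case 1 then show ?thesis by (simp add: D0_schwartz_at_0)
  next
    case 2 then show ?thesis by (simp add: D0_schwartz_0)
  next
    case 3
    have "euler_deriv \<alpha> (\<lambda>x. F (- x)) = (\<lambda>s. euler_deriv \<alpha> F (- s))"
    proof
      fix s
      have "complex_of_real ((- s) ^ n) * (- 1) ^ n = complex_of_real (s ^ n)" for n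
        by (simp add: of_real_minus_power flip: mult.assoc) (simp flip: power_mult_distrib)
      then show "euler_deriv \<alpha> (\<lambda>x. F (- x)) s = euler_deriv \<alpha> F (- s)"
        unfolding euler_deriv_def R(2) by (simp only: mult.assoc[symmetric] minus_minus)
    qed
    then show ?thesis using D0_schwartz_eq[OF 3(2) R(1) 3(1)] D0_schwartz_eq[OF 3(2) F, of "- t"] 3(1)
      by (simp add: dil_op_reflect)
  qed
qed

section \<open>The closure of the range of \<open>D0_schwartz\<close> in L^p\<close>

definition D0_approx :: "real \<Rightarrow> real \<Rightarrow> (real \<Rightarrow> complex) \<Rightarrow> bool" where
  "D0_approx \<alpha> p h \<longleftrightarrow> h \<in> Lp p \<and> (\<forall>e>0. \<exists>F\<in>schwartz. Lp_norm p (\<lambda>t. D0_schwartz \<alpha> F t - h t) < e)"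

context
  fixes \<alpha> p :: real
  assumes p: "1 \<le> p" and a: "0 \<le> \<alpha>"
begin

lemma D0_approx_limit:
  assumes H: "\<And>i. D0_approx \<alpha> p (H i)" and h: "h \<in> Lp p" and lim: "(\<lambda>i. Lp_norm p (\<lambda>t. H i t - h t)) \<longlonglongrightarrow> 0"
  shows "D0_approx \<alpha> p h"
  unfolding D0_approx_def
proof (intro conjI h allI impI)
  fix e :: real assume e: "0 < e"
  obtain i where i: "Lp_norm p (\<lambda>t. H i t - h t) < e / 2"
    using order_tendstoD(2)[OF lim, of "e / 2"] e by (auto simp: eventually_sequentially)
  obtain F where F: "F \<in> schwartz" "Lp_norm p (\<lambda>t. D0_schwartz \<alpha> F t - H i t) < e / 2"
    using H[of i] e unfolding D0_approx_def by (meson half_gt_zero)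
  have "Lp_norm p (\<lambda>t. D0_schwartz \<alpha> F t - h t) < e"
    using Lp_norm_triangle_diff[OF p D0_schwartz_Lp[OF p a F(1)] _ h, of "H i"] H[of i] F(2) i
    by (simp add: D0_approx_def)
  then show "\<exists>F\<in>schwartz. Lp_norm p (\<lambda>t. D0_schwartz \<alpha> F t - h t) < e" using F(1) by blast
qed

lemma D0_approx_schwartz_limit:
  assumes F: "\<And>i::nat. F i \<in> schwartz" and h: "h \<in> Lp p"
      and lim: "(\<lambda>i. Lp_norm p (\<lambda>t. D0_schwartz \<alpha> (F i) t - h t)) \<longlonglongrightarrow> 0"
  shows "D0_approx \<alpha> p h"
proof -
  have z: "Lp_norm p (\<lambda>t. D0_schwartz \<alpha> (F i) t - D0_schwartz \<alpha> (F i) t) = 0" for i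
    using p by (simp add: Lp_norm_def)
  have "D0_approx \<alpha> p (D0_schwartz \<alpha> (F i))" for i
    unfolding D0_approx_def using D0_schwartz_Lp[OF p a F] F z by metis
  then show ?thesis using h lim by (rule D0_approx_limit)
qed

lemma D0_approx_cong_AE:
  assumes h: "D0_approx \<alpha> p h" and g: "g \<in> borel_measurable borel" and eq: "AE t in lborel. h t = g t"
  shows "D0_approx \<alpha> p g"
proof (rule D0_approx_limit[where H = "\<lambda>_. h"])
  have hL: "h \<in> Lp p" using h by (simp add: D0_approx_def)
  note [measurable] = LpD(1)[OF hL] g
  show "g \<in> Lp p" using eq p by (intro Lp_bound_Lp[OF hL g]) (auto elim!: eventually_mono)
  have "Lp_norm p (\<lambda>t. h t - g t) = Lp_norm p (\<lambda>t. 0)" using eq by (intro Lp_norm_cong_AE) auto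
  then show "(\<lambda>i::nat. Lp_norm p (\<lambda>t. h t - g t)) \<longlonglongrightarrow> 0" using p by (simp add: Lp_norm_def)
qed (rule h)

lemma D0_approx_lincomb:
  assumes h: "D0_approx \<alpha> p h" and g: "D0_approx \<alpha> p g"
  shows "D0_approx \<alpha> p (\<lambda>t. c * h t + d * g t)"
proof -
  have L: "h \<in> Lp p" "g \<in> Lp p" using h g by (auto simp: D0_approx_def)
  have "\<forall>i. \<exists>F\<in>schwartz. Lp_norm p (\<lambda>t. D0_schwartz \<alpha> F t - h t) < 1 / real (Suc i)"
    using h by (simp add: D0_approx_def)
  then obtain F where F: "\<And>i. F i \<in> schwartz" "\<And>i. Lp_norm p (\<lambda>t. D0_schwartz \<alpha> (F i) t - h t)
      < 1 / real (Suc i)" by metis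
  have "\<forall>i. \<exists>F\<in>schwartz. Lp_norm p (\<lambda>t. D0_schwartz \<alpha> F t - g t) < 1 / real (Suc i)"
    using g by (simp add: D0_approx_def)
  then obtain G where G: "\<And>i. G i \<in> schwartz" "\<And>i. Lp_norm p (\<lambda>t. D0_schwartz \<alpha> (G i) t - g t)
      < 1 / real (Suc i)" by metis
  note DF = D0_schwartz_Lp[OF p a F(1)] note DG = D0_schwartz_Lp[OF p a G(1)]
  show ?thesis
  proof (rule D0_approx_schwartz_limit[where F = "\<lambda>i x. c * F i x + d * G i x"])
    show "(\<lambda>x. c * F i x + d * G i x) \<in> schwartz" for i by (rule schwartz_lincomb[OF F(1) G(1)])
    show "(\<lambda>t. c * h t + d * g t) \<in> Lp p" by (rule Lp_lincomb[OF p L])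
    have le: "Lp_norm p (\<lambda>t. D0_schwartz \<alpha> (\<lambda>x. c * F i x + d * G i x) t - (c * h t + d * g t))
        \<le> (cmod c + cmod d) * (1 / real (Suc i))" for i
    proof -
      note [measurable] = LpD(1)[OF L(1)] LpD(1)[OF L(2)] LpD(1)[OF DF] LpD(1)[OF DG]
          LpD(1)[OF D0_schwartz_Lp[OF p a schwartz_lincomb(1)[OF F(1) G(1)]]]
      have "Lp_norm p (\<lambda>t. D0_schwartz \<alpha> (\<lambda>x. c * F i x + d * G i x) t - (c * h t + d * g t))
        = Lp_norm p (\<lambda>t. c * (D0_schwartz \<alpha> (F i) t - h t) + d * (D0_schwartz \<alpha> (G i) t - g t))"
        by (rule Lp_norm_cong_AE) (use D0_schwartz_lincomb[OF p a F(1) G(1), where a = c and b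
            = d] in \<open>auto simp: algebra_simps elim!: eventually_mono\<close>)
      also have "\<dots> \<le> Lp_norm p (\<lambda>t. c * (D0_schwartz \<alpha> (F i) t - h t)) + Lp_norm p
          (\<lambda>t. d * (D0_schwartz \<alpha> (G i) t - g t))"
        by (intro Lp_norm_triangle[OF p] Lp_cmult Lp_diff[OF p] DF DG L)
      also have "\<dots> \<le> cmod c * (1 / real (Suc i)) + cmod d * (1 / real (Suc i))"
        unfolding Lp_norm_cmult[OF p] using less_imp_le[OF F(2)] less_imp_le[OF G(2)]
            by (intro add_mono mult_left_mono) auto
      finally show ?thesis by (simp only: distrib_right)
    qed
    show "(\<lambda>i. Lp_norm p (\<lambda>t. D0_schwartz \<alpha> (\<lambda>x. c * F i x + d * G i x) t - (c * h t + d * g t))) \<longlonglongrightarrow> 0"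
    proof (rule Lim_null_comparison[where g = "\<lambda>i. (cmod c + cmod d) * (1 / real (Suc i))"])
      show "(\<lambda>i. (cmod c + cmod d) * (1 / real (Suc i))) \<longlonglongrightarrow> 0"
          by (rule tendsto_mult_right_zero) real_asymp
      show "\<forall>\<^sub>F i in sequentially. norm (Lp_norm p (\<lambda>t. D0_schwartz \<alpha> (\<lambda>x. c * F i x + d * G i x) t -
          (c * h t + d * g t))) \<le> (cmod c + cmod d) * (1 / real (Suc i))"
        using le by (intro always_eventually allI) (simp only: real_norm_def
            abs_of_nonneg[OF Lp_norm_nonneg])
    qed
  qed
qed

lemma D0_approx_reflect:
  assumes h: "D0_approx \<alpha> p h" shows "D0_approx \<alpha> p (\<lambda>t. h (- t))"
  unfolding D0_approx_def
proof (intro conjI allI impI)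
  show "(\<lambda>t. h (- t)) \<in> Lp p" using h by (intro Lp_reflect) (simp add: D0_approx_def)
  fix e :: real assume "0 < e"
  then obtain F where F: "F \<in> schwartz" "Lp_norm p (\<lambda>t. D0_schwartz \<alpha> F t - h t) < e"
    using h unfolding D0_approx_def by blast
  have "Lp_norm p (\<lambda>t. D0_schwartz \<alpha> (\<lambda>x. F (- x)) t - h (- t))
      = Lp_norm p (\<lambda>t. D0_schwartz \<alpha> F t - h t)"
    unfolding D0_schwartz_reflect[OF a F(1)] Lp_norm_def
    using lborel_integral_reflect[of "\<lambda>t. cmod (D0_schwartz \<alpha> F t - h t) powr p" 0] by simp
  then show "\<exists>F\<in>schwartz. Lp_norm p (\<lambda>t. D0_schwartz \<alpha> F t - h (- t)) < e"
    using F schwartz_reflect(1) by metis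
qed

text \<open>The images of the smoothed exponentials converge to a multiple of this function, by
  \<open>exp_step_tendsto\<close> and \<open>dil_op_ek_exp\<close>; the closure is a linear space,
  so the constant can be divided out.\<close>

lemma D0_approx_exp:
  assumes c: "1 \<le> c"
  shows "D0_approx \<alpha> p (\<lambda>t. complex_of_real (if 0 < t then t powr \<alpha> * exp (- c * t) else 0))"
proof -
  \<comment> \<open>For \<alpha> = 0 no derivative is taken, although \<open>weyl_ord 0\<close> is
    1.\<close>
  define n where "n = (if \<alpha> = 0 then 0 else weyl_ord \<alpha>)"
  define F where "F i = (\<lambda>t. complex_of_real (exp_step c (real (Suc i)) 0 t))" for i :: nat
  have F: "F i \<in> schwartz" for i unfolding F_def using c by (intro exp_step_schwartz) auto
  define h where "h t = complex_of_real (if 0 < t then (c * t) ^ n * exp (- c * t) else 0)" for t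
  define E where "E i t = complex_of_real ((- t) ^ n) * nth_deriv n (F i) t" for i t
  have h: "h \<in> Lp p" and lim: "(\<lambda>i. Lp_norm p (\<lambda>t. E i t - h t)) \<longlonglongrightarrow> 0"
    unfolding h_def[abs_def] E_def F_def using exp_step_tendsto[OF p c, of n] by auto
  have E: "E i \<in> Lp p" for i unfolding E_def using schwartz_Lp[OF p F] .
  show ?thesis
  proof (cases "\<alpha> = 0")
    case True
    have eq: "(\<lambda>t. complex_of_real (if 0 < t then t powr \<alpha> * exp (- c * t) else 0)) = h"
      using True by (auto simp: h_def n_def fun_eq_iff)
    note [measurable] = LpD(1)[OF h] LpD(1)[OF E] LpD(1)[OF D0_schwartz_Lp[OF p a F]]
    have "AE t in lborel. (t :: real) \<noteq> 0" by (rule AE_lborel_singleton)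
    then have "AE t in lborel. D0_schwartz \<alpha> (F i) t - h t = E i t - h t" for i
      by eventually_elim (simp add: True D0_schwartz_0 E_def n_def)
    then have "Lp_norm p (\<lambda>t. D0_schwartz \<alpha> (F i) t - h t) = Lp_norm p (\<lambda>t. E i t - h t)" for i
      by (intro Lp_norm_cong_AE) auto
    then show ?thesis unfolding eq using lim by (intro D0_approx_schwartz_limit[OF F h]) simp
  next
    case False
    then have a: "0 < \<alpha>" using a by simp
    define b where "b = real (weyl_ord \<alpha>) - \<alpha>"
    define K where "K = complex_of_real (1 / Gamma (\<alpha> + 1))"
    have K0: "K \<noteq> 0" 
    proof -
      have "0 < Gamma (\<alpha> + 1)" using a by (intro Gamma_real_pos) simp
      then show ?thesis by (simp add: K_def)
    qed
    have b: "0 < b" using weyl_ord_bounds[of \<alpha>] a by (simp add: b_def)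
    have k: "kernel p (ek \<alpha> b)" unfolding b_def by (rule kernel_ek_weyl[OF p a])
    have nn: "n = weyl_ord \<alpha>" using False by (simp add: n_def)
    have Ee: "E i = euler_deriv \<alpha> (F i)" for i by (simp add: E_def euler_deriv_def[abs_def] nn
        fun_eq_iff)
    define g where "g t = K * dil_op (ek \<alpha> b) h t" for t
    have g: "g \<in> Lp p" unfolding g_def[abs_def] by (intro Lp_cmult dil_op_bound(2)[OF p k h])
    note dE = dil_op_bound(2)[OF p k E] note dh = dil_op_bound(2)[OF p k h]
    note [measurable] = LpD(1)[OF g] LpD(1)[OF D0_schwartz_Lp[OF p less_imp_le[OF a] F]] LpD(1)[OF dE]
        LpD(1)[OF dh]
    have "Lp_norm p (\<lambda>t. D0_schwartz \<alpha> (F i) t - g t) = Lp_norm p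
        (\<lambda>t. K * (dil_op (ek \<alpha> b) (E i) t - dil_op (ek \<alpha> b) h t))" for i
    proof (rule Lp_norm_cong_AE)
      show "(\<lambda>t. D0_schwartz \<alpha> (F i) t - g t) \<in> borel_measurable borel" by measurable
      show "(\<lambda>t. K * (dil_op (ek \<alpha> b) (E i) t - dil_op (ek \<alpha> b) h t)) \<in> borel_measurable borel"
          by measurable
      show "AE t in lborel. D0_schwartz \<alpha> (F i) t - g t
          = K * (dil_op (ek \<alpha> b) (E i) t - dil_op (ek \<alpha> b) h t)"
        using D0_schwartz_AE[OF a F, of i] unfolding K_def[symmetric] b_def[symmetric] Ee[symmetric]
        by eventually_elim (simp add: g_def right_diff_distrib)
    qed
    then have "Lp_norm p (\<lambda>t. D0_schwartz \<alpha> (F i) t - g t)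
        = cmod K * Lp_norm p (\<lambda>t. dil_op (ek \<alpha> b) (E i) t - dil_op (ek \<alpha> b) h t)" for i
      by (simp add: Lp_norm_cmult[OF p])
    then have "(\<lambda>i. Lp_norm p (\<lambda>t. D0_schwartz \<alpha> (F i) t - g t)) \<longlonglongrightarrow> 0"
      using tendsto_mult_right_zero[OF dil_op_tendsto[OF p k E h lim], of "cmod K"] by simp
    then have 1: "D0_approx \<alpha> p g" by (rule D0_approx_schwartz_limit[OF F g])
    have z: "D0_approx \<alpha> p (\<lambda>t. inverse (K * complex_of_real (c powr \<alpha>)) * g t + 0 * g t)"
      by (rule D0_approx_lincomb[OF 1 1])
    show ?thesis
    proof (rule D0_approx_cong_AE[OF z])
      show "(\<lambda>t. complex_of_real (if 0 < t then t powr \<alpha> * exp (- c * t) else 0)) \<in> borel_measurable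
          borel" by measurable
      have "AE t in lborel. (t :: real) \<noteq> 0" by (rule AE_lborel_singleton)
      then show "AE t in lborel. inverse (K * complex_of_real (c powr \<alpha>)) * g t + 0 * g t
          = complex_of_real (if 0 < t then t powr \<alpha> * exp (- c * t) else 0)"
      proof eventually_elim
        case (elim t)
        have "dil_op (ek \<alpha> b) h t = complex_of_real (if 0
            < t then (c * t) powr \<alpha> * exp (- c * t) else 0)"
          unfolding h_def[abs_def] using b c elim by (intro dil_op_ek_exp) (auto simp: b_def nn)
        moreover have "complex_of_real (c powr \<alpha>) \<noteq> 0" using c by simp
        ultimately show ?case using K0 c by (auto simp: g_def powr_mult field_simps)
      qed
    qed
  qed
qed

text \<open>The \<open>u\<close> for which \<open>u * g0\<close> can be approximated contain the polynomials in \<open>exp (- t)\<close>, hence by the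
  Weierstrass theorem all continuous functions of \<open>exp (- t)\<close>, hence all bounded Borel functions.\<close>

definition g0 :: "real \<Rightarrow> complex" where
  "g0 t = complex_of_real (if 0 < t then t powr \<alpha> * exp (- t) else 0)"

lemma g0_Lp: "g0 \<in> Lp p"
  using D0_approx_exp[of 1] by (simp add: D0_approx_def g0_def[abs_def] cong: if_cong)

lemma g0_measurable[measurable]: "g0 \<in> borel_measurable borel"
  using LpD(1)[OF g0_Lp] .

lemma D0_approx_g0_bounded_limit:
  fixes U :: "nat \<Rightarrow> real \<Rightarrow> real"
  assumes m[measurable]: "\<And>i. U i \<in> borel_measurable borel"
      and U: "\<And>i. D0_approx \<alpha> p (\<lambda>t. complex_of_real (U i t) * g0 t)"
    and bd: "\<And>i t. 0 < t \<Longrightarrow> \<bar>U i t\<bar> \<le> C" and lim: "\<And>t. 0 < t \<Longrightarrow> (\<lambda>i. U i t) \<longlonglongrightarrow> u t"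
    and um[measurable]: "u \<in> borel_measurable borel"
  shows "D0_approx \<alpha> p (\<lambda>t. complex_of_real (u t) * g0 t)"
proof -
  have C: "0 \<le> C" using order_trans[OF abs_ge_zero bd[of 1 0]] by simp
  have w: "integrable lborel (\<lambda>t. (C * cmod (g0 t)) powr p)"
    using LpD(2)[OF g0_Lp] C by (simp add: powr_mult)
  have l: "AE t in lborel. (\<lambda>i. complex_of_real (U i t) * g0 t) \<longlonglongrightarrow> complex_of_real (u t) * g0 t"
  proof (rule AE_I2)
    fix t
    show "(\<lambda>i. complex_of_real (U i t) * g0 t) \<longlonglongrightarrow> complex_of_real (u t) * g0 t"
    proof (cases "0 < t")
      case True then show ?thesis using lim by (auto intro!: tendsto_intros)
    qed (simp add: g0_def)
  qed
  have b: "AE t in lborel. cmod (complex_of_real (U i t) * g0 t) \<le> C * cmod (g0 t)" for i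
  proof (rule AE_I2)
    fix t show "cmod (complex_of_real (U i t) * g0 t) \<le> C * cmod (g0 t)"
      using bd[of t i] by (cases "0 < t") (auto simp: norm_mult g0_def intro!: mult_right_mono)
  qed
  have m1: "(\<lambda>t. complex_of_real (U i t) * g0 t) \<in> borel_measurable borel" for i by measurable
  have m2: "(\<lambda>t. complex_of_real (u t) * g0 t) \<in> borel_measurable borel" by measurable
  note D = Lp_dominated_convergence[OF p m1 m2 w l b]
  show ?thesis by (rule D0_approx_limit[OF U D(2,3)])
qed

lemma D0_approx_g0_polynomial: "D0_approx \<alpha> p (\<lambda>t. complex_of_real (\<Sum>i\<le>n. c i * exp (- t) ^ i) * g0 t)"
proof (induction n)
  \<comment> \<open>The factor exp (- t)^i raises the rate of the exponential from 1 to 1 + i, and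
    \<open>D0_approx_exp\<close> covers all rates from 1 on.\<close>
  have e: "D0_approx \<alpha> p (\<lambda>t. complex_of_real (exp (- t) ^ i) * g0 t)" for i
  proof -
    have "(\<lambda>t. complex_of_real (exp (- t) ^ i) * g0 t) = (\<lambda>t. complex_of_real (if 0
        < t then t powr \<alpha> * exp (- (1 + real i) * t) else 0))"
    proof
      fix t
      have "exp (- t) ^ i * exp (- t) = exp (- (1 + real i) * t)"
        by (simp add: algebra_simps flip: exp_of_nat_mult exp_add)
      then show "complex_of_real (exp (- t) ^ i) * g0 t
          = complex_of_real (if 0 < t then t powr \<alpha> * exp (- (1 + real i) * t) else 0)"
      proof (cases "0 < t")
        case True
        have "complex_of_real (exp (- t) ^ i) * g0 t = complex_of_real
            (t powr \<alpha> * (exp (- t) ^ i * exp (- t)))"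
          using True by (simp add: g0_def)
        then show ?thesis using True \<open>exp (- t) ^ i * exp (- t) = exp (- (1 + real i) * t)\<close>
            by (simp only: if_True)
      qed (simp add: g0_def)
    qed
    then show ?thesis using D0_approx_exp[of "1 + real i"] by simp
  qed
  {
    case 0
    show ?case using D0_approx_lincomb[OF e[of 0] e[of 0], of "complex_of_real (c 0)" 0] by simp
  next
    case (Suc n)
    show ?case using D0_approx_lincomb[OF Suc e[of "Suc n"], of 1 "complex_of_real (c (Suc n))"]
      by (simp add: algebra_simps)
  }
qed

lemma D0_approx_g0_continuous:
  assumes f: "continuous_on UNIV (f :: real \<Rightarrow> real)"
  shows "D0_approx \<alpha> p (\<lambda>t. complex_of_real (f (exp (- t))) * g0 t)"
proof -
  have [measurable]: "f \<in> borel_measurable borel" using f by (rule borel_measurable_continuous_onI)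
  have f1: "continuous_on {0..1} f" using f by (rule continuous_on_subset) simp
  have "\<exists>c n. \<forall>x\<in>{0..1}. \<bar>f x - (\<Sum>i\<le>n. c i * x ^ i)\<bar> < 1 / real (Suc k)" for k :: nat
  proof -
    obtain g where g: "real_polynomial_function g" "\<And>x. x \<in> {0..1} \<Longrightarrow> \<bar>f x - g x\<bar> < 1 / real (Suc k)"
      using Stone_Weierstrass_real_polynomial_function[of "{0..1}" f "1 / real (Suc k)"] f1
          by (auto simp del: of_nat_Suc)
    then show ?thesis using real_polynomial_function_imp_sum[OF g(1)] by metis
  qed
  then obtain c n where cn: "\<And>k x. x \<in> {0..1} \<Longrightarrow> \<bar>f x - (\<Sum>i\<le>n k. c k i * x ^ i)\<bar> < 1 / real (Suc k)"
    by metis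
  have "compact (f ` {0..1})" using f1 by (rule compact_continuous_image) simp
  then obtain B where B: "\<And>x. x \<in> {0..1} \<Longrightarrow> \<bar>f x\<bar> \<le> B"
    using compact_imp_bounded bounded_iff by (metis imageI real_norm_def)
  show ?thesis
  proof (rule D0_approx_g0_bounded_limit[where U = "\<lambda>k t. \<Sum>i\<le>n k. c k i * exp (- t) ^ i" and C
      = "B + 1"])
    show "D0_approx \<alpha> p (\<lambda>t. complex_of_real (\<Sum>i\<le>n k. c k i * exp (- t) ^ i) * g0 t)" for k
      by (rule D0_approx_g0_polynomial)
    fix t :: real assume "0 < t"
    then have x: "exp (- t) \<in> {0..1}" by simp
    show "\<bar>\<Sum>i\<le>n k. c k i * exp (- t) ^ i\<bar> \<le> B + 1" for k
    proof -
      have "1 / real (Suc k) \<le> 1" by simp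
      then show ?thesis using cn[OF x, of k] B[OF x] by linarith
    qed
    have "(\<lambda>k. f (exp (- t)) - (\<Sum>i\<le>n k. c k i * exp (- t) ^ i)) \<longlonglongrightarrow> 0"
    proof (rule Lim_null_comparison)
      show "\<forall>\<^sub>F k in sequentially. norm (f (exp (- t)) - (\<Sum>i\<le>n k. c k i * exp (- t) ^ i))
          \<le> 1 / real (Suc k)"
        using cn[OF x] by (auto intro!: always_eventually less_imp_le simp del: of_nat_Suc)
      show "(\<lambda>k. 1 / real (Suc k)) \<longlonglongrightarrow> 0" by real_asymp
    qed
    from tendsto_diff[OF tendsto_const[of "f (exp (- t))"] this]
    show "(\<lambda>k. \<Sum>i\<le>n k. c k i * exp (- t) ^ i) \<longlonglongrightarrow> f (exp (- t))" by simp
  qed measurable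
qed

lemma D0_approx_g0_bounded:
  assumes u[measurable]: "u \<in> borel_measurable borel" and bd: "\<And>x. \<bar>u x\<bar> \<le> C"
  shows "D0_approx \<alpha> p (\<lambda>t. complex_of_real (u t) * g0 t)"
  using u bd
proof (rule bounded_borel_induct)
  show one: "D0_approx \<alpha> p (\<lambda>t. complex_of_real 1 * g0 t)"
    using D0_approx_g0_continuous[of "\<lambda>_. 1"] by simp
  show "D0_approx \<alpha> p (\<lambda>t. complex_of_real (indicator {a<..} t) * g0 t)" for a
  proof -
    define s where "s = exp (- a)"
    \<comment> \<open>The condition a < t means exp (- t) < s, and \<open>f k\<close> is a ramp of
      slope k below s that tends to the indicator of this condition.\<close>
    define f where "f k x = max 0 (min 1 (real k * (s - x)))" for k x
    show ?thesis
    proof (rule D0_approx_g0_bounded_limit[where U = "\<lambda>k t. f k (exp (- t))" and C = 1])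
      show "D0_approx \<alpha> p (\<lambda>t. complex_of_real (f k (exp (- t))) * g0 t)" for k
        unfolding f_def by (intro D0_approx_g0_continuous continuous_intros)
      show "(\<lambda>k. f k (exp (- t))) \<longlonglongrightarrow> indicator {a<..} t" for t
      proof (cases "a < t")
        case True
        then have d: "0 < s - exp (- t)" by (simp add: s_def)
        obtain N where N: "1 / (s - exp (- t)) < real N" using reals_Archimedean2 by blast
        have "f k (exp (- t)) = indicator {a<..} t" if "N \<le> k" for k
        proof -
          have "1 / (s - exp (- t)) \<le> real k" using N that by simp
          then have "1 \<le> real k * (s - exp (- t))" using d by (simp add: field_simps)
          then show ?thesis using True by (simp add: f_def)
        qed
        then show ?thesis by (intro tendsto_eventually eventually_sequentiallyI[of N])
      next
        case False
        then have "real k * (s - exp (- t)) \<le> 0" for k by (intro mult_nonneg_nonpos) (auto simp: s_def)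
        then have "f k (exp (- t)) = 0" for k unfolding f_def by (metis max.absorb1 min.coboundedI2)
        then show ?thesis using False by simp
      qed
      show "(\<lambda>t. f k (exp (- t))) \<in> borel_measurable borel" for k unfolding f_def by measurable
      show "\<bar>f k (exp (- t))\<bar> \<le> 1" for k t by (simp add: f_def)
    qed measurable
  qed
next
  fix u v :: "real \<Rightarrow> real" and c d
  assume "D0_approx \<alpha> p (\<lambda>t. complex_of_real (u t) * g0 t)"
      "D0_approx \<alpha> p (\<lambda>t. complex_of_real (v t) * g0 t)"
  from D0_approx_lincomb[OF this, of "complex_of_real c" "complex_of_real d"]
  show "D0_approx \<alpha> p (\<lambda>t. complex_of_real (c * u t + d * v t) * g0 t)" by (simp add: algebra_simps)
next
  fix U :: "nat \<Rightarrow> real \<Rightarrow> real" and u :: "real \<Rightarrow> real" and C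
  assume [measurable]: "\<And>i. U i \<in> borel_measurable borel"
    and U: "\<And>i. D0_approx \<alpha> p (\<lambda>t. complex_of_real (U i t) * g0 t)" "\<And>i x. \<bar>U i x\<bar>
        \<le> C" "\<And>x. (\<lambda>i. U i x) \<longlonglongrightarrow> u x"
  have "u \<in> borel_measurable borel" using U(3) by (intro borel_measurable_LIMSEQ_real[of borel U u]) auto
  then show "D0_approx \<alpha> p (\<lambda>t. complex_of_real (u t) * g0 t)"
    using U by (intro D0_approx_g0_bounded_limit[of U C u]) auto
qed

text \<open>\<open>g0\<close> has no zero on the half-line, so h is \<open>g0\<close> times a
  quotient; cutting the quotient off at height n gives bounded weights, and all products are
  dominated by |h|.\<close>

lemma D0_approx_half_line:
  assumes h: "h \<in> Lp p"
  shows "D0_approx \<alpha> p (\<lambda>t. if 0 < t then h t else 0)"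
proof -
  note [measurable] = LpD(1)[OF h]
  define q where "q t = (if 0 < t then h t / g0 t else 0)" for t
  have [measurable]: "q \<in> borel_measurable borel" unfolding q_def by measurable
  define w where "w n t = (if cmod (q t) \<le> real n then q t else 0)" for n t
  have [measurable]: "w n \<in> borel_measurable borel" for n unfolding w_def by measurable
  have wb: "cmod (w n t) \<le> real n" for n t by (simp add: w_def)
  have 1: "D0_approx \<alpha> p (\<lambda>t. w n t * g0 t)" for n
  proof -
    have "D0_approx \<alpha> p (\<lambda>t. complex_of_real (Re (w n t)) * g0 t)"
        "D0_approx \<alpha> p (\<lambda>t. complex_of_real (Im (w n t)) * g0 t)"
      using order_trans[OF abs_Re_le_cmod wb] order_trans[OF abs_Im_le_cmod wb]
      by (auto intro!: D0_approx_g0_bounded[where C = "real n"])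
    from D0_approx_lincomb[OF this, of 1 \<i>]
    have "D0_approx \<alpha> p (\<lambda>t. 1 * (complex_of_real (Re (w n t)) * g0 t) + \<i> *
        (complex_of_real (Im (w n t)) * g0 t))" .
    moreover have "1 * (complex_of_real (Re (w n t)) * g0 t) + \<i> * (complex_of_real (Im (w n t)) * g0 t)
        = w n t * g0 t" for t
      by (subst (3) complex_eq) (simp add: algebra_simps)
    ultimately show ?thesis by simp
  qed
  have qg: "q t * g0 t = h t" if "0 < t" for t using that by (simp add: q_def g0_def)
  have f: "(\<lambda>t. if 0 < t then h t else 0) \<in> borel_measurable borel" by measurable
  have wm: "(\<lambda>t. w n t * g0 t) \<in> borel_measurable borel" for n by measurable
  have l: "AE t in lborel. (\<lambda>n. w n t * g0 t) \<longlonglongrightarrow> (if 0 < t then h t else 0)"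
  proof (rule AE_I2)
    fix t
    obtain N where "cmod (q t) \<le> real N" using real_arch_simple by blast
    then have "\<forall>\<^sub>F n in sequentially. w n t * g0 t = (if 0 < t then h t else 0)"
      using qg by (intro eventually_sequentiallyI[of N]) (auto simp: w_def g0_def)
    then show "(\<lambda>n. w n t * g0 t) \<longlonglongrightarrow> (if 0 < t then h t else 0)" by (rule tendsto_eventually)
  qed
  have b: "AE t in lborel. cmod (w n t * g0 t) \<le> cmod (h t)" for n
  proof (rule AE_I2)
    fix t show "cmod (w n t * g0 t) \<le> cmod (h t)"
      using qg[of t] by (cases "0 < t") (auto simp: w_def g0_def)
  qed
  note D = Lp_dominated_convergence[OF p wm f LpD(2)[OF h] l b]
  show ?thesis by (rule D0_approx_limit[OF 1 D(2,3)])
qed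

lemma D0_approx_all:
  assumes h: "h \<in> Lp p" shows "D0_approx \<alpha> p h"
proof -
  have 1: "D0_approx \<alpha> p (\<lambda>t. if 0 < t then h t else 0)" by (rule D0_approx_half_line[OF h])
  have 2: "D0_approx \<alpha> p (\<lambda>t. if 0 < - t then h (- (- t)) else 0)"
    using D0_approx_reflect[OF D0_approx_half_line[OF Lp_reflect[OF h]]] .
  have "AE t in lborel. (t :: real) \<noteq> 0" by (rule AE_lborel_singleton)
  then have "AE t in lborel. 1 * (if 0 < t then h t else 0) + 1 * (if 0 < - t then h (- (- t)) else 0)
      = h t"
    by eventually_elim auto
  from D0_approx_cong_AE[OF D0_approx_lincomb[OF 1 2] LpD(1)[OF h] this] show ?thesis .
qed

end

section \<open>The space as the image of a fractional integral\<close>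

text \<open>The inverse of D0. The factor Gamma (\<alpha> + 1) undoes the normalisation in
  \<open>D0_schwartz\<close>; for \<alpha> > 0 and t > 0 the value is \<alpha> times the integral of
  (s - t)^(\<alpha> - 1) s^(- \<alpha>) h s over s > t. Order 0 is split off because its kernel
  would be a point mass.\<close>

definition weyl_int :: "real \<Rightarrow> (real \<Rightarrow> complex) \<Rightarrow> real \<Rightarrow> complex" where
  "weyl_int \<alpha> h = (if \<alpha> = 0 then h else (\<lambda>t. complex_of_real (Gamma (\<alpha> + 1)) * dil_op (ek 0 \<alpha>) h t))"

lemma kernel_ek0: "1 \<le> p \<Longrightarrow> 0 < \<alpha> \<Longrightarrow> kernel p (ek 0 \<alpha>)"
  by (intro kernel_ek) auto

lemma weyl_int_Lp:
  assumes "1 \<le> p" "0 \<le> \<alpha>" "h \<in> Lp p"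
  shows "weyl_int \<alpha> h \<in> Lp p"
  using assms dil_op_bound(2)[OF assms(1) kernel_ek0 assms(3)]
      by (auto simp: weyl_int_def intro!: Lp_cmult)

lemma weyl_int_lincomb:
  assumes p: "1 \<le> p" and a: "0 \<le> \<alpha>" and h: "h \<in> Lp p" "g \<in> Lp p"
  shows "AE t in lborel. weyl_int \<alpha> (\<lambda>s. c * h s + d * g s) t = c * weyl_int \<alpha> h t + d * weyl_int \<alpha> g t"
proof (cases "\<alpha> = 0")
  case False
  then have "kernel p (ek 0 \<alpha>)" using p a by (intro kernel_ek0) auto
  from dil_op_lincomb[OF p this h, of c d] show ?thesis
    by eventually_elim (simp add: weyl_int_def algebra_simps)
qed (simp add: weyl_int_def)

lemma weyl_int_tendsto:
  assumes p: "1 \<le> p" and a: "0 \<le> \<alpha>" and H: "\<And>n. H n \<in> Lp p" and h: "h \<in> Lp p"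
    and lim: "(\<lambda>n. Lp_norm p (\<lambda>t. H n t - h t)) \<longlonglongrightarrow> 0"
  shows "(\<lambda>n. Lp_norm p (\<lambda>t. weyl_int \<alpha> (H n) t - weyl_int \<alpha> h t)) \<longlonglongrightarrow> 0"
proof (cases "\<alpha> = 0")
  case False
  then have k: "kernel p (ek 0 \<alpha>)" using p a by (intro kernel_ek0) auto
  show ?thesis using False tendsto_mult_right_zero[OF dil_op_tendsto[OF p k H h lim],
      of "cmod (complex_of_real (Gamma (\<alpha> + 1)))"]
    by (simp only: weyl_int_def if_False right_diff_distrib[symmetric] Lp_norm_cmult[OF p])
qed (use lim in \<open>simp add: weyl_int_def\<close>)

lemma weyl_int_injective:
  assumes p: "1 \<le> p" and a: "0 \<le> \<alpha>" and h: "h \<in> Lp p" and z: "AE t in lborel. weyl_int \<alpha> h t = 0"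
  shows "AE t in lborel. h t = 0"
proof (cases "\<alpha> = 0")
  case False
  then have a: "0 < \<alpha>" using a by simp
  then have G: "0 < Gamma (\<alpha> + 1)" by (intro Gamma_real_pos) simp
  have "AE t in lborel. dil_op (ek 0 \<alpha>) h t = 0"
    using z by eventually_elim (use G False in \<open>simp add: weyl_int_def\<close>)
  then show ?thesis by (rule ek_injective[OF p a h])
qed (use z in \<open>simp add: weyl_int_def\<close>)

lemma weyl_int_commute:
  assumes p: "1 \<le> p" and a: "0 \<le> \<alpha>" and k: "kernel p k" and h: "h \<in> Lp p"
  shows "AE t in lborel. dil_op k (weyl_int \<alpha> h) t = weyl_int \<alpha> (dil_op k h) t"
proof (cases "\<alpha> = 0")
  case False
  then have "kernel p (ek 0 \<alpha>)" using p a by (intro kernel_ek0) auto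
  from dil_op_commute[OF p k this h] show ?thesis
    by eventually_elim (use False in \<open>simp add: weyl_int_def dil_op_cmult\<close>)
qed (simp add: weyl_int_def)

text \<open>The orders \<alpha> and \<open>weyl_ord \<alpha>\<close> - \<alpha> add up to an
  integer, for which \<open>ek_taylor\<close> applies.\<close>

lemma weyl_int_D0_schwartz:
  fixes p :: real
  assumes p: "1 \<le> p" and a: "0 \<le> \<alpha>" and F: "F \<in> schwartz"
  shows "AE t in lborel. weyl_int \<alpha> (D0_schwartz \<alpha> F) t = F t"
proof (cases "\<alpha> = 0")
  case True
  have "AE t in lborel. (t :: real) \<noteq> 0" by (rule AE_lborel_singleton)
  then show ?thesis by eventually_elim (simp add: weyl_int_def True D0_schwartz_0)
next
  case False
  then have a0: "0 < \<alpha>" using a by simp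
  define b where "b = real (weyl_ord \<alpha>) - \<alpha>"
  define K where "K = complex_of_real (1 / Gamma (\<alpha> + 1))"
  have G: "0 < Gamma (\<alpha> + 1)" using a0 by (intro Gamma_real_pos) simp
  have b: "0 < b" using weyl_ord_bounds[of \<alpha>] a by (simp add: b_def)
  have k0: "kernel p (ek 0 \<alpha>)" using p a0 by (rule kernel_ek0)
  have k1: "kernel p (ek \<alpha> b)" unfolding b_def by (rule kernel_ek_weyl[OF p a0])
  have E: "euler_deriv \<alpha> F \<in> Lp p" by (rule euler_deriv_Lp[OF p F])
  have c: "conv (ek 0 \<alpha>) (ek \<alpha> b) = ek 0 (real (weyl_ord \<alpha>))"
    using conv_ek[OF a0 b, of 0] by (simp add: b_def)
  obtain n where n: "weyl_ord \<alpha> = Suc n" by (simp add: weyl_ord_def)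
  have 1: "AE t in lborel. dil_op (ek 0 \<alpha>) (D0_schwartz \<alpha> F) t
      = dil_op (ek 0 \<alpha>) (\<lambda>t. K * dil_op (ek \<alpha> b) (euler_deriv \<alpha> F) t) t"
    using D0_schwartz_AE[OF a0 F] unfolding K_def[symmetric] b_def[symmetric]
    by (intro dil_op_cong_AE[OF p k0 D0_schwartz_Lp[OF p a F]] Lp_cmult dil_op_bound(2)[OF p k1 E])
  have 2: "AE t in lborel. dil_op (ek 0 (real (weyl_ord \<alpha>))) (euler_deriv \<alpha> F) t = F t"
    unfolding euler_deriv_def[abs_def] n by (rule ek_taylor[OF p F])
  have KG: "complex_of_real (Gamma (\<alpha> + 1)) * K = 1" using G by (simp add: K_def)
  show ?thesis using 1 2 dil_op_comp[OF p k0 k1 E] unfolding c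
    by eventually_elim (use False KG in \<open>simp add: weyl_int_def dil_op_cmult flip: mult.assoc\<close>)
qed

text \<open>Continuity of J works in both directions: D0 F_n -> h implies F_n -> J h, because J (D0
  F_n) = F_n. So f has to be J h; conversely, a sequence with D0 F_n -> h, which density supplies,
  converges to f by itself.\<close>

lemma D0_graph_iff:
  assumes p: "1 \<le> p" and a: "0 \<le> \<alpha>"
  shows "D0_graph \<alpha> p f h \<longleftrightarrow> f \<in> Lp p \<and> h \<in> Lp p \<and> (AE t in lborel. f t = weyl_int \<alpha> h t)"
proof
  assume "D0_graph \<alpha> p f h"
  then obtain F where L: "f \<in> Lp p" "h \<in> Lp p" and F: "\<And>n::nat. F n \<in> schwartz"
    and l1: "(\<lambda>n. Lp_norm p (\<lambda>t. F n t - f t)) \<longlonglongrightarrow> 0"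
    and l2: "(\<lambda>n. Lp_norm p (\<lambda>t. D0_schwartz \<alpha> (F n) t - h t)) \<longlonglongrightarrow> 0"
    unfolding D0_graph_def by blast
  note DL = D0_schwartz_Lp[OF p a F]
  note JL = weyl_int_Lp[OF p a L(2)]
  note [measurable] = LpD(1)[OF L(1)] LpD(1)[OF JL] LpD(1)[OF weyl_int_Lp[OF p a DL]]
      schwartz_measurable0[OF F]
  have "Lp_norm p (\<lambda>t. weyl_int \<alpha> (D0_schwartz \<alpha> (F n)) t - weyl_int \<alpha> h t)
      = Lp_norm p (\<lambda>t. F n t - weyl_int \<alpha> h t)" for n
    by (rule Lp_norm_cong_AE) (use weyl_int_D0_schwartz[OF p a F, of n] in \<open>auto elim!: eventually_mono\<close>)
  then have "(\<lambda>n. Lp_norm p (\<lambda>t. F n t - weyl_int \<alpha> h t)) \<longlonglongrightarrow> 0"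
    using weyl_int_tendsto[OF p a DL L(2) l2] by simp
  from Lp_limit_unique_AE[OF p schwartz_Lp0[OF p F] L(1) JL l1 this]
  show "f \<in> Lp p \<and> h \<in> Lp p \<and> (AE t in lborel. f t = weyl_int \<alpha> h t)" using L by simp
next
  assume r: "f \<in> Lp p \<and> h \<in> Lp p \<and> (AE t in lborel. f t = weyl_int \<alpha> h t)"
  then have L: "f \<in> Lp p" "h \<in> Lp p" and eq: "AE t in lborel. f t = weyl_int \<alpha> h t" by auto
  have "\<forall>i. \<exists>F\<in>schwartz. Lp_norm p (\<lambda>t. D0_schwartz \<alpha> F t - h t) < 1 / real (Suc i)"
    using D0_approx_all[OF p a L(2)] by (simp add: D0_approx_def)
  then obtain F where F: "\<And>i. F i \<in> schwartz" "\<And>i. Lp_norm p (\<lambda>t. D0_schwartz \<alpha> (F i) t - h t)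
      < 1 / real (Suc i)" by metis
  have l2: "(\<lambda>i. Lp_norm p (\<lambda>t. D0_schwartz \<alpha> (F i) t - h t)) \<longlonglongrightarrow> 0"
  proof (rule Lim_null_comparison[where g = "\<lambda>i. 1 / real (Suc i)"])
    show "\<forall>\<^sub>F i in sequentially. norm (Lp_norm p (\<lambda>t. D0_schwartz \<alpha> (F i) t - h t)) \<le> 1 / real (Suc i)"
      using F(2) by (auto simp: Lp_norm_nonneg intro!: always_eventually less_imp_le simp
          del: of_nat_Suc)
    show "(\<lambda>i. 1 / real (Suc i)) \<longlonglongrightarrow> 0" by real_asymp
  qed
  note DL = D0_schwartz_Lp[OF p a F(1)]
  note JL = weyl_int_Lp[OF p a L(2)]
  note [measurable] = LpD(1)[OF L(1)] LpD(1)[OF JL] LpD(1)[OF weyl_int_Lp[OF p a DL]]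
      schwartz_measurable0[OF F(1)]
  have "Lp_norm p (\<lambda>t. weyl_int \<alpha> (D0_schwartz \<alpha> (F n)) t - weyl_int \<alpha> h t)
      = Lp_norm p (\<lambda>t. F n t - f t)" for n
  proof (rule Lp_norm_cong_AE)
    show "AE t in lborel. weyl_int \<alpha> (D0_schwartz \<alpha> (F n)) t - weyl_int \<alpha> h t = F n t - f t"
      using eq weyl_int_D0_schwartz[OF p a F(1), of n] by eventually_elim simp
  qed measurable
  then have "(\<lambda>n. Lp_norm p (\<lambda>t. F n t - f t)) \<longlonglongrightarrow> 0"
    using weyl_int_tendsto[OF p a DL L(2) l2] by simp
  then show "D0_graph \<alpha> p f h" unfolding D0_graph_def using L F(1) l2 by blast
qed

section \<open>\<open>T_space\<close> as a copy of L^p\<close>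

context
  fixes \<alpha> p :: real
  assumes p: "1 \<le> p" and a: "0 \<le> \<alpha>"
begin

lemma D0_graph_D0: "f \<in> T_space \<alpha> p \<Longrightarrow> D0_graph \<alpha> p f (D0 \<alpha> p f)"
  using someI_ex[of "D0_graph \<alpha> p f"] by (simp add: T_space_def D0_def)

lemma T_spaceD:
  assumes "f \<in> T_space \<alpha> p"
  shows "f \<in> Lp p" "D0 \<alpha> p f \<in> Lp p" "AE t in lborel. f t = weyl_int \<alpha> (D0 \<alpha> p f) t"
  using D0_graph_D0[OF assms] unfolding D0_graph_iff[OF p a] by auto

text \<open>\<open>D0\<close> is a choice among the h related to f; injectivity of J shows that any
  two agree almost everywhere, and this determines \<open>T_norm\<close>.\<close>

lemma T_spaceI:
  assumes f: "f \<in> Lp p" and h: "h \<in> Lp p" and eq: "AE t in lborel. f t = weyl_int \<alpha> h t"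
  shows "f \<in> T_space \<alpha> p" "AE t in lborel. D0 \<alpha> p f t = h t" "T_norm \<alpha> p f = Lp_norm p h"
proof -
  have "D0_graph \<alpha> p f h" using assms by (simp add: D0_graph_iff[OF p a])
  then show T: "f \<in> T_space \<alpha> p" by (auto simp: T_space_def)
  note D = T_spaceD[OF T]
  have "AE t in lborel. weyl_int \<alpha> (\<lambda>s. 1 * D0 \<alpha> p f s + (- 1) * h s) t = 0"
    using weyl_int_lincomb[OF p a D(2) h, of 1 "- 1"] D(3) eq by eventually_elim simp
  from weyl_int_injective[OF p a Lp_lincomb[OF p D(2) h] this]
  show 1: "AE t in lborel. D0 \<alpha> p f t = h t" by simp
  show "T_norm \<alpha> p f = Lp_norm p h"
    unfolding T_norm_def using LpD(1)[OF D(2)] LpD(1)[OF h] 1 by (rule Lp_norm_cong_AE)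
qed

lemma T_space_weyl_int:
  assumes "h \<in> Lp p"
  shows "weyl_int \<alpha> h \<in> T_space \<alpha> p" "T_norm \<alpha> p (weyl_int \<alpha> h) = Lp_norm p h"
  using T_spaceI[OF weyl_int_Lp[OF p a assms] assms] by auto

lemma T_space_lincomb:
  assumes f: "f \<in> T_space \<alpha> p" and g: "g \<in> T_space \<alpha> p"
  shows "(\<lambda>t. c * f t + d * g t) \<in> T_space \<alpha> p"
    "AE t in lborel. D0 \<alpha> p (\<lambda>t. c * f t + d * g t) t = c * D0 \<alpha> p f t + d * D0 \<alpha> p g t"
    "T_norm \<alpha> p (\<lambda>t. c * f t + d * g t) = Lp_norm p (\<lambda>t. c * D0 \<alpha> p f t + d * D0 \<alpha> p g t)"
proof -
  note F = T_spaceD[OF f] note G = T_spaceD[OF g]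
  have eq: "AE t in lborel. c * f t + d * g t = weyl_int \<alpha> (\<lambda>t. c * D0 \<alpha> p f t + d * D0 \<alpha> p g t) t"
    using weyl_int_lincomb[OF p a F(2) G(2), of c d] F(3) G(3) by eventually_elim simp
  note T_spaceI[OF Lp_lincomb[OF p F(1) G(1)] Lp_lincomb[OF p F(2) G(2)] eq]
  then show "(\<lambda>t. c * f t + d * g t) \<in> T_space \<alpha> p"
    "AE t in lborel. D0 \<alpha> p (\<lambda>t. c * f t + d * g t) t = c * D0 \<alpha> p f t + d * D0 \<alpha> p g t"
    "T_norm \<alpha> p (\<lambda>t. c * f t + d * g t) = Lp_norm p (\<lambda>t. c * D0 \<alpha> p f t + d * D0 \<alpha> p g t)" by auto
qed

lemma T_norm_cong_AE:
  assumes f: "f \<in> T_space \<alpha> p" and g: "g \<in> T_space \<alpha> p" and eq: "AE t in lborel. f t = g t"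
  shows "T_norm \<alpha> p f = T_norm \<alpha> p g"
proof -
  note F = T_spaceD[OF f] note G = T_spaceD[OF g]
  have "AE t in lborel. f t = weyl_int \<alpha> (D0 \<alpha> p g) t" using eq G(3) by eventually_elim simp
  from T_spaceI(3)[OF F(1) G(2) this] show ?thesis by (simp add: T_norm_def)
qed

lemma dil_op_T_space:
  assumes k: "kernel p k" and f: "f \<in> T_space \<alpha> p"
  shows "dil_op k f \<in> T_space \<alpha> p" "AE t in lborel. D0 \<alpha> p (dil_op k f) t = dil_op k (D0 \<alpha> p f) t"
    "T_norm \<alpha> p (dil_op k f) = Lp_norm p (dil_op k (D0 \<alpha> p f))"
proof -
  note F = T_spaceD[OF f]
  have eq: "AE t in lborel. dil_op k f t = weyl_int \<alpha> (dil_op k (D0 \<alpha> p f)) t"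
    using dil_op_cong_AE[OF p k F(1) weyl_int_Lp[OF p a F(2)] F(3)] weyl_int_commute[OF p a k F(2)]
        by eventually_elim simp
  note T_spaceI[OF dil_op_bound(2)[OF p k F(1)] dil_op_bound(2)[OF p k F(2)] eq]
  then show "dil_op k f \<in> T_space \<alpha> p" "AE t in lborel. D0 \<alpha> p (dil_op k f) t = dil_op k (D0 \<alpha> p f) t"
    "T_norm \<alpha> p (dil_op k f) = Lp_norm p (dil_op k (D0 \<alpha> p f))" by auto
qed

lemma dil_op_bounded_op_on:
  assumes k: "kernel p k"
  shows "bounded_op_on (T_space \<alpha> p) (T_norm \<alpha> p) (dil_op k)"
    and "f \<in> T_space \<alpha> p \<Longrightarrow> T_norm \<alpha> p (dil_op k f) \<le> mass p k * T_norm \<alpha> p f"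
proof -
  show b: "T_norm \<alpha> p (dil_op k f) \<le> mass p k * T_norm \<alpha> p f" if "f \<in> T_space \<alpha> p" for f
    using dil_op_T_space(3)[OF k that] dil_op_bound(3)[OF p k T_spaceD(2)[OF that]]
        by (simp add: T_norm_def)
  show "bounded_op_on (T_space \<alpha> p) (T_norm \<alpha> p) (dil_op k)"
    unfolding bounded_op_on_def
  proof (intro conjI ballI allI)
    show "dil_op k f \<in> T_space \<alpha> p" if "f \<in> T_space \<alpha> p" for f using dil_op_T_space(1)[OF k that] .
    show "AE t in lborel. dil_op k (\<lambda>s. c * f s + d * g s) t = c * dil_op k f t + d * dil_op k g t"
      if "f \<in> T_space \<alpha> p" "g \<in> T_space \<alpha> p" for f g c d
      using dil_op_lincomb[OF p k T_spaceD(1)[OF that(1)] T_spaceD(1)[OF that(2)]] .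
    show "\<exists>C. \<forall>f\<in>T_space \<alpha> p. T_norm \<alpha> p (dil_op k f) \<le> C * T_norm \<alpha> p f" using b by blast
  qed
qed

end

section \<open>Approximate eigenvectors\<close>

text \<open>In the variable ln t, and up to the factor t^(- 1 / p), this is a plane wave of
  frequency \<xi> on [0, N].\<close>

definition power_wave :: "real \<Rightarrow> real \<Rightarrow> real \<Rightarrow> real \<Rightarrow> complex" where
  "power_wave p \<xi> N t = (if 1 \<le> t \<and> t \<le> exp N then t powr (- 1 / p) *\<^sub>R cis (\<xi> * ln t) else 0)"

lemma ln_le_iff_le_exp: "0 < t \<Longrightarrow> ln t \<le> c \<longleftrightarrow> t \<le> exp c" for t c :: real
  by (metis exp_le_cancel_iff exp_ln)

lemma powr_inverse_root:
  fixes p t :: real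
  assumes "1 \<le> p" "0 < t" shows "(t powr (- 1 / p)) powr p = 1 / t"
proof -
  have "- 1 / p * p = - 1" using assms by simp
  then show ?thesis using assms by (simp only: powr_powr powr_minus_divide) simp
qed

lemma power_wave_measurable[measurable]: "power_wave p \<xi> N \<in> borel_measurable borel"
  unfolding power_wave_def by measurable

lemma log_indicator_integral:
  fixes g :: "real \<Rightarrow> real"
  assumes [measurable]: "g \<in> borel_measurable borel"
  shows "integrable lborel (\<lambda>t. indicator {0<..} t *\<^sub>R (g (ln t) / t)) \<longleftrightarrow> integrable lborel g"
    and "(LINT t|lborel. indicator {0<..} t *\<^sub>R (g (ln t) / t)) = integral\<^sup>L lborel g"
  using exp_substitution[of "\<lambda>t. g (ln t) / t"] by simp_all

lemma power_wave_Lp: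
  assumes p: "1 \<le> p" and N: "0 \<le> N"
  shows "power_wave p \<xi> N \<in> Lp p" "Lp_norm p (power_wave p \<xi> N) powr p = N"
proof -
  have eq: "cmod (power_wave p \<xi> N t) powr p = indicator {0<..} t *\<^sub>R (indicator {0..N} (ln t) / t)" for
      t
  proof (cases "0 < t")
    case True
    have "(t powr (- 1 / p)) powr p = 1 / t" by (rule powr_inverse_root[OF p True])
    moreover have "1 \<le> t \<and> t \<le> exp N \<longleftrightarrow> 0 \<le> ln t \<and> ln t \<le> N" using True by (simp add: ln_le_iff_le_exp)
    ultimately show ?thesis using True by (auto simp: power_wave_def)
  next
    case False then show ?thesis using p by (auto simp: power_wave_def)
  qed
  note L = log_indicator_integral[of "indicator {0..N}"]
  have "integrable lborel (indicator {0..N} :: real \<Rightarrow> real)"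
      by (intro integrable_real_indicator) (auto simp: emeasure_lborel_Icc_eq)
  then have i: "integrable lborel (\<lambda>t. indicator {0<..} t *\<^sub>R (indicator {0..N} (ln t) / t) :: real)"
      using L(1) by simp
  show "power_wave p \<xi> N \<in> Lp p"
    by (rule LpI) (use i in \<open>simp_all only: eq power_wave_measurable\<close>)
  show "Lp_norm p (power_wave p \<xi> N) powr p = N"
    unfolding Lp_norm_powr[OF p] eq using L(2) N by simp
qed

text \<open>In the variable ln t a dilation is a translation by r. The plane wave contributes the
  eigenvalue, and what remains is the difference of the indicators of [r, N + r] and [0, N], whose
  modulus has integral at most 2 |r| for every N. Hence the error does not grow with N.\<close>

lemma dil_op_power_wave:
  assumes p: "1 \<le> p" and k: "kernel p k" and kr: "integrable lborel
      (\<lambda>r. exp (r / p) * cmod (k r) * \<bar>r\<bar>)" and N: "0 \<le> N"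
  shows "Lp_norm p (\<lambda>t. dil_op k (power_wave p \<xi> N) t - ft (\<lambda>r. exp (r / p) *\<^sub>R k r) \<xi> * power_wave p \<xi>
      N t) powr p
     \<le> mass p k powr (p - 1) * (2 * (LINT r|lborel. exp (r / p) * cmod (k r) * \<bar>r\<bar>))"
proof -
  note [measurable] = kernelD(1)[OF k]
  define K where "K r = exp (r / p) * cmod (k r)" for r
  define D where "D r s = \<bar>indicator {r..N + r} s - indicator {0..N} s :: real\<bar>" for r s
  define G where "G r t = indicator {0<..} t *\<^sub>R (t powr (- 1 / p) * D r (ln t))" for r t
  have K: "integrable lborel K" unfolding K_def using kernelD(2)[OF k] .
  have K0: "0 \<le> K r" and G0: "0 \<le> G r t" for r t by (auto simp: K_def G_def D_def)
  have Dalt: "D r s = \<bar>(if r \<le> s \<and> s \<le> N + r then 1 else 0) - (if 0 \<le> s \<and> s \<le> N then 1 else 0)\<bar>" for r s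
    by (simp add: D_def indicator_def)
  have [measurable]: "K \<in> borel_measurable borel" "(\<lambda>(r, s). D r s) \<in> borel_measurable (borel \<Otimes>\<^sub>M borel)"
    unfolding K_def Dalt by measurable
  have Dm[measurable]: "D r \<in> borel_measurable borel" for r unfolding D_def by measurable
  have [measurable]: "(\<lambda>(r, t). G r t) \<in> borel_measurable (borel \<Otimes>\<^sub>M borel)"
    unfolding G_def by measurable
  have Gp: "G r t powr p = indicator {0<..} t *\<^sub>R (D r (ln t) / t)" for r t
  proof (cases "0 < t")
    case True
    have "(t powr (- 1 / p)) powr p = 1 / t" by (rule powr_inverse_root[OF p True])
    moreover have "D r (ln t) powr p = D r (ln t)" using p by (auto simp: D_def indicator_def)
    ultimately show ?thesis using True by (simp add: G_def powr_mult D_def)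
  qed (simp add: G_def)
  have Dint: "integrable lborel (D r)" "(LINT s|lborel. D r s) \<le> 2 * \<bar>r\<bar>" for r
  proof -
    have i: "integrable lborel (\<lambda>s. indicator {min 0 r..max 0 r} s + indicator
        {min N (N + r)..max N (N + r)} s :: real)"
      by (intro Bochner_Integration.integrable_add) auto
    have le: "D r s \<le> indicator {min 0 r..max 0 r} s + indicator {min N (N + r)..max N (N + r)} s" for s
      by (auto simp: D_def indicator_def)
    show d: "integrable lborel (D r)"
      by (rule Bochner_Integration.integrable_bound[OF i]) (use le in \<open>auto simp: D_def\<close>)
    have "(LINT s|lborel. D r s) \<le> (LINT s|lborel. indicator {min 0 r..max 0 r} s + indicator
        {min N (N + r)..max N (N + r)} s)"
      by (rule integral_mono[OF d i le])
    also have "\<dots> = 2 * \<bar>r\<bar>" by (subst Bochner_Integration.integral_add) (auto simp: min_def max_def)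
    finally show "(LINT s|lborel. D r s) \<le> 2 * \<bar>r\<bar>" .
  qed
  have Gi: "integrable lborel (\<lambda>t. G r t powr p)" "(LINT t|lborel. G r t powr p)
      = (LINT s|lborel. D r s)" for r
    unfolding Gp using log_indicator_integral[OF Dm] Dint by auto
  have m0: "0 \<le> (LINT s|lborel. D r s)" for r by (intro integral_nonneg_AE) (auto simp: D_def)
  have Kr: "integrable lborel (\<lambda>r. 2 * (K r * \<bar>r\<bar>))" using kr by (simp add: K_def)
  have KD: "integrable lborel (\<lambda>r. K r * (LINT s|lborel. D r s))"
  proof (rule Bochner_Integration.integrable_bound[OF Kr])
    have "K r * (LINT s|lborel. D r s) \<le> K r * (2 * \<bar>r\<bar>)" for r using K0 Dint(2)
        by (intro mult_left_mono)
    then show "AE r in lborel. norm (K r * (LINT s|lborel. D r s)) \<le> norm (2 * (K r * \<bar>r\<bar>))"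
      using K0 m0 by (auto simp: abs_mult mult_ac)
  qed measurable
  have int: "integrable (lborel \<Otimes>\<^sub>M lborel) (\<lambda>(r, t). K r * G r t powr p)"
  proof (rule lborel_pair.Fubini_integrable)
    show "integrable lborel (\<lambda>r. LINT t|lborel. norm (case (r, t) of (r, t) \<Rightarrow> K r * G r t powr p))"
      using KD K0 by (simp add: abs_mult Gi)
    show "AE r in lborel. integrable lborel (\<lambda>t. case (r, t) of (r, t) \<Rightarrow> K r * G r t powr p)"
      using Gi by simp
  qed measurable
  let ?h = "power_wave p \<xi> N"
  let ?l = "ft (\<lambda>r. exp (r / p) *\<^sub>R k r) \<xi>"
  note hL = power_wave_Lp[OF p N, of \<xi>]
  have pt: "cmod (k r * ?h (exp (- r) * t) - (exp (r / p) *\<^sub>R k r * cis (- \<xi> * r)) * ?h t)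
      = K r * G r t" for r t
  proof (cases "0 < t")
    case False
    then have "?h t = 0" "?h (exp (- r) * t) = 0" by (auto simp: power_wave_def mult_le_0_iff
        dest: order_trans[of 1])
       (smt (verit) exp_gt_zero mult_nonneg_nonpos)
    then show ?thesis using False by (simp add: G_def)
  next
    case True
    have 1: "1 \<le> t \<and> t \<le> exp N \<longleftrightarrow> ln t \<in> {0..N}"
      using True by (simp add: ln_le_iff_le_exp)
    have 2: "1 \<le> exp (- r) * t \<and> exp (- r) * t \<le> exp N \<longleftrightarrow> ln t \<in> {r..N + r}"
    proof -
      have "1 \<le> exp (- r) * t \<longleftrightarrow> exp r \<le> t" "exp (- r) * t \<le> exp N \<longleftrightarrow> t \<le> exp (N + r)"
        by (auto simp: exp_minus exp_add field_simps)
      then show ?thesis using True by (auto simp: ln_ge_iff ln_le_iff_le_exp)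
    qed
    have 3: "(exp (- r) * t) powr (- 1 / p) = exp (r / p) * t powr (- 1 / p)"
      using True by (simp add: powr_mult exp_powr_real)
    have 4: "cis (\<xi> * ln (exp (- r) * t)) = cis (\<xi> * ln t) * cis (- \<xi> * r)"
      using True by (simp add: ln_mult cis_mult algebra_simps)
    have "k r * ?h (exp (- r) * t) - (exp (r / p) *\<^sub>R k r * cis (- \<xi> * r)) * ?h t
      = (k r * cis (\<xi> * ln t) * cis (- \<xi> * r)) * complex_of_real
          (exp (r / p) * t powr (- 1 / p) * (indicator {r..N + r} (ln t) - indicator {0..N} (ln t)))"
      unfolding power_wave_def 1 2 3 4 indicator_def by (simp add: scaleR_conv_of_real algebra_simps)
    also have "cmod \<dots> = cmod (k r) * (exp (r / p) * t powr (- 1 / p) * D r (ln t))"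
      by (simp only: norm_mult norm_cis norm_of_real abs_mult D_def) simp
    finally show ?thesis using True by (simp add: K_def G_def)
  qed
  have kc: "integrable lborel (\<lambda>r. exp (r / p) *\<^sub>R k r * cis (- \<xi> * r))"
  proof (rule integrable_mult_cis)
    show "integrable lborel (\<lambda>r. exp (r / p) *\<^sub>R k r)"
      by (rule Bochner_Integration.integrable_bound[OF kernelD(2)[OF k]]) auto
  qed
  note M = minkowski_integral[OF p K K0 G0 _ int]
  have Gm: "(\<lambda>(r, t). G r t) \<in> borel_measurable (borel \<Otimes>\<^sub>M borel)" by measurable
  have le: "AE t in lborel. cmod (dil_op k ?h t - ?l * ?h t) \<le> (LINT r|lborel. K r * G r t)"
    using dil_op_bound(1)[OF p k hL(1)]
  proof eventually_elim
    case (elim t)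
    have E: "dil_op k ?h t - ?l * ?h t = (LINT r|lborel. k r * ?h (exp (- r) * t) -
        (exp (r / p) *\<^sub>R k r * cis (- \<xi> * r)) * ?h t)"
      unfolding dil_op_def ft_def integral_mult_left_zero[symmetric]
      by (rule Bochner_Integration.integral_diff[OF elim integrable_mult_left[OF kc], symmetric])
    show ?case unfolding E pt[symmetric] by (rule integral_norm_bound)
  qed
  have dL: "(\<lambda>t. dil_op k ?h t - ?l * ?h t) \<in> Lp p"
    by (intro Lp_diff[OF p] dil_op_bound(2)[OF p k] Lp_cmult hL)
  have "Lp_norm p (\<lambda>t. dil_op k ?h t - ?l * ?h t) powr p
      \<le> (LINT t|lborel. (LINT r|lborel. K r * G r t) powr p)"
    unfolding Lp_norm_powr[OF p]
    by (rule integral_mono_AE[OF LpD(2)[OF dL] M(2)[OF Gm]])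
        (use le p in \<open>auto elim!: eventually_mono intro!: powr_mono2\<close>)
  also have "\<dots> \<le> (LINT r|lborel. K r) powr (p - 1) * (LINT r|lborel. K r *
      (LINT t|lborel. G r t powr p))"
    by (rule M(3)[OF Gm])
  also have "\<dots> \<le> (LINT r|lborel. K r) powr (p - 1) * (LINT r|lborel. 2 * (K r * \<bar>r\<bar>))"
  proof (rule mult_left_mono)
    show "(LINT r|lborel. K r * (LINT t|lborel. G r t powr p)) \<le> (LINT r|lborel. 2 * (K r * \<bar>r\<bar>))"
      unfolding Gi(2)
    proof (rule integral_mono[OF KD Kr])
      fix r show "K r * (LINT s|lborel. D r s) \<le> 2 * (K r * \<bar>r\<bar>)"
        using mult_left_mono[OF Dint(2)[of r] K0[of r]] by simp
    qed
  qed simp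
  finally show ?thesis by (simp add: mass_def K_def mult.assoc)
qed

lemma approx_eigenvector:
  assumes p: "1 \<le> p" and k: "kernel p k" and kr: "integrable lborel
      (\<lambda>r. exp (r / p) * cmod (k r) * \<bar>r\<bar>)" and e: "0 < e"
  shows "\<exists>h\<in>Lp p. 0 < Lp_norm p h \<and> Lp_norm p (\<lambda>t. dil_op k h t - ft (\<lambda>r. exp (r / p) *\<^sub>R k r) \<xi> * h t)
      \<le> e * Lp_norm p h"
proof -
  define B where "B = mass p k powr (p - 1) * (2 * (LINT r|lborel. exp (r / p) * cmod (k r) * \<bar>r\<bar>))"
  have B: "0 \<le> B" unfolding B_def by (intro mult_nonneg_nonneg integral_nonneg_AE) auto
  \<comment> \<open>Large enough for B \<le> e^p N; the summand 1 keeps N positive when B =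
    0.\<close>
  define N where "N = B / e powr p + 1"
  have ep: "0 < e powr p" using e by simp
  have N: "0 < N" using B ep by (simp add: N_def add_nonneg_pos)
  let ?h = "power_wave p \<xi> N"
  let ?d = "\<lambda>t. dil_op k ?h t - ft (\<lambda>r. exp (r / p) *\<^sub>R k r) \<xi> * ?h t"
  note h = power_wave_Lp[OF p less_imp_le[OF N], of \<xi>]
  have pos: "0 < Lp_norm p ?h" using h(2) N Lp_norm_nonneg[of p ?h] p by (cases "Lp_norm p ?h = 0") auto
  have "Lp_norm p ?d powr p \<le> B" unfolding B_def by (rule dil_op_power_wave[OF p k kr less_imp_le[OF N]])
  also have "\<dots> \<le> e powr p * N" using ep by (simp add: N_def field_simps)
  also have "\<dots> = (e * Lp_norm p ?h) powr p" using e pos h(2) by (simp add: powr_mult)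
  finally have "Lp_norm p ?d \<le> e * Lp_norm p ?h"
    using e pos p Lp_norm_nonneg[of p ?d] by (smt (verit) mult_pos_pos powr_less_mono2)
  then show ?thesis using h(1) pos by blast
qed

section \<open>The Stieltjes operator\<close>

lemma phi_kernel_nonneg: "0 \<le> phi_kernel a \<mu> r"
  by (simp add: phi_kernel_def)

text \<open>For u = exp (- r) the factors exp (- \<beta> r) and (1 + exp (- r))^(- \<mu>) combine to
  this kernel. The weight exp (r / p) raises its first parameter to \<mu> - \<beta> + 1/p.\<close>

definition stieltjes_kernel :: "real \<Rightarrow> real \<Rightarrow> real \<Rightarrow> complex" where
  "stieltjes_kernel \<beta> \<mu> r = complex_of_real (phi_kernel (\<mu> - \<beta>) \<mu> r)"

lemma stieltjes_kernel_measurable[measurable]: "stieltjes_kernel \<beta> \<mu> \<in> borel_measurable borel"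
  unfolding stieltjes_kernel_def phi_kernel_def by measurable

lemma exp_minus_kernel: "(1 + exp (- r)) powr \<mu> = exp (- r * \<mu>) * (1 + exp r) powr \<mu>" for r \<mu> :: real
proof -
  have "1 + exp (- r) = exp (- r) * (1 + exp r)" by (simp add: distrib_left flip: exp_add)
  then show ?thesis by (simp add: powr_mult exp_powr_real)
qed

lemma stieltjes_eq_dil_op:
  assumes [measurable]: "f \<in> borel_measurable borel"
  shows "stieltjes \<beta> \<mu> f = dil_op (stieltjes_kernel \<beta> \<mu>) f"
proof
  fix t
  define g where "g u = (u powr (\<beta> - 1) / (1 + u) powr \<mu>) *\<^sub>R f (t * u)" for u
  have [measurable]: "g \<in> borel_measurable borel" unfolding g_def by measurable
  have "exp (- r) *\<^sub>R g (exp (- r)) = stieltjes_kernel \<beta> \<mu> r * f (exp (- r) * t)" for r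
  proof -
    have "exp (- r) * exp (- r) powr (\<beta> - 1) = exp ((\<mu> - \<beta>) * r) * exp (- r * \<mu>)"
      by (simp add: exp_powr_real algebra_simps flip: exp_add)
    then have "exp (- r) * (exp (- r) powr (\<beta> - 1) / (1 + exp (- r)) powr \<mu>) = phi_kernel (\<mu> - \<beta>) \<mu> r"
      unfolding exp_minus_kernel phi_kernel_def by simp
    then have "exp (- r) *\<^sub>R g (exp (- r)) = phi_kernel (\<mu> - \<beta>) \<mu> r *\<^sub>R f (t * exp (- r))"
      by (simp only: g_def scaleR_scaleR)
    then show ?thesis by (simp add: stieltjes_kernel_def scaleR_conv_of_real mult.commute)
  qed
  then show "stieltjes \<beta> \<mu> f t = dil_op (stieltjes_kernel \<beta> \<mu>) f t"
    using exp_substitution_neg(2)[of g] by (simp add: stieltjes_def set_lebesgue_integral_def dil_op_def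
        g_def)
qed

lemma stieltjes_kernel_weighted:
  "exp (r / p) *\<^sub>R stieltjes_kernel \<beta> \<mu> r = complex_of_real (phi_kernel (\<mu> - \<beta> + 1 / p) \<mu> r)"
  by (simp add: stieltjes_kernel_def phi_kernel_def scaleR_conv_of_real distrib_right exp_add
      flip: of_real_mult of_real_divide)

lemma transpose_stieltjes_kernel: "transpose_kernel (stieltjes_kernel \<beta> \<mu>)
    = stieltjes_kernel (\<mu> - \<beta> + 1) \<mu>"
proof
  fix r
  have "exp (- r) * exp ((\<mu> - \<beta>) * - r) = exp ((\<beta> - 1) * r) * exp (- r * \<mu>)"
    by (simp add: algebra_simps flip: exp_add)
  then have "exp (- r) * phi_kernel (\<mu> - \<beta>) \<mu> (- r) = phi_kernel (\<beta> - 1) \<mu> r"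
    unfolding phi_kernel_def exp_minus_kernel by simp
  then show "transpose_kernel (stieltjes_kernel \<beta> \<mu>) r = stieltjes_kernel (\<mu> - \<beta> + 1) \<mu> r"
    by (simp add: transpose_kernel_def stieltjes_kernel_def flip: of_real_mult)
qed

text \<open>The clause on linearity evaluates the operators at linear combinations, hence the
  closure condition on V.\<close>

lemma bounded_op_on_cong:
  assumes A: "bounded_op_on V N A" and eq: "\<And>f. f \<in> V \<Longrightarrow> B f = A f"
    and lin: "\<And>f g c d. f \<in> V \<Longrightarrow> g \<in> V \<Longrightarrow> (\<lambda>s. c * f s + d * g s) \<in> V"
  shows "bounded_op_on V N B"
  unfolding bounded_op_on_def
proof (intro conjI ballI allI)
  show "B f \<in> V" if "f \<in> V" for f using A that unfolding eq[OF that] bounded_op_on_def by blast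
  show "AE t in lborel. B (\<lambda>s. c * f s + d * g s) t = c * B f t + d * B g t"
      if "f \<in> V" "g \<in> V" for f g c d
    using A that unfolding eq[OF that(1)] eq[OF that(2)] eq[OF lin[OF that]] bounded_op_on_def by blast
  obtain C where "\<And>f. f \<in> V \<Longrightarrow> N (A f) \<le> C * N f" using A unfolding bounded_op_on_def by blast
  then show "\<exists>C. \<forall>f\<in>V. N (B f) \<le> C * N f" using eq by (intro exI[of _ C]) simp
qed

text \<open>In the second resolvent identity the operators act on \<open>R f\<close>, which lies in
  V because a bounded operator maps V to itself.\<close>

lemma spectrum_on_cong:
  assumes "\<And>f. f \<in> V \<Longrightarrow> A f = B f"
  shows "spectrum_on V N A = spectrum_on V N B"
proof -
  have "(\<forall>f\<in>V. AE t in lborel. R (\<lambda>s. l * f s - A f s) t = f t)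
      \<longleftrightarrow> (\<forall>f\<in>V. AE t in lborel. R (\<lambda>s. l * f s - B f s) t = f t)" for R l
    by (intro ball_cong refl) (simp only: assms)
  moreover have "(\<forall>f\<in>V. AE t in lborel. l * R f t - A (R f) t = f t)
      \<longleftrightarrow> (\<forall>f\<in>V. AE t in lborel. l * R f t - B (R f) t = f t)"
    if "bounded_op_on V N R" for R l
  proof (intro ball_cong refl)
    fix f assume "f \<in> V"
    then have "R f \<in> V" using that unfolding bounded_op_on_def by blast
    then show "(AE t in lborel. l * R f t - A (R f) t = f t)
        \<longleftrightarrow> (AE t in lborel. l * R f t - B (R f) t = f t)"
      by (simp only: assms)
  qed
  ultimately have "(bounded_op_on V N R \<and> (\<forall>f\<in>V. AE t in lborel. R (\<lambda>s. l * f s - A f s) t = f t)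
      \<and> (\<forall>f\<in>V. AE t in lborel. l * R f t - A (R f) t = f t))
    \<longleftrightarrow> (bounded_op_on V N R \<and> (\<forall>f\<in>V. AE t in lborel. R (\<lambda>s. l * f s - B f s) t = f t)
        \<and> (\<forall>f\<in>V. AE t in lborel. l * R f t - B (R f) t = f t))" for R l
    by (intro conj_cong refl)
  then show ?thesis unfolding spectrum_on_def by (simp only:)
qed

lemma op_norm_on_cong:
  assumes "\<And>f. f \<in> V \<Longrightarrow> A f = B f"
  shows "op_norm_on V N A = op_norm_on V N B"
  unfolding op_norm_on_def using assms by (intro SUP_cong) auto

section \<open>Norm and spectrum of dilation convolutions on \<open>T_space\<close>\<close>

context
  fixes \<alpha> p :: real
  assumes p: "1 \<le> p" and a: "0 \<le> \<alpha>"
begin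

text \<open>The condition \<open>M\<close> says that the triangle inequality for the integral of the
  weighted kernel is an equality, as for nonnegative k. The approximate eigenvector at frequency 0
  then almost attains the upper bound \<open>mass p k\<close>.\<close>

lemma op_norm_dil_op:
  assumes k: "kernel p k" and kr: "integrable lborel (\<lambda>r. exp (r / p) * cmod (k r) * \<bar>r\<bar>)"
    and M: "ft (\<lambda>r. exp (r / p) *\<^sub>R k r) 0 = complex_of_real (mass p k)"
  shows "op_norm_on (T_space \<alpha> p) (T_norm \<alpha> p) (dil_op k) = mass p k"
proof -
  let ?S = "{f \<in> T_space \<alpha> p. T_norm \<alpha> p f \<le> 1}"
  have le: "T_norm \<alpha> p (dil_op k f) \<le> mass p k" if "f \<in> ?S" for f
    using dil_op_bounded_op_on(2)[OF p a k, of f] that mult_left_mono[of "T_norm \<alpha> p f" 1 "mass p k"]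
        mass_nonneg[of p k]
    by auto
  have ex: "\<exists>f\<in>?S. mass p k - e \<le> T_norm \<alpha> p (dil_op k f)" if e: "0 < e" for e
  proof -
    obtain h where h: "h \<in> Lp p" "0 < Lp_norm p h"
      "Lp_norm p (\<lambda>t. dil_op k h t - complex_of_real (mass p k) * h t) \<le> e * Lp_norm p h"
      using approx_eigenvector[OF p k kr e, of 0] unfolding M by blast
    \<comment> \<open>Normalised to norm 1, since the supremum runs over the unit ball.\<close>
    define c where "c = complex_of_real (1 / Lp_norm p h)"
    define g where "g = (\<lambda>t. c * h t)"
    have g: "g \<in> Lp p" unfolding g_def by (rule Lp_cmult[OF h(1)])
    have g1: "Lp_norm p g = 1" unfolding g_def Lp_norm_cmult[OF p] using h(2)
        by (simp add: c_def norm_divide)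
    note T = T_space_weyl_int[OF p a g]
    have kg: "dil_op k g \<in> Lp p" by (rule dil_op_bound(2)[OF p k g])
    have "Lp_norm p (\<lambda>t. dil_op k g t - complex_of_real (mass p k) * g t)
        = Lp_norm p (\<lambda>t. c * (dil_op k h t - complex_of_real (mass p k) * h t))"
      by (simp add: g_def dil_op_cmult right_diff_distrib mult.left_commute)
    also have "\<dots> = cmod c * Lp_norm p (\<lambda>t. dil_op k h t - complex_of_real (mass p k) * h t)"
      by (rule Lp_norm_cmult[OF p])
    also have "\<dots> \<le> cmod c * (e * Lp_norm p h)" using h(3) by (intro mult_left_mono) auto
    also have "\<dots> = e" using h(2) by (simp add: c_def norm_divide)
    finally have d: "Lp_norm p (\<lambda>t. complex_of_real (mass p k) * g t - dil_op k g t) \<le> e"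
      unfolding Lp_norm_minus[of p "dil_op k g"] .
    have "mass p k = Lp_norm p (\<lambda>t. complex_of_real (mass p k) * g t)"
      unfolding Lp_norm_cmult[OF p] g1 using mass_nonneg[of p k] by simp
    also have "\<dots> \<le> Lp_norm p (\<lambda>t. complex_of_real (mass p k) * g t - dil_op k g t) + Lp_norm p
        (dil_op k g)"
      using Lp_norm_triangle[OF p Lp_diff[OF p Lp_cmult[OF g] kg] kg, of "complex_of_real (mass p k)"]
          by simp
    finally have "mass p k - e \<le> Lp_norm p (dil_op k g)" using d by linarith
    also have "Lp_norm p (dil_op k g) = T_norm \<alpha> p (dil_op k (weyl_int \<alpha> g))"
    proof -
      have "T_norm \<alpha> p (dil_op k (weyl_int \<alpha> g)) = Lp_norm p (dil_op k (D0 \<alpha> p (weyl_int \<alpha> g)))"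
        by (rule dil_op_T_space(3)[OF p a k T(1)])
      also have "\<dots> = Lp_norm p (dil_op k g)"
      proof (rule Lp_norm_cong_AE)
        have "AE t in lborel. D0 \<alpha> p (weyl_int \<alpha> g) t = g t"
          by (rule T_spaceI(2)[OF p a weyl_int_Lp[OF p a g] g]) simp
        then show "AE t in lborel. dil_op k (D0 \<alpha> p (weyl_int \<alpha> g)) t = dil_op k g t"
          by (rule dil_op_cong_AE[OF p k T_spaceD(2)[OF p a T(1)] g])
      qed (use dil_op_bound(2)[OF p k g] dil_op_bound(2)[OF p k T_spaceD(2)[OF p a T(1)]]
          in \<open>auto dest: LpD(1)\<close>)
      finally show ?thesis by simp
    qed
    finally show ?thesis using T g1 by auto
  qed
  have ne: "?S \<noteq> {}" using ex[of 1] by auto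
  have bdd: "bdd_above ((\<lambda>f. T_norm \<alpha> p (dil_op k f)) ` ?S)" using le by (auto intro!: bdd_aboveI2)
  show ?thesis unfolding op_norm_on_def
  proof (rule antisym)
    show "(SUP f\<in>?S. T_norm \<alpha> p (dil_op k f)) \<le> mass p k" using ne le by (rule cSUP_least)
    show "mass p k \<le> (SUP f\<in>?S. T_norm \<alpha> p (dil_op k f))"
    proof (rule field_le_epsilon)
      fix e :: real assume "0 < e"
      then obtain f where f: "f \<in> ?S" "mass p k - e \<le> T_norm \<alpha> p (dil_op k f)" using ex by blast
      have "T_norm \<alpha> p (dil_op k f) \<le> (SUP f\<in>?S. T_norm \<alpha> p (dil_op k f))"
          by (rule cSUP_upper[OF f(1) bdd])
      then show "mass p k \<le> (SUP f\<in>?S. T_norm \<alpha> p (dil_op k f)) + e" using f(2) by linarith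
    qed
  qed
qed

text \<open>A bounded inverse of l - A would bound the norm of h by a multiple of that of (l - A) h,
  which approximate eigenvectors exclude. The hypothesis on l admits limits of values of the Fourier
  transform, not only values.\<close>

lemma approx_eigenvalue_in_spectrum:
  assumes k: "kernel p k" and kr: "integrable lborel (\<lambda>r. exp (r / p) * cmod (k r) * \<bar>r\<bar>)"
    and l: "\<And>e. 0 < e \<Longrightarrow> \<exists>\<xi>. cmod (ft (\<lambda>r. exp (r / p) *\<^sub>R k r) \<xi> - l) < e"
  shows "l \<in> spectrum_on (T_space \<alpha> p) (T_norm \<alpha> p) (dil_op k)"
  unfolding spectrum_on_def mem_Collect_eq
proof
  assume "\<exists>R. bounded_op_on (T_space \<alpha> p) (T_norm \<alpha> p) R \<and>
     (\<forall>f\<in>T_space \<alpha> p. AE t in lborel. R (\<lambda>s. l * f s - dil_op k f s) t = f t) \<and>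
     (\<forall>f\<in>T_space \<alpha> p. AE t in lborel. l * R f t - dil_op k (R f) t = f t)"
  then obtain R where Rb: "bounded_op_on (T_space \<alpha> p) (T_norm \<alpha> p) R"
    and R: "\<And>f. f \<in> T_space \<alpha> p \<Longrightarrow> AE t in lborel. R (\<lambda>s. l * f s - dil_op k f s) t = f t" by blast
  obtain C where C: "\<And>f. f \<in> T_space \<alpha> p \<Longrightarrow> T_norm \<alpha> p (R f) \<le> C * T_norm \<alpha> p f"
    using Rb unfolding bounded_op_on_def by blast
  \<comment> \<open>The bound in \<open>bounded_op_on\<close> need not be positive.\<close>
  define C' where "C' = \<bar>C\<bar> + 1"
  have C': "0 < C'" by (simp add: C'_def)
  have main: "Lp_norm p h \<le> C' * Lp_norm p (\<lambda>t. dil_op k h t - l * h t)" if h: "h \<in> Lp p" for h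
  proof -
    define f where "f = weyl_int \<alpha> h"
    have f: "f \<in> T_space \<alpha> p" "T_norm \<alpha> p f = Lp_norm p h" unfolding f_def
        using T_space_weyl_int[OF p a h] by auto
    have D: "AE t in lborel. D0 \<alpha> p f t = h t"
      unfolding f_def by (rule T_spaceI(2)[OF p a weyl_int_Lp[OF p a h] h]) simp
    note S = dil_op_T_space[OF p a k f(1)]
    define u where "u = (\<lambda>s. l * f s - dil_op k f s)"
    have ueq: "u = (\<lambda>s. l * f s + (- 1) * dil_op k f s)" by (simp add: u_def)
    note U = T_space_lincomb[OF p a f(1) S(1), of l "- 1", folded ueq]
    note dL = dil_op_bound(2)[OF p k h] note fL = T_spaceD(2)[OF p a f(1)] note sL
        = T_spaceD(2)[OF p a S(1)]
    note [measurable] = LpD(1)[OF h] LpD(1)[OF dL] LpD(1)[OF fL] LpD(1)[OF sL]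
    have "T_norm \<alpha> p u = Lp_norm p (\<lambda>t. l * h t - dil_op k h t)"
      unfolding U(3)
    proof (rule Lp_norm_cong_AE)
      show "AE t in lborel. l * D0 \<alpha> p f t + (- 1) * D0 \<alpha> p (dil_op k f) t = l * h t - dil_op k h t"
        using D S(2) dil_op_cong_AE[OF p k fL h D] by eventually_elim simp
    qed measurable
    then have un: "T_norm \<alpha> p u = Lp_norm p (\<lambda>t. dil_op k h t - l * h t)"
        using Lp_norm_minus[of p "dil_op k h"] by simp
    have Ru: "R u \<in> T_space \<alpha> p" using Rb U(1) unfolding bounded_op_on_def by blast
    have "T_norm \<alpha> p f = T_norm \<alpha> p (R u)"
      using T_norm_cong_AE[OF p a Ru f(1)] R[OF f(1)] by (simp add: u_def)
    also have "\<dots> \<le> C * T_norm \<alpha> p u" by (rule C[OF U(1)])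
    also have "\<dots> \<le> C' * T_norm \<alpha> p u" by (rule mult_right_mono)
        (auto simp: C'_def T_norm_def Lp_norm_nonneg)
    finally show ?thesis unfolding f(2) un .
  qed
  \<comment> \<open>The distance to l and the error of the eigenvector each cost e, and C' * (2 * e)
    = 1/2 < 1.\<close>
  define e where "e = 1 / (4 * C')"
  have e: "0 < e" using C' by (simp add: e_def)
  obtain \<xi> where xi: "cmod (ft (\<lambda>r. exp (r / p) *\<^sub>R k r) \<xi> - l) < e" using l[OF e] by blast
  define l' where "l' = ft (\<lambda>r. exp (r / p) *\<^sub>R k r) \<xi>"
  obtain h where h: "h \<in> Lp p" "0 < Lp_norm p h" "Lp_norm p (\<lambda>t. dil_op k h t - l' * h t)
      \<le> e * Lp_norm p h"
    using approx_eigenvector[OF p k kr e, of \<xi>] unfolding l'_def by blast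
  have "Lp_norm p (\<lambda>t. dil_op k h t - l * h t) \<le> Lp_norm p (\<lambda>t. dil_op k h t - l' * h t) + Lp_norm p
      (\<lambda>t. l' * h t - l * h t)"
    by (intro Lp_norm_triangle_diff[OF p] dil_op_bound(2)[OF p k] Lp_cmult h)
  also have "Lp_norm p (\<lambda>t. l' * h t - l * h t) = cmod (l' - l) * Lp_norm p h"
    using Lp_norm_cmult[OF p, of "l' - l" h] by (simp add: left_diff_distrib)
  finally have "Lp_norm p (\<lambda>t. dil_op k h t - l * h t) \<le> e * Lp_norm p h + e * Lp_norm p h"
    using h(3) xi h(2) mult_right_mono[of "cmod (l' - l)" e "Lp_norm p h"] unfolding l'_def by linarith
  then have "C' * Lp_norm p (\<lambda>t. dil_op k h t - l * h t) \<le> C' * (2 * e * Lp_norm p h)" using C' by simp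
  also have "\<dots> = Lp_norm p h / 2" using C' by (simp add: e_def)
  finally show False using main[OF h(1)] h(2) by simp
qed

text \<open>The resolvent is (1 / l) (I + dil_op q). With k and q read as convolution operators, (l
  - k) (I + q) = l I amounts to k = l q - k q, which is the equation for \<open>m\<close> divided by
  the weight.\<close>

lemma resolvent_not_in_spectrum:
  assumes k: "kernel p k" and l0: "l \<noteq> 0" and m: "integrable lborel m"
    and eq: "\<And>r. l * m r - conv (\<lambda>r. exp (r / p) *\<^sub>R k r) m r = exp (r / p) *\<^sub>R k r"
  shows "l \<notin> spectrum_on (T_space \<alpha> p) (T_norm \<alpha> p) (dil_op k)"
proof -
  have [measurable]: "m \<in> borel_measurable borel" using m by auto
  \<comment> \<open>The weight exp (r / p) is multiplicative, so removing it turns \<open>m\<close>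
    into a kernel and respects convolution.\<close>
  define q where "q r = exp (- r / p) *\<^sub>R m r" for r
  have e: "exp (r / p) * cmod (q r) = cmod (m r)" for r by (simp add: q_def flip: mult.assoc exp_add)
  have "q \<in> borel_measurable borel" unfolding q_def by measurable
  then have q: "kernel p q" unfolding kernel_def e using m by simp
  have cv: "conv k q r = exp (- r / p) *\<^sub>R conv (\<lambda>r. exp (r / p) *\<^sub>R k r) m r" for r
  proof -
    have "k s * q (r - s) = exp (- r / p) *\<^sub>R (exp (s / p) *\<^sub>R k s * m (r - s))" for s
    proof -
      have "exp (- (r - s) / p) = exp (- r / p) * exp (s / p)"
          by (simp add: diff_divide_distrib flip: exp_add)
      then show ?thesis by (simp add: q_def)
    qed
    then show ?thesis unfolding conv_def by (simp only: integral_scaleR_right)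
  qed
  have keq: "k = (\<lambda>r. l * q r + (- 1) * conv k q r)"
  proof
    fix r
    have "k r = exp (- r / p) *\<^sub>R (exp (r / p) *\<^sub>R k r)" by (simp flip: exp_add)
    also have "\<dots> = exp (- r / p) *\<^sub>R (l * m r - conv (\<lambda>r. exp (r / p) *\<^sub>R k r) m r)" by (simp only: eq)
    also have "\<dots> = l * q r + (- 1) * conv k q r" by (simp add: cv q_def scaleR_diff_right)
    finally show "k r = l * q r + (- 1) * conv k q r" .
  qed
  note kq = kernel_conv(1)[OF k q]
  have kdec: "AE t in lborel. dil_op k f t = l * dil_op q f t - dil_op (conv k q) f t"
      if f: "f \<in> Lp p" for f
    using dil_op_kernel_lincomb[OF p q kq f, of l "- 1"] unfolding keq[symmetric] by simp
  define R where "R f t = (1 / l) * f t + (1 / l) * dil_op q f t" for f t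
  have RT: "R f \<in> T_space \<alpha> p" if f: "f \<in> T_space \<alpha> p" for f
    unfolding R_def[abs_def] by (rule T_space_lincomb(1)[OF p a f dil_op_T_space(1)[OF p a q f]])
  have Rb: "bounded_op_on (T_space \<alpha> p) (T_norm \<alpha> p) R"
    unfolding bounded_op_on_def
  proof (intro conjI ballI allI)
    fix f g c d assume fg: "f \<in> T_space \<alpha> p" "g \<in> T_space \<alpha> p"
    show "AE t in lborel. R (\<lambda>s. c * f s + d * g s) t = c * R f t + d * R g t"
      using dil_op_lincomb[OF p q T_spaceD(1)[OF p a fg(1)] T_spaceD(1)[OF p a fg(2)], of c d]
      by eventually_elim (simp add: R_def algebra_simps add_divide_distrib)
  next
    have "T_norm \<alpha> p (R f) \<le> (cmod (1 / l) + cmod (1 / l) * mass p q) * T_norm \<alpha> p f"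
        if f: "f \<in> T_space \<alpha> p" for f
    proof -
      note S = dil_op_T_space[OF p a q f]
      have "T_norm \<alpha> p (R f) = Lp_norm p (\<lambda>t. (1 / l) * D0 \<alpha> p f t + (1 / l) * D0 \<alpha> p (dil_op q f) t)"
        unfolding R_def[abs_def] by (rule T_space_lincomb(3)[OF p a f S(1)])
      also have "\<dots> \<le> Lp_norm p (\<lambda>t. (1 / l) * D0 \<alpha> p f t) + Lp_norm p
          (\<lambda>t. (1 / l) * D0 \<alpha> p (dil_op q f) t)"
        by (intro Lp_norm_triangle[OF p] Lp_cmult T_spaceD(2)[OF p a] f S(1))
      also have "\<dots> = cmod (1 / l) * T_norm \<alpha> p f + cmod (1 / l) * T_norm \<alpha> p (dil_op q f)"
        unfolding Lp_norm_cmult[OF p] T_norm_def ..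
      also have "\<dots> \<le> cmod (1 / l) * T_norm \<alpha> p f + cmod (1 / l) * (mass p q * T_norm \<alpha> p f)"
        using dil_op_bounded_op_on(2)[OF p a q f] by (intro add_left_mono mult_left_mono) auto
      finally show ?thesis by (simp add: algebra_simps)
    qed
    then show "\<exists>C. \<forall>f\<in>T_space \<alpha> p. T_norm \<alpha> p (R f) \<le> C * T_norm \<alpha> p f" by blast
  qed (rule RT)
  have 1: "AE t in lborel. R (\<lambda>s. l * f s - dil_op k f s) t = f t" if f: "f \<in> T_space \<alpha> p" for f
  proof -
    have L: "f \<in> Lp p" by (rule T_spaceD(1)[OF p a f])
    have kL: "dil_op k f \<in> Lp p" by (rule dil_op_bound(2)[OF p k L])
    have "AE t in lborel. dil_op q (\<lambda>s. l * f s + (- 1) * dil_op k f s) t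
        = l * dil_op q f t + (- 1) * dil_op q (dil_op k f) t"
      by (rule dil_op_lincomb[OF p q L kL])
    then show ?thesis using dil_op_comp[OF p q k L] kdec[OF L] unfolding conv_commute[of q k]
    proof eventually_elim
      case (elim t)
      have "dil_op q (\<lambda>s. l * f s - dil_op k f s) t = dil_op k f t" using elim by simp
      then show ?case using l0 by (simp add: R_def field_simps)
    qed
  qed
  have 2: "AE t in lborel. l * R f t - dil_op k (R f) t = f t" if f: "f \<in> T_space \<alpha> p" for f
  proof -
    have L: "f \<in> Lp p" by (rule T_spaceD(1)[OF p a f])
    have qL: "dil_op q f \<in> Lp p" by (rule dil_op_bound(2)[OF p q L])
    have "AE t in lborel. dil_op k (R f) t = (1 / l) * dil_op k f t + (1 / l) * dil_op k (dil_op q f) t"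
      unfolding R_def[abs_def] by (rule dil_op_lincomb[OF p k L qL])
    then show ?thesis using dil_op_comp[OF p k q L] kdec[OF L]
      by eventually_elim (use l0 in \<open>simp add: R_def field_simps\<close>)
  qed
  show ?thesis unfolding spectrum_on_def using Rb 1 2 by blast
qed

end

section \<open>The Stieltjes operator: norm, spectrum and adjoint\<close>

lemma stieltjes_kernel_properties:
  fixes p \<beta> \<mu> :: real
  assumes b: "0 < \<beta> - 1 / p" "\<beta> - 1 / p < \<mu>"
  shows "kernel p (stieltjes_kernel \<beta> \<mu>)"
    and "integrable lborel (\<lambda>r. exp (r / p) * cmod (stieltjes_kernel \<beta> \<mu> r) * \<bar>r\<bar>)"
    and "mass p (stieltjes_kernel \<beta> \<mu>) = Beta (\<mu> - \<beta> + 1 / p) (\<beta> - 1 / p)"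
    and "ft (\<lambda>r. exp (r / p) *\<^sub>R stieltjes_kernel \<beta> \<mu> r) \<xi> =
      Beta (complex_of_real (\<beta> - 1 / p) + \<i> * complex_of_real \<xi>)
          (complex_of_real (\<mu> - \<beta> + 1 / p) - \<i> * complex_of_real \<xi>)"
    and "\<exists>k1 k2. smooth_exp_decays (\<lambda>r. exp (r / p) *\<^sub>R stieltjes_kernel \<beta> \<mu> r) k1 k2"
proof -
  define a where "a = \<mu> - \<beta> + 1 / p"
  have a: "0 < a" "a < \<mu>" "\<mu> - a = \<beta> - 1 / p" using b by (auto simp: a_def)
  have eq: "exp (r / p) *\<^sub>R stieltjes_kernel \<beta> \<mu> r = complex_of_real (phi_kernel a \<mu> r)" for r
    unfolding a_def by (rule stieltjes_kernel_weighted)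
  have eqn: "exp (r / p) * cmod (stieltjes_kernel \<beta> \<mu> r) = phi_kernel a \<mu> r" for r
  proof -
    have "exp (r / p) * cmod (stieltjes_kernel \<beta> \<mu> r) = cmod (exp (r / p) *\<^sub>R stieltjes_kernel \<beta> \<mu> r)"
        by simp
    also have "\<dots> = phi_kernel a \<mu> r" unfolding eq by (simp only: norm_of_real
        abs_of_nonneg[OF phi_kernel_nonneg])
    finally show ?thesis .
  qed
  obtain k1 k2 where S: "smooth_exp_decays (\<lambda>r. complex_of_real (phi_kernel a \<mu> r)) k1 k2"
    using phi_kernel_smooth_exp_decays[OF a(1,2)] by blast
  then show "\<exists>k1 k2. smooth_exp_decays (\<lambda>r. exp (r / p) *\<^sub>R stieltjes_kernel \<beta> \<mu> r) k1 k2" unfolding eq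
      by blast
  have i: "integrable lborel (phi_kernel a \<mu>)"
    using smooth_exp_decaysD(1)[OF S] by (simp add: complex_of_real_integrable_eq)
  then show "kernel p (stieltjes_kernel \<beta> \<mu>)" unfolding kernel_def eqn by simp
  have "integrable lborel (\<lambda>r. norm (- \<i> * (complex_of_real r * complex_of_real (phi_kernel a \<mu> r))))"
    by (rule integrable_norm[OF smooth_exp_decaysD(1)[OF smooth_exp_decays_mult_id[OF S]]])
  moreover have "norm (- \<i> * (complex_of_real r * complex_of_real (phi_kernel a \<mu> r)))
      = phi_kernel a \<mu> r * \<bar>r\<bar>" for r
    by (simp only: norm_mult norm_minus_cancel norm_ii norm_of_real abs_of_nonneg[OF phi_kernel_nonneg]
        mult_1_left mult.commute)
  ultimately show "integrable lborel (\<lambda>r. exp (r / p) * cmod (stieltjes_kernel \<beta> \<mu> r) * \<bar>r\<bar>)"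
      unfolding eqn by simp
  have F: "ft (\<lambda>r. exp (r / p) *\<^sub>R stieltjes_kernel \<beta> \<mu> r) \<xi> =
      Beta (complex_of_real (\<mu> - a) + \<i> * complex_of_real \<xi>)
          (complex_of_real a - \<i> * complex_of_real \<xi>)" for \<xi>
    unfolding eq ft_phi_kernel[OF a(1,2)] by (rule Beta_commute)
  show "ft (\<lambda>r. exp (r / p) *\<^sub>R stieltjes_kernel \<beta> \<mu> r) \<xi> =
      Beta (complex_of_real (\<beta> - 1 / p) + \<i> * complex_of_real \<xi>)
          (complex_of_real (\<mu> - \<beta> + 1 / p) - \<i> * complex_of_real \<xi>)"
    unfolding F a(3) unfolding a_def ..
  have "complex_of_real (mass p (stieltjes_kernel \<beta> \<mu>))
      = ft (\<lambda>r. exp (r / p) *\<^sub>R stieltjes_kernel \<beta> \<mu> r) 0"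
    unfolding mass_def eqn ft_def eq by simp
  also have "\<dots> = complex_of_real (Beta (\<mu> - \<beta> + 1 / p) (\<beta> - 1 / p))"
    unfolding F a(3) by (simp add: Beta_def a_def Gamma_complex_of_real add.commute mult.commute
        flip: of_real_add of_real_diff of_real_divide) simp
  finally show "mass p (stieltjes_kernel \<beta> \<mu>) = Beta (\<mu> - \<beta> + 1 / p) (\<beta> - 1 / p)"
      by (simp only: of_real_eq_iff)
qed

lemma stieltjes_on_T_space:
  "1 \<le> p \<Longrightarrow> 0 \<le> \<alpha> \<Longrightarrow> f \<in> T_space \<alpha> p \<Longrightarrow> stieltjes \<beta> \<mu> f = dil_op (stieltjes_kernel \<beta> \<mu>) f"
  using T_spaceD(1) LpD(1) by (intro stieltjes_eq_dil_op) blast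

lemma stieltjes_bounded_op_on:
  fixes \<alpha> p \<beta> \<mu> :: real
  assumes p: "1 \<le> p" and a: "0 \<le> \<alpha>" and b: "0 < \<beta> - 1 / p" "\<beta> - 1 / p < \<mu>"
  shows "bounded_op_on (T_space \<alpha> p) (T_norm \<alpha> p) (stieltjes \<beta> \<mu>)"
  by (rule bounded_op_on_cong[OF dil_op_bounded_op_on(1)[OF p a stieltjes_kernel_properties(1)[OF b]]])
    (rule stieltjes_on_T_space[OF p a] T_space_lincomb(1)[OF p a]; assumption)+

lemma stieltjes_spectrum:
  fixes \<alpha> p \<beta> \<mu> :: real
  assumes p: "1 \<le> p" and a: "0 \<le> \<alpha>" and b: "0 < \<beta> - 1 / p" "\<beta> - 1 / p < \<mu>"
  shows "spectrum_on (T_space \<alpha> p) (T_norm \<alpha> p) (stieltjes \<beta> \<mu>)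
       = {Beta (of_real (\<beta> - 1 / p) + \<i> * of_real \<xi>)
               (of_real (\<mu> - \<beta> + 1 / p) - \<i> * of_real \<xi>) | \<xi>::real. True} \<union> {0}"
proof -
  let ?k = "stieltjes_kernel \<beta> \<mu>"
  let ?f = "ft (\<lambda>r. exp (r / p) *\<^sub>R ?k r)"
  note K = stieltjes_kernel_properties[OF b]
  obtain k1 k2 where S: "smooth_exp_decays (\<lambda>r. exp (r / p) *\<^sub>R ?k r) k1 k2" using K(5) by blast
  have "spectrum_on (T_space \<alpha> p) (T_norm \<alpha> p) (stieltjes \<beta> \<mu>)
      = spectrum_on (T_space \<alpha> p) (T_norm \<alpha> p) (dil_op ?k)"
    by (rule spectrum_on_cong) (rule stieltjes_on_T_space[OF p a])
  also have "\<dots> = range ?f \<union> {0}"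
  proof (intro equalityI subsetI)
    fix l assume l: "l \<in> spectrum_on (T_space \<alpha> p) (T_norm \<alpha> p) (dil_op ?k)"
    show "l \<in> range ?f \<union> {0}"
    proof (rule ccontr)
      assume "l \<notin> range ?f \<union> {0}"
      then have "l \<noteq> 0" "\<And>\<xi>. ?f \<xi> \<noteq> l" by auto
      from resolvent_kernel[OF S this] obtain m where "integrable lborel m"
        "\<And>r. l * m r - conv (\<lambda>r. exp (r / p) *\<^sub>R ?k r) m r = exp (r / p) *\<^sub>R ?k r" by blast
      from resolvent_not_in_spectrum[OF p a K(1) \<open>l \<noteq> 0\<close> this] l show False by simp
    qed
  next
    fix l assume "l \<in> range ?f \<union> {0}"
    then have "\<exists>\<xi>. cmod (?f \<xi> - l) < e" if e: "0 < e" for e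
    proof
      assume "l \<in> range ?f"
      then obtain \<xi> where "l = ?f \<xi>" by blast
      then show ?thesis using e by (intro exI[of _ \<xi>]) simp
    next
      \<comment> \<open>0 is the limit of the Fourier transform at infinity, by its quadratic
        decay.\<close>
      assume "l \<in> {0}"
      moreover have "\<forall>\<^sub>F \<xi> in at_top. cmod (?f \<xi>) < e"
        using order_tendstoD(2)[OF tendsto_norm_zero[OF
            decays_tendsto(1)[OF smooth_exp_decaysD(2)[OF S]]] e] .
      then obtain \<xi> where "cmod (?f \<xi>) < e" by (auto simp: eventually_at_top_linorder)
      ultimately show ?thesis by auto
    qed
    then show "l \<in> spectrum_on (T_space \<alpha> p) (T_norm \<alpha> p) (dil_op ?k)"
      by (rule approx_eigenvalue_in_spectrum[OF p a K(1,2)])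
  qed
  finally show ?thesis unfolding K(4) by auto
qed

text \<open>With c the identity this concerns the bilinear pairing, with c = cnj the inner product.
  The kernel is real, so conjugation commutes with the operator and both cases follow from
  \<open>dil_op_transpose\<close>.\<close>

lemma stieltjes_pairing:
  fixes \<alpha> p q \<beta> \<mu> :: real
  assumes pq: "1 < p" "1 < q" "1 / p + 1 / q = 1" and a: "0 \<le> \<alpha>" and b: "0 < \<beta> - 1 / p" "\<beta> - 1 / p < \<mu>"
    and f: "f \<in> T_space \<alpha> p" and g: "g \<in> T_space \<alpha> q" and c: "c = (\<lambda>z. z) \<or> c = cnj"
  shows "(LINT t|lborel. D0 \<alpha> p (stieltjes \<beta> \<mu> f) t * c (D0 \<alpha> q g t)) =
     (LINT t|lborel. D0 \<alpha> p f t * c (D0 \<alpha> q (stieltjes (\<mu> - \<beta> + 1) \<mu> g) t))"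
proof -
  let ?k = "stieltjes_kernel \<beta> \<mu>" and ?k' = "stieltjes_kernel (\<mu> - \<beta> + 1) \<mu>"
  have p: "1 \<le> p" "1 \<le> q" using pq by auto
  \<comment> \<open>By conjugacy of p and q, \<mu> - \<beta> + 1 - 1/q is \<mu> minus \<beta> - 1/p,
    so the two conditions change places.\<close>
  have b': "0 < (\<mu> - \<beta> + 1) - 1 / q" "(\<mu> - \<beta> + 1) - 1 / q < \<mu>" using b pq(3) by linarith+
  note K = stieltjes_kernel_properties(1)[OF b] note K' = stieltjes_kernel_properties(1)[OF b']
  note F = T_spaceD(2)[OF p(1) a f] note G = T_spaceD(2)[OF p(2) a g]
  have [measurable]: "c \<in> borel_measurable borel"
    using c by (auto intro!: borel_measurable_continuous_onI continuous_intros)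
  have cn: "cmod (c z) = cmod z" for z using c by auto
  have "(\<lambda>t. c (D0 \<alpha> q g t)) \<in> borel_measurable borel"
    using measurable_compose[OF LpD(1)[OF G] \<open>c \<in> borel_measurable borel\<close>] .
  then have cG: "(\<lambda>t. c (D0 \<alpha> q g t)) \<in> Lp q" using LpD(2)[OF G] by (intro LpI) (simp_all only: cn)
  have cd: "dil_op ?k' (\<lambda>t. c (D0 \<alpha> q g t)) t = c (dil_op ?k' (D0 \<alpha> q g) t)" for t
  proof -
    have "dil_op ?k' (\<lambda>t. cnj (D0 \<alpha> q g t)) t = (LINT r|lborel. cnj (?k' r * D0 \<alpha> q g (exp (- r) * t)))"
      unfolding dil_op_def by (simp only: stieltjes_kernel_def complex_cnj_mult
          complex_cnj_complex_of_real)
    also have "\<dots> = cnj (dil_op ?k' (D0 \<alpha> q g) t)" unfolding dil_op_def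
        by (rule Bochner_Integration.integral_cnj)
    finally show ?thesis using c by auto
  qed
  note SF = dil_op_T_space[OF p(1) a K f] note SG = dil_op_T_space[OF p(2) a K' g]
  note [measurable] = LpD(1)[OF F] LpD(1)[OF G] LpD(1)[OF T_spaceD(2)[OF p(1) a SF(1)]]
      LpD(1)[OF T_spaceD(2)[OF p(2) a SG(1)]]
    LpD(1)[OF dil_op_bound(2)[OF p(1) K F]] LpD(1)[OF dil_op_bound(2)[OF p(2) K' G]]
  have "(LINT t|lborel. D0 \<alpha> p (stieltjes \<beta> \<mu> f) t * c (D0 \<alpha> q g t))
      = (LINT t|lborel. dil_op ?k (D0 \<alpha> p f) t * c (D0 \<alpha> q g t))"
    unfolding stieltjes_on_T_space[OF p(1) a f]
    by (rule integral_cong_AE) (use SF(2) in \<open>auto elim!: eventually_mono\<close>)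
  also have "\<dots> = (LINT t|lborel. D0 \<alpha> p f t * dil_op ?k' (\<lambda>t. c (D0 \<alpha> q g t)) t)"
    using dil_op_transpose[OF pq K F cG] unfolding transpose_stieltjes_kernel .
  also have "\<dots> = (LINT t|lborel. D0 \<alpha> p f t * c (D0 \<alpha> q (stieltjes (\<mu> - \<beta> + 1) \<mu> g) t))"
    unfolding stieltjes_on_T_space[OF p(2) a g] cd
    by (rule integral_cong_AE) (use SG(2) in \<open>auto elim!: eventually_mono\<close>)
  finally show ?thesis .
qed

theorem theorem4:
  fixes \<alpha> p \<beta> \<mu> :: real
  assumes "0 \<le> \<alpha>" and "1 \<le> p"
    and "\<mu> > \<beta> - 1 / p" and "\<beta> - 1 / p > 0"
  shows
    "(bounded_op_on (T_space \<alpha> p) (T_norm \<alpha> p) (stieltjes \<beta> \<mu>) \<and>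
      op_norm_on (T_space \<alpha> p) (T_norm \<alpha> p) (stieltjes \<beta> \<mu>)
        = Beta (\<mu> - \<beta> + 1 / p) (\<beta> - 1 / p)) \<and>
     (\<forall>f\<in>T_space \<alpha> p. AE t in lborel.
        has_bochner_integral lborel
          (\<lambda>r. phi_kernel (\<mu> - \<beta> + 1 / p) \<mu> r *\<^sub>R dilation r p f t)
          (stieltjes \<beta> \<mu> f t)) \<and>
     spectrum_on (T_space \<alpha> p) (T_norm \<alpha> p) (stieltjes \<beta> \<mu>)
       = {Beta (of_real (\<beta> - 1 / p) + \<i> * of_real \<xi>)
               (of_real (\<mu> - \<beta> + 1 / p) - \<i> * of_real \<xi>) | \<xi>::real. True} \<union> {0} \<and>
     (p > 1 \<longrightarrow> (\<forall>q::real. 1 / p + 1 / q = 1 \<longrightarrow>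
        is_T_adjoint \<alpha> p q (stieltjes \<beta> \<mu>) (stieltjes (\<mu> - \<beta> + 1) \<mu>))) \<and>
     (\<forall>\<gamma>::real. \<gamma> > 1 / 2 \<longrightarrow> T_self_adjoint \<alpha> (stieltjes \<gamma> (2 * \<gamma> - 1)))"
proof (intro conjI ballI allI impI)
  note a = assms(1) and p = assms(2) and b = assms(4,3)
  note K = stieltjes_kernel_properties[OF b]
  show "bounded_op_on (T_space \<alpha> p) (T_norm \<alpha> p) (stieltjes \<beta> \<mu>)"
      by (rule stieltjes_bounded_op_on[OF p a b])
  \<comment> \<open>The kernel is nonnegative, so its weighted integral equals its mass.\<close>
  have "ft (\<lambda>r. exp (r / p) *\<^sub>R stieltjes_kernel \<beta> \<mu> r) 0
      = complex_of_real (mass p (stieltjes_kernel \<beta> \<mu>))"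
  proof -
    have "exp (r / p) *\<^sub>R stieltjes_kernel \<beta> \<mu> r = complex_of_real
        (exp (r / p) * cmod (stieltjes_kernel \<beta> \<mu> r))" for r
      by (simp only: stieltjes_kernel_def norm_of_real scaleR_conv_of_real of_real_mult
          abs_of_nonneg[OF phi_kernel_nonneg])
    then show ?thesis unfolding ft_def
      by (simp only: mult_zero_left minus_zero cis_zero mult_1_right integral_complex_of_real mass_def)
  qed
  from op_norm_dil_op[OF p a K(1,2) this]
  show "op_norm_on (T_space \<alpha> p) (T_norm \<alpha> p) (stieltjes \<beta> \<mu>) = Beta (\<mu> - \<beta> + 1 / p) (\<beta> - 1 / p)"
    unfolding K(3) using op_norm_on_cong[of "T_space \<alpha> p" "stieltjes \<beta> \<mu>", OF
        stieltjes_on_T_space[OF p a]] by simp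
  show "spectrum_on (T_space \<alpha> p) (T_norm \<alpha> p) (stieltjes \<beta> \<mu>)
       = {Beta (of_real (\<beta> - 1 / p) + \<i> * of_real \<xi>)
               (of_real (\<mu> - \<beta> + 1 / p) - \<i> * of_real \<xi>) | \<xi>::real. True} \<union> {0}"
    by (rule stieltjes_spectrum[OF p a b])
  fix f assume f: "f \<in> T_space \<alpha> p"
  have eq: "phi_kernel (\<mu> - \<beta> + 1 / p) \<mu> r *\<^sub>R dilation r p f t
      = stieltjes_kernel \<beta> \<mu> r * f (exp (- r) * t)" for r t
  proof -
    have "phi_kernel (\<mu> - \<beta> + 1 / p) \<mu> r * exp (- r / p) = phi_kernel (\<mu> - \<beta>) \<mu> r"
      by (simp add: phi_kernel_def distrib_right flip: exp_add)
    then have "phi_kernel (\<mu> - \<beta> + 1 / p) \<mu> r *\<^sub>R dilation r p f t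
        = phi_kernel (\<mu> - \<beta>) \<mu> r *\<^sub>R f (exp (- r) * t)"
      by (simp only: dilation_def scaleR_scaleR)
    then show ?thesis by (simp only: stieltjes_kernel_def scaleR_conv_of_real)
  qed
  show "AE t in lborel. has_bochner_integral lborel
          (\<lambda>r. phi_kernel (\<mu> - \<beta> + 1 / p) \<mu> r *\<^sub>R dilation r p f t) (stieltjes \<beta> \<mu> f t)"
    unfolding stieltjes_on_T_space[OF p a f] eq
    using dil_op_bound(1)[OF p K(1) T_spaceD(1)[OF p a f]]
    by eventually_elim (simp add: has_bochner_integral_iff dil_op_def)
next
  fix q :: real assume p1: "1 < p" and pq: "1 / p + 1 / q = 1"
  note a = assms(1) and p = assms(2) and b = assms(4,3)
  have "0 < 1 / p" "1 / p < 1" using p1 by auto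
  then have "0 < 1 / q" "1 / q < 1" using pq by linarith+
  then have q1: "1 < q" by (simp add: divide_less_eq_1 zero_less_divide_iff)
  then have q: "1 \<le> q" by simp
  have b': "0 < (\<mu> - \<beta> + 1) - 1 / q" "(\<mu> - \<beta> + 1) - 1 / q < \<mu>" using b pq by linarith+
  show "is_T_adjoint \<alpha> p q (stieltjes \<beta> \<mu>) (stieltjes (\<mu> - \<beta> + 1) \<mu>)"
    unfolding is_T_adjoint_def T_pairing_def
    using stieltjes_bounded_op_on[OF p a b] stieltjes_bounded_op_on[OF q a b']
      stieltjes_pairing[OF p1 q1 pq a b, of _ _ "\<lambda>z. z"] by simp
next
  fix \<gamma> :: real assume g: "1 / 2 < \<gamma>"
  have b: "0 < \<gamma> - 1 / 2" "\<gamma> - 1 / 2 < 2 * \<gamma> - 1" using g by auto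
  \<comment> \<open>For \<mu> = 2 * \<gamma> - 1 the first index of the adjoint is \<gamma>
    again.\<close>
  have e: "2 * \<gamma> - 1 - \<gamma> + 1 = \<gamma>" by simp
  show "T_self_adjoint \<alpha> (stieltjes \<gamma> (2 * \<gamma> - 1))"
    unfolding T_self_adjoint_def T_inner_def
    using stieltjes_bounded_op_on[of 2 \<alpha> \<gamma> "2 * \<gamma> - 1"]
        stieltjes_pairing[of 2 2 \<alpha> \<gamma> "2 * \<gamma> - 1" _ _ cnj] assms(1) b
    unfolding e by simp
qed

end
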